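(* Let $S$ be a simple symmetric operator with deficiency indices $\langle 2,2\rangle$ and let $\vec{\alpha}\in\mathbb{S}^2$. Then the following statements are equivalent: (i) the strict inclusion $$\Xi_{\vec{\alpha}}\supset\bigcup_{\vec{\beta}\in\mathbb{S}^2,\ \vec{\alpha}\cdot\vec{\beta}=0}\Xi_{\vec{\alpha},\vec{\beta}}$$ holds; (ii) the Weyl function $M(\cdot)$ of $S$ is a constant on $\mathbb{C}\setminus\mathbb{R}$; (iii) $S$ is unitarily equivalent to the symmetric operator in $L_2(\mathbb{R},\mathbb{C}^2)$ $$S'=i\frac{d}{dx},\qquad \mathcal{D}(S')=\{u\in W_2^1(\mathbb{R},\mathbb{C}^2): u(0)=0\}.$$
   Context: $\mathfrak{H}$ is a complex Hilbert space. A fundamental symmetry is a bounded operator $K$ with $K=K^*$, $K^2=I$; it is non-trivial if $K\neq\pm I$. $J$ and $R$ are fixed non-trivial fundamental symmetries in $\mathfrak{H}$ with $JR=-RJ$. For $\vec{\alpha}=(\alpha_1,\alpha_2,\alpha_3)\in\mathbb{S}^2\subset\mathbb{R}^3$ put $J_{\vec{\alpha}}=\alpha_1J+\alpha_2R+\alpha_3\,iJR$, a non-trivial fundamental symmetry. $S$ is a closed densely defined symmetric operator in $\mathfrak{H}$ such that $SJ=JS$ and $SR=RS$. Simple means that $S$ has no non-zero reducing subspace on which it is self-adjoint. $\Sigma_{J_{\vec{\alpha}}}=\{A\supset S: J_{\vec{\alpha}}A^*=AJ_{\vec{\alpha}}\}$ is the set of $J_{\vec{\alpha}}$-self-adjoint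 extensions of $S$, and $\Xi_{\vec{\alpha}}=\{A\in\Sigma_{J_{\vec{\alpha}}}:\rho(A)=\emptyset\}$, where $\rho(A)$ is the resolvent set. For $\vec{\alpha},\vec{\beta}\in\mathbb{S}^2$ with $\vec{\alpha}\cdot\vec{\beta}=0$, the operator $J_{\vec{\gamma}}=iJ_{\vec{\alpha}}J_{\vec{\beta}}$ is a fundamental symmetry commuting with $S$. The decomposition $\mathfrak{H}=\mathfrak{H}_+^\gamma\oplus\mathfrak{H}_-^\gamma$, $\mathfrak{H}_\pm^\gamma=\frac12(I\pm J_{\vec{\gamma}})\mathfrak{H}$, reduces $S$ to $S=S_{\gamma+}\oplus S_{\gamma-}$. Put $A_\gamma=S_{\gamma+}\oplus S_{\gamma-}^*$, so $A_\gamma^*=S_{\gamma+}^*\oplus S_{\gamma-}$ (adjoints of $S_{\gamma\pm}$ taken in $\mathfrak{H}_\pm^\gamma$), and $\Xi_{\vec{\alpha},\vec{\beta}}=\{A_\gamma,A_\gamma^*\}$. A boundary triplet of $S^*$ is $(\mathcal{H},\Gamma_0,\Gamma_1)$ with $\mathcal{H}$ a Hilbert space and $\Gamma_0,\Gamma_1:\mathcal{D}(S^* )\to\mathcal{H}$ linear, such that $(S^*x,y)-(x,S^*y)=(\Gamma_1x,\Gamma_0y)_{\mathcal{H}}-(\Gamma_0x,\Gamma_1y)_{\mathcal{H}}$ for all $x,y\in\mathcal{D}(S^* )$ and $(\Gamma_0,\Gamma_1):\mathcal{D}(S^* )\to\mathcal{H}\oplus\mathcal{H}$ is surjective. The Weyl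 function $M(\mu)$, $\mu\in\mathbb{C}\setminus\mathbb{R}$, of $S$ associated with the triplet is defined by $M(\mu)\Gamma_0f_\mu=\Gamma_1f_\mu$ for all $f_\mu\in\ker(S^*-\mu I)$. According to the paper, if the Weyl function differs from a constant for one boundary triplet, then it does so for every boundary triplet. $W_2^1$ is the Sobolev space.
   Formalization: In (ii), "constant on C∖R" is taken to mean constant on each of the two open half-planes separately; a single constant for both is impossible, since M(μ̄)=M(μ)* and Im M(μ)>0 for Im μ>0, while S' itself has M=iI above and −iI below. *)

theory Defs
  imports "HOL-Analysis.Analysis"
begin

section \<open>Complex Hilbert spaces\<close>

class scaleC = scaleR +
  fixes scaleC :: "complex \<Rightarrow> 'a \<Rightarrow> 'a" (infixr \<open>*\<^sub>C\<close> 75)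
  assumes scaleR_scaleC: "r *\<^sub>R x = complex_of_real r *\<^sub>C x"

class complex_vector = scaleC + real_vector +
  assumes scaleC_add_right: "c *\<^sub>C (x + y) = c *\<^sub>C x + c *\<^sub>C y"
    and scaleC_add_left: "(c + d) *\<^sub>C x = c *\<^sub>C x + d *\<^sub>C x"
    and scaleC_scaleC: "c *\<^sub>C d *\<^sub>C x = (c * d) *\<^sub>C x"
    and scaleC_one: "1 *\<^sub>C x = x"

global_interpretation complex_vector:
    vector_space "scaleC :: complex \<Rightarrow> 'a \<Rightarrow> 'a::complex_vector"
  defines csubspace = complex_vector.subspace
    and cspan = complex_vector.span
    and cdependent = complex_vector.dependent
    and crepresentation = complex_vector.representation
    and cextend_basis = complex_vector.extend_basis
    and cdim = complex_vector.dim
  by unfold_locales (fact scaleC_add_right scaleC_add_left scaleC_scaleC scaleC_one)+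

text \<open>The inner product is linear in its first argument. Positivity and the relation to the norm
  are inherited from \<^class>\<open>real_inner\<close>, whose inner product is the real part.\<close>

class complex_inner = complex_vector + real_inner +
  fixes cinner :: "'a \<Rightarrow> 'a \<Rightarrow> complex"
  assumes cinner_commute: "cinner x y = cnj (cinner y x)"
    and cinner_add_left: "cinner (x + y) z = cinner x z + cinner y z"
    and cinner_scaleC_left: "cinner (c *\<^sub>C x) y = c * cinner x y"
    and inner_eq_Re_cinner: "inner x y = Re (cinner x y)"

class chilbert_space = complex_inner + complete_space

instantiation complex :: chilbert_space
begin
definition scaleC_complex :: "complex \<Rightarrow> complex \<Rightarrow> complex"
  where "scaleC_complex c x = c * x"
definition cinner_complex :: "complex \<Rightarrow> complex \<Rightarrow> complex"
  where "cinner_complex x y = x * cnj y"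
instance
  by standard
    (auto simp: scaleC_complex_def cinner_complex_def inner_complex_def algebra_simps scaleR_conv_of_real)
end

instantiation vec :: (complex_vector, finite) complex_vector
begin
definition scaleC_vec :: "complex \<Rightarrow> 'a ^ 'b \<Rightarrow> 'a ^ 'b"
  where "scaleC_vec c x = (\<chi> i. c *\<^sub>C (x $ i))"
instance
  by standard
    (auto simp: scaleC_vec_def vec_eq_iff scaleR_scaleC scaleC_add_right scaleC_add_left
      scaleC_scaleC scaleC_one)
end

instantiation vec :: (complex_inner, finite) complex_inner
begin
definition cinner_vec :: "'a ^ 'b \<Rightarrow> 'a ^ 'b \<Rightarrow> complex"
  where "cinner_vec x y = (\<Sum>i\<in>UNIV. cinner (x $ i) (y $ i))"
instance
proof
  fix x y z :: "'a ^ 'b" and c :: complex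
  show "cinner x y = cnj (cinner y x)"
    unfolding cinner_vec_def cnj_sum by (intro sum.cong refl cinner_commute)
  show "cinner (x + y) z = cinner x z + cinner y z"
    by (simp add: cinner_vec_def cinner_add_left sum.distrib)
  show "cinner (c *\<^sub>C x) y = c * cinner x y"
    by (simp add: cinner_vec_def scaleC_vec_def cinner_scaleC_left sum_distrib_left)
  show "inner x y = Re (cinner x y)"
    by (simp add: cinner_vec_def inner_vec_def inner_eq_Re_cinner)
qed
end

instance vec :: (chilbert_space, finite) chilbert_space ..

instantiation prod :: (complex_vector, complex_vector) complex_vector
begin
definition scaleC_prod :: "complex \<Rightarrow> 'a \<times> 'b \<Rightarrow> 'a \<times> 'b"
  where "scaleC_prod c x = (c *\<^sub>C fst x, c *\<^sub>C snd x)"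
instance
  by standard
    (auto simp: scaleC_prod_def prod_eq_iff scaleR_scaleC scaleC_add_right scaleC_add_left
      scaleC_scaleC scaleC_one)
end


section \<open>Unbounded operators\<close>

text \<open>An operator is identified with its graph, so that inclusion of graphs is extension of
  operators and \<^const>\<open>Domain\<close> is the domain of definition.\<close>

type_synonym 'a operator = "('a \<times> 'a) set"

definition linear_operator :: "'a::complex_vector operator \<Rightarrow> bool"
  where "linear_operator A \<longleftrightarrow> csubspace A \<and> single_valued A"

definition graph_of :: "('a \<Rightarrow> 'a) \<Rightarrow> 'a operator"
  where "graph_of f = {(x, f x) | x. True}"

definition op_comp :: "'a operator \<Rightarrow> 'a operator \<Rightarrow> 'a operator" (infixr \<open>\<circ>\<^sub>o\<close> 75)
  where "A \<circ>\<^sub>o B = B O A"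

definition densely_defined :: "'a::topological_space operator \<Rightarrow> bool"
  where "densely_defined A \<longleftrightarrow> closure (Domain A) = UNIV"

text \<open>The adjoint of an operator \<open>A\<close> acting in the subspace \<open>M\<close>, taken in \<open>M\<close>.\<close>

definition adj_in :: "'a::complex_inner set \<Rightarrow> 'a operator \<Rightarrow> 'a operator"
  where "adj_in M A = {(y, z). y \<in> M \<and> z \<in> M \<and> (\<forall>(x, w)\<in>A. cinner w y = cinner x z)}"

abbreviation adj :: "'a::complex_inner operator \<Rightarrow> 'a operator"
  where "adj \<equiv> adj_in UNIV"

definition symmetric_operator :: "'a::complex_inner operator \<Rightarrow> bool"
  where "symmetric_operator A \<longleftrightarrow> A \<subseteq> adj A"

definition op_minus :: "'a::complex_vector operator \<Rightarrow> complex \<Rightarrow> 'a operator"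
  where "op_minus A \<mu> = {(x, y - \<mu> *\<^sub>C x) | x y. (x, y) \<in> A}"

definition op_ker :: "'a::zero operator \<Rightarrow> 'a set"
  where "op_ker A = {x. (x, 0) \<in> A}"

definition bounded_clinear :: "('a::complex_inner \<Rightarrow> 'a) \<Rightarrow> bool"
  where "bounded_clinear f \<longleftrightarrow> bounded_linear f \<and> (\<forall>c x. f (c *\<^sub>C x) = c *\<^sub>C f x)"

definition resolvent_set :: "'a::complex_inner operator \<Rightarrow> complex set"
  where "resolvent_set A = {\<mu>. \<exists>B. bounded_clinear B \<and> (op_minus A \<mu>)\<inverse> = graph_of B}"

definition deficiency_indices :: "'a::complex_inner operator \<Rightarrow> nat \<times> nat"
  where "deficiency_indices S =
    (cdim (op_ker (op_minus (adj S) \<i>)), cdim (op_ker (op_minus (adj S) (- \<i>))))"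

definition part_in :: "'a set \<Rightarrow> 'a operator \<Rightarrow> 'a operator"
  where "part_in M A = A \<inter> (M \<times> M)"

definition op_sum :: "'a::plus operator \<Rightarrow> 'a operator \<Rightarrow> 'a operator" (infixr \<open>\<oplus>\<^sub>o\<close> 65)
  where "A \<oplus>\<^sub>o B = {(x + x', y + y') | x y x' y'. (x, y) \<in> A \<and> (x', y') \<in> B}"

definition corth :: "'a::complex_inner set \<Rightarrow> 'a set"
  where "corth M = {x. \<forall>y\<in>M. cinner x y = 0}"

definition reducing :: "'a::complex_inner set \<Rightarrow> 'a operator \<Rightarrow> bool"
  where "reducing M A \<longleftrightarrow>
    csubspace M \<and> closed M \<and> A = part_in M A \<oplus>\<^sub>o part_in (corth M) A"

definition simple_operator :: "'a::complex_inner operator \<Rightarrow> bool"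
  where "simple_operator S \<longleftrightarrow>
    (\<forall>M. reducing M S \<and> adj_in M (part_in M S) = part_in M S \<longrightarrow> M = {0})"

definition unitary :: "('a::complex_inner \<Rightarrow> 'b::complex_inner) \<Rightarrow> bool"
  where "unitary U \<longleftrightarrow> bij U \<and> (\<forall>x y. U (x + y) = U x + U y) \<and> (\<forall>c x. U (c *\<^sub>C x) = c *\<^sub>C U x)
    \<and> (\<forall>x y. cinner (U x) (U y) = cinner x y)"

definition unitarily_equivalent ::
    "'a::complex_inner operator \<Rightarrow> 'b::complex_inner operator \<Rightarrow> bool"
  where "unitarily_equivalent A B \<longleftrightarrow> (\<exists>U. unitary U \<and> B = {(U x, U y) | x y. (x, y) \<in> A})"


section \<open>Fundamental symmetries and the sets of extensions\<close>

definition fundamental_symmetry :: "('a::complex_inner \<Rightarrow> 'a) \<Rightarrow> bool"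
  where "fundamental_symmetry K \<longleftrightarrow>
    bounded_clinear K \<and> adj (graph_of K) = graph_of K \<and> K \<circ> K = id"

definition nontrivial_fundamental_symmetry :: "('a::complex_inner \<Rightarrow> 'a) \<Rightarrow> bool"
  where "nontrivial_fundamental_symmetry K \<longleftrightarrow> fundamental_symmetry K \<and> K \<noteq> id \<and> K \<noteq> uminus"

definition clifford_sym ::
    "('a::complex_vector \<Rightarrow> 'a) \<Rightarrow> ('a \<Rightarrow> 'a) \<Rightarrow> real ^ 3 \<Rightarrow> 'a \<Rightarrow> 'a"
  where "clifford_sym J R \<alpha> =
    (\<lambda>x. (\<alpha> $ 1) *\<^sub>R J x + (\<alpha> $ 2) *\<^sub>R R x + (\<alpha> $ 3) *\<^sub>R (\<i> *\<^sub>C J (R x)))"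

definition Sigma_ext ::
    "'a::complex_inner operator \<Rightarrow> ('a \<Rightarrow> 'a) \<Rightarrow> 'a operator set"
  where "Sigma_ext S K =
    {A. linear_operator A \<and> S \<subseteq> A \<and> graph_of K \<circ>\<^sub>o adj A = A \<circ>\<^sub>o graph_of K}"

definition Xi_ext ::
    "'a::complex_inner operator \<Rightarrow> ('a \<Rightarrow> 'a) \<Rightarrow> 'a operator set"
  where "Xi_ext S K = {A \<in> Sigma_ext S K. resolvent_set A = {}}"

definition eigen_plus :: "('a::complex_vector \<Rightarrow> 'a) \<Rightarrow> 'a set"
  where "eigen_plus K = range (\<lambda>x. (1/2) *\<^sub>R (x + K x))"

definition eigen_minus :: "('a::complex_vector \<Rightarrow> 'a) \<Rightarrow> 'a set"
  where "eigen_minus K = range (\<lambda>x. (1/2) *\<^sub>R (x - K x))"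

text \<open>With \<open>K = J\<^sub>\<gamma>\<close> this is \<open>A\<^sub>\<gamma>\<close>; the adjoint of the second part is taken in its own subspace.\<close>

definition A_ext :: "'a::complex_inner operator \<Rightarrow> ('a \<Rightarrow> 'a) \<Rightarrow> 'a operator"
  where "A_ext S K =
    part_in (eigen_plus K) S \<oplus>\<^sub>o adj_in (eigen_minus K) (part_in (eigen_minus K) S)"

definition Xi_pair ::
    "'a::complex_inner operator \<Rightarrow> ('a \<Rightarrow> 'a) \<Rightarrow> ('a \<Rightarrow> 'a) \<Rightarrow> 'a operator set"
  where "Xi_pair S K L =
    (let G = (\<lambda>x. \<i> *\<^sub>C K (L x)) in {A_ext S G, adj (A_ext S G)})"


section \<open>Boundary triplets and Weyl functions\<close>

definition clinear_on :: "'a::complex_vector set \<Rightarrow> ('a \<Rightarrow> 'b::complex_vector) \<Rightarrow> bool"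
  where "clinear_on V f \<longleftrightarrow>
    (\<forall>x\<in>V. \<forall>y\<in>V. f (x + y) = f x + f y) \<and> (\<forall>c. \<forall>x\<in>V. f (c *\<^sub>C x) = c *\<^sub>C f x)"

text \<open>Only the values of \<open>\<Gamma>\<^sub>0\<close>, \<open>\<Gamma>\<^sub>1\<close> on the domain of the adjoint matter.\<close>

definition boundary_triplet ::
    "'a::complex_inner operator \<Rightarrow> ('a \<Rightarrow> 'h::chilbert_space) \<Rightarrow> ('a \<Rightarrow> 'h) \<Rightarrow> bool"
  where "boundary_triplet S \<Gamma>0 \<Gamma>1 \<longleftrightarrow>
    clinear_on (Domain (adj S)) \<Gamma>0 \<and> clinear_on (Domain (adj S)) \<Gamma>1 \<and>
    (\<forall>(x, x')\<in>adj S. \<forall>(y, y')\<in>adj S.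
      cinner x' y - cinner x y' = cinner (\<Gamma>1 x) (\<Gamma>0 y) - cinner (\<Gamma>0 x) (\<Gamma>1 y)) \<and>
    (\<lambda>x. (\<Gamma>0 x, \<Gamma>1 x)) ` Domain (adj S) = UNIV"

text \<open>The operator \<open>M(\<mu>)\<close>, again as a graph: it maps \<open>\<Gamma>\<^sub>0 f\<close> to \<open>\<Gamma>\<^sub>1 f\<close> for \<open>f\<close> in the
  defect subspace at \<open>\<mu>\<close>.\<close>

definition weyl_function ::
    "'a::complex_inner operator \<Rightarrow> ('a \<Rightarrow> 'h) \<Rightarrow> ('a \<Rightarrow> 'h) \<Rightarrow> complex \<Rightarrow> 'h operator"
  where "weyl_function S \<Gamma>0 \<Gamma>1 \<mu> = (\<lambda>f. (\<Gamma>0 f, \<Gamma>1 f)) ` op_ker (op_minus (adj S) \<mu>)"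

text \<open>``Constant on the non-real numbers'' means constant on each of the two open half-planes.
  One value for both is impossible unless the boundary space is trivial: \<open>M(\<mu>)\<^sup>* = M(cnj \<mu>)\<close> and \<open>Im M(\<mu>)\<close> is positive definite
  in the upper half-plane. For \<open>i d/dx\<close> with \<open>u(0) = 0\<close>, say, one may choose the triplet such that
  \<open>M = i I\<close> on the upper and \<open>M = - i I\<close> on the lower half-plane.\<close>

definition weyl_constant ::
    "'a::complex_inner operator \<Rightarrow> ('a \<Rightarrow> 'h) \<Rightarrow> ('a \<Rightarrow> 'h) \<Rightarrow> bool"
  where "weyl_constant S \<Gamma>0 \<Gamma>1 \<longleftrightarrow>
    weyl_function S \<Gamma>0 \<Gamma>1 constant_on {\<mu>. Im \<mu> > 0} \<and>
    weyl_function S \<Gamma>0 \<Gamma>1 constant_on {\<mu>. Im \<mu> < 0}"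


section \<open>The space $L_2(\mathbb{R}, \mathbb{C}^2)$ and the model operator\<close>

definition square_integrable :: "(real \<Rightarrow> complex ^ 2) \<Rightarrow> bool"
  where "square_integrable f \<longleftrightarrow>
    f \<in> borel_measurable lborel \<and> integrable lborel (\<lambda>x. (norm (f x))\<^sup>2)"

definition L2_rel :: "(real \<Rightarrow> complex ^ 2) \<Rightarrow> (real \<Rightarrow> complex ^ 2) \<Rightarrow> bool"
  where "L2_rel f g \<longleftrightarrow>
    square_integrable f \<and> square_integrable g \<and> (AE x in lborel. f x = g x)"

lemma square_integrable_0: "square_integrable (\<lambda>_. 0)"
  by (simp add: square_integrable_def)

quotient_type L2 = "real \<Rightarrow> complex ^ 2" / partial: L2_rel
proof (rule part_equivpI)
  show "\<exists>f. L2_rel f f"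
    using square_integrable_0 by (auto simp: L2_rel_def)
  show "symp L2_rel"
    by (rule sympI) (auto simp: L2_rel_def eq_commute)
  show "transp L2_rel"
    by (rule transpI) (auto simp: L2_rel_def)
qed

lemma norm_cinner_vec_le:
  fixes a b :: "complex ^ 2"
  shows "norm (cinner a b) \<le> (norm a)\<^sup>2 + (norm b)\<^sup>2"
proof -
  have "norm (cinner a b) \<le> (\<Sum>i\<in>UNIV. norm (a $ i) * norm (b $ i))"
    unfolding cinner_vec_def cinner_complex_def by (rule sum_norm_le) (simp add: norm_mult)
  also have "\<dots> \<le> (\<Sum>i\<in>UNIV. (norm (a $ i))\<^sup>2 + (norm (b $ i))\<^sup>2)"
  proof (rule sum_mono)
    fix i
    show "norm (a $ i) * norm (b $ i) \<le> (norm (a $ i))\<^sup>2 + (norm (b $ i))\<^sup>2"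
      using sum_squares_bound[of "norm (a $ i)" "norm (b $ i)"]
        mult_nonneg_nonneg[OF norm_ge_zero[of "a $ i"] norm_ge_zero[of "b $ i"]]
      by linarith
  qed
  also have "\<dots> = (norm a)\<^sup>2 + (norm b)\<^sup>2"
    by (simp add: norm_vec_def L2_set_def sum.distrib sum_nonneg)
  finally show ?thesis .
qed

lemma cinner_vec_2:
  fixes a b :: "complex ^ 2"
  shows "cinner a b = a $ 1 * cnj (b $ 1) + a $ 2 * cnj (b $ 2)"
  by (simp add: cinner_vec_def cinner_complex_def sum_2)

lemma borel_measurable_cnj [measurable]: "cnj \<in> borel_measurable borel"
  by (intro borel_measurable_continuous_onI continuous_intros)

lemma borel_measurable_vec_component [measurable]:
  "(\<lambda>x :: complex ^ 2. x $ i) \<in> borel_measurable borel"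
  by (intro borel_measurable_continuous_onI continuous_intros)

lemma borel_measurable_scaleC [measurable]:
  "(\<lambda>x :: complex ^ 2. c *\<^sub>C x) \<in> borel_measurable borel"
proof -
  have "linear (\<lambda>x :: complex ^ 2. c *\<^sub>C x)"
    by (rule linearI) (simp_all add: scaleC_add_right scaleR_scaleC scaleC_scaleC mult.commute)
  then show ?thesis
    by (intro borel_measurable_continuous_onI linear_continuous_on linear_conv_bounded_linear[THEN iffD1])
qed

lemma norm_scaleC_vec: "norm (c *\<^sub>C (x :: complex ^ 2)) = norm c * norm x"
  by (simp add: norm_vec_def L2_set_def scaleC_vec_def scaleC_complex_def norm_mult power_mult_distrib
      flip: sum_distrib_left real_sqrt_mult) (simp add: real_sqrt_mult)

lemma square_integrable_add:
  assumes f: "square_integrable f" and g: "square_integrable g"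
  shows "square_integrable (\<lambda>x. f x + g x)"
proof -
  have [measurable]: "f \<in> borel_measurable borel" "g \<in> borel_measurable borel"
    using f g by (auto simp: square_integrable_def)
  have "integrable lborel (\<lambda>x. (norm (f x + g x))\<^sup>2)"
  proof (rule Bochner_Integration.integrable_bound)
    show "integrable lborel (\<lambda>x. 2 * (norm (f x))\<^sup>2 + 2 * (norm (g x))\<^sup>2)"
      using f g by (auto simp: square_integrable_def)
    have "(norm (f x + g x))\<^sup>2 \<le> 2 * (norm (f x))\<^sup>2 + 2 * (norm (g x))\<^sup>2" for x
    proof -
      have "(norm (f x + g x))\<^sup>2 \<le> (norm (f x) + norm (g x))\<^sup>2"
        by (intro power_mono norm_triangle_ineq) auto
      also have "\<dots> \<le> 2 * (norm (f x))\<^sup>2 + 2 * (norm (g x))\<^sup>2"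
        using sum_squares_bound[of "norm (f x)" "norm (g x)"] by (simp add: power2_sum)
      finally show ?thesis .
    qed
    then show "AE x in lborel. norm ((norm (f x + g x))\<^sup>2)
        \<le> norm (2 * (norm (f x))\<^sup>2 + 2 * (norm (g x))\<^sup>2)"
      by (intro AE_I2) simp
  qed measurable
  then show ?thesis
    by (simp add: square_integrable_def)
qed

lemma square_integrable_scaleC:
  assumes f: "square_integrable f"
  shows "square_integrable (\<lambda>x. c *\<^sub>C f x)"
proof -
  have [measurable]: "f \<in> borel_measurable borel"
    using f by (auto simp: square_integrable_def)
  show ?thesis
    using f by (simp add: square_integrable_def norm_scaleC_vec power_mult_distrib)
qed

lemma square_integrable_scaleR: "square_integrable f \<Longrightarrow> square_integrable (\<lambda>x. r *\<^sub>R f x)"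
  by (simp add: scaleR_scaleC square_integrable_scaleC)

lemma square_integrable_uminus: "square_integrable f \<Longrightarrow> square_integrable (\<lambda>x. - f x)"
  using square_integrable_scaleR[of f "-1"] by simp

lemma square_integrable_diff:
  "square_integrable f \<Longrightarrow> square_integrable g \<Longrightarrow> square_integrable (\<lambda>x. f x - g x)"
  using square_integrable_add[of f "\<lambda>x. - g x"] square_integrable_uminus[of g] by simp

lemma integrable_cinner:
  assumes f: "square_integrable f" and g: "square_integrable g"
  shows "integrable lborel (\<lambda>x. cinner (f x) (g x))"
proof (rule Bochner_Integration.integrable_bound)
  have [measurable]: "f \<in> borel_measurable borel" "g \<in> borel_measurable borel"
    using f g by (auto simp: square_integrable_def)
  show "integrable lborel (\<lambda>x. (norm (f x))\<^sup>2 + (norm (g x))\<^sup>2)"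
    using f g by (auto simp: square_integrable_def)
  show "(\<lambda>x. cinner (f x) (g x)) \<in> borel_measurable lborel"
    unfolding cinner_vec_2 by measurable
  show "AE x in lborel. norm (cinner (f x) (g x)) \<le> norm ((norm (f x))\<^sup>2 + (norm (g x))\<^sup>2)"
    using norm_cinner_vec_le by (intro AE_I2) auto
qed

instantiation L2 :: complex_vector
begin

lift_definition zero_L2 :: L2 is "\<lambda>_. 0"
  by (simp add: L2_rel_def square_integrable_0)

lift_definition plus_L2 :: "L2 \<Rightarrow> L2 \<Rightarrow> L2" is "\<lambda>f g x. f x + g x"
  by (auto simp: L2_rel_def intro: square_integrable_add)

lift_definition minus_L2 :: "L2 \<Rightarrow> L2 \<Rightarrow> L2" is "\<lambda>f g x. f x - g x"
  by (auto simp: L2_rel_def intro: square_integrable_diff)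

lift_definition uminus_L2 :: "L2 \<Rightarrow> L2" is "\<lambda>f x. - f x"
  by (auto simp: L2_rel_def intro: square_integrable_uminus)

lift_definition scaleR_L2 :: "real \<Rightarrow> L2 \<Rightarrow> L2" is "\<lambda>r f x. r *\<^sub>R f x"
  by (auto simp: L2_rel_def intro: square_integrable_scaleR)

lift_definition scaleC_L2 :: "complex \<Rightarrow> L2 \<Rightarrow> L2" is "\<lambda>c f x. c *\<^sub>C f x"
  by (auto simp: L2_rel_def intro: square_integrable_scaleC)

instance
proof
  fix u v w :: L2 and r s :: real and c d :: complex
  show "u + v + w = u + (v + w)" "u + v = v + u" "0 + u = u" "- u + u = 0" "u - v = u + - v"
    "r *\<^sub>R (u + v) = r *\<^sub>R u + r *\<^sub>R v" "(r + s) *\<^sub>R u = r *\<^sub>R u + s *\<^sub>R u"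
    "r *\<^sub>R s *\<^sub>R u = (r * s) *\<^sub>R u" "1 *\<^sub>R u = u" "r *\<^sub>R u = complex_of_real r *\<^sub>C u"
    "c *\<^sub>C (u + v) = c *\<^sub>C u + c *\<^sub>C v" "(c + d) *\<^sub>C u = c *\<^sub>C u + d *\<^sub>C u"
    "c *\<^sub>C d *\<^sub>C u = (c * d) *\<^sub>C u" "1 *\<^sub>C u = u"
    by (transfer, auto simp: L2_rel_def algebra_simps scaleR_scaleC scaleC_add_right
        scaleC_add_left scaleC_scaleC scaleC_one
        intro!: square_integrable_add square_integrable_scaleC square_integrable_uminus
          square_integrable_diff square_integrable_0)+
qed

end

instantiation L2 :: complex_inner
begin

lift_definition cinner_L2 :: "L2 \<Rightarrow> L2 \<Rightarrow> complex"
  is "\<lambda>f g. \<integral>x. cinner (f x) (g x) \<partial>lborel"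
proof -
  fix f f' g g' assume *: "L2_rel f f'" "L2_rel g g'"
  show "(\<integral>x. cinner (f x) (g x) \<partial>lborel) = (\<integral>x. cinner (f' x) (g' x) \<partial>lborel)"
  proof (rule integral_cong_AE)
    show "(\<lambda>x. cinner (f x) (g x)) \<in> borel_measurable lborel"
      using integrable_cinner[of f g] * by (auto simp: L2_rel_def)
    show "(\<lambda>x. cinner (f' x) (g' x)) \<in> borel_measurable lborel"
      using integrable_cinner[of f' g'] * by (auto simp: L2_rel_def)
    have "AE x in lborel. f x = f' x" "AE x in lborel. g x = g' x"
      using * by (auto simp: L2_rel_def)
    then show "AE x in lborel. cinner (f x) (g x) = cinner (f' x) (g' x)"
      by eventually_elim simp
  qed
qed

definition inner_L2 :: "L2 \<Rightarrow> L2 \<Rightarrow> real" where "inner_L2 u v = Re (cinner u v)"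
definition norm_L2 :: "L2 \<Rightarrow> real" where "norm_L2 u = sqrt (inner u u)"
definition dist_L2 :: "L2 \<Rightarrow> L2 \<Rightarrow> real" where "dist_L2 u v = norm (u - v)"
definition sgn_L2 :: "L2 \<Rightarrow> L2" where "sgn_L2 u = u /\<^sub>R norm u"
definition uniformity_L2 :: "(L2 \<times> L2) filter"
  where "uniformity_L2 = (INF e\<in>{0<..}. principal {(u, v). dist u v < e})"
definition open_L2 :: "L2 set \<Rightarrow> bool"
  where "open_L2 U = (\<forall>u\<in>U. eventually (\<lambda>(u', v). u' = u \<longrightarrow> v \<in> U) uniformity)"

instance
proof
  fix u v w :: L2 and r s :: real and c d :: complex
  show comm: "cinner u v = cnj (cinner v u)" for u v :: L2
    by transfer (subst cinner_commute, simp)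
  show add: "cinner (u + v) w = cinner u w + cinner v w" for u v w :: L2
    by transfer (simp add: L2_rel_def cinner_add_left integrable_cinner)
  show scale: "cinner (c *\<^sub>C u) v = c * cinner u v" for c and u v :: L2
    by transfer (simp add: cinner_scaleC_left)
  show "inner u v = Re (cinner u v)"
    by (fact inner_L2_def)
  show "inner u v = inner v u"
    unfolding inner_L2_def by (subst comm) simp
  show "inner (u + v) w = inner u w + inner v w"
    by (simp add: inner_L2_def add)
  have scaleR: "r *\<^sub>R u = complex_of_real r *\<^sub>C u"
    by transfer (auto simp: L2_rel_def scaleR_scaleC intro: square_integrable_scaleC)
  show "inner (r *\<^sub>R u) v = r * inner u v"
    by (simp add: inner_L2_def scaleR scale)
  have inner_self: "Re (cinner a a) = (norm a)\<^sup>2" for a :: "complex ^ 2"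
    by (simp add: inner_eq_Re_cinner[symmetric] power2_norm_eq_inner)
  show "0 \<le> inner u u"
    unfolding inner_L2_def
    by transfer (simp add: L2_rel_def integral_Re[symmetric] integrable_cinner inner_self)
  show "inner u u = 0 \<longleftrightarrow> u = 0"
    unfolding inner_L2_def
  proof transfer
    fix f assume "L2_rel f f"
    then have f: "square_integrable f"
      by (simp add: L2_rel_def)
    have "Re (\<integral>x. cinner (f x) (f x) \<partial>lborel) = (\<integral>x. (norm (f x))\<^sup>2 \<partial>lborel)"
      by (simp add: integral_Re[symmetric] integrable_cinner f inner_self)
    moreover have "(\<integral>x. (norm (f x))\<^sup>2 \<partial>lborel) = 0 \<longleftrightarrow> (AE x in lborel. (norm (f x))\<^sup>2 = 0)"
      using f by (intro integral_nonneg_eq_0_iff_AE) (auto simp: square_integrable_def)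
    ultimately show "Re (\<integral>x. cinner (f x) (f x) \<partial>lborel) = 0 \<longleftrightarrow> L2_rel f (\<lambda>_. 0)"
      using f by (simp add: L2_rel_def square_integrable_0)
  qed
qed (fact dist_L2_def sgn_L2_def uniformity_L2_def open_L2_def norm_L2_def)+

end

definition test_function :: "(real \<Rightarrow> real) \<Rightarrow> bool"
  where "test_function \<phi> \<longleftrightarrow>
    (\<forall>n x. (deriv ^^ n) \<phi> field_differentiable at x) \<and> compact (closure {x. \<phi> x \<noteq> 0})"

lemma test_function_measurable:
  assumes "test_function \<phi>"
  shows "\<phi> \<in> borel_measurable borel" "deriv \<phi> \<in> borel_measurable borel"
proof -
  have "(deriv ^^ n) \<phi> \<in> borel_measurable borel" for n
    using assms by (intro borel_measurable_continuous_onI continuous_at_imp_continuous_on)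
      (auto simp: test_function_def intro: field_differentiable_imp_continuous_at)
  from this[of 0] this[of 1] show "\<phi> \<in> borel_measurable borel" "deriv \<phi> \<in> borel_measurable borel"
    by simp_all
qed

lift_definition has_weak_derivative :: "L2 \<Rightarrow> L2 \<Rightarrow> bool"
  is "\<lambda>u v. \<forall>\<phi>. test_function \<phi> \<longrightarrow>
    (\<integral>x. deriv \<phi> x *\<^sub>R u x \<partial>lborel) = - (\<integral>x. \<phi> x *\<^sub>R v x \<partial>lborel)"
proof -
  have *: "(\<integral>x. h x *\<^sub>R f x \<partial>lborel) = (\<integral>x. h x *\<^sub>R g x \<partial>lborel)"
    if "L2_rel f g" and [measurable]: "h \<in> borel_measurable borel" for f g and h :: "real \<Rightarrow> real"
  proof (rule integral_cong_AE)
    have [measurable]: "f \<in> borel_measurable borel" "g \<in> borel_measurable borel"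
      using that by (auto simp: L2_rel_def square_integrable_def)
    show "(\<lambda>x. h x *\<^sub>R f x) \<in> borel_measurable lborel" "(\<lambda>x. h x *\<^sub>R g x) \<in> borel_measurable lborel"
      by measurable
    have "AE x in lborel. f x = g x"
      using that by (simp add: L2_rel_def)
    then show "AE x in lborel. h x *\<^sub>R f x = h x *\<^sub>R g x"
      by eventually_elim simp
  qed
  fix u u' v v' assume "L2_rel u u'" "L2_rel v v'"
  then show "(\<forall>\<phi>. test_function \<phi> \<longrightarrow>
      (\<integral>x. deriv \<phi> x *\<^sub>R u x \<partial>lborel) = - (\<integral>x. \<phi> x *\<^sub>R v x \<partial>lborel)) \<longleftrightarrow>
    (\<forall>\<phi>. test_function \<phi> \<longrightarrow>
      (\<integral>x. deriv \<phi> x *\<^sub>R u' x \<partial>lborel) = - (\<integral>x. \<phi> x *\<^sub>R v' x \<partial>lborel))"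
    by (simp add: * test_function_measurable)
qed

definition sobolev_W21 :: "L2 set"
  where "sobolev_W21 = {u. \<exists>v. has_weak_derivative u v}"

text \<open>The value of a Sobolev function at a point is that of its continuous representative.\<close>

lift_definition vanishes_at :: "L2 \<Rightarrow> real \<Rightarrow> bool"
  is "\<lambda>u a. \<exists>f. continuous_on UNIV f \<and> (AE x in lborel. f x = u x) \<and> f a = 0"
proof -
  fix u u' assume "L2_rel u u'"
  then have eq: "AE x in lborel. u x = u' x"
    by (simp add: L2_rel_def)
  have "(AE x in lborel. f x = u x) \<longleftrightarrow> (AE x in lborel. f x = u' x)" for f
    using eq by (intro eventually_cong) auto
  then show "(\<lambda>a. \<exists>f. continuous_on UNIV f \<and> (AE x in lborel. f x = u x) \<and> f a = 0) =
      (\<lambda>a. \<exists>f. continuous_on UNIV f \<and> (AE x in lborel. f x = u' x) \<and> f a = 0)"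
    by simp
qed

definition model_operator :: "L2 operator"
  where "model_operator =
    {(u, \<i> *\<^sub>C v) | u v. u \<in> sobolev_W21 \<and> has_weak_derivative u v \<and> vanishes_at u 0}"

end

theory Submission
  imports Defs
begin

text \<open>Write \<open>N\<^sub>\<mu> = ker (S\<^sup>* - \<mu>)\<close>. All three statements are compared with the condition that
  \<open>D(S) + N\<^sub>\<mu> = D(S) + N\<^sub>\<nu>\<close> whenever \<open>\<mu>\<close> and \<open>\<nu>\<close> lie in the same half-plane. Since \<open>D(S)\<close> is the kernel
  of \<open>(\<Gamma>\<^sub>0, \<Gamma>\<^sub>1)\<close>, this is the constancy of the Weyl function, for every boundary triplet.

  Under this condition Green's identity makes the defect spaces of the two half-planes orthogonal, and
  it determines the inner products of the vectors \<open>f(\<mu>, c) \<in> N\<^sub>\<mu>\<close> that are congruent modulo \<open>D(S)\<close> to a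
  fixed vector of \<open>N\<^sub>\<plusminus>\<^sub>i\<close> with coordinates \<open>c\<close>: up to sign they are \<open>2 i (c, d) / (\<mu> - cnj \<nu>)\<close>, as for the
  exponentials of the model operator. By simplicity the defect vectors are total and \<open>S\<close> consists
  of the pairs \<open>(y, z)\<close> with \<open>z - cnj \<mu> y \<bottom> N\<^sub>\<mu>\<close> for all \<open>\<mu>\<close>, so \<open>S\<close> is determined up to unitary equivalence.

  A \<open>J\<^sub>\<alpha>\<close>-self-adjoint extension with empty resolvent set contains an eigenvector for every non-real
  \<open>\<mu>\<close>. Hence its domain is \<open>D(S) + \<complex> a + \<complex> b\<close> with \<open>a \<in> N\<^sub>i\<close> and \<open>b \<in> N\<^sub>-\<^sub>i\<close>, each orthogonal to its image
  under \<open>J\<^sub>\<alpha>\<close>. If the condition holds, then \<open>a\<close> and \<open>b\<close> may be chosen independently of each other.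
  Otherwise the eigenvectors for a suitable \<open>\<mu>\<close> couple them: both are eigenvectors, for the same
  eigenvalue, of one symmetry \<open>J\<^sub>\<gamma>\<close> with \<open>\<gamma>\<close> orthogonal to \<open>\<alpha>\<close>, and the extension is \<open>A\<^sub>\<gamma>\<close>.\<close>

section \<open>Complex inner product spaces\<close>

text \<open>Operators are graphs, so adjoints, extensions and congruence modulo D(S) are all handled
  in the product space by one skew-Hermitian form, \<open>bform\<close>. Complements for this form
  are adjoints, it vanishes between \<open>S\<close> and its adjoint, and on the eigenpairs of a
  defect space it is definite with the sign of Im \<mu>. All comparisons of the two half-planes rest
  on these three facts.

  The recurring obstacle is the point \<mu> = cnj \<nu>: the factor \<mu> - cnj \<nu> of the form
  vanishes there and Green's identity gives no information. Orthogonality at this point is obtained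
  as a limit along a horizontal line.

  Dimension two acts through one fact: a non-zero defect vector orthogonal to its image under
  \<open>J\<^sub>\<alpha>\<close> forms with that image an orthogonal basis of the defect space, so
  the symmetry exchanges a line and its complement.

  For the model operator everything becomes a statement on Laplace transforms: its pairs (y, z) are
  those where y is the primitive of - \<i> z vanishing at 0, and primitives are recognised by their
  integrals against exponentials on half-lines.\<close>

lemmas scaleC_simps = complex_vector.scale_right_distrib complex_vector.scale_left_distrib
  complex_vector.scale_right_diff_distrib complex_vector.scale_left_diff_distrib

lemma cinner_add_right: "cinner x (y + z) = cinner x y + cinner x z"
  by (metis cinner_add_left cinner_commute complex_cnj_add)

lemma cinner_scaleC_right: "cinner x (c *\<^sub>C y) = cnj c * cinner x y"
  by (metis cinner_commute cinner_scaleC_left complex_cnj_mult)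

lemma cinner_zero_left [simp]: "cinner 0 x = 0"
  using cinner_scaleC_left[of 0 0 x] by simp

lemma cinner_zero_right [simp]: "cinner x 0 = 0"
  using cinner_scaleC_right[of x 0 0] by simp

lemma cinner_minus_left: "cinner (- x) y = - cinner x y"
  using cinner_scaleC_left[of "-1" x y] by (simp add: complex_vector.scale_minus_left)

lemma cinner_minus_right: "cinner x (- y) = - cinner x y"
  using cinner_scaleC_right[of x "-1" y] by (simp add: complex_vector.scale_minus_left)

lemma cinner_diff_left: "cinner (x - y) z = cinner x z - cinner y z"
  using cinner_add_left[of x "- y" z] by (simp add: cinner_minus_left)

lemma cinner_diff_right: "cinner x (y - z) = cinner x y - cinner x z"
  using cinner_add_right[of x y "- z"] by (simp add: cinner_minus_right)

lemmas cinner_simps = cinner_add_left cinner_add_right cinner_diff_left cinner_diff_right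
  cinner_minus_left cinner_minus_right cinner_scaleC_left cinner_scaleC_right

lemma cinner_self: "cinner x x = of_real ((norm x)\<^sup>2)"
proof (rule complex_eqI)
  show "Re (cinner x x) = Re (of_real ((norm x)\<^sup>2))"
    by (simp add: inner_eq_Re_cinner[symmetric] power2_norm_eq_inner)
  have "Im (cinner x x) = - Im (cinner x x)"
    by (metis cinner_commute cnj.simps(2))
  then show "Im (cinner x x) = Im (of_real ((norm x)\<^sup>2))"
    by simp
qed

lemma cinner_self_eq_0 [simp]: "cinner x x = 0 \<longleftrightarrow> x = 0"
  by (simp add: cinner_self)

lemma cinner_eq_0_commute: "cinner x y = 0 \<longleftrightarrow> cinner y x = 0"
  by (metis cinner_commute complex_cnj_zero)

lemma norm_scaleC [simp]: "norm (c *\<^sub>C x) = cmod c * norm x" for x :: "'a::complex_inner"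
proof -
  have "of_real ((norm (c *\<^sub>C x))\<^sup>2) = (of_real ((cmod c * norm x)\<^sup>2) :: complex)"
    unfolding cinner_self[symmetric] cinner_simps
    using complex_norm_square[of c] by (simp add: cinner_self power_mult_distrib mult_ac)
  then show ?thesis
    by (metis mult_nonneg_nonneg norm_ge_zero of_real_eq_iff power2_eq_iff_nonneg)
qed

text \<open>The real Cauchy-Schwarz inequality applies after multiplying \<open>x\<close> by a
  unimodular \<open>c\<close> that makes the inner product real and nonnegative.\<close>

lemma norm_cinner_le: "cmod (cinner x y) \<le> norm x * norm y"
proof (cases "cinner x y = 0")
  case False
  define c where "c = cnj (sgn (cinner x y))"
  have c: "cmod c = 1"
    using False by (simp add: c_def norm_sgn)
  have "c * cinner x y = of_real (cmod (cinner x y))"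
    using complex_norm_square[of "cinner x y"] False
    by (simp add: c_def sgn_div_norm scaleR_conv_of_real power2_eq_square field_simps)
  then have "cmod (cinner x y) = inner (c *\<^sub>C x) y"
    by (simp add: inner_eq_Re_cinner cinner_scaleC_left)
  also have "\<dots> \<le> norm (c *\<^sub>C x) * norm y"
    by (rule norm_cauchy_schwarz)
  finally show ?thesis by (simp add: c)
qed simp

lemma cinner_eq_zeroI: "(\<And>y. cinner x y = 0) \<Longrightarrow> x = 0"
  using cinner_self_eq_0 by blast

lemma bounded_bilinear_cinner: "bounded_bilinear cinner"
proof
  fix r and x y :: 'a
  show "cinner (r *\<^sub>R x) y = r *\<^sub>R cinner x y" "cinner x (r *\<^sub>R y) = r *\<^sub>R cinner x y"
    by (simp_all add: scaleR_scaleC cinner_simps scaleC_complex_def)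
  show "\<exists>K. \<forall>x y::'a. cmod (cinner x y) \<le> norm x * norm y * K"
    using norm_cinner_le by (intro exI[of _ 1]) auto
qed (simp_all add: cinner_simps)

lemmas continuous_on_cinner [continuous_intros] =
  bounded_bilinear.continuous_on[OF bounded_bilinear_cinner]

lemma bounded_linear_scaleC: "bounded_linear (\<lambda>x::'a::complex_inner. c *\<^sub>C x)"
  by (rule bounded_linear_intro[of _ "cmod c"])
     (auto simp: scaleC_add_right scaleR_scaleC scaleC_scaleC mult.commute)

lemmas tendsto_scaleC = bounded_linear.tendsto[OF bounded_linear_scaleC]

section \<open>Complex subspaces and orthogonal projection\<close>

lemma csubspace_0: "csubspace V \<Longrightarrow> 0 \<in> V"
  and csubspace_add: "csubspace V \<Longrightarrow> x \<in> V \<Longrightarrow> y \<in> V \<Longrightarrow> x + y \<in> V"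
  and csubspace_scale: "csubspace V \<Longrightarrow> x \<in> V \<Longrightarrow> c *\<^sub>C x \<in> V"
  by (auto simp: complex_vector.subspace_def)

lemma csubspace_diff: "csubspace V \<Longrightarrow> x \<in> V \<Longrightarrow> y \<in> V \<Longrightarrow> x - y \<in> V"
  by (rule complex_vector.subspace_diff)

lemma csubspace_uminus: "csubspace V \<Longrightarrow> x \<in> V \<Longrightarrow> - x \<in> V"
  by (rule complex_vector.subspace_neg)

lemma csubspace_imp_subspace: "csubspace V \<Longrightarrow> subspace V"
  by (auto simp: complex_vector.subspace_def subspace_def scaleR_scaleC)

text \<open>A complex subspace contains \<open>\<i> *\<^sub>C y\<close> together with
  \<open>y\<close>, and the real part of the inner product with the former is the imaginary part of
  the inner product with the latter.\<close>

lemma cinner_eq_0_if_inner_csubspace: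
  assumes V: "csubspace V" and "\<And>y. y \<in> V \<Longrightarrow> inner x y = 0" "y \<in> V"
  shows "cinner x y = 0"
proof (rule complex_eqI)
  show "Re (cinner x y) = Re 0"
    using assms(2)[OF assms(3)] by (simp add: inner_eq_Re_cinner)
  have "\<i> *\<^sub>C y \<in> V"
    using V assms(3) by (rule csubspace_scale)
  from assms(2)[OF this] show "Im (cinner x y) = Im 0"
    by (simp add: inner_eq_Re_cinner cinner_simps)
qed

lemma csubspace_corth: "csubspace (corth M)"
  by (auto simp: complex_vector.subspace_def corth_def cinner_simps)

lemma closed_corth: "closed (corth M)"
proof -
  have "corth M = (\<Inter>y\<in>M. {x. cinner x y = 0})"
    by (auto simp: corth_def)
  moreover have "closed {x. cinner x y = 0}" for y :: 'a
    by (intro closed_Collect_eq continuous_intros)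
  ultimately show ?thesis by auto
qed

text \<open>Projection theorem by a minimising sequence: the parallelogram law makes it Cauchy, and
  minimality at the limit gives orthogonality. Real scalars are used so that it also applies to the
  projections of a graph that is only known to be a real subspace.\<close>

lemma orthogonal_decomposition:
  fixes V :: "'b::{real_inner, complete_space} set"
  assumes V: "subspace V" and "closed V"
  obtains v where "v \<in> V" "\<And>w. w \<in> V \<Longrightarrow> inner (x - v) w = 0"
proof -
  define d where "d = infdist x V"
  have "V \<noteq> {}"
    using subspace_0[OF V] by auto
  have d_le: "d \<le> dist x v" if "v \<in> V" for v
    using that unfolding d_def by (rule infdist_le)
  have "\<exists>v\<in>V. dist x v < d + inverse (real (Suc n))" for n
  proof -
    have "(INF v\<in>V. dist x v) < d + inverse (real (Suc n))"
      using \<open>V \<noteq> {}\<close> by (simp add: d_def infdist_def)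
    then show ?thesis
      using \<open>V \<noteq> {}\<close> by (subst (asm) cINF_less_iff) auto
  qed
  then obtain v where v: "\<And>n. v n \<in> V" "\<And>n. dist x (v n) < d + inverse (real (Suc n))"
    by metis
  have para: "(norm (a - b))\<^sup>2 \<le> 2 * (norm (x - a))\<^sup>2 + 2 * (norm (x - b))\<^sup>2 - 4 * d\<^sup>2"
    if "a \<in> V" "b \<in> V" for a b
  proof -
    have "(1/2) *\<^sub>R (a + b) \<in> V"
      using V that by (simp add: subspace_add subspace_scale)
    then have "d \<le> norm (x - (1/2) *\<^sub>R (a + b))"
      using d_le by (simp add: dist_norm)
    then have "d\<^sup>2 \<le> (norm (x - (1/2) *\<^sub>R (a + b)))\<^sup>2"
      by (intro power_mono) (auto simp: d_def infdist_nonneg)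
    moreover have "(norm (a - b))\<^sup>2 + 4 * (norm (x - (1/2) *\<^sub>R (a + b)))\<^sup>2
        = 2 * (norm (x - a))\<^sup>2 + 2 * (norm (x - b))\<^sup>2"
      by (simp add: power2_norm_eq_inner inner_simps inner_commute algebra_simps)
    ultimately show ?thesis by simp
  qed
  have "Cauchy v"
  proof (rule metric_CauchyI)
    fix e :: real assume "e > 0"
    have "(\<lambda>n. 4 * ((d + inverse (real (Suc n)))\<^sup>2 - d\<^sup>2)) \<longlonglongrightarrow> 4 * ((d + 0)\<^sup>2 - d\<^sup>2)"
      by (intro tendsto_intros LIMSEQ_inverse_real_of_nat)
    then have "\<forall>\<^sub>F n in sequentially. 4 * ((d + inverse (real (Suc n)))\<^sup>2 - d\<^sup>2) < e\<^sup>2"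
      by (rule order_tendstoD) (use \<open>e > 0\<close> in simp)
    then obtain M where M: "\<And>n. n \<ge> M \<Longrightarrow> 4 * ((d + inverse (real (Suc n)))\<^sup>2 - d\<^sup>2) < e\<^sup>2"
      by (auto simp: eventually_sequentially)
    have sq: "(norm (x - v n))\<^sup>2 \<le> (d + inverse (real (Suc M)))\<^sup>2" if "n \<ge> M" for n
    proof -
      have "inverse (real (Suc n)) \<le> inverse (real (Suc M))"
        using that by (simp add: field_simps)
      then show ?thesis
        using v(2)[of n] by (intro power_mono) (simp_all only: dist_norm norm_ge_zero)
    qed
    show "\<exists>M. \<forall>m\<ge>M. \<forall>n\<ge>M. dist (v m) (v n) < e"
    proof (intro exI[of _ M] allI impI)
      fix m n assume mn: "m \<ge> M" "n \<ge> M"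
      have "(norm (v m - v n))\<^sup>2 < e\<^sup>2"
        using para[OF v(1) v(1), of m n] sq[OF mn(1)] sq[OF mn(2)] M[of M] by simp
      then show "dist (v m) (v n) < e"
        using \<open>e > 0\<close> by (simp add: dist_norm power2_less_imp_less)
    qed
  qed
  then obtain l where l: "v \<longlonglongrightarrow> l"
    using convergent_eq_Cauchy convergentD convergent_def by (metis Cauchy_convergent)
  have lV: "l \<in> V"
    using \<open>closed V\<close> l v(1) by (auto simp: closed_sequential_limits)
  have "(\<lambda>n. dist x (v n)) \<longlonglongrightarrow> dist x l"
    by (intro tendsto_intros l)
  moreover have "(\<lambda>n. d + inverse (real (Suc n))) \<longlonglongrightarrow> d + 0"
    by (intro tendsto_intros LIMSEQ_inverse_real_of_nat)
  ultimately have dl: "dist x l \<le> d"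
    using v(2) by (intro LIMSEQ_le) (auto intro: less_imp_le)
  have "inner (x - l) w = 0" if "w \<in> V" for w
  proof (rule ccontr)
    assume ne: "inner (x - l) w \<noteq> 0"
    then have "w \<noteq> 0" by auto
    \<comment> \<open>The minimiser of \<open>norm (x - l - t *\<^sub>R w)\<close> in
      \<open>t\<close>; a non-zero inner product would make the distance smaller than
      \<open>d\<close>.\<close>
    define t where "t = inner (x - l) w / (norm w)\<^sup>2"
    have "d \<le> norm (x - (l + t *\<^sub>R w))"
      using d_le[of "l + t *\<^sub>R w"] lV that V by (simp add: dist_norm subspace_add subspace_scale)
    then have "(norm (x - l))\<^sup>2 \<le> (norm (x - l - t *\<^sub>R w))\<^sup>2"
      using dl by (intro power_mono) (auto simp: dist_norm algebra_simps)
    also have "\<dots> = (norm (x - l))\<^sup>2 - 2 * t * inner (x - l) w + t\<^sup>2 * (norm w)\<^sup>2"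
      unfolding power2_norm_eq_inner
      by (simp add: inner_simps inner_commute algebra_simps power2_eq_square)
    also have "t\<^sup>2 * (norm w)\<^sup>2 = t * inner (x - l) w"
      using \<open>w \<noteq> 0\<close> by (simp add: t_def power2_eq_square)
    finally have "t * inner (x - l) w \<le> 0" by simp
    moreover have "t * inner (x - l) w > 0"
      using ne \<open>w \<noteq> 0\<close> by (auto simp: t_def zero_less_mult_iff zero_less_divide_iff linorder_neq_iff)
    ultimately show False by simp
  qed
  with lV show ?thesis by (rule that)
qed

lemma corth_decomposition:
  fixes V :: "'a::chilbert_space set"
  assumes "csubspace V" "closed V"
  obtains v u where "v \<in> V" "u \<in> corth V" "x = v + u"
proof -
  obtain v where v: "v \<in> V" "\<And>w. w \<in> V \<Longrightarrow> inner (x - v) w = 0"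
    using orthogonal_decomposition[OF csubspace_imp_subspace[OF assms(1)] assms(2)] by metis
  then have "x - v \<in> corth V"
    using cinner_eq_0_if_inner_csubspace[OF assms(1)] by (auto simp: corth_def)
  with v(1) show ?thesis by (intro that[of v "x - v"]) auto
qed

lemma closed_subspace_eq_UNIV:
  fixes V :: "'b::{real_inner, complete_space} set"
  assumes "subspace V" "closed V" "\<And>x. (\<And>y. y \<in> V \<Longrightarrow> inner x y = 0) \<Longrightarrow> x = 0"
  shows "V = UNIV"
proof -
  have "x \<in> V" for x
  proof -
    obtain v where "v \<in> V" "\<And>w. w \<in> V \<Longrightarrow> inner (x - v) w = 0"
      using orthogonal_decomposition[OF assms(1,2)] by metis
    with assms(3)[of "x - v"] show ?thesis by simp
  qed
  then show ?thesis by auto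
qed

section \<open>Closed symmetric operators\<close>

lemma fst_scaleC [simp]: "fst (c *\<^sub>C p) = c *\<^sub>C fst p"
  and snd_scaleC [simp]: "snd (c *\<^sub>C p) = c *\<^sub>C snd p"
  by (simp_all add: scaleC_prod_def)

text \<open>The boundary form of Green's identity, taken on graph points instead of domain vectors,
  so that no partner of a vector under the adjoint has to be named.\<close>

definition bform :: "'a::complex_inner \<times> 'a \<Rightarrow> 'a \<times> 'a \<Rightarrow> complex"
  where "bform p q = cinner (snd p) (fst q) - cinner (fst p) (snd q)"

lemma mem_adj_iff: "q \<in> adj A \<longleftrightarrow> (\<forall>p\<in>A. bform p q = 0)"
  by (cases q) (auto simp: adj_in_def bform_def)

lemma bform_simps:
  "bform (p + q) r = bform p r + bform q r"
  "bform p (q + r) = bform p q + bform p r"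
  "bform (p - q) r = bform p r - bform q r"
  "bform p (q - r) = bform p q - bform p r"
  "bform (c *\<^sub>C p) q = c * bform p q"
  "bform p (c *\<^sub>C q) = cnj c * bform p q"
  "bform 0 q = 0" "bform p 0 = 0"
  by (simp_all add: bform_def cinner_simps algebra_simps)

lemma bform_commute: "bform p q = - cnj (bform q p)"
  using cinner_commute[of "snd p" "fst q"] cinner_commute[of "fst p" "snd q"]
  by (simp add: bform_def)

lemma bform_eq_0_commute: "bform p q = 0 \<longleftrightarrow> bform q p = 0"
  using bform_commute[of p q] bform_commute[of q p] by auto

lemma csubspace_adj: "csubspace (adj A)"
  by (auto simp: complex_vector.subspace_def mem_adj_iff bform_simps)

lemma adj_antimono: "A \<subseteq> B \<Longrightarrow> adj B \<subseteq> adj A"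
  unfolding mem_adj_iff subset_iff by blast

text \<open>The graph point of a would-be eigenvector: membership of \<open>ev \<mu> f\<close> in a
  graph is the eigenvalue equation together with the domain condition.\<close>

definition ev :: "complex \<Rightarrow> 'a::complex_vector \<Rightarrow> 'a \<times> 'a"
  where "ev \<mu> f = (f, \<mu> *\<^sub>C f)"

lemma fst_ev [simp]: "fst (ev \<mu> f) = f"
  and snd_ev [simp]: "snd (ev \<mu> f) = \<mu> *\<^sub>C f"
  by (simp_all add: ev_def)

lemma ev_add: "ev \<mu> (f + g) = ev \<mu> f + ev \<mu> g"
  and ev_diff: "ev \<mu> (f - g) = ev \<mu> f - ev \<mu> g"
  and ev_scaleC: "ev \<mu> (c *\<^sub>C f) = c *\<^sub>C ev \<mu> f"
  and ev_0 [simp]: "ev \<mu> 0 = 0"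
  by (simp_all add: prod_eq_iff scaleC_simps scaleC_scaleC mult.commute)

lemma bform_ev: "bform (ev \<mu> f) (ev \<nu> g) = (\<mu> - cnj \<nu>) * cinner f g"
  by (simp add: bform_def cinner_simps algebra_simps)

text \<open>This sign is what separates the upper from the lower half-plane in all later
  arguments.\<close>

lemma bform_ev_self: "bform (ev \<mu> f) (ev \<mu> f) = of_real (2 * Im \<mu> * (norm f)\<^sup>2) * \<i>"
  by (simp add: bform_ev cinner_self complex_diff_cnj)

definition defect :: "'a::complex_inner operator \<Rightarrow> complex \<Rightarrow> 'a set"
  where "defect S \<mu> = op_ker (op_minus (adj S) \<mu>)"

lemma mem_defect_iff: "f \<in> defect S \<mu> \<longleftrightarrow> ev \<mu> f \<in> adj S"
  by (auto simp: defect_def op_ker_def op_minus_def ev_def)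

lemma csubspace_defect: "csubspace (defect S \<mu>)"
  using csubspace_adj[of S]
  by (auto simp: complex_vector.subspace_def mem_defect_iff ev_add ev_scaleC)

section \<open>Spaces of dimension at most two, without reference to bases\<close>

definition three_dependent :: "'a::complex_vector set \<Rightarrow> bool"
  where "three_dependent V \<longleftrightarrow> (\<forall>x\<in>V. \<forall>y\<in>V. \<forall>z\<in>V. \<exists>a b c.
    (a \<noteq> 0 \<or> b \<noteq> 0 \<or> c \<noteq> 0) \<and> a *\<^sub>C x + b *\<^sub>C y + c *\<^sub>C z = 0)"

lemma three_dependent_if_cdim_2:
  assumes "cdim V = 2"
  shows "three_dependent V"
  unfolding three_dependent_def
proof (intro ballI, rule ccontr)
  fix x y z assume V: "x \<in> V" "y \<in> V" "z \<in> V"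
    and "\<not> (\<exists>a b c. (a \<noteq> 0 \<or> b \<noteq> 0 \<or> c \<noteq> 0) \<and> a *\<^sub>C x + b *\<^sub>C y + c *\<^sub>C z = 0)"
  then have z: "a = 0 \<and> b = 0 \<and> c = 0" if "a *\<^sub>C x + b *\<^sub>C y + c *\<^sub>C z = 0" for a b c
    using that by blast
  have "x \<noteq> y" "x \<noteq> z" "y \<noteq> z"
    using z[of 1 "-1" 0] z[of 1 0 "-1"] z[of 0 1 "-1"] by auto
  moreover have "z \<noteq> 0"
    using z[of 0 0 1] by auto
  moreover have "y \<notin> cspan {z}"
  proof
    assume "y \<in> cspan {z}"
    then obtain k where "y = k *\<^sub>C z"
      by (auto simp: complex_vector.span_singleton)
    then show False
      using z[of 0 1 "- k"] by simp
  qed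
  moreover have "x \<notin> cspan {y, z}"
  proof
    assume "x \<in> cspan {y, z}"
    then obtain a b where "x - a *\<^sub>C y = b *\<^sub>C z"
      by (auto simp: complex_vector.span_insert complex_vector.span_singleton)
    then show False
      using z[of 1 "-a" "-b"] by (simp add: diff_diff_eq[symmetric])
  qed
  ultimately have ind: "\<not> cdependent {x, y, z}"
    by (auto simp: complex_vector.independent_insert)
  obtain B where B: "B \<subseteq> V" "\<not> cdependent B" "V \<subseteq> cspan B" "card B = cdim V"
    by (rule complex_vector.basis_exists)
  \<comment> \<open>An infinite set has cardinality 0, so cardinality 2 forces finiteness.\<close>
  have "finite B"
    using B(4) assms by (intro card_ge_0_finite) simp
  then have "card {x, y, z} \<le> card B"
    using complex_vector.independent_span_bound[OF _ ind, of B] V B(3) by auto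
  with B(4) assms \<open>x \<noteq> y\<close> \<open>x \<noteq> z\<close> \<open>y \<noteq> z\<close> show False by simp
qed

lemma three_dependentE:
  assumes "three_dependent V" "a \<in> V" "b \<in> V" "w \<in> V" "a \<noteq> 0" "b \<noteq> 0" "cinner a b = 0"
  obtains p q where "w = p *\<^sub>C a + q *\<^sub>C b"
proof -
  obtain x y z where xyz: "x \<noteq> 0 \<or> y \<noteq> 0 \<or> z \<noteq> 0" "x *\<^sub>C a + y *\<^sub>C b + z *\<^sub>C w = 0"
    using assms(1-4) unfolding three_dependent_def by metis
  have ba: "cinner b a = 0"
    using assms(7) by (simp add: cinner_eq_0_commute)
  have "z \<noteq> 0"
  proof
    assume "z = 0"
    then have "cinner (x *\<^sub>C a + y *\<^sub>C b) a = 0" "cinner (x *\<^sub>C a + y *\<^sub>C b) b = 0"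
      using xyz(2) by auto
    then show False
      using xyz(1) \<open>z = 0\<close> assms(5-7) ba by (simp add: cinner_simps)
  qed
  have "z *\<^sub>C w = - (x *\<^sub>C a) - y *\<^sub>C b"
    using xyz(2) by (metis add.inverse_unique diff_conv_add_uminus minus_add_distrib)
  then have "inverse z *\<^sub>C z *\<^sub>C w = inverse z *\<^sub>C (- (x *\<^sub>C a) - y *\<^sub>C b)"
    by simp
  then have "w = (- (inverse z * x)) *\<^sub>C a + (- (inverse z * y)) *\<^sub>C b"
    using \<open>z \<noteq> 0\<close> by (simp add: scaleC_scaleC scaleC_simps scaleC_one)
  then show ?thesis by (rule that)
qed

lemma three_dependent_orthogonal:
  assumes "three_dependent V" "a \<in> V" "b \<in> V" "w \<in> V" "a \<noteq> 0" "b \<noteq> 0" "cinner a b = 0"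
    and "cinner w b = 0"
  obtains p where "w = p *\<^sub>C a"
proof -
  obtain p q where pq: "w = p *\<^sub>C a + q *\<^sub>C b"
    using three_dependentE[OF assms(1-7)] .
  have "q * cinner b b = 0"
    using assms(7,8) by (simp add: pq cinner_simps)
  with \<open>b \<noteq> 0\<close> have "q = 0" by simp
  with pq show ?thesis by (intro that[of p]) simp
qed

lemma orthonormal_pair_exists:
  assumes V: "csubspace V" "cdim V = 2"
  obtains a b where "a \<in> V" "b \<in> V" "norm a = 1" "norm b = 1" "cinner a b = 0"
    "\<And>w. w \<in> V \<Longrightarrow> w = cinner w a *\<^sub>C a + cinner w b *\<^sub>C b"
proof -
  obtain B where B: "B \<subseteq> V" "\<not> cdependent B" "V \<subseteq> cspan B" "card B = cdim V"
    by (rule complex_vector.basis_exists)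
  obtain u v where uv: "B = {u, v}" "u \<noteq> v"
    using B(4) V(2) card_2_iff by metis
  have "u \<noteq> 0"
    using B(2) uv complex_vector.dependent_zero by auto
  have "v \<notin> cspan {u}"
    using B(2) uv by (auto simp: insert_commute[of u] complex_vector.independent_insert)
  define b where "b = v - (cinner v u / cinner u u) *\<^sub>C u"
  have "b \<noteq> 0"
    using \<open>v \<notin> cspan {u}\<close> by (auto simp: b_def complex_vector.span_singleton)
  have ub: "cinner u b = 0"
    using \<open>u \<noteq> 0\<close> by (subst cinner_eq_0_commute) (simp add: b_def cinner_simps)
  have V': "u \<in> V" "v \<in> V" "b \<in> V"
    using B(1) uv V(1) by (auto simp: b_def intro: csubspace_diff csubspace_scale)
  define a' b' where "a' = of_real (inverse (norm u)) *\<^sub>C u" and "b' = of_real (inverse (norm b)) *\<^sub>C b"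
  have n: "a' \<in> V" "b' \<in> V" "norm a' = 1" "norm b' = 1" "cinner a' b' = 0"
    using V(1) V' \<open>u \<noteq> 0\<close> \<open>b \<noteq> 0\<close> ub
    by (auto simp: a'_def b'_def cinner_simps norm_inverse intro: csubspace_scale)
  have "w = cinner w a' *\<^sub>C a' + cinner w b' *\<^sub>C b'" if w: "w \<in> V" for w
  proof -
    have "a' \<noteq> 0" "b' \<noteq> 0" using n by auto
    then obtain p q where pq: "w = p *\<^sub>C a' + q *\<^sub>C b'"
      using three_dependentE[OF three_dependent_if_cdim_2[OF V(2)] n(1,2) w _ _ n(5)] by blast
    moreover have "cinner b' a' = 0"
      using n(5) by (simp add: cinner_eq_0_commute)
    ultimately show ?thesis
      using n by (simp add: cinner_simps cinner_self)
  qed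
  with n show ?thesis by (rule that)
qed

locale closed_symmetric =
  fixes S :: "'a::chilbert_space operator"
  assumes linear_S: "linear_operator S" and closed_S: "closed S"
    and dense_S: "densely_defined S" and symmetric_S: "symmetric_operator S"
begin

abbreviation N where "N \<equiv> defect S"

lemma csubspace_S: "csubspace S"
  using linear_S by (simp add: linear_operator_def)

lemma S_subset_adj: "p \<in> S \<Longrightarrow> p \<in> adj S"
  using symmetric_S by (auto simp: symmetric_operator_def)

lemma bform_S_left [simp]: "p \<in> S \<Longrightarrow> q \<in> adj S \<Longrightarrow> bform p q = 0"
  by (simp add: mem_adj_iff)

lemma bform_S_right [simp]: "q \<in> S \<Longrightarrow> p \<in> adj S \<Longrightarrow> bform p q = 0"
  by (subst bform_eq_0_commute) simp

lemma adj_zero_imp_zero: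
  assumes "(0, z) \<in> adj S"
  shows "z = 0"
proof -
  have "closure (Domain S) \<subseteq> {x. cinner x z = 0}"
  proof (rule closure_minimal)
    show "Domain S \<subseteq> {x. cinner x z = 0}"
      using assms by (auto simp: adj_in_def)
    show "closed {x. cinner x z = 0}"
      by (intro closed_Collect_eq continuous_intros)
  qed
  then have "cinner z z = 0"
    using dense_S unfolding densely_defined_def by blast
  then show ?thesis by simp
qed

lemma adj_eqI:
  assumes "p \<in> adj S" "q \<in> adj S" "fst p = fst q"
  shows "p = q"
proof -
  have "p - q \<in> adj S"
    by (intro csubspace_diff csubspace_adj assms)
  moreover have "p - q = (0, snd p - snd q)"
    using assms(3) by (simp add: prod_eq_iff)
  ultimately show ?thesis
    using adj_zero_imp_zero[of "snd p - snd q"] assms(3) by (simp add: prod_eq_iff)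
qed

text \<open>For a symmetric operator (S x, x) is real, so the imaginary part of ((S - \<mu>) x, x)
  is - Im \<mu> times the squared norm of x. This bound makes the ranges of S - \<mu>
  closed.\<close>

lemma norm_le_ran:
  assumes "p \<in> S"
  shows "\<bar>Im \<mu>\<bar> * norm (fst p) \<le> norm (snd p - \<mu> *\<^sub>C fst p)"
proof (cases "fst p = 0")
  case False
  have "bform p p = 0"
    using assms S_subset_adj by simp
  then have "cinner (snd p) (fst p) = cnj (cinner (snd p) (fst p))"
    by (metis bform_def cinner_commute eq_iff_diff_eq_0)
  then have "Im (cinner (snd p) (fst p)) = 0"
    by (metis Reals_cnj_iff complex_is_Real_iff)
  then have "\<bar>Im \<mu>\<bar> * (norm (fst p))\<^sup>2 = \<bar>Im (cinner (snd p - \<mu> *\<^sub>C fst p) (fst p))\<bar>"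
    by (simp add: cinner_simps cinner_self abs_mult)
  also have "\<dots> \<le> cmod (cinner (snd p - \<mu> *\<^sub>C fst p) (fst p))"
    by (rule abs_Im_le_cmod)
  also have "\<dots> \<le> norm (snd p - \<mu> *\<^sub>C fst p) * norm (fst p)"
    by (rule norm_cinner_le)
  finally show ?thesis
    using False by (simp add: power2_eq_square)
qed simp

section \<open>Ranges of S - \<mu> and von Neumann's decomposition\<close>

definition ran :: "complex \<Rightarrow> 'a set"
  where "ran \<mu> = (\<lambda>p. snd p - \<mu> *\<^sub>C fst p) ` S"

lemma csubspace_ran: "csubspace (ran \<mu>)"
  unfolding complex_vector.subspace_def
proof (intro conjI ballI allI)
  show "0 \<in> ran \<mu>"
    using csubspace_0[OF csubspace_S] by (force simp: ran_def)
  fix x assume "x \<in> ran \<mu>"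
  then obtain p where p: "p \<in> S" "x = snd p - \<mu> *\<^sub>C fst p"
    by (auto simp: ran_def)
  show "c *\<^sub>C x \<in> ran \<mu>" for c
    unfolding ran_def
    by (rule image_eqI[of _ _ "c *\<^sub>C p"])
      (simp_all add: p csubspace_scale[OF csubspace_S] scaleC_simps scaleC_scaleC mult.commute)
  fix y assume "y \<in> ran \<mu>"
  then obtain q where q: "q \<in> S" "y = snd q - \<mu> *\<^sub>C fst q"
    by (auto simp: ran_def)
  show "x + y \<in> ran \<mu>"
    unfolding ran_def
    by (rule image_eqI[of _ _ "p + q"])
      (simp_all add: p q csubspace_add[OF csubspace_S] scaleC_simps algebra_simps)
qed

lemma closed_ran:
  assumes "Im \<mu> \<noteq> 0"
  shows "closed (ran \<mu>)"
  unfolding closed_sequential_limits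
proof (intro allI impI, elim conjE)
  fix y l assume y: "\<forall>n. y n \<in> ran \<mu>" and lim: "y \<longlonglongrightarrow> l"
  then obtain p where p: "\<And>n. p n \<in> S" "\<And>n. y n = snd (p n) - \<mu> *\<^sub>C fst (p n)"
    unfolding ran_def image_iff by metis
  have "Cauchy y"
    using lim by (rule LIMSEQ_imp_Cauchy)
  have "Cauchy (\<lambda>n. fst (p n))"
  proof (rule metric_CauchyI)
    fix e :: real assume "e > 0"
    then have "e * \<bar>Im \<mu>\<bar> > 0" using assms by simp
    then obtain M where M: "\<And>m n. m \<ge> M \<Longrightarrow> n \<ge> M \<Longrightarrow> dist (y m) (y n) < e * \<bar>Im \<mu>\<bar>"
      using metric_CauchyD[OF \<open>Cauchy y\<close>] by metis
    have "dist (fst (p m)) (fst (p n)) < e" if mn: "m \<ge> M" "n \<ge> M" for m n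
    proof -
      have "\<bar>Im \<mu>\<bar> * norm (fst (p m - p n)) \<le> norm (snd (p m - p n) - \<mu> *\<^sub>C fst (p m - p n))"
        by (intro norm_le_ran csubspace_diff csubspace_S p)
      also have "snd (p m - p n) - \<mu> *\<^sub>C fst (p m - p n) = y m - y n"
        by (simp add: p scaleC_simps algebra_simps)
      also have "norm \<dots> < e * \<bar>Im \<mu>\<bar>"
        using M[OF mn] by (simp add: dist_norm)
      finally show ?thesis
        using assms by (simp add: dist_norm mult.commute)
    qed
    then show "\<exists>M. \<forall>m\<ge>M. \<forall>n\<ge>M. dist (fst (p m)) (fst (p n)) < e" by blast
  qed
  then obtain x where x: "(\<lambda>n. fst (p n)) \<longlonglongrightarrow> x"
    using Cauchy_convergent convergent_def by blast
  have "(\<lambda>n. y n + \<mu> *\<^sub>C fst (p n)) \<longlonglongrightarrow> l + \<mu> *\<^sub>C x"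
    by (intro tendsto_add tendsto_scaleC x lim)
  then have "(\<lambda>n. snd (p n)) \<longlonglongrightarrow> l + \<mu> *\<^sub>C x"
    by (simp add: p)
  with x have "(\<lambda>n. (fst (p n), snd (p n))) \<longlonglongrightarrow> (x, l + \<mu> *\<^sub>C x)"
    by (rule tendsto_Pair)
  then have "(x, l + \<mu> *\<^sub>C x) \<in> S"
    using closed_S p(1) by (auto simp: closed_sequential_limits)
  then show "l \<in> ran \<mu>"
    unfolding ran_def by (rule image_eqI[rotated]) simp
qed

lemma corth_ran: "corth (ran \<mu>) = N (cnj \<mu>)"
proof -
  have "cinner y (snd p - \<mu> *\<^sub>C fst p) = 0 \<longleftrightarrow> bform p (ev (cnj \<mu>) y) = 0"
    for y and p :: "'a \<times> 'a"
    by (subst cinner_eq_0_commute) (simp add: bform_def cinner_simps)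
  then show ?thesis
    by (auto simp: corth_def ran_def mem_defect_iff mem_adj_iff)
qed

lemma ran_decomposition:
  assumes "Im \<mu> \<noteq> 0"
  obtains p g where "p \<in> S" "g \<in> N (cnj \<mu>)" "y = snd p - \<mu> *\<^sub>C fst p + g"
proof -
  obtain v u where "v \<in> ran \<mu>" "u \<in> corth (ran \<mu>)" "y = v + u"
    by (rule corth_decomposition[OF csubspace_ran closed_ran[OF assms]])
  moreover from this obtain p where "p \<in> S" "v = snd p - \<mu> *\<^sub>C fst p"
    unfolding ran_def by blast
  ultimately show ?thesis
    using that unfolding corth_ran by blast
qed

lemma cinner_ran_defect:
  assumes "p \<in> S" "g \<in> N (cnj \<mu>)"
  shows "cinner (snd p - \<mu> *\<^sub>C fst p) g = 0"
proof -
  have "g \<in> corth (ran \<mu>)" using assms(2) by (simp add: corth_ran)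
  then show ?thesis
    using assms(1) by (subst cinner_eq_0_commute) (auto simp: corth_def ran_def)
qed

lemma ran_if_orthogonal:
  assumes "Im \<mu> \<noteq> 0" "\<And>g. g \<in> N (cnj \<mu>) \<Longrightarrow> cinner y g = 0"
  obtains p where "p \<in> S" "y = snd p - \<mu> *\<^sub>C fst p"
proof -
  obtain p g where pg: "p \<in> S" "g \<in> N (cnj \<mu>)" "y = snd p - \<mu> *\<^sub>C fst p + g"
    using ran_decomposition[OF assms(1)] .
  have "cinner (snd p - \<mu> *\<^sub>C fst p) g + cinner g g = 0"
    using assms(2)[OF pg(2)] by (simp add: pg(3) cinner_simps)
  then have "g = 0"
    using cinner_ran_defect[OF pg(1,2)] by simp
  with pg show ?thesis by (intro that[of p]) auto
qed

text \<open>Split the image of \<open>p\<close> under the adjoint minus \<mu> along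
  \<open>ran \<mu>\<close> and its complement \<open>N (cnj \<mu>)\<close>. On
  \<open>N (cnj \<mu>)\<close> that map is multiplication by \<open>cnj \<mu> - \<mu>\<close>, which
  is invertible, so both parts have preimages; what is left of \<open>p\<close> lies in the
  kernel.\<close>

lemma von_Neumann:
  assumes "Im \<mu> \<noteq> 0" "p \<in> adj S"
  obtains s f g where "s \<in> S" "f \<in> N \<mu>" "g \<in> N (cnj \<mu>)" "p = s + ev \<mu> f + ev (cnj \<mu>) g"
proof -
  obtain s h where sh: "s \<in> S" "h \<in> N (cnj \<mu>)"
      "snd p - \<mu> *\<^sub>C fst p = snd s - \<mu> *\<^sub>C fst s + h"
    using ran_decomposition[OF assms(1)] .
  have ne: "cnj \<mu> - \<mu> \<noteq> 0"
    using assms(1) by (simp add: complex_eq_iff)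
  define g where "g = inverse (cnj \<mu> - \<mu>) *\<^sub>C h"
  have g: "g \<in> N (cnj \<mu>)" "h = (cnj \<mu> - \<mu>) *\<^sub>C g"
    using sh(2) ne by (auto simp: g_def scaleC_scaleC scaleC_one intro: csubspace_scale csubspace_defect)
  define q where "q = p - s - ev (cnj \<mu>) g"
  have "q \<in> adj S"
    unfolding q_def using assms(2) S_subset_adj[OF sh(1)] g(1)
    by (intro csubspace_diff csubspace_adj) (auto simp: mem_defect_iff)
  moreover have "snd q - \<mu> *\<^sub>C fst q = (snd p - \<mu> *\<^sub>C fst p) - (snd s - \<mu> *\<^sub>C fst s) - (cnj \<mu> - \<mu>) *\<^sub>C g"
    by (simp add: q_def scaleC_simps algebra_simps)
  then have "snd q = \<mu> *\<^sub>C fst q"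
    using sh(3) g(2) by simp
  then have "q = ev \<mu> (fst q)"
    by (simp add: prod_eq_iff)
  moreover have "p = s + q + ev (cnj \<mu>) g"
    by (simp add: q_def)
  ultimately have "fst q \<in> N \<mu>" "p = s + ev \<mu> (fst q) + ev (cnj \<mu>) g"
    by (simp_all add: mem_defect_iff)
  then show ?thesis using sh(1) g(1) that by blast
qed

section \<open>Comparison of defect spaces at different points\<close>

lemma ev_in_adj: "f \<in> N \<mu> \<Longrightarrow> ev \<mu> f \<in> adj S"
  by (simp add: mem_defect_iff)

text \<open>The boundary form does not see \<open>S\<close>, so it takes the same value on both
  eigenpairs, while the half-planes give these values opposite signs.\<close>

lemma opposite_defect:
  assumes "f \<in> N \<mu>" "g \<in> N \<nu>" "ev \<mu> f - ev \<nu> g \<in> S" "Im \<mu> * Im \<nu> < 0"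
  shows "f = 0" "g = 0"
proof -
  let ?s = "ev \<mu> f - ev \<nu> g"
  have "bform (ev \<mu> f) (ev \<mu> f) = bform (ev \<nu> g + ?s) (ev \<nu> g + ?s)"
    by simp
  also have "\<dots> = bform (ev \<nu> g) (ev \<nu> g)"
    unfolding bform_simps(1,2) using assms ev_in_adj S_subset_adj by simp
  finally have eq: "Im \<mu> * (norm f)\<^sup>2 = Im \<nu> * (norm g)\<^sup>2"
    unfolding bform_ev_self by (simp add: of_real_eq_iff[symmetric, where 'a=complex] del: of_real_eq_iff)
  have "Im \<mu> * Im \<mu> * (norm f)\<^sup>2 = Im \<mu> * Im \<nu> * (norm g)\<^sup>2"
    using eq by (simp add: mult.assoc)
  moreover have "Im \<mu> * Im \<nu> * (norm g)\<^sup>2 \<le> 0" "Im \<mu> * Im \<mu> * (norm f)\<^sup>2 \<ge> 0"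
    using assms(4) by (auto intro: mult_nonpos_nonneg)
  ultimately have "Im \<mu> * Im \<mu> * (norm f)\<^sup>2 = 0" "Im \<mu> * Im \<nu> * (norm g)\<^sup>2 = 0"
    by linarith+
  then show "f = 0" "g = 0"
    using assms(4) by auto
qed

lemma ev_in_S_imp_0:
  assumes "f \<in> N \<mu>" "ev \<mu> f \<in> S" "Im \<mu> \<noteq> 0"
  shows "f = 0"
proof -
  have "bform (ev \<mu> f) (ev \<mu> f) = 0"
    using assms ev_in_adj by simp
  then show ?thesis
    using assms(3) by (simp add: bform_ev_self)
qed

text \<open>A closed operator is its second adjoint. In von Neumann's decomposition at
  \<open>\<i>\<close> the two eigenpairs are orthogonal for the form, so testing \<open>p\<close>
  against each of them yields the squared norm of that component.\<close>

lemma adj_adj: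
  assumes "p \<in> adj S" "\<And>q. q \<in> adj S \<Longrightarrow> bform p q = 0"
  shows "p \<in> S"
proof -
  obtain s f g where *: "s \<in> S" "f \<in> N \<i>" "g \<in> N (cnj \<i>)" "p = s + ev \<i> f + ev (cnj \<i>) g"
    using von_Neumann[of \<i>, OF _ assms(1)] by (metis imaginary_unit.simps(2) zero_neq_one)
  have "bform p (ev \<i> f) = 0" "bform p (ev (cnj \<i>) g) = 0"
    using assms(2) * ev_in_adj by auto
  then have "f = 0" "g = 0"
    using * ev_in_adj by (simp_all add: bform_simps bform_ev)
  with * show ?thesis by simp
qed

lemma defect_nonzero_transfer:
  assumes "f \<in> N \<nu>" "f \<noteq> 0" "Im \<mu> * Im \<nu> > 0"
  obtains g where "g \<in> N \<mu>" "g \<noteq> 0"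
proof -
  have "Im \<mu> \<noteq> 0" using assms(3) by auto
  then obtain s g h where *: "s \<in> S" "g \<in> N \<mu>" "h \<in> N (cnj \<mu>)" "ev \<nu> f = s + ev \<mu> g + ev (cnj \<mu>) h"
    using von_Neumann[OF _ ev_in_adj[OF assms(1)]] by metis
  have "g \<noteq> 0"
  proof
    assume "g = 0"
    then have "ev \<nu> f - ev (cnj \<mu>) h \<in> S" using * by simp
    then show False
      using opposite_defect(1)[OF assms(1) *(3)] assms(2,3) by (simp add: mult.commute)
  qed
  with *(2) show ?thesis by (rule that)
qed

text \<open>The component in \<open>N \<nu>\<close> of von Neumann's decomposition maps
  \<open>N \<mu>\<close> to \<open>N \<nu>\<close>, and by \<open>opposite_defect\<close> nothing is
  lost: a vector with zero component is congruent to one of the opposite half-plane. This is one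
  half of the invariance of the deficiency index.\<close>

lemma three_dependent_transfer:
  assumes dep: "three_dependent (N \<nu>)" and sgn: "Im \<mu> * Im \<nu> > 0"
  shows "three_dependent (N \<mu>)"
  unfolding three_dependent_def
proof (intro ballI)
  fix x y z assume xyz: "x \<in> N \<mu>" "y \<in> N \<mu>" "z \<in> N \<mu>"
  have "Im \<nu> \<noteq> 0" using sgn by auto
  have "\<exists>f g. f \<in> N \<nu> \<and> g \<in> N (cnj \<nu>) \<and> ev \<mu> x - ev \<nu> f - ev (cnj \<nu>) g \<in> S" if x: "x \<in> N \<mu>" for x
  proof -
    obtain s f g where "s \<in> S" "f \<in> N \<nu>" "g \<in> N (cnj \<nu>)" "ev \<mu> x = s + ev \<nu> f + ev (cnj \<nu>) g"
      by (rule von_Neumann[OF \<open>Im \<nu> \<noteq> 0\<close> ev_in_adj[OF x]])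
    moreover from this have "ev \<mu> x - ev \<nu> f - ev (cnj \<nu>) g = s"
      by simp
    ultimately show ?thesis by metis
  qed
  then obtain F G where FG: "\<And>x. x \<in> N \<mu> \<Longrightarrow> F x \<in> N \<nu>" "\<And>x. x \<in> N \<mu> \<Longrightarrow> G x \<in> N (cnj \<nu>)"
    "\<And>x. x \<in> N \<mu> \<Longrightarrow> ev \<mu> x - ev \<nu> (F x) - ev (cnj \<nu>) (G x) \<in> S"
    by metis
  obtain a b c where abc: "a \<noteq> 0 \<or> b \<noteq> 0 \<or> c \<noteq> 0" "a *\<^sub>C F x + b *\<^sub>C F y + c *\<^sub>C F z = 0"
    using dep FG(1) xyz unfolding three_dependent_def by metis
  let ?u = "a *\<^sub>C x + b *\<^sub>C y + c *\<^sub>C z" and ?g = "a *\<^sub>C G x + b *\<^sub>C G y + c *\<^sub>C G z"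
  let ?r = "\<lambda>x. ev \<mu> x - ev \<nu> (F x) - ev (cnj \<nu>) (G x)"
  have "a *\<^sub>C ?r x + b *\<^sub>C ?r y + c *\<^sub>C ?r z \<in> S"
    by (intro csubspace_add csubspace_scale csubspace_S FG xyz)
  also have "a *\<^sub>C ?r x + b *\<^sub>C ?r y + c *\<^sub>C ?r z
      = ev \<mu> ?u - ev \<nu> (a *\<^sub>C F x + b *\<^sub>C F y + c *\<^sub>C F z) - ev (cnj \<nu>) ?g"
    by (simp add: ev_add ev_scaleC scaleC_simps)
  finally have *: "ev \<mu> ?u - ev (cnj \<nu>) ?g \<in> S"
    by (simp add: abc(2))
  have "?u \<in> N \<mu>" "?g \<in> N (cnj \<nu>)"
    by (intro csubspace_add csubspace_scale csubspace_defect FG xyz)+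
  from opposite_defect(1)[OF this *] sgn have "?u = 0"
    by simp
  with abc(1) show "\<exists>a b c. (a \<noteq> 0 \<or> b \<noteq> 0 \<or> c \<noteq> 0) \<and> a *\<^sub>C x + b *\<^sub>C y + c *\<^sub>C z = 0"
    by blast
qed

end

section \<open>Boundary triplets and constant Weyl functions\<close>

context closed_symmetric
begin

text \<open>For every boundary triplet this says that the Weyl function is constant on each half-plane,
  but it does not mention the triplet.\<close>

definition constant_defect :: bool
  where "constant_defect \<longleftrightarrow>
    (\<forall>\<mu> \<nu>. Im \<mu> * Im \<nu> > 0 \<longrightarrow> (\<forall>f\<in>N \<nu>. \<exists>g\<in>N \<mu>. ev \<nu> f - ev \<mu> g \<in> S))"

lemma constant_defectD:
  assumes constant_defect "f \<in> N \<nu>" "Im \<mu> * Im \<nu> > 0"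
  obtains g where "g \<in> N \<mu>" "ev \<nu> f - ev \<mu> g \<in> S"
  using assms unfolding constant_defect_def by blast

text \<open>The given transfer from \<open>\<iota>\<close> to \<open>\<nu>\<close> removes the
  \<open>N \<iota>\<close> component of \<open>f\<close>. The remainder in \<open>N \<nu>\<close> is
  congruent to a vector of the opposite half-plane and therefore zero.\<close>

lemma defect_transfer_sym:
  assumes *: "\<And>f. f \<in> N \<iota> \<Longrightarrow> \<exists>g\<in>N \<nu>. ev \<iota> f - ev \<nu> g \<in> S"
    and sgn: "Im \<iota> * Im \<nu> > 0" and f: "f \<in> N \<nu>"
  shows "\<exists>g\<in>N \<iota>. ev \<nu> f - ev \<iota> g \<in> S"
proof -
  have "Im \<iota> \<noteq> 0" using sgn by auto
  then obtain s n m where vN: "s \<in> S" "n \<in> N \<iota>" "m \<in> N (cnj \<iota>)"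
      "ev \<nu> f = s + ev \<iota> n + ev (cnj \<iota>) m"
    using von_Neumann[OF _ ev_in_adj[OF f]] by metis
  obtain n' where n': "n' \<in> N \<nu>" "ev \<iota> n - ev \<nu> n' \<in> S"
    using *[OF vN(2)] by blast
  have "s + (ev \<iota> n - ev \<nu> n') \<in> S"
    using vN(1) n'(2) by (rule csubspace_add[OF csubspace_S])
  also have "s + (ev \<iota> n - ev \<nu> n') = ev \<nu> (f - n') - ev (cnj \<iota>) m"
    by (simp add: ev_diff vN(4))
  finally have "ev \<nu> (f - n') - ev (cnj \<iota>) m \<in> S" .
  moreover have "f - n' \<in> N \<nu>"
    using f n'(1) by (rule csubspace_diff[OF csubspace_defect])
  moreover have "Im \<nu> * Im (cnj \<iota>) < 0"
    using sgn by (simp add: mult.commute)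
  ultimately have "f - n' = 0"
    using opposite_defect(1) vN(3) by blast
  moreover have "- (ev \<iota> n - ev \<nu> n') \<in> S"
    using n'(2) by (rule csubspace_uminus[OF csubspace_S])
  ultimately show ?thesis
    using vN(2) by (intro bexI[of _ n]) auto
qed

text \<open>Two points of a half-plane are compared through its base point \<open>\<i>\<close> or
  \<open>- \<i>\<close>, the way back being \<open>defect_transfer_sym\<close>. The contrapositive
  yields, when the condition fails, a vector at a base point that cannot be moved.\<close>

lemma constant_defectI:
  assumes *: "\<And>\<iota> \<nu> f. \<iota> = \<i> \<or> \<iota> = - \<i> \<Longrightarrow> Im \<iota> * Im \<nu> > 0 \<Longrightarrow> f \<in> N \<iota> \<Longrightarrow>
    \<exists>g\<in>N \<nu>. ev \<iota> f - ev \<nu> g \<in> S"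
  shows constant_defect
  unfolding constant_defect_def
proof (intro allI impI ballI)
  fix \<mu> \<nu> f assume sgn: "Im \<mu> * Im \<nu> > 0" and f: "f \<in> N \<nu>"
  define \<iota> where "\<iota> = (if Im \<nu> > 0 then \<i> else - \<i>)"
  have \<iota>: "\<iota> = \<i> \<or> \<iota> = - \<i>" "Im \<iota> * Im \<nu> > 0" "Im \<iota> * Im \<mu> > 0"
    using sgn by (auto simp: \<iota>_def zero_less_mult_iff)
  obtain n where n: "n \<in> N \<iota>" "ev \<nu> f - ev \<iota> n \<in> S"
    using defect_transfer_sym[OF *[OF \<iota>(1,2)] \<iota>(2) f] by blast
  obtain g where g: "g \<in> N \<mu>" "ev \<iota> n - ev \<mu> g \<in> S"
    using *[OF \<iota>(1,3) n(1)] by blast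
  have "(ev \<nu> f - ev \<iota> n) + (ev \<iota> n - ev \<mu> g) \<in> S"
    using n(2) g(2) by (rule csubspace_add[OF csubspace_S])
  then show "\<exists>g\<in>N \<mu>. ev \<nu> f - ev \<mu> g \<in> S"
    using g(1) by (intro bexI[of _ g]) auto
qed

section \<open>Elimination of the boundary triplet\<close>

lemma fst_in_Domain: "p \<in> adj S \<Longrightarrow> fst p \<in> Domain (adj S)"
  by (cases p) auto

lemma clinear_on_fst_diff:
  assumes "clinear_on (Domain (adj S)) \<Gamma>" "p \<in> adj S" "q \<in> adj S"
  shows "\<Gamma> (fst (p - q)) = \<Gamma> (fst p) - \<Gamma> (fst q)"
proof -
  have "\<Gamma> (fst p + (- 1) *\<^sub>C fst q) = \<Gamma> (fst p) + \<Gamma> ((- 1) *\<^sub>C fst q)"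
    using assms csubspace_scale[OF csubspace_adj assms(3), of "- 1"]
    unfolding clinear_on_def by (metis fst_in_Domain fst_scaleC)
  moreover have "\<Gamma> ((- 1) *\<^sub>C fst q) = (- 1) *\<^sub>C \<Gamma> (fst q)"
    using assms fst_in_Domain unfolding clinear_on_def by blast
  ultimately show ?thesis by simp
qed

lemma boundary_triplet_kernel:
  fixes \<Gamma>0 \<Gamma>1 :: "'a \<Rightarrow> 'h::chilbert_space"
  assumes bt: "boundary_triplet S \<Gamma>0 \<Gamma>1" and p: "p \<in> adj S"
  shows "\<Gamma>0 (fst p) = 0 \<and> \<Gamma>1 (fst p) = 0 \<longleftrightarrow> p \<in> S"
proof -
  have green: "bform q r = cinner (\<Gamma>1 (fst q)) (\<Gamma>0 (fst r)) - cinner (\<Gamma>0 (fst q)) (\<Gamma>1 (fst r))"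
    if "q \<in> adj S" "r \<in> adj S" for q r
    using bt that unfolding boundary_triplet_def bform_def by (cases q; cases r) fastforce
  show ?thesis
  proof
    assume "\<Gamma>0 (fst p) = 0 \<and> \<Gamma>1 (fst p) = 0"
    then show "p \<in> S"
      using p by (intro adj_adj) (auto simp: green)
  next
    assume "p \<in> S"
    \<comment> \<open>Surjectivity supplies a \<open>q\<close> with these boundary values, chosen so
      that Green's identity for \<open>p\<close> and \<open>q\<close> becomes a sum of two squared
      norms.\<close>
    have "(\<Gamma>1 (fst p), - \<Gamma>0 (fst p)) \<in> (\<lambda>x. (\<Gamma>0 x, \<Gamma>1 x)) ` Domain (adj S)"
      using bt unfolding boundary_triplet_def by simp
    then obtain q where q: "q \<in> adj S" "\<Gamma>0 (fst q) = \<Gamma>1 (fst p)" "\<Gamma>1 (fst q) = - \<Gamma>0 (fst p)"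
      by force
    have "bform p q = 0"
      using \<open>p \<in> S\<close> q(1) by simp
    then have "cinner (\<Gamma>1 (fst p)) (\<Gamma>1 (fst p)) + cinner (\<Gamma>0 (fst p)) (\<Gamma>0 (fst p)) = 0"
      using green[OF p q(1)] q by (simp add: cinner_simps)
    then have "(norm (\<Gamma>1 (fst p)))\<^sup>2 + (norm (\<Gamma>0 (fst p)))\<^sup>2 = 0"
      unfolding cinner_self of_real_add[symmetric] of_real_eq_0_iff .
    then show "\<Gamma>0 (fst p) = 0 \<and> \<Gamma>1 (fst p) = 0"
      by (simp add: sum_power2_eq_zero_iff)
  qed
qed

lemma boundary_triplet_eq_iff:
  fixes \<Gamma>0 \<Gamma>1 :: "'a \<Rightarrow> 'h::chilbert_space"
  assumes bt: "boundary_triplet S \<Gamma>0 \<Gamma>1" and "p \<in> adj S" "q \<in> adj S"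
  shows "\<Gamma>0 (fst p) = \<Gamma>0 (fst q) \<and> \<Gamma>1 (fst p) = \<Gamma>1 (fst q) \<longleftrightarrow> p - q \<in> S"
proof -
  have lin: "clinear_on (Domain (adj S)) \<Gamma>0" "clinear_on (Domain (adj S)) \<Gamma>1"
    using bt by (auto simp: boundary_triplet_def)
  show ?thesis
    unfolding boundary_triplet_kernel[OF bt csubspace_diff[OF csubspace_adj assms(2,3)], symmetric]
    using lin[THEN clinear_on_fst_diff, OF assms(2,3)] by auto
qed

lemma weyl_function_mem_iff:
  fixes \<Gamma>0 \<Gamma>1 :: "'a \<Rightarrow> 'h::chilbert_space"
  assumes bt: "boundary_triplet S \<Gamma>0 \<Gamma>1" and f: "f \<in> N \<nu>"
  shows "(\<Gamma>0 f, \<Gamma>1 f) \<in> weyl_function S \<Gamma>0 \<Gamma>1 \<mu> \<longleftrightarrow> (\<exists>g\<in>N \<mu>. ev \<nu> f - ev \<mu> g \<in> S)"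
proof -
  have "\<Gamma>0 f = \<Gamma>0 g \<and> \<Gamma>1 f = \<Gamma>1 g \<longleftrightarrow> ev \<nu> f - ev \<mu> g \<in> S" if "g \<in> N \<mu>" for g
    using boundary_triplet_eq_iff[OF bt ev_in_adj[OF f] ev_in_adj[OF that]] by simp
  then show ?thesis
    unfolding weyl_function_def defect_def[symmetric] by auto
qed

lemma weyl_constant_iff:
  fixes \<Gamma>0 \<Gamma>1 :: "'a \<Rightarrow> 'h::chilbert_space"
  assumes bt: "boundary_triplet S \<Gamma>0 \<Gamma>1"
  shows "weyl_constant S \<Gamma>0 \<Gamma>1 \<longleftrightarrow> constant_defect"
proof
  assume const: "weyl_constant S \<Gamma>0 \<Gamma>1"
  show constant_defect
    unfolding constant_defect_def
  proof (intro allI impI ballI)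
    fix \<mu> \<nu> f assume "Im \<mu> * Im \<nu> > 0" and f: "f \<in> N \<nu>"
    then have "weyl_function S \<Gamma>0 \<Gamma>1 \<mu> = weyl_function S \<Gamma>0 \<Gamma>1 \<nu>"
      using const unfolding weyl_constant_def constant_on_def zero_less_mult_iff by auto
    moreover have "(\<Gamma>0 f, \<Gamma>1 f) \<in> weyl_function S \<Gamma>0 \<Gamma>1 \<nu>"
      using f by (auto simp: weyl_function_def defect_def)
    ultimately show "\<exists>g\<in>N \<mu>. ev \<nu> f - ev \<mu> g \<in> S"
      unfolding weyl_function_mem_iff[OF bt f, symmetric] by simp
  qed
next
  assume const: constant_defect
  have "weyl_function S \<Gamma>0 \<Gamma>1 \<nu> \<subseteq> weyl_function S \<Gamma>0 \<Gamma>1 \<mu>" if "Im \<mu> * Im \<nu> > 0" for \<mu> \<nu>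
  proof
    fix z assume "z \<in> weyl_function S \<Gamma>0 \<Gamma>1 \<nu>"
    then obtain f where "f \<in> N \<nu>" "z = (\<Gamma>0 f, \<Gamma>1 f)"
      by (auto simp: weyl_function_def defect_def)
    then show "z \<in> weyl_function S \<Gamma>0 \<Gamma>1 \<mu>"
      using const that by (simp add: weyl_function_mem_iff[OF bt] constant_defect_def)
  qed
  then have "weyl_function S \<Gamma>0 \<Gamma>1 \<mu> = weyl_function S \<Gamma>0 \<Gamma>1 \<nu>" if "Im \<mu> * Im \<nu> > 0" for \<mu> \<nu>
    using that by (intro equalityI) (auto simp: mult.commute)
  note eq = this
  show "weyl_constant S \<Gamma>0 \<Gamma>1"
    unfolding weyl_constant_def constant_on_def
    by (intro conjI exI ballI) (rule eq[of _ \<i>], simp, rule eq[of _ "- \<i>"], simp)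
qed

text \<open>Needed because the second statement of the theorem asserts that a triplet exists. The
  boundary values are coordinates of the two von Neumann components.\<close>

lemma boundary_triplet_exists:
  assumes "cdim (N \<i>) = 2" "cdim (N (- \<i>)) = 2"
  shows "\<exists>\<Gamma>0 \<Gamma>1 :: 'a \<Rightarrow> complex ^ 2. boundary_triplet S \<Gamma>0 \<Gamma>1"
proof -
  obtain a1 a2 where a: "a1 \<in> N \<i>" "a2 \<in> N \<i>" "norm a1 = 1" "norm a2 = 1" "cinner a1 a2 = 0"
      "\<And>w. w \<in> N \<i> \<Longrightarrow> w = cinner w a1 *\<^sub>C a1 + cinner w a2 *\<^sub>C a2"
    by (rule orthonormal_pair_exists[OF csubspace_defect assms(1)]) blast
  obtain b1 b2 where b: "b1 \<in> N (- \<i>)" "b2 \<in> N (- \<i>)" "norm b1 = 1" "norm b2 = 1" "cinner b1 b2 = 0"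
      "\<And>w. w \<in> N (- \<i>) \<Longrightarrow> w = cinner w b1 *\<^sub>C b1 + cinner w b2 *\<^sub>C b2"
    by (rule orthonormal_pair_exists[OF csubspace_defect assms(2)]) blast
  \<comment> \<open>Boundary maps depend on the vector alone; \<open>T\<close> restores its partner
    in the graph of the adjoint, which is unique because \<open>S\<close> is densely
    defined.\<close>
  define T where "T x = (x, SOME w. (x, w) \<in> adj S)" for x
  have T: "T (fst p) = p" if "p \<in> adj S" for p
  proof (rule adj_eqI[OF _ that])
    show "T (fst p) \<in> adj S"
      unfolding T_def by (rule someI[of _ "snd p"]) (use that in simp)
  qed (simp add: T_def)
  \<comment> \<open>The form with the eigenpair of \<open>a1\<close> annihilates \<open>S\<close>
    and the component at \<open>- \<i>\<close>, and on the component at \<open>\<i>\<close> it is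
    \<open>2 * \<i>\<close> times the coefficient of \<open>a1\<close>. The map \<open>d\<close>
    does the same at \<open>- \<i>\<close>, with factor \<open>- 2 * \<i>\<close>.\<close>
  define c :: "'a \<times> 'a \<Rightarrow> complex ^ 2"
    where "c p = vector [bform p (ev \<i> a1) / (2 * \<i>), bform p (ev \<i> a2) / (2 * \<i>)]" for p
  define d :: "'a \<times> 'a \<Rightarrow> complex ^ 2"
    where "d p = vector [bform p (ev (- \<i>) b1) / (- 2 * \<i>), bform p (ev (- \<i>) b2) / (- 2 * \<i>)]" for p
  have lin: "c (p + q) = c p + c q" "d (p + q) = d p + d q"
      "c (z *\<^sub>C p) = z *\<^sub>C c p" "d (z *\<^sub>C p) = z *\<^sub>C d p" for p q z
    by (simp_all add: c_def d_def vec_eq_iff forall_2 bform_simps add_divide_distrib scaleC_vec_def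
        scaleC_complex_def diff_divide_distrib algebra_simps)
  have cd: "c (s + ev \<i> f + ev (- \<i>) g) = vector [cinner f a1, cinner f a2]"
      "d (s + ev \<i> f + ev (- \<i>) g) = vector [cinner g b1, cinner g b2]"
    if "s \<in> S" "f \<in> N \<i>" "g \<in> N (- \<i>)" for s f g
    using that a b by (simp_all add: c_def d_def bform_simps bform_ev ev_in_adj)
  have vN: "\<exists>s f g. s \<in> S \<and> f \<in> N \<i> \<and> g \<in> N (- \<i>) \<and> p = s + ev \<i> f + ev (- \<i>) g"
    if p: "p \<in> adj S" for p
    using von_Neumann[of \<i>, OF _ p] by (metis complex_cnj_i imaginary_unit.simps(2) zero_neq_one)
  have green: "bform p q = 2 * \<i> * cinner (c p) (c q) - 2 * \<i> * cinner (d p) (d q)"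
    if pq: "p \<in> adj S" "q \<in> adj S" for p q
  proof -
    obtain s f g where p: "s \<in> S" "f \<in> N \<i>" "g \<in> N (- \<i>)" "p = s + ev \<i> f + ev (- \<i>) g"
      using vN[OF pq(1)] by blast
    obtain t h k where q: "t \<in> S" "h \<in> N \<i>" "k \<in> N (- \<i>)" "q = t + ev \<i> h + ev (- \<i>) k"
      using vN[OF pq(2)] by blast
    have "bform p q = 2 * \<i> * cinner f h - 2 * \<i> * cinner g k"
      using p(1-3) q(1-3) ev_in_adj S_subset_adj unfolding p(4) q(4)
      by (simp add: bform_simps bform_ev)
    moreover have "cinner f h = cinner (c p) (c q)"
      unfolding p(4) q(4) cd[OF p(1-3)] cd[OF q(1-3)]
      by (subst a(6)[OF q(2)]) (simp add: cinner_vec_2 cinner_simps mult.commute)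
    moreover have "cinner g k = cinner (d p) (d q)"
      unfolding p(4) q(4) cd[OF p(1-3)] cd[OF q(1-3)]
      by (subst b(6)[OF q(3)]) (simp add: cinner_vec_2 cinner_simps mult.commute)
    ultimately show ?thesis by simp
  qed
  \<comment> \<open>A Cayley transform: it turns the diagonal form \<open>green\<close> in
    \<open>c\<close> and \<open>d\<close> into the off-diagonal one that a boundary triplet
    requires.\<close>
  define \<Gamma>0 where "\<Gamma>0 x = c (T x) + d (T x)" for x
  define \<Gamma>1 where "\<Gamma>1 x = \<i> *\<^sub>C (c (T x) - d (T x))" for x
  have fst0: "\<Gamma>0 (fst p) = c p + d p" "\<Gamma>1 (fst p) = \<i> *\<^sub>C (c p - d p)" if "p \<in> adj S" for p
    using T[OF that] by (simp_all add: \<Gamma>0_def \<Gamma>1_def)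
  have "boundary_triplet S \<Gamma>0 \<Gamma>1"
    unfolding boundary_triplet_def clinear_on_def
  proof (intro conjI ballI allI)
    fix x y assume "x \<in> Domain (adj S)" "y \<in> Domain (adj S)"
    then obtain p q where pq: "p \<in> adj S" "x = fst p" "q \<in> adj S" "y = fst q" by force
    have "p + q \<in> adj S" using pq by (intro csubspace_add csubspace_adj)
    from fst0[OF this] fst0[OF pq(1)] fst0[OF pq(3)]
    show "\<Gamma>0 (x + y) = \<Gamma>0 x + \<Gamma>0 y" "\<Gamma>1 (x + y) = \<Gamma>1 x + \<Gamma>1 y"
      by (simp_all add: pq lin scaleC_simps)
  next
    fix x z assume "x \<in> Domain (adj S)"
    then obtain p where p: "p \<in> adj S" "x = fst p" by force
    have "z *\<^sub>C p \<in> adj S" using p by (intro csubspace_scale csubspace_adj)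
    from fst0[OF this] fst0[OF p(1)]
    show "\<Gamma>0 (z *\<^sub>C x) = z *\<^sub>C \<Gamma>0 x" "\<Gamma>1 (z *\<^sub>C x) = z *\<^sub>C \<Gamma>1 x"
      by (simp_all add: p lin scaleC_simps scaleC_scaleC mult.commute)
  next
    have "bform p q = cinner (\<Gamma>1 (fst p)) (\<Gamma>0 (fst q)) - cinner (\<Gamma>0 (fst p)) (\<Gamma>1 (fst q))"
      if "p \<in> adj S" "q \<in> adj S" for p q
      by (simp add: fst0 that green cinner_simps algebra_simps)
    then show "case p of (x, x') \<Rightarrow> \<forall>(y, y')\<in>adj S.
        cinner x' y - cinner x y' = cinner (\<Gamma>1 x) (\<Gamma>0 y) - cinner (\<Gamma>0 x) (\<Gamma>1 y)"
      if "p \<in> adj S" for p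
      using that by (cases p) (force simp: bform_def)
  next
    have "(u, v) \<in> (\<lambda>x. (\<Gamma>0 x, \<Gamma>1 x)) ` Domain (adj S)" for u v
    proof -
      define k l where "k = (1/2) *\<^sub>C (u - \<i> *\<^sub>C v)" and "l = (1/2) *\<^sub>C (u + \<i> *\<^sub>C v)"
      have kl: "k + l = u" "\<i> *\<^sub>C (k - l) = v"
        by (simp_all add: k_def l_def vec_eq_iff scaleC_vec_def scaleC_complex_def field_simps)
      define f where "f = k $ 1 *\<^sub>C a1 + k $ 2 *\<^sub>C a2"
      define g where "g = l $ 1 *\<^sub>C b1 + l $ 2 *\<^sub>C b2"
      define p where "p = 0 + ev \<i> f + ev (- \<i>) g"
      have fg: "f \<in> N \<i>" "g \<in> N (- \<i>)"
        unfolding f_def g_def using a b by (auto intro!: csubspace_add csubspace_scale csubspace_defect)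
      then have p: "p \<in> adj S"
        unfolding p_def by (intro csubspace_add csubspace_0 csubspace_adj ev_in_adj)
      have "cinner a2 a1 = 0" "cinner b2 b1 = 0"
        using a(5) b(5) by (simp_all add: cinner_eq_0_commute)
      then have "c p = k" "d p = l"
        unfolding p_def cd[OF csubspace_0[OF csubspace_S] fg] using a b
        by (simp_all add: vec_eq_iff forall_2 f_def g_def cinner_simps cinner_self)
      then have "\<Gamma>0 (fst p) = u" "\<Gamma>1 (fst p) = v"
        unfolding fst0[OF p] by (simp_all add: kl)
      then show ?thesis
        using fst_in_Domain[OF p] by (intro image_eqI[of _ _ "fst p"]) auto
    qed
    then show "(\<lambda>x. (\<Gamma>0 x, \<Gamma>1 x)) ` Domain (adj S) = UNIV"
      by (simp add: set_eq_iff)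
  qed
  then show ?thesis by blast
qed

end

section \<open>Unitary equivalence of simple operators with constant Weyl function\<close>

lemma subspace_closure:
  fixes V :: "'b::real_normed_vector set"
  assumes V: "subspace V"
  shows "subspace (closure V)"
  unfolding subspace_def
proof (intro conjI ballI allI)
  show "0 \<in> closure V"
    using subspace_0[OF V] closure_subset by blast
  fix x assume "x \<in> closure V"
  then obtain u where u: "\<And>n. u n \<in> V" "u \<longlonglongrightarrow> x"
    by (auto simp: closure_sequential)
  show "c *\<^sub>R x \<in> closure V" for c
    unfolding closure_sequential
    by (rule exI[of _ "\<lambda>n. c *\<^sub>R u n"]) (use u V in \<open>auto intro: tendsto_intros subspace_scale\<close>)
  fix y assume "y \<in> closure V"
  then obtain v where v: "\<And>n. v n \<in> V" "v \<longlonglongrightarrow> y"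
    by (auto simp: closure_sequential)
  show "x + y \<in> closure V"
    unfolding closure_sequential
    by (rule exI[of _ "\<lambda>n. u n + v n"]) (use u v V in \<open>auto intro: tendsto_intros subspace_add\<close>)
qed

text \<open>The map is built as a graph, the closed span of the pairs of corresponding vectors.
  Equal Gram matrices make this graph isometric, hence single-valued and injective, and totality
  makes both of its projections the whole space.\<close>

lemma isometry_on_total_family:
  fixes F :: "'i \<Rightarrow> 'a::chilbert_space" and E :: "'i \<Rightarrow> 'b::chilbert_space"
  assumes gram: "\<And>i j. i \<in> I \<Longrightarrow> j \<in> I \<Longrightarrow> cinner (F i) (F j) = cinner (E i) (E j)"
    and totalF: "\<And>x. (\<And>i. i \<in> I \<Longrightarrow> cinner x (F i) = 0) \<Longrightarrow> x = 0"
    and totalE: "\<And>x. (\<And>i. i \<in> I \<Longrightarrow> cinner x (E i) = 0) \<Longrightarrow> x = 0"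
  obtains U where "unitary U" "\<And>i. i \<in> I \<Longrightarrow> U (F i) = E i"
proof -
  \<comment> \<open>Complex multiples are included so that the real span is closed under complex
    scalars as well.\<close>
  define X where "X = {(c *\<^sub>C F i, c *\<^sub>C E i) | c i. i \<in> I}"
  define G where "G = closure (span X)"
  have sub: "subspace G"
    unfolding G_def by (intro subspace_closure subspace_span)
  have inX: "cinner (fst p) (fst q) = cinner (snd p) (snd q)" if "p \<in> X" "q \<in> X" for p q
    using that gram by (auto simp: X_def cinner_simps)
  have bb: "bounded_linear (\<lambda>p. cinner (fst p) (fst q) - cinner (snd p) (snd q))"
       "bounded_linear (\<lambda>p. cinner (fst q) (fst p) - cinner (snd q) (snd p))"
    for q :: "'a \<times> 'b"
    by (intro bounded_linear_sub
        bounded_linear_compose[OF bounded_bilinear.bounded_linear_left[OF bounded_bilinear_cinner]]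
        bounded_linear_compose[OF bounded_bilinear.bounded_linear_right[OF bounded_bilinear_cinner]]
        bounded_linear_fst bounded_linear_snd)+
  have kern: "(\<forall>p\<in>G. f p = 0)" if f: "bounded_linear f" "\<forall>p\<in>X. f p = 0" for f :: "'a \<times> 'b \<Rightarrow> complex"
  proof -
    have "span X \<subseteq> {p. f p = 0}"
      using f by (intro span_minimal linear_subspace_kernel bounded_linear.linear) auto
    moreover have "closed {p. f p = 0}"
      using f(1) by (intro closed_Collect_eq continuous_intros linear_continuous_on)
    ultimately show ?thesis
      unfolding G_def using closure_minimal by blast
  qed
  \<comment> \<open>The isometry relation passes from \<open>X\<close> to its closed span in one
    argument at a time.\<close>
  have "\<forall>p\<in>G. cinner (fst p) (fst q) - cinner (snd p) (snd q) = 0" if "q \<in> X" for q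
    using that inX by (intro kern bb) auto
  then have "\<forall>q\<in>G. cinner (fst p) (fst q) - cinner (snd p) (snd q) = 0" if "p \<in> G" for p
    using that by (intro kern bb) auto
  then have iso: "cinner (fst p) (fst q) = cinner (snd p) (snd q)" if "p \<in> G" "q \<in> G" for p q
    using that by auto
  have iso_norm: "norm (fst p) = norm (snd p)" if "p \<in> G" for p
    using iso[OF that that] unfolding cinner_self
    by (metis norm_ge_zero of_real_eq_iff power2_eq_iff_nonneg)
  have "closed G" by (simp add: G_def)
  have XG: "X \<subseteq> G"
    unfolding G_def using span_superset closure_subset by blast
  have dist_eq: "dist (fst p) (fst q) = dist (snd p) (snd q)" if "p \<in> G" "q \<in> G" for p q
    using iso_norm[OF subspace_diff[OF sub that]] by (simp add: dist_norm)
  \<comment> \<open>Distances agree in the two coordinates, so convergent first coordinates have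
    Cauchy second coordinates, and closedness of \<open>G\<close> contains the limit.\<close>
  have closed_fst: "closed (fst ` G)"
    unfolding closed_sequential_limits
  proof (intro allI impI, elim conjE)
    fix x l assume "\<forall>n. x n \<in> fst ` G" and lim: "x \<longlonglongrightarrow> l"
    then obtain p where p: "\<And>n. p n \<in> G" "\<And>n. x n = fst (p n)"
      unfolding image_iff by metis
    have "Cauchy (\<lambda>n. snd (p n))"
      using LIMSEQ_imp_Cauchy[OF lim] by (simp add: Cauchy_def p(2) dist_eq[OF p(1) p(1)])
    then obtain y where "(\<lambda>n. snd (p n)) \<longlonglongrightarrow> y"
      using Cauchy_convergent convergent_def by blast
    with lim have "(\<lambda>n. (x n, snd (p n))) \<longlonglongrightarrow> (l, y)"
      by (rule tendsto_Pair)
    then have "(l, y) \<in> G"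
      using \<open>closed G\<close> p by (auto simp: closed_sequential_limits)
    then show "l \<in> fst ` G" by force
  qed
  have closed_snd: "closed (snd ` G)"
    unfolding closed_sequential_limits
  proof (intro allI impI, elim conjE)
    fix y l assume "\<forall>n. y n \<in> snd ` G" and lim: "y \<longlonglongrightarrow> l"
    then obtain p where p: "\<And>n. p n \<in> G" "\<And>n. y n = snd (p n)"
      unfolding image_iff by metis
    have "Cauchy (\<lambda>n. fst (p n))"
      using LIMSEQ_imp_Cauchy[OF lim] by (simp add: Cauchy_def p(2) dist_eq[OF p(1) p(1)])
    then obtain x where "(\<lambda>n. fst (p n)) \<longlonglongrightarrow> x"
      using Cauchy_convergent convergent_def by blast
    from this lim have "(\<lambda>n. (fst (p n), y n)) \<longlonglongrightarrow> (x, l)"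
      by (rule tendsto_Pair)
    then have "(x, l) \<in> G"
      using \<open>closed G\<close> p by (auto simp: closed_sequential_limits)
    then show "l \<in> snd ` G" by force
  qed
  have complex_orth: "cinner x y = 0" if "inner x y = 0" "inner x (\<i> *\<^sub>C y) = 0"
    for x y :: "'c::complex_inner"
    using that by (simp add: inner_eq_Re_cinner cinner_simps complex_eq_iff)
  have inXI: "c *\<^sub>C F i \<in> fst ` G" "c *\<^sub>C E i \<in> snd ` G" if "i \<in> I" for c i
    using that XG by (force simp: X_def)+
  have fst_G: "fst ` G = UNIV"
  proof (rule closed_subspace_eq_UNIV[OF _ closed_fst])
    show "subspace (fst ` G)"
      by (rule linear_subspace_image[OF linear_fst sub])
    fix x assume x: "\<And>y. y \<in> fst ` G \<Longrightarrow> inner x y = 0"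
    show "x = 0"
    proof (rule totalF, rule complex_orth)
      fix i assume "i \<in> I"
      then show "inner x (F i) = 0" "inner x (\<i> *\<^sub>C F i) = 0"
        using x[OF inXI(1)[of i 1]] x[OF inXI(1)[of i \<i>]] by (simp_all add: scaleC_one)
    qed
  qed
  have snd_G: "snd ` G = UNIV"
  proof (rule closed_subspace_eq_UNIV[OF _ closed_snd])
    show "subspace (snd ` G)"
      by (rule linear_subspace_image[OF linear_snd sub])
    fix x assume x: "\<And>y. y \<in> snd ` G \<Longrightarrow> inner x y = 0"
    show "x = 0"
    proof (rule totalE, rule complex_orth)
      fix i assume "i \<in> I"
      then show "inner x (E i) = 0" "inner x (\<i> *\<^sub>C E i) = 0"
        using x[OF inXI(2)[of i 1]] x[OF inXI(2)[of i \<i>]] by (simp_all add: scaleC_one)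
    qed
  qed
  have "\<exists>y. (x, y) \<in> G" for x
    using fst_G by (metis UNIV_I imageE prod.collapse)
  then obtain U where U: "\<And>x. (x, U x) \<in> G" by metis
  have uniq: "y = U x" if "(x, y) \<in> G" for x y
    using dist_eq[OF that U[of x]] by simp
  have pres: "cinner (U x) (U y) = cinner x y" for x y
    using iso[OF U U] by simp
  have surj: "surj U"
  proof -
    have "\<exists>x. y = U x" for y
      using snd_G uniq by (metis UNIV_I imageE prod.collapse)
    then show ?thesis by (auto simp: surj_def)
  qed
  have "inj U"
  proof (rule injI)
    fix x y assume "U x = U y"
    then show "x = y"
      using dist_eq[OF U[of x] U[of y]] by simp
  qed
  \<comment> \<open>Linearity comes from preserved inner products: each difference is orthogonal to
    the range of \<open>U\<close>, which is everything.\<close>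
  moreover have "U (x + y) - (U x + U y) = 0" "U (c *\<^sub>C x) - c *\<^sub>C U x = 0" for x y c
    by (rule cinner_eq_zeroI, metis (no_types) surj surjD pres cinner_diff_left cinner_add_left
        cinner_scaleC_left diff_self)+
  ultimately have "unitary U"
    unfolding unitary_def bij_def using surj pres by simp
  moreover have "U (F i) = E i" if "i \<in> I" for i
  proof -
    have "(1 *\<^sub>C F i, 1 *\<^sub>C E i) \<in> G"
      using XG that unfolding X_def by blast
    then show ?thesis
      using uniq[of "F i" "E i"] by (simp add: scaleC_one)
  qed
  ultimately show ?thesis by (rule that)
qed

text \<open>\<open>E \<mu> c\<close> plays the role of the exponential \<open>e\<^sup>-\<^sup>i\<^sup>\<mu>\<^sup>x c\<close> on the half-line on which it decays;
  \<open>defect_kernel\<close> gives the inner products of these functions.\<close>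

definition defect_kernel :: "complex \<Rightarrow> complex \<Rightarrow> complex"
  where "defect_kernel \<mu> \<nu> =
    (if Im \<mu> * Im \<nu> > 0 then 2 * \<i> * of_real (sgn (Im \<mu>)) / (\<mu> - cnj \<nu>) else 0)"

text \<open>These data determine \<open>T\<close> up to unitary equivalence: inner products and
  totality fix the vectors up to a unitary map, and the last clause recovers \<open>T\<close> as the
  complement of the eigenpairs for the boundary form.\<close>

definition canonical_family ::
    "(complex \<Rightarrow> complex ^ 2 \<Rightarrow> 'a::complex_inner) \<Rightarrow> 'a operator \<Rightarrow> bool"
  where "canonical_family E T \<longleftrightarrow>
    (\<forall>\<mu> \<nu> c d. Im \<mu> \<noteq> 0 \<longrightarrow> Im \<nu> \<noteq> 0 \<longrightarrow> cinner (E \<mu> c) (E \<nu> d) = defect_kernel \<mu> \<nu> * cinner c d) \<and>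
    (\<forall>x. (\<forall>\<mu> c. Im \<mu> \<noteq> 0 \<longrightarrow> cinner x (E \<mu> c) = 0) \<longrightarrow> x = 0) \<and>
    T = adj {ev \<mu> (E \<mu> c) | \<mu> c. Im \<mu> \<noteq> 0}"

lemma canonical_familyD:
  assumes "canonical_family E T"
  shows "Im \<mu> \<noteq> 0 \<Longrightarrow> Im \<nu> \<noteq> 0 \<Longrightarrow> cinner (E \<mu> c) (E \<nu> d) = defect_kernel \<mu> \<nu> * cinner c d"
    and "(\<And>\<mu> c. Im \<mu> \<noteq> 0 \<Longrightarrow> cinner x (E \<mu> c) = 0) \<Longrightarrow> x = 0"
    and "q \<in> T \<longleftrightarrow> (\<forall>\<mu> c. Im \<mu> \<noteq> 0 \<longrightarrow> bform (ev \<mu> (E \<mu> c)) q = 0)"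
proof -
  show "Im \<mu> \<noteq> 0 \<Longrightarrow> Im \<nu> \<noteq> 0 \<Longrightarrow> cinner (E \<mu> c) (E \<nu> d) = defect_kernel \<mu> \<nu> * cinner c d"
    using assms unfolding canonical_family_def by blast
  show "(\<And>\<mu> c. Im \<mu> \<noteq> 0 \<Longrightarrow> cinner x (E \<mu> c) = 0) \<Longrightarrow> x = 0"
    using assms unfolding canonical_family_def by blast
  have T: "T = adj {ev \<mu> (E \<mu> c) | \<mu> c. Im \<mu> \<noteq> 0}"
    using assms unfolding canonical_family_def by blast
  show "q \<in> T \<longleftrightarrow> (\<forall>\<mu> c. Im \<mu> \<noteq> 0 \<longrightarrow> bform (ev \<mu> (E \<mu> c)) q = 0)"
    unfolding T mem_adj_iff by blast
qed

lemma unitaryD: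
  assumes "unitary U"
  shows "bij U" "U (x + y) = U x + U y" "U (c *\<^sub>C x) = c *\<^sub>C U x" "cinner (U x) (U y) = cinner x y"
  using assms unfolding unitary_def by blast+

lemma bform_unitary:
  assumes "unitary U"
  shows "bform (ev \<mu> (U f)) (U x, U y) = bform (ev \<mu> f) (x, y)"
  using unitaryD(3,4)[OF assms] by (simp add: bform_def unitaryD(3)[OF assms, symmetric])

lemma canonical_families_unitarily_equivalent:
  fixes S :: "'a::chilbert_space operator" and T :: "'b::chilbert_space operator"
  assumes F: "canonical_family F S" and E: "canonical_family E T"
  shows "unitarily_equivalent S T"
proof -
  define I :: "(complex \<times> (complex ^ 2)) set" where "I = {i. Im (fst i) \<noteq> 0}"
  obtain U where U: "unitary U" and UF: "\<And>i. i \<in> I \<Longrightarrow> U (F (fst i) (snd i)) = E (fst i) (snd i)"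
  proof (rule isometry_on_total_family[of I "\<lambda>i. F (fst i) (snd i)" "\<lambda>i. E (fst i) (snd i)"])
    show "cinner (F (fst i) (snd i)) (F (fst j) (snd j)) = cinner (E (fst i) (snd i)) (E (fst j) (snd j))"
      if "i \<in> I" "j \<in> I" for i j
      using that by (simp add: I_def canonical_familyD(1)[OF F] canonical_familyD(1)[OF E])
    show "x = 0" if "\<And>i. i \<in> I \<Longrightarrow> cinner x (F (fst i) (snd i)) = 0" for x
      using that[of "(_, _)"] by (intro canonical_familyD(2)[OF F]) (simp add: I_def)
    show "x = 0" if "\<And>i. i \<in> I \<Longrightarrow> cinner x (E (fst i) (snd i)) = 0" for x
      using that[of "(_, _)"] by (intro canonical_familyD(2)[OF E]) (simp add: I_def)
  qed blast
  have UF': "U (F \<mu> c) = E \<mu> c" if "Im \<mu> \<noteq> 0" for \<mu> c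
    using UF[of "(\<mu>, c)"] that by (simp add: I_def)
  have mem: "(U x, U y) \<in> T \<longleftrightarrow> (x, y) \<in> S" for x y
    unfolding canonical_familyD(3)[OF E] canonical_familyD(3)[OF F]
    using bform_unitary[OF U, of _ _ x y] UF' by metis
  have "T = {(U x, U y) | x y. (x, y) \<in> S}"
  proof (intro set_eqI iffI)
    fix q assume "q \<in> T"
    moreover obtain x y where "q = (U x, U y)"
      using unitaryD(1)[OF U] by (metis bij_pointE prod.collapse)
    ultimately show "q \<in> {(U x, U y) | x y. (x, y) \<in> S}"
      using mem by auto
  qed (use mem in auto)
  with U show ?thesis
    unfolding unitarily_equivalent_def by blast
qed

lemma canonical_family_transport:
  assumes "unitarily_equivalent S T" and E: "canonical_family E T"
  obtains F where "canonical_family F S"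
proof -
  obtain U where U: "unitary U" and T: "T = {(U x, U y) | x y. (x, y) \<in> S}"
    using assms(1) unfolding unitarily_equivalent_def by blast
  define F where "F \<mu> c = inv U (E \<mu> c)" for \<mu> c
  have UF: "U (F \<mu> c) = E \<mu> c" for \<mu> c
    using unitaryD(1)[OF U] by (simp add: F_def bij_is_surj surj_f_inv_f)
  have mem: "(U x, U y) \<in> T \<longleftrightarrow> (x, y) \<in> S" for x y
    using unitaryD(1)[OF U] by (auto simp: T bij_def inj_eq)
  have "canonical_family F S"
    unfolding canonical_family_def
  proof (intro conjI allI impI)
    fix \<mu> \<nu> c d assume "Im \<mu> \<noteq> 0" "Im \<nu> \<noteq> 0"
    then show "cinner (F \<mu> c) (F \<nu> d) = defect_kernel \<mu> \<nu> * cinner c d"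
      using canonical_familyD(1)[OF E, of \<mu> \<nu>] by (simp add: UF[symmetric] unitaryD(4)[OF U])
  next
    fix x assume "\<forall>\<mu> c. Im \<mu> \<noteq> 0 \<longrightarrow> cinner x (F \<mu> c) = 0"
    then have "U x = 0"
      by (intro canonical_familyD(2)[OF E]) (simp add: UF[symmetric] unitaryD(4)[OF U])
    then show "x = 0"
      using unitaryD(4)[OF U, of x x] by simp
  next
    have "(x, y) \<in> S \<longleftrightarrow> (\<forall>\<mu> c. Im \<mu> \<noteq> 0 \<longrightarrow> bform (ev \<mu> (F \<mu> c)) (x, y) = 0)" for x y
      unfolding mem[symmetric] canonical_familyD(3)[OF E] UF[symmetric] bform_unitary[OF U] ..
    then have "q \<in> S \<longleftrightarrow> (\<forall>\<mu> c. Im \<mu> \<noteq> 0 \<longrightarrow> bform (ev \<mu> (F \<mu> c)) q = 0)" for q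
      by (cases q) simp
    then show "S = adj {ev \<mu> (F \<mu> c) | \<mu> c. Im \<mu> \<noteq> 0}"
      unfolding set_eq_iff mem_adj_iff by blast
  qed
  then show ?thesis by (rule that)
qed

section \<open>Simplicity and totality of the defect vectors\<close>

context closed_symmetric
begin

text \<open>This handles the exceptional point of Green's identity. For \<zeta> near \<mu>
  orthogonality to \<open>N \<zeta>\<close> gives x = (S - cnj \<zeta>) p with \<open>p\<close>
  bounded in terms of \<open>x\<close>, so (x, f) is a bounded quantity times the distance of
  \<zeta> from \<mu>.\<close>

lemma orthogonal_punctured:
  assumes "Im \<mu> \<noteq> 0" and orth: "\<And>\<zeta> f. Im \<zeta> * Im \<mu> > 0 \<Longrightarrow> \<zeta> \<noteq> \<mu> \<Longrightarrow> f \<in> N \<zeta> \<Longrightarrow> cinner x f = 0"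
    and f: "f \<in> N \<mu>"
  shows "cinner x f = 0"
proof -
  have bound: "cmod (cinner x f) \<le> t * (norm x * norm f / \<bar>Im \<mu>\<bar>)" if "t > 0" for t :: real
  proof -
    \<comment> \<open>A horizontal shift keeps the imaginary part, so the bound on
      \<open>fst p\<close> is uniform in \<open>t\<close>.\<close>
    define \<zeta> where "\<zeta> = \<mu> + of_real t"
    have Im: "Im \<zeta> = Im \<mu>" by (simp add: \<zeta>_def)
    have "Im \<zeta> * Im \<mu> > 0" "\<zeta> \<noteq> \<mu>"
      using assms(1) \<open>t > 0\<close> by (auto simp: \<zeta>_def zero_less_mult_iff)
    then obtain p where p: "p \<in> S" "x = snd p - cnj \<zeta> *\<^sub>C fst p"
      using ran_if_orthogonal[of "cnj \<zeta>" x] orth assms(1) Im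
      by (metis complex_cnj_cnj complex_cnj_cancel_iff cnj.simps(2) neg_equal_0_iff_equal)
    have "x = (snd p - cnj \<mu> *\<^sub>C fst p) - of_real t *\<^sub>C fst p"
      by (simp add: p(2) \<zeta>_def scaleC_simps)
    then have "cinner x f = - (of_real t * cinner (fst p) f)"
      using cinner_ran_defect[OF p(1), of f "cnj \<mu>"] f by (simp add: cinner_simps)
    then have "cmod (cinner x f) = t * cmod (cinner (fst p) f)"
      using \<open>t > 0\<close> by (simp add: norm_mult)
    also have "\<dots> \<le> t * (norm (fst p) * norm f)"
      using \<open>t > 0\<close> norm_cinner_le by (intro mult_left_mono) auto
    also have "norm (fst p) \<le> norm x / \<bar>Im \<mu>\<bar>"
      using norm_le_ran[OF p(1), of "cnj \<zeta>"] assms(1) by (simp add: p(2) Im field_simps)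
    finally show ?thesis
      using \<open>t > 0\<close> by (simp add: mult_left_mono mult_right_mono)
  qed
  have "((\<lambda>t. t * (norm x * norm f / \<bar>Im \<mu>\<bar>)) \<longlongrightarrow> 0 * (norm x * norm f / \<bar>Im \<mu>\<bar>)) (at_right 0)"
    by (intro tendsto_intros)
  then have "cmod (cinner x f) \<le> 0 * (norm x * norm f / \<bar>Im \<mu>\<bar>)"
    by (rule tendsto_lowerbound) (auto intro!: eventually_at_rightI[of 0 1] simp del: times_divide_eq_right dest: bound)
  then show ?thesis by simp
qed

text \<open>The subspace on which the self-adjoint part of \<open>S\<close> lives; simplicity will
  make it trivial.\<close>

definition defect_complement :: "'a set"
  where "defect_complement = corth (\<Union>\<mu>\<in>{\<mu>. Im \<mu> \<noteq> 0}. N \<mu>)"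

lemma mem_defect_complement_iff:
  "x \<in> defect_complement \<longleftrightarrow> (\<forall>\<mu> f. Im \<mu> \<noteq> 0 \<longrightarrow> f \<in> N \<mu> \<longrightarrow> cinner x f = 0)"
  by (auto simp: defect_complement_def corth_def)

lemma csubspace_defect_complement: "csubspace defect_complement"
  and closed_defect_complement: "closed defect_complement"
  by (simp_all add: defect_complement_def csubspace_corth closed_corth)

text \<open>Orthogonality to \<open>N (cnj \<mu>)\<close> puts \<open>x\<close> into the range of S
  - \<mu>, and Green's identity hands the orthogonality to every other \<open>N \<zeta>\<close> down
  to the preimage. Only \<zeta> = cnj \<mu> escapes, and \<open>orthogonal_punctured\<close> fills
  that gap.\<close>

lemma defect_complement_solve:
  assumes x: "x \<in> defect_complement" and "Im \<mu> \<noteq> 0"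
  obtains p where "p \<in> S" "x = snd p - \<mu> *\<^sub>C fst p" "fst p \<in> defect_complement" "snd p \<in> defect_complement"
proof -
  have "Im (cnj \<mu>) \<noteq> 0" using assms(2) by simp
  then obtain p where p: "p \<in> S" "x = snd p - \<mu> *\<^sub>C fst p"
    using ran_if_orthogonal[OF assms(2), of x] x unfolding mem_defect_complement_iff by blast
  have *: "cinner (fst p) f = 0" if "f \<in> N \<zeta>" "Im \<zeta> \<noteq> 0" "\<zeta> \<noteq> cnj \<mu>" for f \<zeta>
  proof -
    have "0 = cinner x f"
      using x that unfolding mem_defect_complement_iff by auto
    also have "\<dots> = cinner (snd p) f - \<mu> * cinner (fst p) f"
      by (simp add: p(2) cinner_simps)
    also have "cinner (snd p) f = cnj \<zeta> * cinner (fst p) f"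
      using bform_S_left[OF p(1) ev_in_adj[OF that(1)]] by (simp add: bform_def cinner_simps)
    finally have "(cnj \<zeta> - \<mu>) * cinner (fst p) f = 0"
      unfolding left_diff_distrib by (rule sym)
    moreover have "cnj \<zeta> - \<mu> \<noteq> 0"
      using that(3) by (metis complex_cnj_cnj right_minus_eq)
    ultimately show ?thesis by simp
  qed
  have "fst p \<in> defect_complement"
    unfolding mem_defect_complement_iff
  proof (intro allI impI)
    fix \<zeta> f assume f: "Im \<zeta> \<noteq> 0" "f \<in> N \<zeta>"
    show "cinner (fst p) f = 0"
    proof (cases "\<zeta> = cnj \<mu>")
      case True
      show ?thesis
        by (rule orthogonal_punctured[OF f(1) _ f(2)], rule *) (auto simp: True)
    qed (use * f in blast)
  qed
  moreover have "snd p = x + \<mu> *\<^sub>C fst p"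
    by (simp add: p(2))
  ultimately show ?thesis
    using x by (intro that[OF p]) (simp_all add: csubspace_add csubspace_scale csubspace_defect_complement)
qed

text \<open>By \<open>defect_complement_solve\<close> both S - \<i> and S + \<i> map a part of
  \<open>S\<close> onto the complement of the defect vectors. Hence the complement reduces
  \<open>S\<close>, and \<open>S\<close> is self-adjoint there, which simplicity allows only on the
  zero space.\<close>

lemma defects_total:
  assumes "simple_operator S" and x: "\<And>\<mu> f. Im \<mu> \<noteq> 0 \<Longrightarrow> f \<in> N \<mu> \<Longrightarrow> cinner x f = 0"
  shows "x = 0"
proof -
  let ?M = defect_complement
  have red: "S = part_in ?M S \<oplus>\<^sub>o part_in (corth ?M) S"
  proof (intro set_eqI iffI)
    fix q assume "q \<in> part_in ?M S \<oplus>\<^sub>o part_in (corth ?M) S"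
    then obtain a b c d where "q = (a, b) + (c, d)" "(a, b) \<in> S" "(c, d) \<in> S"
      by (auto simp: op_sum_def part_in_def)
    then show "q \<in> S"
      using csubspace_add[OF csubspace_S] by blast
  next
    fix q assume q: "q \<in> S"
    obtain m m' where m: "m \<in> ?M" "m' \<in> corth ?M" "snd q - \<i> *\<^sub>C fst q = m + m'"
      by (rule corth_decomposition[OF csubspace_defect_complement closed_defect_complement])
    obtain s where s: "s \<in> S" "m = snd s - \<i> *\<^sub>C fst s" "fst s \<in> ?M" "snd s \<in> ?M"
      by (rule defect_complement_solve[OF m(1), of \<i>]) auto
    define t where "t = q - s"
    have t: "t \<in> S"
      unfolding t_def using q s(1) by (rule csubspace_diff[OF csubspace_S])
    have m': "m' = snd t - \<i> *\<^sub>C fst t"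
      using m(3) by (simp add: t_def s(2) scaleC_simps algebra_simps)
    \<comment> \<open>Writing \<open>y\<close> as (S + \<i>) r with \<open>fst r\<close> in the
      complement, symmetry moves the operator to the other side: (fst t, y) = (m', fst r), which is
      0.\<close>
    have "fst t \<in> corth ?M"
      unfolding corth_def
    proof (intro CollectI ballI)
      fix y assume y: "y \<in> ?M"
      obtain r where r: "r \<in> S" "y = snd r - (- \<i>) *\<^sub>C fst r" "fst r \<in> ?M"
        by (rule defect_complement_solve[OF y, of "- \<i>"]) auto
      have "bform t r = 0"
        using t r(1) S_subset_adj by simp
      moreover have "cinner m' (fst r) = 0"
        using m(2) r(3) by (auto simp: corth_def)
      ultimately show "cinner (fst t) y = 0"
        by (simp add: r(2) m' bform_def cinner_simps algebra_simps)
    qed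
    moreover have "snd t = m' + \<i> *\<^sub>C fst t"
      by (simp add: m')
    ultimately have "t \<in> part_in (corth ?M) S"
      using t m(2) by (cases t) (auto simp: part_in_def intro: csubspace_add csubspace_scale csubspace_corth)
    moreover have "s \<in> part_in ?M S"
      using s by (cases s) (auto simp: part_in_def)
    moreover have "q = s + t" by (simp add: t_def)
    ultimately show "q \<in> part_in ?M S \<oplus>\<^sub>o part_in (corth ?M) S"
      by (cases s; cases t) (auto simp: op_sum_def)
  qed
  have "adj_in ?M (part_in ?M S) = part_in ?M S"
  proof (intro set_eqI iffI)
    fix q assume "q \<in> part_in ?M S"
    then have "q \<in> S" "fst q \<in> ?M" "snd q \<in> ?M"
      by (auto simp: part_in_def)
    moreover have "bform p q = 0" if "p \<in> S" for p
      using that \<open>q \<in> S\<close> S_subset_adj by simp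
    ultimately show "q \<in> adj_in ?M (part_in ?M S)"
      by (cases q) (force simp: adj_in_def part_in_def bform_def)
  next
    fix q assume q: "q \<in> adj_in ?M (part_in ?M S)"
    then have qM: "fst q \<in> ?M" "snd q \<in> ?M"
      by (auto simp: adj_in_def)
    have q0: "bform p q = 0" if "p \<in> S" "fst p \<in> ?M" "snd p \<in> ?M" for p
      using q that by (cases p; cases q) (force simp: adj_in_def part_in_def bform_def)
    have r: "snd q - \<i> *\<^sub>C fst q \<in> ?M"
      using qM by (intro csubspace_diff csubspace_scale csubspace_defect_complement)
    obtain s where s: "s \<in> S" "snd q - \<i> *\<^sub>C fst q = snd s - \<i> *\<^sub>C fst s" "fst s \<in> ?M" "snd s \<in> ?M"
      by (rule defect_complement_solve[OF r, of \<i>]) auto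
    define u where "u = fst q - fst s"
    have u: "u \<in> ?M"
      unfolding u_def using qM s by (intro csubspace_diff csubspace_defect_complement)
    \<comment> \<open>The difference \<open>q - s\<close> is the eigenpair of \<open>u\<close> at
      \<open>\<i>\<close>. With \<open>u\<close> written as (S + \<i>) r, the form of
      \<open>r\<close> with this eigenpair is (u, u).\<close>
    obtain r where r: "r \<in> S" "u = snd r - (- \<i>) *\<^sub>C fst r" "fst r \<in> ?M" "snd r \<in> ?M"
      by (rule defect_complement_solve[OF u, of "- \<i>"]) auto
    have qs: "q - s = ev \<i> u"
      using s(2) by (simp add: prod_eq_iff u_def scaleC_simps algebra_simps)
    have "bform r (q - s) = 0"
      using q0[OF r(1,3,4)] r(1) s(1) S_subset_adj by (simp add: bform_simps)
    then have "cinner u u = 0"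
      unfolding qs bform_def by (subst r(2)) (simp add: cinner_simps)
    then have "q = s"
      using qs by simp
    with s show "q \<in> part_in ?M S"
      by (cases s) (auto simp: part_in_def)
  qed
  with assms(1) red have "?M = {0}"
    unfolding simple_operator_def reducing_def
    using csubspace_defect_complement closed_defect_complement by blast
  moreover have "x \<in> ?M"
    using x by (simp add: mem_defect_complement_iff)
  ultimately show ?thesis by auto
qed

text \<open>Modulo \<open>S\<close> the pair \<open>q\<close> is an eigenpair of some
  \<open>u\<close> at \<open>\<i>\<close>. The form then makes \<open>u\<close> orthogonal to all
  defect spaces except perhaps the one at \<open>- \<i>\<close>, which
  \<open>orthogonal_punctured\<close> adds, and totality gives u = 0.\<close>

lemma simple_eq_adj_defects:
  assumes "simple_operator S"
  shows "q \<in> S \<longleftrightarrow> (\<forall>\<mu> f. Im \<mu> \<noteq> 0 \<longrightarrow> f \<in> N \<mu> \<longrightarrow> bform (ev \<mu> f) q = 0)"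
proof
  assume "q \<in> S"
  then show "\<forall>\<mu> f. Im \<mu> \<noteq> 0 \<longrightarrow> f \<in> N \<mu> \<longrightarrow> bform (ev \<mu> f) q = 0"
    using ev_in_adj by simp
next
  assume q: "\<forall>\<mu> f. Im \<mu> \<noteq> 0 \<longrightarrow> f \<in> N \<mu> \<longrightarrow> bform (ev \<mu> f) q = 0"
  have "cinner (snd q - \<i> *\<^sub>C fst q) f = 0" if "f \<in> N (cnj \<i>)" for f
  proof -
    have "bform (ev (- \<i>) f) q = 0"
      using q that by simp
    then have "cinner f (snd q - \<i> *\<^sub>C fst q) = 0"
      by (simp add: bform_def cinner_simps algebra_simps)
    then show ?thesis by (simp add: cinner_eq_0_commute)
  qed
  then obtain s where s: "s \<in> S" "snd q - \<i> *\<^sub>C fst q = snd s - \<i> *\<^sub>C fst s"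
    using ran_if_orthogonal[of \<i> "snd q - \<i> *\<^sub>C fst q"]
    by (metis imaginary_unit.simps(2) zero_neq_one)
  define u where "u = fst q - fst s"
  have qs: "q - s = ev \<i> u"
    using s(2) by (simp add: prod_eq_iff u_def scaleC_simps algebra_simps)
  have *: "cinner u f = 0" if "f \<in> N \<mu>" "Im \<mu> \<noteq> 0" "\<mu> \<noteq> - \<i>" for f \<mu>
  proof -
    have "bform (ev \<mu> f) (q - s) = 0"
      using q that s(1) ev_in_adj by (simp add: bform_simps)
    then have "(\<mu> + \<i>) * cinner f u = 0"
      by (simp add: qs bform_ev)
    then show ?thesis
      using that(3) by (simp add: cinner_eq_0_commute[of u] add_eq_0_iff2)
  qed
  have "u = 0"
  proof (rule defects_total[OF assms])
    fix \<mu> f assume f: "Im \<mu> \<noteq> 0" "f \<in> N \<mu>"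
    show "cinner u f = 0"
    proof (cases "\<mu> = - \<i>")
      case True
      then show ?thesis
        using * f by (intro orthogonal_punctured[OF f(1) _ f(2)]) auto
    qed (use * f in blast)
  qed
  with qs s(1) show "q \<in> S" by simp
qed

text \<open>Modulo \<open>S\<close> the vector \<open>f\<close> may be moved to
  \<open>N (cnj \<nu>)\<close>, and the form between that space and \<open>N \<nu>\<close> is zero.
  For \<mu> = cnj \<nu> this says nothing, and the limit argument takes over.\<close>

lemma opposite_defects_orthogonal:
  assumes const: constant_defect and "f \<in> N \<mu>" "g \<in> N \<nu>" "Im \<mu> * Im \<nu> < 0"
  shows "cinner f g = 0"
proof -
  have *: "cinner f g = 0" if f: "f \<in> N \<mu>" and g: "g \<in> N \<nu>" and sgn: "Im \<mu> * Im \<nu> < 0" and ne: "\<mu> \<noteq> cnj \<nu>"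
    for f g \<mu> \<nu>
  proof -
    have "Im (cnj \<nu>) * Im \<mu> > 0"
      using sgn by (simp add: mult.commute)
    then obtain h where h: "h \<in> N (cnj \<nu>)" "ev \<mu> f - ev (cnj \<nu>) h \<in> S"
      using constant_defectD[OF const f] by blast
    have "bform (ev \<mu> f) (ev \<nu> g) = bform (ev \<mu> f - ev (cnj \<nu>) h) (ev \<nu> g) + bform (ev (cnj \<nu>) h) (ev \<nu> g)"
      by (simp add: bform_simps)
    also have "\<dots> = 0"
      using h(2) ev_in_adj[OF g] by (simp add: bform_ev)
    finally show ?thesis
      using ne by (simp add: bform_ev)
  qed
  show ?thesis
  proof (cases "\<mu> = cnj \<nu>")
    case True
    have "Im \<mu> \<noteq> 0" using assms(4) by auto
    then have "cinner g f = 0"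
    proof (rule orthogonal_punctured[OF _ _ assms(2)])
      fix \<zeta> h assume h: "Im \<zeta> * Im \<mu> > 0" "\<zeta> \<noteq> \<mu>" "h \<in> N \<zeta>"
      have "Im \<zeta> * Im \<nu> < 0"
        using h(1) assms(4) by (auto simp: zero_less_mult_iff mult_less_0_iff)
      then have "cinner h g = 0"
        using * h(2,3) assms(3) True by blast
      then show "cinner g h = 0" by (simp add: cinner_eq_0_commute)
    qed
    then show ?thesis by (simp add: cinner_eq_0_commute)
  qed (use * assms in blast)
qed

section \<open>Constant defect and canonical families\<close>

lemma bform_cong_mod_S:
  assumes "p \<in> adj S" "q \<in> adj S" "p' \<in> adj S" "q' \<in> adj S" "p - p' \<in> S" "q - q' \<in> S"
  shows "bform p q = bform p' q'"
proof -
  have "bform p q = bform (p - p') q + bform p' (q - q') + bform p' q'"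
    by (simp add: bform_simps)
  then show ?thesis using assms by simp
qed

text \<open>The product is the boundary form of two members of the family up to (c, d). It depends
  on the half-planes only, as it must if the members over a half-plane are congruent modulo
  \<open>S\<close>.\<close>

lemma defect_kernel_mult:
  assumes "Im \<mu> \<noteq> 0" "Im \<nu> \<noteq> 0"
  shows "(\<mu> - cnj \<nu>) * defect_kernel \<mu> \<nu> =
    (if Im \<mu> * Im \<nu> > 0 then 2 * \<i> * of_real (sgn (Im \<mu>)) else 0)"
proof -
  have "\<mu> - cnj \<nu> \<noteq> 0" if "Im \<mu> * Im \<nu> > 0"
    using that by (auto simp: complex_eq_iff zero_less_mult_iff)
  then show ?thesis by (simp add: defect_kernel_def)
qed

text \<open>By \<open>defect_kernel_mult\<close>, moving \<mu> within its half-plane changes the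
  eigenpair of \<open>F \<mu> c\<close> by something orthogonal to the family for the form, that is,
  by an element of \<open>S\<close>. The dimension ensures that \<open>F\<close> exhausts the defect
  spaces at the base points.\<close>

lemma constant_defect_if_canonical_family:
  assumes F: "canonical_family F S" and dim: "cdim (N \<i>) = 2" "cdim (N (- \<i>)) = 2"
  shows constant_defect
proof (rule constant_defectI)
  have FN: "F \<mu> c \<in> N \<mu>" if "Im \<mu> \<noteq> 0" for \<mu> c
    unfolding mem_defect_iff mem_adj_iff
    using canonical_familyD(3)[OF F] that by (subst bform_eq_0_commute) blast
  have diff: "ev \<mu> (F \<mu> c) - ev \<nu> (F \<nu> c) \<in> S" if sgn: "Im \<mu> * Im \<nu> > 0" for \<mu> \<nu> c
    unfolding canonical_familyD(3)[OF F]
  proof (intro allI impI)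
    fix \<zeta> d assume "Im \<zeta> \<noteq> 0"
    have "Im \<mu> \<noteq> 0" "Im \<nu> \<noteq> 0" using sgn by auto
    note K = canonical_familyD(1)[OF F \<open>Im \<zeta> \<noteq> 0\<close> this(1)] canonical_familyD(1)[OF F \<open>Im \<zeta> \<noteq> 0\<close> this(2)]
      defect_kernel_mult[OF \<open>Im \<zeta> \<noteq> 0\<close> this(1)] defect_kernel_mult[OF \<open>Im \<zeta> \<noteq> 0\<close> this(2)]
    have "(0 < Im \<zeta> * Im \<mu>) = (0 < Im \<zeta> * Im \<nu>)"
      using sgn by (auto simp: zero_less_mult_iff)
    then show "bform (ev \<zeta> (F \<zeta> d)) (ev \<mu> (F \<mu> c) - ev \<nu> (F \<nu> c)) = 0"
      by (simp add: bform_simps bform_ev K mult.assoc[symmetric])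
  qed
  fix \<iota> \<nu> f assume \<iota>: "\<iota> = \<i> \<or> \<iota> = - \<i>" and sgn: "Im \<iota> * Im \<nu> > 0" and f: "f \<in> N \<iota>"
  have Im: "Im \<iota> \<noteq> 0" using sgn by auto
  have dep: "three_dependent (N \<iota>)"
    using \<iota> dim three_dependent_if_cdim_2 by blast
  let ?e1 = "axis 1 1 :: complex ^ 2" and ?e2 = "axis 2 1 :: complex ^ 2"
  have e: "cinner ?e1 ?e1 = 1" "cinner ?e2 ?e2 = 1" "cinner ?e1 ?e2 = 0"
    by (simp_all add: cinner_vec_2 axis_def)
  have "defect_kernel \<iota> \<iota> = 1"
    using \<iota> by (auto simp: defect_kernel_def)
  then have "cinner (F \<iota> ?e1) (F \<iota> ?e1) = 1" "cinner (F \<iota> ?e2) (F \<iota> ?e2) = 1" "cinner (F \<iota> ?e1) (F \<iota> ?e2) = 0"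
    by (simp_all add: canonical_familyD(1)[OF F Im Im] e)
  then have "F \<iota> ?e1 \<noteq> 0" "F \<iota> ?e2 \<noteq> 0" "cinner (F \<iota> ?e1) (F \<iota> ?e2) = 0"
    by auto
  then obtain p q where pq: "f = p *\<^sub>C F \<iota> ?e1 + q *\<^sub>C F \<iota> ?e2"
    using three_dependentE[OF dep FN[OF Im] FN[OF Im] f] by blast
  define c where "c = p *\<^sub>C ?e1 + q *\<^sub>C ?e2"
  \<comment> \<open>Linearity of \<open>F \<iota>\<close> in the coordinates is recovered from inner
    products with the total family.\<close>
  have "F \<iota> c - f = 0"
    by (rule canonical_familyD(2)[OF F])
      (simp add: pq c_def cinner_simps canonical_familyD(1)[OF F Im] algebra_simps)
  then have "f = F \<iota> c" by simp
  moreover have "Im \<nu> \<noteq> 0" using sgn by auto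
  ultimately show "\<exists>g\<in>N \<nu>. ev \<iota> f - ev \<nu> g \<in> S"
    using diff[OF sgn] FN by blast
qed

lemma canonical_family_exists:
  assumes const: constant_defect and simple: "simple_operator S"
    and dim: "cdim (N \<i>) = 2" "cdim (N (- \<i>)) = 2"
  obtains F where "canonical_family F S"
proof -
  have "\<exists>n :: complex ^ 2 \<Rightarrow> 'a. (\<forall>c. n c \<in> N \<iota>) \<and> (\<forall>c d. cinner (n c) (n d) = cinner c d) \<and> (\<forall>f\<in>N \<iota>. \<exists>c. f = n c)"
    if dim\<iota>: "cdim (N \<iota>) = 2" for \<iota>
  proof -
    obtain a b where ab: "a \<in> N \<iota>" "b \<in> N \<iota>" "norm a = 1" "norm b = 1" "cinner a b = 0"
        "\<And>w. w \<in> N \<iota> \<Longrightarrow> w = cinner w a *\<^sub>C a + cinner w b *\<^sub>C b"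
      by (rule orthonormal_pair_exists[OF csubspace_defect dim\<iota>]) blast
    have "cinner b a = 0"
      using ab(5) by (simp add: cinner_eq_0_commute)
    define n :: "complex ^ 2 \<Rightarrow> 'a" where "n c = c $ 1 *\<^sub>C a + c $ 2 *\<^sub>C b" for c
    have "\<forall>c. n c \<in> N \<iota>"
      unfolding n_def using ab by (auto intro: csubspace_add csubspace_scale csubspace_defect)
    moreover have "\<forall>c d. cinner (n c) (n d) = cinner c d"
      using ab(3-5) \<open>cinner b a = 0\<close> by (simp add: n_def cinner_simps cinner_self cinner_vec_2 mult.commute)
    moreover have "\<forall>f\<in>N \<iota>. \<exists>c. f = n c"
    proof
      fix f assume "f \<in> N \<iota>"
      then have "f = n (vector [cinner f a, cinner f b])"
        using ab(6) by (simp add: n_def)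
      then show "\<exists>c. f = n c" ..
    qed
    ultimately show ?thesis by blast
  qed
  note * = this
  define \<iota> where "\<iota> \<mu> = (if Im \<mu> > 0 then \<i> else - \<i>)" for \<mu>
  have \<iota>: "Im (\<iota> \<mu>) * Im \<mu> > 0" "Im \<mu> * Im (\<iota> \<mu>) > 0" if "Im \<mu> \<noteq> 0" for \<mu>
    using that by (auto simp: \<iota>_def)
  obtain n m :: "complex ^ 2 \<Rightarrow> 'a" where
    n: "\<And>c. n c \<in> N \<i>" "\<And>c d. cinner (n c) (n d) = cinner c d" "\<And>f. f \<in> N \<i> \<Longrightarrow> \<exists>c. f = n c" and
    m: "\<And>c. m c \<in> N (- \<i>)" "\<And>c d. cinner (m c) (m d) = cinner c d" "\<And>f. f \<in> N (- \<i>) \<Longrightarrow> \<exists>c. f = m c"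
    using *[OF dim(1)] *[OF dim(2)] by metis
  define b where "b \<mu> = (if Im \<mu> > 0 then n else m)" for \<mu>
  have b: "b \<mu> c \<in> N (\<iota> \<mu>)" "cinner (b \<mu> c) (b \<mu> d) = cinner c d" "f \<in> N (\<iota> \<mu>) \<Longrightarrow> \<exists>c. f = b \<mu> c"
    for \<mu> c d f
    using n m by (auto simp: b_def \<iota>_def)
  have "\<exists>f. Im \<mu> \<noteq> 0 \<longrightarrow> f \<in> N \<mu> \<and> ev (\<iota> \<mu>) (b \<mu> c) - ev \<mu> f \<in> S" for \<mu> c
    using constant_defectD[OF const b(1) \<iota>(2)] by metis
  then obtain F where F: "\<And>\<mu> c. Im \<mu> \<noteq> 0 \<Longrightarrow> F \<mu> c \<in> N \<mu>"
      "\<And>\<mu> c. Im \<mu> \<noteq> 0 \<Longrightarrow> ev (\<iota> \<mu>) (b \<mu> c) - ev \<mu> (F \<mu> c) \<in> S"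
    by metis
  have surj: "\<exists>c. f = F \<mu> c" if "Im \<mu> \<noteq> 0" and f: "f \<in> N \<mu>" for \<mu> f
  proof -
    obtain g where "g \<in> N (\<iota> \<mu>)" "ev \<mu> f - ev (\<iota> \<mu>) g \<in> S"
      using constant_defectD[OF const f \<iota>(1)[OF \<open>Im \<mu> \<noteq> 0\<close>]] .
    then obtain c where c: "ev \<mu> f - ev (\<iota> \<mu>) (b \<mu> c) \<in> S"
      using b(3) by blast
    have "(ev \<mu> f - ev (\<iota> \<mu>) (b \<mu> c)) + (ev (\<iota> \<mu>) (b \<mu> c) - ev \<mu> (F \<mu> c)) \<in> S"
      by (intro csubspace_add csubspace_S c F that)
    then have "ev \<mu> (f - F \<mu> c) \<in> S"
      by (simp add: ev_diff)
    then have "f - F \<mu> c = 0"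
      using F(1) that by (intro ev_in_S_imp_0[OF csubspace_diff[OF csubspace_defect]]) auto
    then show ?thesis by auto
  qed
  have "canonical_family F S"
    unfolding canonical_family_def
  proof (intro conjI allI impI)
    fix \<mu> \<nu> c d assume Im: "Im \<mu> \<noteq> 0" "Im \<nu> \<noteq> 0"
    show "cinner (F \<mu> c) (F \<nu> d) = defect_kernel \<mu> \<nu> * cinner c d"
    proof (cases "Im \<mu> * Im \<nu> > 0")
      case True
      then have same: "\<iota> \<nu> = \<iota> \<mu>" "b \<nu> = b \<mu>" and ne: "\<mu> - cnj \<nu> \<noteq> 0"
        by (auto simp: \<iota>_def b_def zero_less_mult_iff complex_eq_iff)
      \<comment> \<open>The form is unchanged modulo \<open>S\<close>, so it may be evaluated at the
        base point, where the coordinates are isometric.\<close>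
      have "bform (ev (\<iota> \<mu>) (b \<mu> c)) (ev (\<iota> \<nu>) (b \<nu> d)) = bform (ev \<mu> (F \<mu> c)) (ev \<nu> (F \<nu> d))"
        by (intro bform_cong_mod_S ev_in_adj F b Im)
      then have "(\<mu> - cnj \<nu>) * cinner (F \<mu> c) (F \<nu> d) = (\<iota> \<mu> - cnj (\<iota> \<mu>)) * cinner c d"
        by (simp add: bform_ev same b(2))
      also have "\<dots> = (\<mu> - cnj \<nu>) * (defect_kernel \<mu> \<nu> * cinner c d)"
        unfolding mult.assoc[symmetric] defect_kernel_mult[OF Im] using True by (auto simp: \<iota>_def sgn_if)
      finally show ?thesis using ne by simp
    next
      case False
      then have "Im \<mu> * Im \<nu> < 0" using Im by (simp add: linorder_neq_iff not_less le_less)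
      then show ?thesis
        using opposite_defects_orthogonal[OF const F(1) F(1)] Im False by (simp add: defect_kernel_def)
    qed
  next
    fix x assume "\<forall>\<mu> c. Im \<mu> \<noteq> 0 \<longrightarrow> cinner x (F \<mu> c) = 0"
    then show "x = 0"
      using surj by (intro defects_total[OF simple]) blast
  next
    have "q \<in> S \<longleftrightarrow> (\<forall>\<mu> c. Im \<mu> \<noteq> 0 \<longrightarrow> bform (ev \<mu> (F \<mu> c)) q = 0)" for q
      unfolding simple_eq_adj_defects[OF simple] using surj F(1) by blast
    then show "S = adj {ev \<mu> (F \<mu> c) | \<mu> c. Im \<mu> \<noteq> 0}"
      unfolding set_eq_iff mem_adj_iff by blast
  qed
  then show ?thesis by (rule that)
qed

lemma unitarily_equivalent_iff_constant_defect:
  fixes T :: "'b::chilbert_space operator"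
  assumes simple: "simple_operator S" and dim: "cdim (N \<i>) = 2" "cdim (N (- \<i>)) = 2"
    and E: "canonical_family E T"
  shows "unitarily_equivalent S T \<longleftrightarrow> constant_defect"
proof
  assume "unitarily_equivalent S T"
  then obtain F where "canonical_family F S"
    using E by (rule canonical_family_transport)
  then show constant_defect
    using dim by (rule constant_defect_if_canonical_family)
next
  assume constant_defect
  then obtain F where "canonical_family F S"
    using simple dim by (rule canonical_family_exists)
  then show "unitarily_equivalent S T"
    using E by (rule canonical_families_unitarily_equivalent)
qed

end

section \<open>The symmetries of the Clifford algebra\<close>

lemma op_comp_graph_of_iff: "(x, z) \<in> A \<circ>\<^sub>o graph_of K \<longleftrightarrow> (K x, z) \<in> A"
  by (auto simp: op_comp_def graph_of_def)

lemma graph_of_op_comp_iff: "(x, z) \<in> graph_of K \<circ>\<^sub>o A \<longleftrightarrow> (\<exists>w. (x, w) \<in> A \<and> z = K w)"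
  by (auto simp: op_comp_def graph_of_def)

lemma fundamental_symmetryD:
  assumes "fundamental_symmetry K"
  shows "K (x + y) = K x + K y" "K (c *\<^sub>C x) = c *\<^sub>C K x" "cinner (K x) y = cinner x (K y)" "K (K x) = x"
proof -
  have bl: "bounded_linear K" and scale: "\<forall>c x. K (c *\<^sub>C x) = c *\<^sub>C K x"
    using assms by (auto simp: fundamental_symmetry_def bounded_clinear_def)
  show "K (x + y) = K x + K y"
    using bl by (simp add: linear_add bounded_linear.linear)
  show "K (c *\<^sub>C x) = c *\<^sub>C K x"
    using scale by blast
  have "(y, K y) \<in> adj (graph_of K)"
    using assms by (auto simp: fundamental_symmetry_def graph_of_def)
  then show "cinner (K x) y = cinner x (K y)"
    by (auto simp: adj_in_def graph_of_def)
  show "K (K x) = x"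
    using assms by (metis fundamental_symmetry_def comp_apply id_apply)
qed

locale clifford_operator = closed_symmetric S for S :: "'a::chilbert_space operator" +
  fixes J R :: "'a \<Rightarrow> 'a"
  assumes J: "fundamental_symmetry J" and R: "fundamental_symmetry R"
    and anticommute: "J (R x) = - R (J x)"
    and S_J: "S \<circ>\<^sub>o graph_of J = graph_of J \<circ>\<^sub>o S" and S_R: "S \<circ>\<^sub>o graph_of R = graph_of R \<circ>\<^sub>o S"
    and dim_plus: "cdim (defect S \<i>) = 2" and dim_minus: "cdim (defect S (- \<i>)) = 2"
begin

abbreviation C where "C \<equiv> clifford_sym J R"

lemmas J_simps = fundamental_symmetryD[OF J]
lemmas R_simps = fundamental_symmetryD[OF R]

lemma JR_minus: "J (- x) = - J x" "R (- x) = - R x"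
  using J_simps(2)[of "-1" x] R_simps(2)[of "-1" x] by simp_all

lemma JR_diff: "J (x - y) = J x - J y" "R (x - y) = R x - R y"
  using J_simps(1)[of x "- y"] R_simps(1)[of x "- y"] by (simp_all add: JR_minus)

lemma R_J: "R (J x) = - J (R x)"
  by (simp add: anticommute)

lemma clifford_eq: "C \<alpha> x = of_real (\<alpha> $ 1) *\<^sub>C J x + of_real (\<alpha> $ 2) *\<^sub>C R x + (of_real (\<alpha> $ 3) * \<i>) *\<^sub>C J (R x)"
  by (simp add: clifford_sym_def scaleR_scaleC scaleC_scaleC)

lemma C_add: "C \<alpha> (x + y) = C \<alpha> x + C \<alpha> y"
  by (simp add: clifford_eq J_simps R_simps scaleC_simps)

lemma C_scaleC: "C \<alpha> (c *\<^sub>C x) = c *\<^sub>C C \<alpha> x"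
  by (simp add: clifford_eq J_simps R_simps scaleC_simps scaleC_scaleC mult_ac)

lemma C_selfadjoint: "cinner (C \<alpha> x) y = cinner x (C \<alpha> y)"
proof -
  have "cinner (J (R x)) y = - cinner x (J (R y))"
    by (simp add: J_simps(3) R_simps(3) R_J cinner_minus_right)
  then show ?thesis
    by (simp add: clifford_eq cinner_simps J_simps(3) R_simps(3))
qed

text \<open>The multiplication rule of the Pauli matrices, with a minus sign because the third
  generator is \<i> J R, so that J R is - \<i> times it.\<close>

lemma C_product: "C \<alpha> (C \<beta> x) = of_real (\<alpha> \<bullet> \<beta>) *\<^sub>C x - \<i> *\<^sub>C C (cross3 \<alpha> \<beta>) x"
proof -
  have "C \<alpha> (C \<beta> x) = of_real (\<alpha> $ 1 * \<beta> $ 1 + \<alpha> $ 2 * \<beta> $ 2 + \<alpha> $ 3 * \<beta> $ 3) *\<^sub>C x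
    + (\<i> * of_real (\<alpha> $ 3 * \<beta> $ 2 - \<alpha> $ 2 * \<beta> $ 3)) *\<^sub>C J x
    + (\<i> * of_real (\<alpha> $ 1 * \<beta> $ 3 - \<alpha> $ 3 * \<beta> $ 1)) *\<^sub>C R x
    + of_real (\<alpha> $ 1 * \<beta> $ 2 - \<alpha> $ 2 * \<beta> $ 1) *\<^sub>C J (R x)"
    by (simp add: clifford_eq J_simps R_simps R_J JR_minus JR_diff scaleC_simps scaleC_scaleC algebra_simps)
  also have "\<dots> = of_real (\<alpha> \<bullet> \<beta>) *\<^sub>C x - \<i> *\<^sub>C C (cross3 \<alpha> \<beta>) x"
    by (simp add: clifford_eq cross3_def inner_vec_def sum_3 scaleC_simps scaleC_scaleC algebra_simps)
  finally show ?thesis .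
qed

lemma C_lin: "C (p *\<^sub>R \<alpha> + q *\<^sub>R \<beta>) x = of_real p *\<^sub>C C \<alpha> x + of_real q *\<^sub>C C \<beta> x"
  by (simp add: clifford_eq scaleC_simps scaleC_scaleC algebra_simps)

lemma C_uminus: "C (- \<alpha>) x = - C \<alpha> x"
  by (simp add: clifford_eq scaleC_simps)

lemma C_anticommutator: "C \<alpha> (C \<beta> x) + C \<beta> (C \<alpha> x) = of_real (2 * (\<alpha> \<bullet> \<beta>)) *\<^sub>C x"
proof -
  have "cross3 \<beta> \<alpha> = - cross3 \<alpha> \<beta>"
    by (rule cross_skew)
  then show ?thesis
    by (simp add: C_product C_uminus inner_commute[of \<beta>] scaleC_simps)
      (simp add: complex_vector.scale_left_distrib[symmetric])
qed

lemma C_S: "(x, w) \<in> S \<Longrightarrow> (C \<alpha> x, C \<alpha> w) \<in> S"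
proof -
  have J': "(J x, J w) \<in> S" if "(x, w) \<in> S" for x w
  proof -
    have "(x, J w) \<in> S \<circ>\<^sub>o graph_of J"
      unfolding S_J graph_of_op_comp_iff using that by blast
    then show ?thesis by (simp add: op_comp_graph_of_iff)
  qed
  have R': "(R x, R w) \<in> S" if "(x, w) \<in> S" for x w
  proof -
    have "(x, R w) \<in> S \<circ>\<^sub>o graph_of R"
      unfolding S_R graph_of_op_comp_iff using that by blast
    then show ?thesis by (simp add: op_comp_graph_of_iff)
  qed
  assume xw: "(x, w) \<in> S"
  have "of_real (\<alpha> $ 1) *\<^sub>C (J x, J w) + of_real (\<alpha> $ 2) *\<^sub>C (R x, R w)
      + (of_real (\<alpha> $ 3) * \<i>) *\<^sub>C (J (R x), J (R w)) \<in> S"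
    by (intro csubspace_add csubspace_scale csubspace_S J' R' xw)
  then show "(C \<alpha> x, C \<alpha> w) \<in> S"
    by (simp add: clifford_eq scaleC_prod_def)
qed

section \<open>Action of the symmetries on graphs and defect spaces\<close>

definition csym :: "('a \<Rightarrow> 'a) \<Rightarrow> bool"
  where "csym K \<longleftrightarrow> (\<exists>\<alpha>. norm \<alpha> = 1 \<and> K = C \<alpha>)"

lemma csym_C: "norm \<alpha> = 1 \<Longrightarrow> csym (C \<alpha>)"
  by (auto simp: csym_def)

lemma csym_uminus: "csym K \<Longrightarrow> csym (\<lambda>x. - K x)"
  unfolding csym_def
proof (elim exE conjE)
  fix \<alpha> assume "norm \<alpha> = 1" "K = C \<alpha>"
  then show "\<exists>\<beta>. norm \<beta> = 1 \<and> (\<lambda>x. - K x) = C \<beta>"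
    by (intro exI[of _ "- \<alpha>"]) (simp add: C_uminus fun_eq_iff)
qed

lemma csymD:
  assumes "csym K"
  shows "K (x + y) = K x + K y" "K (c *\<^sub>C x) = c *\<^sub>C K x" "cinner (K x) y = cinner x (K y)" "K (K x) = x"
    "(x, w) \<in> S \<Longrightarrow> (K x, K w) \<in> S"
proof -
  obtain \<alpha> where \<alpha>: "norm \<alpha> = 1" "K = C \<alpha>"
    using assms by (auto simp: csym_def)
  show "K (x + y) = K x + K y" "K (c *\<^sub>C x) = c *\<^sub>C K x" "cinner (K x) y = cinner x (K y)"
    "(x, w) \<in> S \<Longrightarrow> (K x, K w) \<in> S"
    by (simp_all add: \<alpha> C_add C_scaleC C_selfadjoint C_S)
  have "\<alpha> \<bullet> \<alpha> = 1"
    using \<alpha>(1) by (simp add: dot_square_norm)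
  moreover have "C 0 x = 0"
    by (simp add: clifford_eq)
  ultimately show "K (K x) = x"
    by (simp add: \<alpha>(2) C_product scaleC_one)
qed

lemma csym_minus:
  assumes "csym K"
  shows "K (- x) = - K x" "K (x - y) = K x - K y" "K 0 = 0" "K x = 0 \<longleftrightarrow> x = 0"
proof -
  show m: "K (- x) = - K x" for x
    using csymD(2)[OF assms, of "-1" x] by simp
  show "K (x - y) = K x - K y"
    using csymD(1)[OF assms, of x "- y"] m by simp
  show z: "K 0 = 0"
    using csymD(2)[OF assms, of 0 0] by simp
  show "K x = 0 \<longleftrightarrow> x = 0"
    using csymD(4)[OF assms, of x] z by metis
qed

text \<open>The action on graphs: as \<open>K\<close> is an involution,
  \<open>lift2 K p \<in> A\<close> says that \<open>p\<close> lies in the graph of K A K. The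
  defining relation of \<open>Sigma_ext\<close> thereby becomes a membership statement about
  pairs.\<close>

definition lift2 :: "('a \<Rightarrow> 'a) \<Rightarrow> 'a \<times> 'a \<Rightarrow> 'a \<times> 'a"
  where "lift2 K p = (K (fst p), K (snd p))"

lemma fst_lift2 [simp]: "fst (lift2 K p) = K (fst p)"
  and snd_lift2 [simp]: "snd (lift2 K p) = K (snd p)"
  by (simp_all add: lift2_def)

lemma lift2_simps:
  assumes "csym K"
  shows "lift2 K (p + q) = lift2 K p + lift2 K q" "lift2 K (p - q) = lift2 K p - lift2 K q"
    "lift2 K (c *\<^sub>C p) = c *\<^sub>C lift2 K p" "lift2 K (lift2 K p) = p" "lift2 K (ev \<mu> f) = ev \<mu> (K f)"
    "bform (lift2 K p) q = bform p (lift2 K q)"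
  by (simp_all add: prod_eq_iff csymD[OF assms] csym_minus[OF assms] bform_def)

lemma lift2_S: "csym K \<Longrightarrow> p \<in> S \<Longrightarrow> lift2 K p \<in> S"
  unfolding lift2_def using csymD(5) by (metis prod.collapse)

lemma lift2_adj:
  assumes K: "csym K" and p: "p \<in> adj S"
  shows "lift2 K p \<in> adj S"
  unfolding mem_adj_iff
proof
  fix q assume "q \<in> S"
  then have "bform (lift2 K q) p = 0"
    using lift2_S[OF K] p by simp
  then show "bform q (lift2 K p) = 0"
    by (simp add: lift2_simps[OF K])
qed

lemma csym_defect: "csym K \<Longrightarrow> f \<in> N \<mu> \<Longrightarrow> K f \<in> N \<mu>"
  using lift2_adj[of K "ev \<mu> f"] by (simp add: mem_defect_iff lift2_simps)

section \<open>The extensions attached to a symmetry\<close>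

lemma eigen_plus_eq:
  assumes "csym K"
  shows "eigen_plus K = {x. K x = x}"
proof (intro set_eqI iffI)
  fix x assume "x \<in> eigen_plus K"
  then show "x \<in> {x. K x = x}"
    by (auto simp: eigen_plus_def scaleR_scaleC csymD[OF assms] add.commute)
next
  fix x assume "x \<in> {x. K x = x}"
  then have "x = (1/2) *\<^sub>R (x + K x)"
    by (simp add: scaleR_2[symmetric])
  then show "x \<in> eigen_plus K"
    unfolding eigen_plus_def by blast
qed

lemma eigen_minus_eq:
  assumes "csym K"
  shows "eigen_minus K = {x. K x = - x}"
proof (intro set_eqI iffI)
  fix x assume "x \<in> eigen_minus K"
  then show "x \<in> {x. K x = - x}"
    by (auto simp: eigen_minus_def scaleR_scaleC csymD[OF assms] csym_minus[OF assms] scaleC_simps)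
next
  fix x assume "x \<in> {x. K x = - x}"
  then have "x = (1/2) *\<^sub>R (x - K x)"
    by (simp add: scaleR_2[symmetric])
  then show "x \<in> eigen_minus K"
    unfolding eigen_minus_def by blast
qed

text \<open>The sum \<open>p + lift2 K p\<close> is twice the projection of \<open>p\<close> to the
  eigenspace for 1, and this is the part on which the extension does not exceed \<open>S\<close>.
  All later arguments use this form instead of the orthogonal sum.\<close>

lemma A_ext_eq:
  assumes K: "csym K"
  shows "A_ext S K = {p \<in> adj S. p + lift2 K p \<in> S}"
proof (intro set_eqI iffI)
  fix p assume "p \<in> A_ext S K"
  then obtain a b where ab: "p = a + b" "a \<in> S" "lift2 K a = a" "lift2 K b = - b"
      "b \<in> adj_in {x. K x = - x} (part_in {x. K x = - x} S)"
    unfolding A_ext_def op_sum_def eigen_plus_eq[OF K] eigen_minus_eq[OF K]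
    by (force simp: part_in_def lift2_def adj_in_def)
  \<comment> \<open>The adjoint in the subspace tests \<open>b\<close> only against elements of
    \<open>S\<close> that are odd under \<open>K\<close>. As \<open>b\<close> is odd, its form with
    \<open>s - lift2 K s\<close> is twice its form with \<open>s\<close>.\<close>
  have "bform s b = 0" if s: "s \<in> S" for s
  proof -
    have sm: "s - lift2 K s \<in> S"
      using s lift2_S[OF K s] by (rule csubspace_diff[OF csubspace_S])
    have "lift2 K (s - lift2 K s) = - (s - lift2 K s)"
      by (simp add: lift2_simps[OF K])
    then have "bform (s - lift2 K s) b = 0"
      using ab(5) sm by (cases "s - lift2 K s"; cases b) (force simp: adj_in_def part_in_def bform_def lift2_def)
    moreover have "bform (lift2 K s) b = - bform s b"
      unfolding lift2_simps(6)[OF K] ab(4) using bform_simps(4)[of s 0 b] by (simp add: bform_simps)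
    ultimately show ?thesis
      by (simp add: bform_simps)
  qed
  then have "b \<in> adj S"
    by (simp add: mem_adj_iff)
  then show "p \<in> {p \<in> adj S. p + lift2 K p \<in> S}"
    using ab(2) S_subset_adj[OF ab(2)]
    by (auto simp: ab(1) lift2_simps[OF K] ab(3,4) intro!: csubspace_add csubspace_adj csubspace_S)
next
  fix p assume "p \<in> {p \<in> adj S. p + lift2 K p \<in> S}"
  then have p: "p \<in> adj S" "p + lift2 K p \<in> S" by auto
  define a b where "a = (1/2) *\<^sub>C (p + lift2 K p)" and "b = (1/2) *\<^sub>C (p - lift2 K p)"
  have a: "a \<in> S" "lift2 K a = a"
    using p by (auto simp: a_def lift2_simps[OF K] add.commute intro: csubspace_scale csubspace_S)
  have b: "b \<in> adj S" "lift2 K b = - b"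
    using p lift2_adj[OF K p(1)]
    by (auto simp: b_def lift2_simps[OF K] scaleC_simps intro!: csubspace_scale csubspace_diff csubspace_adj)
  have "p = a + b"
    unfolding a_def b_def by (simp add: scaleC_simps) (simp add: complex_vector.scale_left_distrib[symmetric] scaleC_one)
  moreover have "a \<in> part_in (eigen_plus K) S"
    using a unfolding eigen_plus_eq[OF K] by (cases a) (auto simp: part_in_def lift2_def)
  moreover have "b \<in> adj_in (eigen_minus K) (part_in (eigen_minus K) S)"
    using b unfolding eigen_minus_eq[OF K] mem_adj_iff
    by (cases b) (force simp: part_in_def lift2_def adj_in_def bform_def)
  ultimately show "p \<in> A_ext S K"
    unfolding A_ext_def op_sum_def by (cases a; cases b) auto
qed

lemma S_subset_A_ext: "csym K \<Longrightarrow> S \<subseteq> A_ext S K"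
  using lift2_S S_subset_adj by (auto simp: A_ext_eq intro!: csubspace_add csubspace_S)

text \<open>Taking adjoints exchanges the roles of the two eigenspaces. Both members of
  \<open>Xi_pair\<close> are thus of the form \<open>A_ext S (C \<gamma>)\<close> with a unit vector
  \<gamma> orthogonal to \<alpha>.\<close>

lemma adj_A_ext:
  assumes K: "csym K"
  shows "adj (A_ext S K) = A_ext S (\<lambda>x. - K x)"
proof -
  have minus: "lift2 (\<lambda>x. - K x) p = - lift2 K p" for p
    by (simp add: prod_eq_iff)
  have "q \<in> adj (A_ext S K) \<longleftrightarrow> q \<in> adj S \<and> q - lift2 K q \<in> S" for q
  proof
    assume q: "q \<in> adj (A_ext S K)"
    then have qS: "q \<in> adj S"
      using adj_antimono[OF S_subset_A_ext[OF K]] by blast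
    have "q - lift2 K q \<in> S"
    proof (rule adj_adj)
      show "q - lift2 K q \<in> adj S"
        using qS lift2_adj[OF K qS] by (rule csubspace_diff[OF csubspace_adj])
      fix r assume r: "r \<in> adj S"
      \<comment> \<open>An odd pair has \<open>p + lift2 K p = 0\<close>, so the odd part of every
        element of the adjoint is available for testing.\<close>
      have "r - lift2 K r \<in> A_ext S K"
        using r lift2_adj[OF K r] csubspace_0[OF csubspace_S]
        by (auto simp: A_ext_eq[OF K] lift2_simps[OF K] intro: csubspace_diff[OF csubspace_adj])
      then have "bform (r - lift2 K r) q = 0"
        using q by (simp add: mem_adj_iff)
      then have "bform q (r - lift2 K r) = 0"
        by (simp add: bform_eq_0_commute[of q])
      then show "bform (q - lift2 K q) r = 0"
        by (simp add: bform_simps lift2_simps[OF K])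
    qed
    with qS show "q \<in> adj S \<and> q - lift2 K q \<in> S" ..
  next
    assume q: "q \<in> adj S \<and> q - lift2 K q \<in> S"
    show "q \<in> adj (A_ext S K)"
      unfolding mem_adj_iff
    proof
      fix p assume "p \<in> A_ext S K"
      then have "p \<in> adj S" "p + lift2 K p \<in> S" by (auto simp: A_ext_eq[OF K])
      then have "bform (p + lift2 K p) q = 0" "bform p (q - lift2 K q) = 0"
        using q by simp_all
      then have "2 * bform p q = 0"
        by (simp add: bform_simps lift2_simps[OF K])
      then show "bform p q = 0" by simp
    qed
  qed
  then show ?thesis
    by (auto simp: A_ext_eq[OF csym_uminus[OF K]] minus)
qed

lemma Sigma_ext_iff:
  assumes K: "csym K"
  shows "A \<in> Sigma_ext S K \<longleftrightarrow> linear_operator A \<and> S \<subseteq> A \<and> (\<forall>p. p \<in> adj A \<longleftrightarrow> lift2 K p \<in> A)"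
proof -
  have "graph_of K \<circ>\<^sub>o adj A = A \<circ>\<^sub>o graph_of K \<longleftrightarrow> (\<forall>p. p \<in> adj A \<longleftrightarrow> lift2 K p \<in> A)"
  proof
    assume eq: "graph_of K \<circ>\<^sub>o adj A = A \<circ>\<^sub>o graph_of K"
    show "\<forall>p. p \<in> adj A \<longleftrightarrow> lift2 K p \<in> A"
    proof
      fix p
      have "p \<in> adj A \<longleftrightarrow> (fst p, K (snd p)) \<in> graph_of K \<circ>\<^sub>o adj A"
        unfolding graph_of_op_comp_iff using csymD(4)[OF K] by (metis prod.collapse)
      then show "p \<in> adj A \<longleftrightarrow> lift2 K p \<in> A"
        unfolding eq op_comp_graph_of_iff lift2_def .
    qed
  next
    assume iff: "\<forall>p. p \<in> adj A \<longleftrightarrow> lift2 K p \<in> A"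
    have "(x, z) \<in> graph_of K \<circ>\<^sub>o adj A \<longleftrightarrow> (x, z) \<in> A \<circ>\<^sub>o graph_of K" for x z
    proof -
      have "(x, z) \<in> graph_of K \<circ>\<^sub>o adj A \<longleftrightarrow> (x, K z) \<in> adj A"
        unfolding graph_of_op_comp_iff using csymD(4)[OF K] by metis
      also have "\<dots> \<longleftrightarrow> (K x, z) \<in> A"
        using iff csymD(4)[OF K] by (simp add: lift2_def)
      finally show ?thesis
        unfolding op_comp_graph_of_iff .
    qed
    then show "graph_of K \<circ>\<^sub>o adj A = A \<circ>\<^sub>o graph_of K"
      by (auto simp: set_eq_iff)
  qed
  then show ?thesis
    by (simp add: Sigma_ext_def)
qed

lemma single_valued_if_subset_adj: "A \<subseteq> adj S \<Longrightarrow> single_valued A"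
  unfolding single_valued_def using adj_eqI by (metis fst_conv snd_conv subsetD)

lemma csubspace_A_ext: "csym K \<Longrightarrow> csubspace (A_ext S K)"
  unfolding complex_vector.subspace_def
proof (intro conjI ballI allI)
  assume K: "csym K"
  show "0 \<in> A_ext S K"
    using S_subset_A_ext[OF K] csubspace_0[OF csubspace_S] by blast
  fix p assume p: "p \<in> A_ext S K"
  have "c *\<^sub>C p + lift2 K (c *\<^sub>C p) = c *\<^sub>C (p + lift2 K p)" for c
    by (simp add: lift2_simps[OF K] scaleC_simps)
  then show "c *\<^sub>C p \<in> A_ext S K" for c
    using p by (auto simp: A_ext_eq[OF K] intro: csubspace_scale[OF csubspace_adj] csubspace_scale[OF csubspace_S])
  fix q assume q: "q \<in> A_ext S K"
  have "p + q + lift2 K (p + q) = (p + lift2 K p) + (q + lift2 K q)"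
    by (simp add: lift2_simps[OF K])
  moreover have "(p + lift2 K p) + (q + lift2 K q) \<in> S" "p + q \<in> adj S"
    using p q by (auto simp only: A_ext_eq[OF K] mem_Collect_eq
        intro!: csubspace_add[OF csubspace_adj] csubspace_add[OF csubspace_S])
  ultimately show "p + q \<in> A_ext S K"
    by (simp only: A_ext_eq[OF K] mem_Collect_eq)
qed

text \<open>Anticommutation makes \<open>K\<close> exchange the eigenspaces of \<open>G\<close>, so
  conjugation by \<open>K\<close> turns the extension for \<open>G\<close> into the one for
  \<open>- G\<close>, which is the adjoint.\<close>

lemma A_ext_in_Sigma:
  assumes K: "csym K" and G: "csym G" and anti: "\<And>x. K (G x) = - G (K x)"
  shows "A_ext S G \<in> Sigma_ext S K"
  unfolding Sigma_ext_iff[OF K]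
proof (intro conjI allI)
  show "linear_operator (A_ext S G)"
    unfolding linear_operator_def using csubspace_A_ext[OF G] single_valued_if_subset_adj
    by (auto simp: A_ext_eq[OF G])
  show "S \<subseteq> A_ext S G"
    by (rule S_subset_A_ext[OF G])
  fix p
  have *: "lift2 K p + lift2 G (lift2 K p) = lift2 K (p + lift2 (\<lambda>x. - G x) p)"
    by (simp add: prod_eq_iff anti csymD[OF K] csym_minus[OF K])
  have "lift2 K q \<in> adj S \<longleftrightarrow> q \<in> adj S" "lift2 K q \<in> S \<longleftrightarrow> q \<in> S" for q
    using lift2_adj[OF K] lift2_S[OF K] lift2_simps(4)[OF K] by metis+
  then show "p \<in> adj (A_ext S G) \<longleftrightarrow> lift2 K p \<in> A_ext S G"
    unfolding adj_A_ext[OF G] unfolding A_ext_eq[OF G] A_ext_eq[OF csym_uminus[OF G]] by (simp add: *)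
qed

text \<open>Eigenvectors are given off the real line only. A bounded inverse at any point, real or
  not, excludes eigenvalues closer than the reciprocal of its bound, and non-real points exist
  within that distance.\<close>

lemma resolvent_set_empty:
  assumes ev: "\<And>\<mu>. Im \<mu> \<noteq> 0 \<Longrightarrow> \<exists>f. f \<noteq> 0 \<and> ev \<mu> f \<in> A"
  shows "resolvent_set A = {}"
proof (rule ccontr)
  assume "resolvent_set A \<noteq> {}"
  then obtain \<mu> B where B: "bounded_clinear B" "(op_minus A \<mu>)\<inverse> = graph_of B"
    by (auto simp: resolvent_set_def)
  obtain k where k: "k > 0" "\<And>x. norm (B x) \<le> norm x * k"
    using B(1) bounded_linear.pos_bounded unfolding bounded_clinear_def by metis
  \<comment> \<open>The smaller value is taken exactly when the larger one would land on the real
    axis.\<close>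
  define t where "t = (if Im \<mu> + 1 / (2 * k) = 0 then 1 / (4 * k) else 1 / (2 * k))"
  have t: "t > 0" "t * k < 1" "Im \<mu> + t \<noteq> 0"
    using k(1) by (auto simp: t_def field_simps split: if_splits)
  obtain f where f: "f \<noteq> 0" "ev (\<mu> + of_real t * \<i>) f \<in> A"
    using ev[of "\<mu> + of_real t * \<i>"] t(3) by auto
  have "(f, (of_real t * \<i>) *\<^sub>C f) \<in> op_minus A \<mu>"
    using f(2) by (force simp: op_minus_def ev_def scaleC_simps)
  then have "((of_real t * \<i>) *\<^sub>C f, f) \<in> graph_of B"
    unfolding B(2)[symmetric] by simp
  then have "f = B ((of_real t * \<i>) *\<^sub>C f)"
    by (auto simp: graph_of_def)
  then have "norm f \<le> t * norm f * k"
    using k(2)[of "(of_real t * \<i>) *\<^sub>C f"] t(1) by (simp add: norm_mult)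
  then have "norm f * (1 - t * k) \<le> 0"
    by (simp add: algebra_simps)
  with f(1) t(2) show False
    by (simp add: mult_le_0_iff)
qed

lemma defect_nonzero:
  assumes "Im \<mu> \<noteq> 0"
  obtains f where "f \<in> N \<mu>" "f \<noteq> 0"
proof -
  have *: "\<exists>f\<in>N \<iota>. f \<noteq> 0" if "cdim (N \<iota>) = 2" for \<iota>
    by (rule orthonormal_pair_exists[OF csubspace_defect that]) force
  show ?thesis
  proof (cases "Im \<mu> > 0")
    case True
    then show ?thesis
      using *[OF dim_plus] defect_nonzero_transfer[of _ \<i> \<mu>] that by auto
  next
    case False
    then have "Im \<mu> * Im (- \<i>) > 0"
      using assms by simp
    then show ?thesis
      using *[OF dim_minus] defect_nonzero_transfer[of _ "- \<i>" \<mu>] that by metis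
  qed
qed

lemma three_dependent_defect: "Im \<mu> \<noteq> 0 \<Longrightarrow> three_dependent (N \<mu>)"
  using three_dependent_transfer[OF three_dependent_if_cdim_2[OF dim_plus], of \<mu>]
    three_dependent_transfer[OF three_dependent_if_cdim_2[OF dim_minus], of \<mu>]
  by (cases "Im \<mu> > 0") auto

text \<open>Project any defect vector to the eigenspace of \<open>G\<close> for -1. If the
  projection vanishes, \<open>G\<close> fixes the vector, and \<open>K\<close> carries it into that
  eigenspace.\<close>

lemma eigenvector_in_defect:
  assumes K: "csym K" and G: "csym G" and anti: "\<And>x. K (G x) = - G (K x)" and "Im \<mu> \<noteq> 0"
  obtains f where "f \<in> N \<mu>" "f \<noteq> 0" "G f = - f"
proof -
  obtain h where h: "h \<in> N \<mu>" "h \<noteq> 0"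
    using defect_nonzero[OF assms(4)] .
  show ?thesis
  proof (cases "h = G h")
    case True
    have "G (K h) = - K h"
      using anti[of h] True by (metis minus_minus)
    then show ?thesis
      using that[of "K h"] csym_defect[OF K h(1)] h(2) csym_minus(4)[OF K] by auto
  next
    case False
    then show ?thesis
      using that[of "h - G h"] h(1) csym_defect[OF G h(1)]
      by (simp add: csym_minus[OF G] csymD[OF G] csubspace_diff[OF csubspace_defect])
  qed
qed

lemma A_ext_in_Xi:
  assumes K: "csym K" and G: "csym G" and anti: "\<And>x. K (G x) = - G (K x)"
  shows "A_ext S G \<in> Xi_ext S K"
proof -
  have "resolvent_set (A_ext S G) = {}"
  proof (rule resolvent_set_empty)
    fix \<mu> :: complex assume "Im \<mu> \<noteq> 0"
    obtain f where f: "f \<in> N \<mu>" "f \<noteq> 0" "G f = - f"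
      by (rule eigenvector_in_defect[OF K G anti \<open>Im \<mu> \<noteq> 0\<close>])
    have "ev \<mu> f + lift2 G (ev \<mu> f) = 0"
      by (simp add: lift2_simps[OF G] f(3) prod_eq_iff)
    then have "ev \<mu> f \<in> A_ext S G"
      using ev_in_adj[OF f(1)] csubspace_0[OF csubspace_S] by (simp add: A_ext_eq[OF G])
    then show "\<exists>f. f \<noteq> 0 \<and> ev \<mu> f \<in> A_ext S G"
      using f(2) by blast
  qed
  then show ?thesis
    using A_ext_in_Sigma[OF K G anti] by (simp add: Xi_ext_def)
qed

lemma J_gamma:
  assumes "norm \<alpha> = 1" "norm \<beta> = 1" "\<alpha> \<bullet> \<beta> = 0"
  shows "(\<lambda>x. \<i> *\<^sub>C C \<alpha> (C \<beta> x)) = C (cross3 \<alpha> \<beta>)" "norm (cross3 \<alpha> \<beta>) = 1" "\<alpha> \<bullet> cross3 \<alpha> \<beta> = 0"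
    "\<beta> \<bullet> cross3 \<alpha> \<beta> = 0"
proof -
  show "(\<lambda>x. \<i> *\<^sub>C C \<alpha> (C \<beta> x)) = C (cross3 \<alpha> \<beta>)"
    by (simp add: C_product assms(3) scaleC_simps scaleC_scaleC scaleC_one fun_eq_iff)
  have "(norm (cross3 \<alpha> \<beta>))\<^sup>2 = 1"
    using norm_cross_dot[of \<alpha> \<beta>] assms by simp
  then show "norm (cross3 \<alpha> \<beta>) = 1"
    by (simp add: power2_eq_1_iff) (smt (verit) norm_ge_zero)
  show "\<alpha> \<bullet> cross3 \<alpha> \<beta> = 0" "\<beta> \<bullet> cross3 \<alpha> \<beta> = 0"
    by (simp_all add: dot_cross_self)
qed

lemma C_anticommute: "\<alpha> \<bullet> \<beta> = 0 \<Longrightarrow> C \<alpha> (C \<beta> x) = - C \<beta> (C \<alpha> x)"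
  using C_anticommutator[of \<alpha> \<beta> x] by (simp add: eq_neg_iff_add_eq_0)

lemma Xi_pair_eq:
  assumes "norm \<alpha> = 1" "norm \<beta> = 1" "\<alpha> \<bullet> \<beta> = 0"
  shows "Xi_pair S (C \<alpha>) (C \<beta>) = {A_ext S (C (cross3 \<alpha> \<beta>)), A_ext S (C (- cross3 \<alpha> \<beta>))}"
  unfolding Xi_pair_def Let_def J_gamma(1)[OF assms] adj_A_ext[OF csym_C[OF J_gamma(2)[OF assms]]] C_uminus ..

lemma Xi_pair_subset_Xi:
  assumes "norm \<alpha> = 1" "norm \<beta> = 1" "\<alpha> \<bullet> \<beta> = 0"
  shows "Xi_pair S (C \<alpha>) (C \<beta>) \<subseteq> Xi_ext S (C \<alpha>)"
  unfolding Xi_pair_eq[OF assms] using J_gamma(2,3)[OF assms]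
  by (auto intro!: A_ext_in_Xi csym_C C_anticommute assms)

end

section \<open>Extensions with empty resolvent set\<close>

context clifford_operator
begin

lemma anticommuting_unit_exists:
  fixes \<alpha> :: "real ^ 3"
  assumes "norm \<alpha> = 1"
  obtains \<beta> where "norm \<beta> = 1" "\<alpha> \<bullet> \<beta> = 0"
proof -
  obtain y :: "real ^ 3" where y: "y \<noteq> 0" "orthogonal \<alpha> y"
    using orthogonal_to_vector_exists[of \<alpha>] by auto
  then show ?thesis
    by (intro that[of "y /\<^sub>R norm y"]) (simp_all add: orthogonal_def)
qed

text \<open>The eigenspaces of the self-adjoint \<open>L\<close> for 1 and -1 are orthogonal, and
  \<open>K\<close> exchanges them.\<close>

lemma anti_orthogonal:
  assumes K: "csym K" and L: "csym L" and anti: "\<And>x. K (L x) = - L (K x)" and "L a = c *\<^sub>C a" "c = 1 \<or> c = -1"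
  shows "cinner a (K a) = 0"
proof -
  have "cinner (L a) (K a) = cinner a (L (K a))"
    by (rule csymD(3)[OF L])
  also have "L (K a) = - K (L a)"
    by (simp add: anti)
  finally show ?thesis
    using assms(4,5) by (auto simp: cinner_simps csym_minus[OF K] csymD[OF K])
qed

lemma defect_span:
  assumes K: "csym K" and a: "a \<in> N \<mu>" "a \<noteq> 0" "cinner a (K a) = 0" and "Im \<mu> \<noteq> 0" and f: "f \<in> N \<mu>"
  obtains p q where "f = p *\<^sub>C a + q *\<^sub>C K a"
  using three_dependentE[OF three_dependent_defect[OF assms(5)] a(1) csym_defect[OF K a(1)] f a(2) _ a(3)]
    a(2) csym_minus(4)[OF K] by metis

lemma defect_multiple:
  assumes K: "csym K" and a: "a \<in> N \<mu>" "a \<noteq> 0" "cinner a (K a) = 0" and "Im \<mu> \<noteq> 0" and f: "f \<in> N \<mu>"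
  shows "cinner f (K a) = 0 \<Longrightarrow> \<exists>p. f = p *\<^sub>C a" "cinner f a = 0 \<Longrightarrow> \<exists>p. f = p *\<^sub>C K a"
proof -
  have Ka: "K a \<in> N \<mu>" "K a \<noteq> 0" "cinner (K a) a = 0"
    using csym_defect[OF K a(1)] a(2,3) csym_minus(4)[OF K] by (simp_all add: cinner_eq_0_commute)
  note dep = three_dependent_defect[OF assms(5)]
  show "\<exists>p. f = p *\<^sub>C a" if "cinner f (K a) = 0"
    using three_dependent_orthogonal[OF dep a(1) Ka(1) f a(2) Ka(2) a(3) that] by metis
  show "\<exists>p. f = p *\<^sub>C K a" if "cinner f a = 0"
    using three_dependent_orthogonal[OF dep Ka(1) a(1) f Ka(2) a(2) Ka(3) that] by metis
qed

text \<open>The two defect vectors of the additional extension are eigenvectors of the same symmetry for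
  different eigenvalues, while both members of a pair \<open>\<Xi>\<^sub>\<alpha>\<^sub>,\<^sub>\<beta>\<close> require equal eigenvalues.\<close>

lemma extra_extension:
  assumes const: constant_defect and \<alpha>: "norm \<alpha> = 1"
  shows "\<exists>A\<in>Xi_ext S (C \<alpha>). \<forall>\<beta>. norm \<beta> = 1 \<longrightarrow> \<alpha> \<bullet> \<beta> = 0 \<longrightarrow> A \<notin> Xi_pair S (C \<alpha>) (C \<beta>)"
proof -
  obtain \<beta>0 where \<beta>0: "norm \<beta>0 = 1" "\<alpha> \<bullet> \<beta>0 = 0"
    by (rule anticommuting_unit_exists[OF \<alpha>])
  define K L where "K = C \<alpha>" and "L = C \<beta>0"
  have K: "csym K" and L: "csym L" and anti: "K (L x) = - L (K x)" for x
    using \<alpha> \<beta>0 C_anticommute[OF \<beta>0(2)] by (auto simp: K_def L_def intro: csym_C)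
  have anti': "K (- L x) = - (- L (K x))" for x
    by (simp add: csym_minus[OF K] anti)
  obtain a where a: "a \<in> N \<i>" "a \<noteq> 0" "L a = - a"
    by (rule eigenvector_in_defect[OF K L anti, of \<i>]) auto
  obtain b where b: "b \<in> N (- \<i>)" "b \<noteq> 0" "- L b = - b"
    by (rule eigenvector_in_defect[OF K csym_uminus[OF L] anti', of "- \<i>"]) auto
  have aKa: "cinner a (K a) = 0" and bKb: "cinner b (K b) = 0"
    using anti_orthogonal[OF K L anti, of a "-1"] anti_orthogonal[OF K L anti, of b 1] a(3) b(3)
    by (auto simp: scaleC_one)
  define A where "A = {p \<in> adj S. \<exists>x y. p - ev \<i> (x *\<^sub>C a) - ev (- \<i>) (y *\<^sub>C b) \<in> S}"
  have AI: "p \<in> A" if "s \<in> S" "p = s + ev \<i> (x *\<^sub>C a) + ev (- \<i>) (y *\<^sub>C b)" for p s x y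
  proof -
    have "p \<in> adj S"
      unfolding that(2) by (intro csubspace_add csubspace_adj S_subset_adj that(1) ev_in_adj csubspace_scale
          csubspace_defect a b)
    moreover have "p - ev \<i> (x *\<^sub>C a) - ev (- \<i>) (y *\<^sub>C b) \<in> S"
      using that by simp
    ultimately show ?thesis by (auto simp: A_def)
  qed
  have AE: "\<exists>s x y. s \<in> S \<and> p = s + ev \<i> (x *\<^sub>C a) + ev (- \<i>) (y *\<^sub>C b)" if p: "p \<in> A" for p
  proof -
    obtain x y where xy: "p - ev \<i> (x *\<^sub>C a) - ev (- \<i>) (y *\<^sub>C b) \<in> S"
      using p unfolding A_def by blast
    have "p = (p - ev \<i> (x *\<^sub>C a) - ev (- \<i>) (y *\<^sub>C b)) + ev \<i> (x *\<^sub>C a) + ev (- \<i>) (y *\<^sub>C b)"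
      by simp
    with xy show ?thesis by blast
  qed
  have "csubspace A"
    unfolding complex_vector.subspace_def
  proof (intro conjI ballI allI)
    show "0 \<in> A"
      by (rule AI[of 0 _ 0 0]) (simp_all add: csubspace_0[OF csubspace_S])
    fix p assume "p \<in> A"
    then obtain s x y where p: "s \<in> S" "p = s + ev \<i> (x *\<^sub>C a) + ev (- \<i>) (y *\<^sub>C b)"
      using AE by blast
    show "c *\<^sub>C p \<in> A" for c
      by (rule AI[of "c *\<^sub>C s" _ "c * x" "c * y"])
        (simp_all add: csubspace_scale[OF csubspace_S] p scaleC_simps ev_scaleC scaleC_scaleC)
    fix q assume "q \<in> A"
    then obtain t x' y' where q: "t \<in> S" "q = t + ev \<i> (x' *\<^sub>C a) + ev (- \<i>) (y' *\<^sub>C b)"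
      using AE by blast
    show "p + q \<in> A"
      by (rule AI[of "s + t" _ "x + x'" "y + y'"])
        (simp_all add: csubspace_add[OF csubspace_S] p q scaleC_simps ev_add)
  qed
  have "A \<subseteq> adj S" by (auto simp: A_def)
  have "S \<subseteq> A"
    using AI[of _ _ 0 0] by auto
  have evA: "ev \<i> a \<in> A" "ev (- \<i>) b \<in> A"
    using AI[of 0 _ 1 0] AI[of 0 _ 0 1] csubspace_0[OF csubspace_S] by (auto simp: scaleC_one)
  \<comment> \<open>In its defect space the vectors orthogonal to \<open>a\<close> are the multiples
    of \<open>K a\<close>, and likewise for \<open>b\<close>. The adjoint of \<open>A\<close> is
    therefore \<open>A\<close> with \<open>a\<close> and \<open>b\<close> replaced by their
    images.\<close>
  have adjA: "q \<in> adj A \<longleftrightarrow> lift2 K q \<in> A" for q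
  proof
    assume q: "q \<in> adj A"
    then have qS: "q \<in> adj S"
      using adj_antimono[OF \<open>S \<subseteq> A\<close>] by blast
    obtain s f g where vN: "s \<in> S" "f \<in> N \<i>" "g \<in> N (cnj \<i>)" "q = s + ev \<i> f + ev (cnj \<i>) g"
      by (rule von_Neumann[OF _ qS, of \<i>]) auto
    have g: "g \<in> N (- \<i>)" using vN(3) by simp
    have "bform (ev \<i> a) q = 0" "bform (ev (- \<i>) b) q = 0"
      using q evA by (auto simp: mem_adj_iff)
    then have "cinner a f = 0" "cinner b g = 0"
      using vN a(1) b(1) ev_in_adj by (simp_all add: bform_simps bform_ev)
    then have fg: "cinner f a = 0" "cinner g b = 0"
      by (simp_all add: cinner_eq_0_commute)
    obtain x where x: "f = x *\<^sub>C K a"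
      using defect_multiple(2)[OF K a(1,2) aKa _ vN(2) fg(1)] by auto
    obtain y where y: "g = y *\<^sub>C K b"
      using defect_multiple(2)[OF K b(1,2) bKb _ g fg(2)] by auto
    show "lift2 K q \<in> A"
      by (rule AI[OF lift2_S[OF K vN(1)], of _ x y])
        (simp add: vN(4) lift2_simps[OF K] x y csymD[OF K])
  next
    assume "lift2 K q \<in> A"
    then obtain s x y where s: "s \<in> S" "lift2 K q = s + ev \<i> (x *\<^sub>C a) + ev (- \<i>) (y *\<^sub>C b)"
      using AE by blast
    have "q = lift2 K (lift2 K q)"
      by (simp add: lift2_simps[OF K])
    then have q: "q = lift2 K s + ev \<i> (x *\<^sub>C K a) + ev (- \<i>) (y *\<^sub>C K b)"
      by (simp add: s(2) lift2_simps[OF K] csymD[OF K])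
    show "q \<in> adj A"
      unfolding mem_adj_iff
    proof
      fix p assume "p \<in> A"
      then obtain t x' y' where p: "t \<in> S" "p = t + ev \<i> (x' *\<^sub>C a) + ev (- \<i>) (y' *\<^sub>C b)"
        using AE by blast
      have adjs: "ev \<i> (z *\<^sub>C K a) \<in> adj S" "ev (- \<i>) (z *\<^sub>C K b) \<in> adj S" "ev \<i> (z *\<^sub>C a) \<in> adj S"
          "ev (- \<i>) (z *\<^sub>C b) \<in> adj S" for z
        by (intro ev_in_adj csubspace_scale csubspace_defect csym_defect[OF K] a b)+
      show "bform p q = 0"
        using p(1) lift2_S[OF K s(1)] S_subset_adj adjs
        by (simp add: p(2) q bform_simps bform_ev cinner_simps aKa bKb)
    qed
  qed
  have "A \<in> Sigma_ext S K"
    unfolding Sigma_ext_iff[OF K] linear_operator_def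
    using \<open>csubspace A\<close> \<open>S \<subseteq> A\<close> single_valued_if_subset_adj[OF \<open>A \<subseteq> adj S\<close>] adjA by blast
  moreover have "resolvent_set A = {}"
  proof (rule resolvent_set_empty)
    fix \<mu> :: complex assume Im: "Im \<mu> \<noteq> 0"
    \<comment> \<open>Constancy moves the eigenpair from \<open>\<iota>\<close> to
      \<open>\<mu>\<close> modulo \<open>S\<close>, which \<open>A\<close> contains; the moved
      vector is non-zero because \<open>S\<close> has no non-real eigenvalue.\<close>
    have *: "\<exists>f. f \<noteq> 0 \<and> ev \<mu> f \<in> A"
      if c: "c \<in> N \<iota>" "c \<noteq> 0" "ev \<iota> c \<in> A" and sgn: "Im \<mu> * Im \<iota> > 0" for c \<iota>
    proof -
      obtain f where f: "f \<in> N \<mu>" "ev \<iota> c - ev \<mu> f \<in> S"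
        by (rule constant_defectD[OF const c(1) sgn])
      have "Im \<iota> \<noteq> 0" using sgn by auto
      then have "f \<noteq> 0"
        using ev_in_S_imp_0[OF c(1)] c(2) f(2) by auto
      moreover have "ev \<iota> c - (ev \<iota> c - ev \<mu> f) \<in> A"
        by (rule csubspace_diff[OF \<open>csubspace A\<close> c(3)]) (use f(2) \<open>S \<subseteq> A\<close> in blast)
      ultimately show ?thesis by auto
    qed
    show "\<exists>f. f \<noteq> 0 \<and> ev \<mu> f \<in> A"
      using *[OF a(1,2) evA(1)] *[OF b(1,2) evA(2)] Im by (cases "Im \<mu> > 0") auto
  qed
  ultimately have "A \<in> Xi_ext S K"
    by (simp add: Xi_ext_def)
  moreover have "A \<noteq> A_ext S (C \<gamma>)" if \<gamma>: "norm \<gamma> = 1" for \<gamma>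
  proof
    assume eq: "A = A_ext S (C \<gamma>)"
    have G: "csym (C \<gamma>)" using \<gamma> by (rule csym_C)
    have *: "C \<gamma> c = - c" if "c \<in> N \<iota>" "ev \<iota> c \<in> A" "Im \<iota> \<noteq> 0" for c \<iota>
    proof -
      have "ev \<iota> (c + C \<gamma> c) \<in> S"
        using that(2) by (simp add: eq A_ext_eq[OF G] lift2_simps[OF G] ev_add)
      then have "c + C \<gamma> c = 0"
        using that csym_defect[OF G that(1)] by (intro ev_in_S_imp_0[OF csubspace_add[OF csubspace_defect]])
      then show ?thesis by (simp add: eq_neg_iff_add_eq_0 add.commute)
    qed
    have Ga: "C \<gamma> a = - a" and Gb: "C \<gamma> b = - b"
      using *[OF a(1) evA(1)] *[OF b(1) evA(2)] by auto
    \<comment> \<open>The anticommutator is the scalar 2 (\<gamma>, \<beta>0). Here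
      \<open>C \<gamma>\<close> negates both vectors while \<open>L\<close> negates \<open>a\<close>
      and fixes \<open>b\<close>, so the scalar would be 2 on \<open>a\<close> and -2 on
      \<open>b\<close>.\<close>
    have "C \<gamma> (L a) + L (C \<gamma> a) = of_real (2 * (\<gamma> \<bullet> \<beta>0)) *\<^sub>C a"
      "C \<gamma> (L b) + L (C \<gamma> b) = of_real (2 * (\<gamma> \<bullet> \<beta>0)) *\<^sub>C b"
      unfolding L_def by (rule C_anticommutator)+
    then have "a + a = of_real (2 * (\<gamma> \<bullet> \<beta>0)) *\<^sub>C a" "- b - b = of_real (2 * (\<gamma> \<bullet> \<beta>0)) *\<^sub>C b"
      using a(3) b(3) Ga Gb by (simp_all add: csym_minus[OF G] csym_minus[OF L])
    from arg_cong[OF this(1), of "\<lambda>x. cinner x a"] arg_cong[OF this(2), of "\<lambda>x. cinner x b"]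
    have "of_real 2 * cinner a a = of_real (2 * (\<gamma> \<bullet> \<beta>0)) * cinner a a"
      "of_real (- 2) * cinner b b = of_real (2 * (\<gamma> \<bullet> \<beta>0)) * cinner b b"
      by (simp_all add: cinner_simps)
    then have "2 = 2 * (\<gamma> \<bullet> \<beta>0)" "- 2 = 2 * (\<gamma> \<bullet> \<beta>0)"
      using a(2) b(2) cinner_self_eq_0 mult_right_cancel of_real_eq_iff by metis+
    then show False by simp
  qed
  ultimately show ?thesis
    unfolding K_def using Xi_pair_eq[OF \<alpha>] J_gamma(2)[OF \<alpha>] norm_minus_cancel
    by (metis insert_iff empty_iff)
qed

text \<open>The unit vectors orthogonal to \<alpha> form a circle. For one of the corresponding
  symmetries \<open>G\<close> self-adjointness and anticommutation give G a = P a + Q K a with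
  \<open>P\<close> real, \<open>Q\<close> imaginary and P P - Q Q = 1; the point (P, Im Q) of the
  unit circle tells how far to rotate.\<close>

lemma eigen_symmetry_exists:
  assumes \<alpha>: "norm \<alpha> = 1" and a: "a \<in> N \<mu>" "a \<noteq> 0" "cinner a (C \<alpha> a) = 0" and Im: "Im \<mu> \<noteq> 0"
  obtains \<beta> where "norm \<beta> = 1" "\<alpha> \<bullet> \<beta> = 0" "C (cross3 \<alpha> \<beta>) a = - a"
proof -
  obtain \<beta>0 where \<beta>0: "norm \<beta>0 = 1" "\<alpha> \<bullet> \<beta>0 = 0"
    by (rule anticommuting_unit_exists[OF \<alpha>])
  note \<gamma> = J_gamma[OF \<alpha> \<beta>0]
  define K G where "K = C \<alpha>" and "G = C (cross3 \<alpha> \<beta>0)"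
  have K: "csym K" and G: "csym G" and anti: "K (G x) = - G (K x)" for x
    using \<alpha> \<gamma> C_anticommute[OF \<gamma>(3)] by (auto simp: K_def G_def intro: csym_C)
  obtain P Q where PQ: "G a = P *\<^sub>C a + Q *\<^sub>C K a"
    by (rule defect_span[OF K a(1,2) _ Im csym_defect[OF G a(1)]]) (use a(3) in \<open>auto simp: K_def\<close>)
  have Kaa: "cinner (K a) a = 0" "cinner a (K a) = 0" and KK: "cinner (K a) (K a) = cinner a a"
    using a(3) csymD(3,4)[OF K] by (simp_all add: K_def cinner_eq_0_commute)
  have nz: "cinner a a \<noteq> 0" using a(2) by simp
  have "cinner (G a) a = cinner a (G a)"
    by (rule csymD(3)[OF G])
  then have P: "cnj P = P"
    using nz by (simp add: PQ cinner_simps Kaa)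
  have "cinner (G a) (K a) = cinner a (G (K a))"
    by (rule csymD(3)[OF G])
  also have "G (K a) = - K (G a)"
    by (simp add: anti)
  finally have "cinner (G a) (K a) = - cinner a (K (G a))"
    by (simp add: cinner_minus_right)
  moreover have "cinner (G a) (K a) = Q * cinner a a" "cinner a (K (G a)) = cnj Q * cinner a a"
    by (simp_all add: PQ cinner_simps Kaa KK csymD[OF K])
  ultimately have "(cnj Q + Q) * cinner a a = 0"
    by (simp add: algebra_simps)
  then have Q: "cnj Q = - Q"
    using nz by (simp add: eq_neg_iff_add_eq_0)
  have "a = G (P *\<^sub>C a + Q *\<^sub>C K a)"
    by (simp add: PQ[symmetric] csymD[OF G])
  also have "\<dots> = P *\<^sub>C G a - Q *\<^sub>C K (G a)"
    by (simp add: csymD[OF G] anti complex_vector.scale_minus_right)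
  also have "\<dots> = (P * P - Q * Q) *\<^sub>C a"
    by (simp add: PQ csymD[OF K] scaleC_simps scaleC_scaleC mult.commute)
  finally have "(P * P - Q * Q - 1) *\<^sub>C a = 0"
    by (simp add: scaleC_simps scaleC_one)
  then have PQ1: "P * P - Q * Q = 1"
    using a(2) by (simp add: complex_vector.scale_eq_0_iff)
  define p r where "p = Re P" and "r = Im Q"
  have P': "P = of_real p" and Q': "Q = \<i> * of_real r"
    using P Q by (auto simp: p_def r_def complex_eq_iff)
  have "of_real (p * p + r * r) = (1 :: complex)"
    using PQ1 by (simp add: P' Q' algebra_simps)
  then have pr: "p * p + r * r = 1"
    using of_real_eq_1_iff by blast
  \<comment> \<open>The rotation of \<open>\<beta>0\<close> in the plane orthogonal to \<alpha>,
    with signs chosen to produce the eigenvalue -1.\<close>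
  define \<beta> where "\<beta> = (- p) *\<^sub>R \<beta>0 + r *\<^sub>R cross3 \<alpha> \<beta>0"
  have "(norm \<beta>)\<^sup>2 = p * p * (norm \<beta>0)\<^sup>2 + r * r * (norm (cross3 \<alpha> \<beta>0))\<^sup>2"
    unfolding power2_norm_eq_inner \<beta>_def
    by (simp add: inner_simps \<gamma>(4) inner_commute[of "cross3 \<alpha> \<beta>0" \<beta>0])
  then have "(norm \<beta>)\<^sup>2 = 1"
    using \<beta>0(1) \<gamma>(2) pr by simp
  then have \<beta>1: "norm \<beta> = 1"
    by (simp add: power2_eq_1_iff) (smt (verit) norm_ge_zero)
  have \<beta>2: "\<alpha> \<bullet> \<beta> = 0"
    by (simp add: \<beta>_def inner_simps \<beta>0 \<gamma>)
  have Gx: "G x = \<i> *\<^sub>C K (C \<beta>0 x)" for x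
    unfolding G_def K_def \<gamma>(1)[symmetric] ..
  have "C (cross3 \<alpha> \<beta>) a = \<i> *\<^sub>C K (C \<beta> a)"
    unfolding K_def J_gamma(1)[OF \<alpha> \<beta>1 \<beta>2, symmetric] ..
  also have "C \<beta> a = of_real (- p) *\<^sub>C C \<beta>0 a + of_real r *\<^sub>C G a"
    unfolding \<beta>_def C_lin G_def ..
  also have "C \<beta>0 a = (- \<i>) *\<^sub>C K (G a)"
    by (simp add: Gx csymD[OF K] scaleC_scaleC scaleC_one complex_vector.scale_minus_left)
  also have "\<i> *\<^sub>C K (of_real (- p) *\<^sub>C (- \<i>) *\<^sub>C K (G a) + of_real r *\<^sub>C G a)
      = - ((of_real p * P) *\<^sub>C a + (of_real p * Q) *\<^sub>C K a) + (\<i> * of_real r * P) *\<^sub>C K a + (\<i> * of_real r * Q) *\<^sub>C a"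
    by (simp add: PQ csymD[OF K] csym_minus[OF K] scaleC_simps scaleC_scaleC mult_ac)
  also have "\<dots> = (- of_real (p * p + r * r)) *\<^sub>C a"
    by (simp add: P' Q' scaleC_simps scaleC_scaleC algebra_simps)
  finally have "C (cross3 \<alpha> \<beta>) a = - a"
    by (simp add: pr scaleC_one)
  with \<beta>1 \<beta>2 show ?thesis by (rule that)
qed

text \<open>The relation defining \<open>Sigma_ext\<close> makes \<open>A\<close> its own complement
  for the form \<open>bform p (lift2 K q)\<close>; the last two claims are neutrality and
  maximality.\<close>

lemma Sigma_extD:
  assumes K: "csym K" and A: "A \<in> Sigma_ext S K"
  shows "csubspace A" "S \<subseteq> A" "A \<subseteq> adj S"
    and "p \<in> A \<Longrightarrow> q \<in> A \<Longrightarrow> bform p (lift2 K q) = 0"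
    and "(\<And>p. p \<in> A \<Longrightarrow> bform p q = 0) \<Longrightarrow> lift2 K q \<in> A"
proof -
  have A': "linear_operator A" "S \<subseteq> A" "\<And>p. p \<in> adj A \<longleftrightarrow> lift2 K p \<in> A"
    using A unfolding Sigma_ext_iff[OF K] by blast+
  have mem: "lift2 K p \<in> adj A \<longleftrightarrow> p \<in> A" for p
    by (simp add: A'(3) lift2_simps[OF K])
  show "csubspace A" "S \<subseteq> A"
    using A' by (simp_all add: linear_operator_def)
  show "A \<subseteq> adj S"
  proof
    fix p assume "p \<in> A"
    then have "lift2 K p \<in> adj S"
      using mem adj_antimono[OF A'(2)] by blast
    then show "p \<in> adj S"
      using lift2_adj[OF K, of "lift2 K p"] by (simp add: lift2_simps[OF K])
  qed
  show "bform p (lift2 K q) = 0" if "p \<in> A" "q \<in> A"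
    using mem[of q] that by (simp add: mem_adj_iff)
  show "lift2 K q \<in> A" if "\<And>p. p \<in> A \<Longrightarrow> bform p q = 0"
    using that A'(3)[of q] by (simp add: mem_adj_iff)
qed

text \<open>In the proof, \<open>D\<close> consists of the components of the elements of \<open>A\<close> in \<open>N (cnj \<mu>)\<close>. Maximality of
  \<open>A\<close> with respect to the neutrality \<open>bform p (lift2 K q) = 0\<close> forces \<open>D\<close> to be everything.\<close>

lemma Sigma_ext_full_component:
  assumes K: "csym K" and A: "A \<in> Sigma_ext S K" and Im: "Im \<mu> \<noteq> 0"
    and inj: "\<And>f. ev \<mu> f \<in> A \<Longrightarrow> f = 0" and g: "g \<in> N (cnj \<mu>)"
  shows "\<exists>f\<in>N \<mu>. ev \<mu> f + ev (cnj \<mu>) g \<in> A"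
proof (rule ccontr)
  note A' = Sigma_extD[OF K A]
  define D where "D = {g \<in> N (cnj \<mu>). \<exists>f\<in>N \<mu>. ev \<mu> f + ev (cnj \<mu>) g \<in> A}"
  have Im': "Im (cnj \<mu>) \<noteq> 0" using Im by simp
  note dep = three_dependent_defect[OF Im']
  assume "\<not> ?thesis"
  then have "g \<notin> D" by (auto simp: D_def)
  have D_add: "u + v \<in> D" if "u \<in> D" "v \<in> D" for u v
  proof -
    obtain f h where "f \<in> N \<mu>" "ev \<mu> f + ev (cnj \<mu>) u \<in> A" "h \<in> N \<mu>" "ev \<mu> h + ev (cnj \<mu>) v \<in> A"
      using \<open>u \<in> D\<close> \<open>v \<in> D\<close> by (auto simp: D_def)
    moreover from this have "ev \<mu> (f + h) + ev (cnj \<mu>) (u + v) \<in> A"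
      using csubspace_add[OF A'(1), of "ev \<mu> f + ev (cnj \<mu>) u" "ev \<mu> h + ev (cnj \<mu>) v"]
      by (simp add: ev_add add_ac)
    ultimately show ?thesis
      using \<open>u \<in> D\<close> \<open>v \<in> D\<close> by (auto simp: D_def intro: csubspace_add[OF csubspace_defect])
  qed
  have D_scale: "c *\<^sub>C u \<in> D" if "u \<in> D" for u c
  proof -
    obtain f where "f \<in> N \<mu>" "ev \<mu> f + ev (cnj \<mu>) u \<in> A"
      using \<open>u \<in> D\<close> by (auto simp: D_def)
    moreover from this have "ev \<mu> (c *\<^sub>C f) + ev (cnj \<mu>) (c *\<^sub>C u) \<in> A"
      using csubspace_scale[OF A'(1), of "ev \<mu> f + ev (cnj \<mu>) u" c] by (simp add: ev_scaleC scaleC_simps)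
    ultimately show ?thesis
      using \<open>u \<in> D\<close> by (auto simp: D_def intro: csubspace_scale[OF csubspace_defect])
  qed
  \<comment> \<open>\<open>D\<close> misses \<open>g\<close> in a two-dimensional space, so it is at
    most a line, and \<open>y\<close> is \<open>g\<close> or its Gram-Schmidt correction.\<close>
  obtain y where y: "y \<in> N (cnj \<mu>)" "y \<noteq> 0" "\<And>d. d \<in> D \<Longrightarrow> cinner d y = 0"
  proof (cases "\<exists>d\<in>D. d \<noteq> 0")
    case False
    have "0 \<in> D"
      using csubspace_0[OF A'(1)] csubspace_0[OF csubspace_defect] by (force simp: D_def)
    then have "g \<noteq> 0" using \<open>g \<notin> D\<close> by auto
    with False g show ?thesis by (intro that[of g]) auto
  next
    case True
    then obtain d where d: "d \<in> D" "d \<noteq> 0" by blast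
    define c where "c = cinner g d / cinner d d"
    define y where "y = g - c *\<^sub>C d"
    have dN: "d \<in> N (cnj \<mu>)" using d(1) by (auto simp: D_def)
    have yN: "y \<in> N (cnj \<mu>)"
      unfolding y_def using g dN by (intro csubspace_diff csubspace_scale csubspace_defect)
    have "y \<noteq> 0"
      using D_scale[OF d(1), of c] \<open>g \<notin> D\<close> by (auto simp: y_def)
    have "cinner y d = 0"
      using d(2) by (simp add: y_def c_def cinner_simps)
    then have dy: "cinner d y = 0" by (simp add: cinner_eq_0_commute)
    have "cinner e y = 0" if e: "e \<in> D" for e
    proof -
      have eN: "e \<in> N (cnj \<mu>)" using e by (auto simp: D_def)
      obtain p q where pq: "e = p *\<^sub>C d + q *\<^sub>C y"
        using three_dependentE[OF dep dN yN eN d(2) \<open>y \<noteq> 0\<close> dy] .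
      have "q = 0"
      proof (rule ccontr)
        assume "q \<noteq> 0"
        have "e + (- p) *\<^sub>C d \<in> D"
          by (intro D_add D_scale e d)
        then have "inverse q *\<^sub>C q *\<^sub>C y \<in> D"
          by (intro D_scale[of "q *\<^sub>C y"]) (simp add: pq)
        then have "y + c *\<^sub>C d \<in> D"
          using \<open>q \<noteq> 0\<close> d(1) by (intro D_add D_scale) (simp_all add: scaleC_scaleC scaleC_one)
        with \<open>g \<notin> D\<close> show False by (simp add: y_def)
      qed
      then show ?thesis by (simp add: pq cinner_simps dy)
    qed
    with yN \<open>y \<noteq> 0\<close> show ?thesis by (rule that)
  qed
  have decomp: "\<exists>s f h. s \<in> S \<and> f \<in> N \<mu> \<and> h \<in> D \<and> p = s + ev \<mu> f + ev (cnj \<mu>) h" if p: "p \<in> A" for p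
  proof -
    obtain s f h where vN: "s \<in> S" "f \<in> N \<mu>" "h \<in> N (cnj \<mu>)" "p = s + ev \<mu> f + ev (cnj \<mu>) h"
      by (rule von_Neumann[OF Im]) (use p A'(3) in auto)
    have "p - s \<in> A"
      using p vN(1) A'(2) by (intro csubspace_diff[OF A'(1)]) auto
    then have "h \<in> D"
      using vN by (auto simp: D_def)
    with vN show ?thesis by blast
  qed
  \<comment> \<open>Only the component of \<open>p\<close> in \<open>N (cnj \<mu>)\<close> pairs
    with this eigenpair, and it lies in \<open>D\<close>. Maximality then puts the eigenpair of
    \<open>K y\<close> into \<open>A\<close>.\<close>
  have "bform p (ev (cnj \<mu>) y) = 0" if p: "p \<in> A" for p
  proof -
    obtain s f h where "s \<in> S" "f \<in> N \<mu>" "h \<in> D" "p = s + ev \<mu> f + ev (cnj \<mu>) h"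
      using decomp[OF p] by blast
    then show ?thesis
      using ev_in_adj[OF y(1)] y(3) by (simp add: bform_simps bform_ev)
  qed
  then have "ev (cnj \<mu>) (K y) \<in> A"
    using A'(5)[of "ev (cnj \<mu>) y"] by (simp add: lift2_simps[OF K])
  note Ky = this
  have "K y \<in> D"
    using Ky csym_defect[OF K y(1)] csubspace_0[OF csubspace_defect] by (force simp: D_def)
  then have yKy: "cinner y (K y) = 0"
    using y(3) cinner_eq_0_commute by blast
  \<comment> \<open>Elements of \<open>D\<close> are now multiples of \<open>K y\<close>.
    Subtracting the eigenpair of \<open>K y\<close> leaves an eigenpair at \<open>\<mu>\<close>,
    which \<open>inj\<close> annihilates.\<close>
  have form: "\<exists>s c. s \<in> S \<and> p = s + ev (cnj \<mu>) (c *\<^sub>C K y)" if p: "p \<in> A" for p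
  proof -
    obtain s f h where d: "s \<in> S" "f \<in> N \<mu>" "h \<in> D" "p = s + ev \<mu> f + ev (cnj \<mu>) h"
      using decomp[OF p] by blast
    then obtain c where c: "h = c *\<^sub>C K y"
      using defect_multiple(2)[OF K y(1,2) yKy Im', of h] y(3) by (auto simp: D_def)
    have "p - s - c *\<^sub>C ev (cnj \<mu>) (K y) \<in> A"
      using p d(1) A'(2) Ky by (intro csubspace_diff csubspace_scale A'(1)) auto
    then have "ev \<mu> f \<in> A"
      by (simp add: d(4) c ev_scaleC)
    then have "f = 0" by (rule inj)
    then have "p = s + ev (cnj \<mu>) (c *\<^sub>C K y)"
      by (simp add: d(4) c)
    with d(1) show ?thesis by blast
  qed
  obtain f where f: "f \<in> N \<mu>" "f \<noteq> 0"
    by (rule defect_nonzero[OF Im])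
  \<comment> \<open>Such an \<open>A\<close> is too small: \<open>N (cnj \<mu>)\<close> and
    \<open>N \<mu>\<close> do not pair, so maximality forces an eigenvector at \<open>\<mu>\<close>
    into \<open>A\<close>, against \<open>inj\<close>.\<close>
  have "bform p (ev \<mu> f) = 0" if p: "p \<in> A" for p
  proof -
    obtain s c where "s \<in> S" "p = s + ev (cnj \<mu>) (c *\<^sub>C K y)"
      using form[OF p] by blast
    then show ?thesis
      using ev_in_adj[OF f(1)] by (simp add: bform_simps bform_ev)
  qed
  then have "ev \<mu> (K f) \<in> A"
    using A'(5)[of "ev \<mu> f"] by (simp add: lift2_simps[OF K])
  then show False
    using inj f(2) csym_minus(4)[OF K] by blast
qed

text \<open>Its contrapositive gives an eigenvector at every non-real point once the resolvent set
  is empty. The inverse is bounded by splitting its argument into \<open>ran \<mu>\<close>, where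
  \<open>norm_le_ran\<close> applies, and the two-dimensional \<open>N (cnj \<mu>)\<close>, where
  the values on a basis suffice.\<close>

lemma Sigma_ext_resolvent:
  assumes \<alpha>: "norm \<alpha> = 1" and A: "A \<in> Sigma_ext S (C \<alpha>)" and Im: "Im \<mu> \<noteq> 0"
    and inj: "\<And>f. ev \<mu> f \<in> A \<Longrightarrow> f = 0"
  shows "\<mu> \<in> resolvent_set A"
proof -
  define K where "K = C \<alpha>"
  have K: "csym K" using \<alpha> by (simp add: K_def csym_C)
  note A' = Sigma_extD[OF K A[folded K_def]]
  have ex: "\<exists>p\<in>A. snd p - \<mu> *\<^sub>C fst p = y" for y
  proof -
    obtain s g where sg: "s \<in> S" "g \<in> N (cnj \<mu>)" "y = snd s - \<mu> *\<^sub>C fst s + g"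
      by (rule ran_decomposition[OF Im])
    have ne: "cnj \<mu> - \<mu> \<noteq> 0"
      using Im by (simp add: complex_eq_iff)
    define h where "h = inverse (cnj \<mu> - \<mu>) *\<^sub>C g"
    have "h \<in> N (cnj \<mu>)"
      unfolding h_def using sg(2) by (rule csubspace_scale[OF csubspace_defect])
    then obtain f where f: "ev \<mu> f + ev (cnj \<mu>) h \<in> A"
      using Sigma_ext_full_component[OF K A[folded K_def] Im inj] by blast
    have "(cnj \<mu> - \<mu>) *\<^sub>C h = g"
      using ne by (simp add: h_def scaleC_scaleC scaleC_one)
    then have "snd (s + (ev \<mu> f + ev (cnj \<mu>) h)) - \<mu> *\<^sub>C fst (s + (ev \<mu> f + ev (cnj \<mu>) h)) = y"
      by (simp add: sg(3) scaleC_simps algebra_simps)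
    moreover have "s + (ev \<mu> f + ev (cnj \<mu>) h) \<in> A"
      using sg(1) A'(2) by (intro csubspace_add[OF A'(1) _ f]) auto
    ultimately show ?thesis by blast
  qed
  have uniq: "fst p = fst q" if "p \<in> A" "q \<in> A" "snd p - \<mu> *\<^sub>C fst p = snd q - \<mu> *\<^sub>C fst q" for p q
  proof -
    have "p - q \<in> A"
      using that(1,2) by (rule csubspace_diff[OF A'(1)])
    moreover have "p - q = ev \<mu> (fst p - fst q)"
      using that(3) by (simp add: prod_eq_iff scaleC_simps algebra_simps)
    ultimately show ?thesis
      using inj by fastforce
  qed
  obtain r where r: "\<And>y. r y \<in> A" "\<And>y. snd (r y) - \<mu> *\<^sub>C fst (r y) = y"
    using ex by metis
  define B where "B y = fst (r y)" for y
  have B: "B y = fst p" if "p \<in> A" "snd p - \<mu> *\<^sub>C fst p = y" for p y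
    unfolding B_def using r that by (intro uniq) auto
  have B_add: "B (x + y) = B x + B y" for x y
  proof -
    have "B (x + y) = fst (r x + r y)"
      using r by (intro B csubspace_add A'(1)) (simp_all add: scaleC_simps add_diff_add)
    then show ?thesis by (simp add: B_def)
  qed
  have B_scale: "B (c *\<^sub>C y) = c *\<^sub>C B y" for c y
  proof -
    have "snd (c *\<^sub>C r y) - \<mu> *\<^sub>C fst (c *\<^sub>C r y) = c *\<^sub>C (snd (r y) - \<mu> *\<^sub>C fst (r y))"
      by (simp add: scaleC_simps scaleC_scaleC mult.commute)
    then have "B (c *\<^sub>C y) = fst (c *\<^sub>C r y)"
      using r by (intro B csubspace_scale A'(1)) simp_all
    then show ?thesis by (simp add: B_def)
  qed
  obtain \<beta> where \<beta>: "norm \<beta> = 1" "\<alpha> \<bullet> \<beta> = 0"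
    by (rule anticommuting_unit_exists[OF \<alpha>])
  have anti: "K (C \<beta> x) = - C \<beta> (K x)" for x
    unfolding K_def by (rule C_anticommute[OF \<beta>(2)])
  \<comment> \<open>An eigenvector of a symmetry anticommuting with \<open>K\<close> is orthogonal
    to its image, so \<open>h\<close> and \<open>K h\<close> form an orthogonal basis of the defect
    space.\<close>
  obtain h where h: "h \<in> N (cnj \<mu>)" "h \<noteq> 0" "C \<beta> h = - h"
    by (rule eigenvector_in_defect[OF K csym_C[OF \<beta>(1)] anti, of "cnj \<mu>"]) (use Im in auto)
  have hKh: "cinner h (K h) = 0"
    using anti_orthogonal[OF K csym_C[OF \<beta>(1)] anti, of h "-1"] h(3) by (simp add: scaleC_one)
  have Khh: "cinner (K h) h = 0" and KK: "cinner (K h) (K h) = cinner h h" and nK: "norm (K h) = norm h"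
  proof -
    show "cinner (K h) h = 0" using hKh by (simp add: cinner_eq_0_commute)
    show *: "cinner (K h) (K h) = cinner h h"
      using csymD(3,4)[OF K] by simp
    show "norm (K h) = norm h"
      using * unfolding cinner_self by (metis norm_ge_zero of_real_eq_iff power2_eq_iff_nonneg)
  qed
  define k where "k = (norm (B h) + norm (B (K h))) / norm h"
  have Bg: "norm (B g) \<le> norm g * k" if g: "g \<in> N (cnj \<mu>)" for g
  proof -
    obtain p q where pq: "g = p *\<^sub>C h + q *\<^sub>C K h"
      by (rule defect_span[OF K h(1,2) hKh _ g]) (use Im in auto)
    have "cinner g h = p * cinner h h" "cinner g (K h) = q * cinner h h"
      by (simp_all add: pq cinner_simps hKh Khh KK)
    then have "cmod p * (norm h)\<^sup>2 = cmod (cinner g h)" "cmod q * (norm h)\<^sup>2 = cmod (cinner g (K h))"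
      by (simp_all add: norm_mult cinner_self norm_power)
    then have "cmod p * (norm h)\<^sup>2 \<le> norm g * norm h" "cmod q * (norm h)\<^sup>2 \<le> norm g * norm h"
      using norm_cinner_le[of g h] norm_cinner_le[of g "K h"] by (simp_all add: nK)
    then have pq_le: "cmod p \<le> norm g / norm h" "cmod q \<le> norm g / norm h"
      using h(2) by (simp_all add: power2_eq_square field_simps)
    have "norm (B g) \<le> cmod p * norm (B h) + cmod q * norm (B (K h))"
      by (simp add: pq B_add B_scale norm_triangle_le)
    also have "\<dots> \<le> norm g / norm h * norm (B h) + norm g / norm h * norm (B (K h))"
      using pq_le by (intro add_mono mult_right_mono) auto
    also have "\<dots> = norm g * k"
      by (simp add: k_def add_divide_distrib distrib_left)
    finally show ?thesis .
  qed
  have "k \<ge> 0" by (simp add: k_def)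
  have B_bound: "norm (B y) \<le> norm y * (1 / \<bar>Im \<mu>\<bar> + k)" for y
  proof -
    obtain s g where sg: "s \<in> S" "g \<in> N (cnj \<mu>)" "y = snd s - \<mu> *\<^sub>C fst s + g"
      by (rule ran_decomposition[OF Im])
    define z where "z = snd s - \<mu> *\<^sub>C fst s"
    have "inner z g = 0"
      using cinner_ran_defect[OF sg(1,2)] by (simp add: inner_eq_Re_cinner z_def)
    then have "(norm y)\<^sup>2 = (norm z)\<^sup>2 + (norm g)\<^sup>2"
      unfolding sg(3) z_def[symmetric] power2_norm_eq_inner by (simp add: inner_simps inner_commute)
    then have "(norm z)\<^sup>2 \<le> (norm y)\<^sup>2" "(norm g)\<^sup>2 \<le> (norm y)\<^sup>2"
      by simp_all
    then have le: "norm z \<le> norm y" "norm g \<le> norm y"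
      by (simp_all add: power2_le_iff_abs_le)
    have "B z = fst s"
      using sg(1) A'(2) by (intro B) (auto simp: z_def)
    then have "norm (B z) \<le> norm z / \<bar>Im \<mu>\<bar>"
      using norm_le_ran[OF sg(1), of \<mu>] Im by (simp add: z_def field_simps)
    also have "\<dots> \<le> norm y / \<bar>Im \<mu>\<bar>"
      using le(1) by (simp add: divide_right_mono)
    finally have "norm (B z) + norm (B g) \<le> norm y / \<bar>Im \<mu>\<bar> + norm y * k"
      using order_trans[OF Bg[OF sg(2)] mult_right_mono[OF le(2) \<open>k \<ge> 0\<close>]] by (rule add_mono)
    moreover have "B y = B z + B g"
      using sg(3) by (simp add: z_def B_add)
    ultimately show ?thesis
      using norm_triangle_ineq[of "B z" "B g"] by (simp add: algebra_simps)
  qed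
  have "bounded_linear B"
    by (rule bounded_linear_intro[OF B_add _ B_bound]) (simp add: scaleR_scaleC B_scale)
  then have "bounded_clinear B"
    by (simp add: bounded_clinear_def B_scale)
  moreover have "(op_minus A \<mu>)\<inverse> = graph_of B"
  proof (intro set_eqI iffI)
    fix z assume "z \<in> (op_minus A \<mu>)\<inverse>"
    then obtain x y where "(x, y) \<in> A" "z = (y - \<mu> *\<^sub>C x, x)"
      by (auto simp: op_minus_def)
    then show "z \<in> graph_of B"
      using B[of "(x, y)"] by (auto simp: graph_of_def)
  next
    fix z assume "z \<in> graph_of B"
    then obtain y where y: "z = (y, B y)"
      by (auto simp: graph_of_def)
    have "(B y, y) \<in> op_minus A \<mu>"
      unfolding op_minus_def B_def using r[of y] by (cases "r y") force
    then show "z \<in> (op_minus A \<mu>)\<inverse>"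
      by (simp add: y)
  qed
  ultimately show ?thesis
    by (auto simp: resolvent_set_def)
qed

text \<open>Projecting an eigenvector of the extension onto the eigenspaces of a symmetry that fixes one of the two
  defect vectors, and comparing the signs of the boundary form, shows that it fixes the other one too.\<close>

lemma nonconstant_common_eigenspace:
  assumes K: "csym K" and G: "csym G" and A: "csubspace A" "S \<subseteq> A"
    and a: "a \<in> N \<iota>" "a \<noteq> 0" "cinner a (K a) = 0" "G a = - a" and b: "b \<in> N (- \<iota>)"
    and form: "\<And>p. p \<in> A \<Longrightarrow> \<exists>s x y. s \<in> S \<and> p = s + ev \<iota> (x *\<^sub>C a) + ev (- \<iota>) (y *\<^sub>C b)"
    and sgn: "Im \<iota> * Im \<nu> > 0" and f0: "f0 \<in> N \<iota>" "\<And>g. g \<in> N \<nu> \<Longrightarrow> ev \<iota> f0 - ev \<nu> g \<notin> S"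
    and f: "f \<noteq> 0" "ev \<nu> f \<in> A" "f \<in> N \<nu>"
  shows "G b = - b"
proof -
  obtain s x y where s: "s \<in> S" "ev \<nu> f = s + ev \<iota> (x *\<^sub>C a) + ev (- \<iota>) (y *\<^sub>C b)"
    using form[OF f(2)] by blast
  have Im: "Im \<iota> \<noteq> 0" "Im \<nu> \<noteq> 0" using sgn by auto
  \<comment> \<open>Otherwise a non-zero multiple of \<open>a\<close> is congruent to
    \<open>f\<close>. Applying \<open>K\<close>, both basis vectors \<open>a\<close> and
    \<open>K a\<close> can be moved to \<open>N \<nu>\<close>, and with them \<open>f0\<close>,
    contrary to its choice.\<close>
  have "y \<noteq> 0"
  proof
    assume "y = 0"
    then have f_eq: "ev \<nu> f = s + ev \<iota> (x *\<^sub>C a)" using s(2) by simp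
    have "x \<noteq> 0"
      using f_eq s(1) ev_in_S_imp_0[OF f(3)] Im(2) f(1) by auto
    obtain p q where pq: "f0 = p *\<^sub>C a + q *\<^sub>C K a"
      by (rule defect_span[OF K a(1-3) Im(1) f0(1)])
    define c d where "c = p / x" and "d = q / x"
    have pq': "p = c * x" "q = d * x" using \<open>x \<noteq> 0\<close> by (simp_all add: c_def d_def)
    have "c *\<^sub>C s + d *\<^sub>C lift2 K s \<in> S"
      by (intro csubspace_add csubspace_scale csubspace_S lift2_S[OF K] s(1))
    then have mem: "- (c *\<^sub>C s + d *\<^sub>C lift2 K s) \<in> S"
      by (rule csubspace_uminus[OF csubspace_S])
    have s_eq: "s = ev \<nu> f - ev \<iota> (x *\<^sub>C a)"
      using f_eq by simp
    then have "lift2 K s = ev \<nu> (K f) - ev \<iota> (x *\<^sub>C K a)"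
      by (simp add: lift2_simps[OF K] csymD[OF K])
    then have eq: "- (c *\<^sub>C s + d *\<^sub>C lift2 K s) = ev \<iota> f0 - ev \<nu> (c *\<^sub>C f + d *\<^sub>C K f)"
      using s_eq by (simp add: pq pq' ev_add ev_scaleC scaleC_simps scaleC_scaleC)
    have "c *\<^sub>C f + d *\<^sub>C K f \<in> N \<nu>"
      by (intro csubspace_add csubspace_scale csubspace_defect csym_defect[OF K] f)
    from f0(2)[OF this] mem show False
      by (simp only: eq)
  qed
  \<comment> \<open>Adding the image under \<open>G\<close> cancels the term with \<open>a\<close>;
    a defect vector at \<open>\<nu>\<close> is then congruent to one of the opposite half-plane, and
    both vanish.\<close>
  have "ev \<nu> (f + G f) = ev \<nu> f + lift2 G (ev \<nu> f)"
    by (simp add: lift2_simps[OF G] ev_add)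
  also have "\<dots> = s + lift2 G s + ev (- \<iota>) (y *\<^sub>C (b + G b))"
    unfolding s(2) by (simp add: lift2_simps[OF G] csymD[OF G] a(4) scaleC_simps ev_add ev_scaleC
        complex_vector.scale_minus_right ev_diff[of \<iota> 0, simplified])
  finally have "ev \<nu> (f + G f) - ev (- \<iota>) (y *\<^sub>C (b + G b)) \<in> S"
    using s(1) lift2_S[OF G s(1)] by (simp add: csubspace_add[OF csubspace_S])
  moreover have "f + G f \<in> N \<nu>" "y *\<^sub>C (b + G b) \<in> N (- \<iota>)"
    by (intro csubspace_add csubspace_scale csubspace_defect csym_defect[OF G] f b)+
  moreover have "Im \<nu> * Im (- \<iota>) < 0"
    using sgn by (simp add: mult.commute)
  ultimately have "y *\<^sub>C (b + G b) = 0"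
    using opposite_defect(2) by blast
  with \<open>y \<noteq> 0\<close> show ?thesis
    by (simp add: complex_vector.scale_eq_0_iff eq_neg_iff_add_eq_0 add.commute)
qed

lemma Xi_ext_form:
  assumes \<alpha>: "norm \<alpha> = 1" and A: "A \<in> Xi_ext S (C \<alpha>)" and \<iota>: "\<iota> = \<i> \<or> \<iota> = - \<i>"
  obtains a b where "a \<in> N \<iota>" "a \<noteq> 0" "cinner a (C \<alpha> a) = 0" "b \<in> N (- \<iota>)" "b \<noteq> 0"
    "\<And>p. p \<in> A \<Longrightarrow> \<exists>s x y. s \<in> S \<and> p = s + ev \<iota> (x *\<^sub>C a) + ev (- \<iota>) (y *\<^sub>C b)"
proof -
  define K where "K = C \<alpha>"
  have K: "csym K" using \<alpha> by (simp add: K_def csym_C)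
  have A1: "A \<in> Sigma_ext S (C \<alpha>)" and A2: "resolvent_set A = {}"
    using A by (auto simp: Xi_ext_def)
  note A' = Sigma_extD[OF K A1[folded K_def]]
  have Im: "Im \<iota> \<noteq> 0" "Im (- \<iota>) \<noteq> 0" and cnj: "cnj \<iota> = - \<iota>" using \<iota> by auto
  obtain a b where a: "a \<noteq> 0" "ev \<iota> a \<in> A" and b: "b \<noteq> 0" "ev (- \<iota>) b \<in> A"
    using Sigma_ext_resolvent[OF \<alpha> A1 Im(1)] Sigma_ext_resolvent[OF \<alpha> A1 Im(2)] A2 by blast
  have aN: "a \<in> N \<iota>" and bN: "b \<in> N (- \<iota>)"
    using a b A'(3) by (auto simp: mem_defect_iff)
  have ne: "\<iota> - cnj \<iota> \<noteq> 0" "- \<iota> - cnj (- \<iota>) \<noteq> 0"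
    using \<iota> by (auto simp: complex_eq_iff)
  \<comment> \<open>Neutrality of each eigenpair with itself. Neutrality of an arbitrary
    \<open>p\<close> with the two eigenpairs then confines the components of \<open>p\<close> to the
    lines of \<open>a\<close> and \<open>b\<close>.\<close>
  have aKa: "cinner a (K a) = 0" "cinner b (K b) = 0"
    using A'(4)[OF a(2) a(2)] A'(4)[OF b(2) b(2)] ne by (simp_all add: lift2_simps[OF K] bform_ev)
  have "\<exists>s x y. s \<in> S \<and> p = s + ev \<iota> (x *\<^sub>C a) + ev (- \<iota>) (y *\<^sub>C b)" if p: "p \<in> A" for p
  proof -
    obtain s f g where vN: "s \<in> S" "f \<in> N \<iota>" "g \<in> N (cnj \<iota>)" "p = s + ev \<iota> f + ev (cnj \<iota>) g"
      by (rule von_Neumann[OF Im(1)]) (use p A'(3) in auto)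
    note vN' = vN[unfolded cnj]
    have "bform p (ev \<iota> (K a)) = 0" "bform p (ev (- \<iota>) (K b)) = 0"
      using A'(4)[OF p a(2)] A'(4)[OF p b(2)] by (simp_all add: lift2_simps[OF K])
    then have "cinner f (K a) = 0" "cinner g (K b) = 0"
      using vN'(1) ev_in_adj[OF csym_defect[OF K aN]] ev_in_adj[OF csym_defect[OF K bN]] ne
      by (simp_all add: vN'(4) bform_simps bform_ev cnj)
    then obtain x y where "f = x *\<^sub>C a" "g = y *\<^sub>C b"
      using defect_multiple(1)[OF K aN a(1) aKa(1) Im(1) vN'(2)]
        defect_multiple(1)[OF K bN b(1) aKa(2) Im(2) vN'(3)] by blast
    with vN' show ?thesis by blast
  qed
  with aN bN a(1) b(1) aKa show ?thesis
    unfolding K_def by (intro that[of a b]) auto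
qed

lemma Xi_ext_subset_pairs:
  assumes \<alpha>: "norm \<alpha> = 1" and nonconst: "\<not> constant_defect" and A: "A \<in> Xi_ext S (C \<alpha>)"
  obtains \<beta> where "norm \<beta> = 1" "\<alpha> \<bullet> \<beta> = 0" "A \<in> Xi_pair S (C \<alpha>) (C \<beta>)"
proof -
  define K where "K = C \<alpha>"
  have K: "csym K" using \<alpha> by (simp add: K_def csym_C)
  have A1: "A \<in> Sigma_ext S (C \<alpha>)" and A2: "resolvent_set A = {}"
    using A by (auto simp: Xi_ext_def)
  note A' = Sigma_extD[OF K A1[folded K_def]]
  obtain \<iota> \<nu> f0 where \<iota>: "\<iota> = \<i> \<or> \<iota> = - \<i>" and sgn: "Im \<iota> * Im \<nu> > 0"
    and f0: "f0 \<in> N \<iota>" "\<And>g. g \<in> N \<nu> \<Longrightarrow> ev \<iota> f0 - ev \<nu> g \<notin> S"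
    using nonconst constant_defectI by blast
  have Im: "Im \<iota> \<noteq> 0" "Im \<nu> \<noteq> 0" using sgn by auto
  obtain a b where a: "a \<in> N \<iota>" "a \<noteq> 0" "cinner a (C \<alpha> a) = 0" and b: "b \<in> N (- \<iota>)" "b \<noteq> 0"
    and form: "\<And>p. p \<in> A \<Longrightarrow> \<exists>s x y. s \<in> S \<and> p = s + ev \<iota> (x *\<^sub>C a) + ev (- \<iota>) (y *\<^sub>C b)"
    by (rule Xi_ext_form[OF \<alpha> A \<iota>]) blast
  obtain \<beta> where \<beta>: "norm \<beta> = 1" "\<alpha> \<bullet> \<beta> = 0" "C (cross3 \<alpha> \<beta>) a = - a"
    by (rule eigen_symmetry_exists[OF \<alpha> a Im(1)])
  define G where "G = C (cross3 \<alpha> \<beta>)"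
  have G: "csym G"
    unfolding G_def by (rule csym_C[OF J_gamma(2)[OF \<alpha> \<beta>(1,2)]])
  obtain f where f: "f \<noteq> 0" "ev \<nu> f \<in> A"
    using Sigma_ext_resolvent[OF \<alpha> A1 Im(2)] A2 by blast
  then have fN: "f \<in> N \<nu>"
    using A'(3) by (auto simp: mem_defect_iff)
  have Ga: "G a = - a" using \<beta>(3) by (simp add: G_def)
  have Gb: "G b = - b"
    by (rule nonconstant_common_eigenspace[OF K G A'(1,2) a(1,2) a(3)[folded K_def] Ga b(1) form sgn f0 f fN])
  have sub: "A \<subseteq> A_ext S G"
  proof
    fix p assume p: "p \<in> A"
    then obtain s x y where s: "s \<in> S" "p = s + ev \<iota> (x *\<^sub>C a) + ev (- \<iota>) (y *\<^sub>C b)"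
      using form by blast
    have "lift2 G (ev \<mu> (x *\<^sub>C c)) = - ev \<mu> (x *\<^sub>C c)" if "G c = - c" for \<mu> x c
      by (simp add: prod_eq_iff csymD[OF G] csym_minus[OF G] that)
    then have "p + lift2 G p = s + lift2 G s"
      by (simp add: s(2) lift2_simps(1-4)[OF G] Ga Gb)
    then have "p + lift2 G p \<in> S"
      using s(1) lift2_S[OF G s(1)] by (simp add: csubspace_add[OF csubspace_S])
    then show "p \<in> A_ext S G"
      using p A'(3) by (auto simp: A_ext_eq[OF G])
  qed
  \<comment> \<open>Both extensions are their own complements for the form twisted by
    \<open>K\<close>, and such subspaces cannot be strictly nested.\<close>
  have "A_ext S G \<subseteq> A"
  proof
    fix q assume q: "q \<in> A_ext S G"
    have "A_ext S G \<in> Sigma_ext S K"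
      unfolding G_def K_def by (intro A_ext_in_Sigma csym_C \<alpha> J_gamma(2)[OF \<alpha> \<beta>(1,2)] C_anticommute J_gamma(3)[OF \<alpha> \<beta>(1,2)])
    then have "bform p (lift2 K q) = 0" if "p \<in> A" for p
      using Sigma_extD(4)[OF K _ _ q] sub that by blast
    then have "lift2 K (lift2 K q) \<in> A"
      by (rule A'(5))
    then show "q \<in> A"
      by (simp add: lift2_simps[OF K])
  qed
  with sub have "A = A_ext S G" by blast
  then show ?thesis
    using \<beta> by (intro that[of \<beta>]) (simp_all add: Xi_pair_eq[OF \<alpha> \<beta>(1,2)] G_def)
qed

lemma strict_inclusion_iff_constant_defect:
  assumes \<alpha>: "norm \<alpha> = 1"
  shows "(\<Union>\<beta>\<in>{\<beta> \<in> sphere 0 1. \<alpha> \<bullet> \<beta> = 0}. Xi_pair S (C \<alpha>) (C \<beta>)) \<subset> Xi_ext S (C \<alpha>) \<longleftrightarrow> constant_defect"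
    (is "?U \<subset> ?X \<longleftrightarrow> _")
proof
  assume strict: "?U \<subset> ?X"
  show constant_defect
  proof (rule ccontr)
    assume nonconst: "\<not> constant_defect"
    have "?X \<subseteq> ?U"
    proof
      fix A assume "A \<in> ?X"
      then obtain \<beta> where "norm \<beta> = 1" "\<alpha> \<bullet> \<beta> = 0" "A \<in> Xi_pair S (C \<alpha>) (C \<beta>)"
        using Xi_ext_subset_pairs[OF \<alpha> nonconst] by blast
      then show "A \<in> ?U" by auto
    qed
    with strict show False by blast
  qed
next
  assume constant_defect
  then have "\<exists>A\<in>?X. A \<notin> ?U"
    using extra_extension[OF _ \<alpha>] by fastforce
  moreover have "?U \<subseteq> ?X"
    using Xi_pair_subset_Xi[OF \<alpha>] by auto
  ultimately show "?U \<subset> ?X" by blast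
qed

end

section \<open>Completeness of $L_2$\<close>

lemma L2_cases [case_names rep]:
  obtains f where "square_integrable f" "u = abs_L2 f"
proof -
  have "L2_rel (rep_L2 u) (rep_L2 u)" "abs_L2 (rep_L2 u) = u"
    using Quotient_rep_reflp[OF Quotient_L2] Quotient_abs_rep[OF Quotient_L2] by blast+
  then show ?thesis
    using that[of "rep_L2 u"] by (simp add: L2_rel_def)
qed

lemma L2_rel_refl_iff: "L2_rel f f \<longleftrightarrow> square_integrable f"
  by (simp add: L2_rel_def)

lemma abs_L2_eq_iff:
  assumes "square_integrable f" "square_integrable g"
  shows "abs_L2 f = abs_L2 g \<longleftrightarrow> (AE x in lborel. f x = g x)"
proof -
  have "abs_L2 f = abs_L2 g \<longleftrightarrow> L2_rel f g"
    using Quotient_rel[OF Quotient_L2, of f g] assms by (simp add: L2_rel_refl_iff)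
  then show ?thesis
    using assms by (simp add: L2_rel_def)
qed

lemma abs_L2_ops:
  assumes "square_integrable f" "square_integrable g"
  shows "abs_L2 f + abs_L2 g = abs_L2 (\<lambda>x. f x + g x)"
    "abs_L2 f - abs_L2 g = abs_L2 (\<lambda>x. f x - g x)"
    "c *\<^sub>C abs_L2 f = abs_L2 (\<lambda>x. c *\<^sub>C f x)"
    "cinner (abs_L2 f) (abs_L2 g) = (\<integral>x. cinner (f x) (g x) \<partial>lborel)"
  using assms by (simp_all add: plus_L2.abs_eq minus_L2.abs_eq scaleC_L2.abs_eq cinner_L2.abs_eq L2_rel_refl_iff)

lemma norm_abs_L2:
  assumes "square_integrable f"
  shows "(norm (abs_L2 f))\<^sup>2 = (\<integral>x. (norm (f x))\<^sup>2 \<partial>lborel)"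
proof -
  have "complex_of_real ((norm (abs_L2 f))\<^sup>2) = of_real (\<integral>x. (norm (f x))\<^sup>2 \<partial>lborel)"
    unfolding cinner_self[symmetric] abs_L2_ops(4)[OF assms assms]
    unfolding cinner_self by (rule integral_complex_of_real)
  then show ?thesis
    using of_real_eq_iff by blast
qed

lemma nn_integral_norm_L2:
  assumes "square_integrable f"
  shows "(\<integral>\<^sup>+ x. ennreal ((norm (f x))\<^sup>2) \<partial>lborel) = ennreal ((norm (abs_L2 f))\<^sup>2)"
  unfolding norm_abs_L2[OF assms]
  using assms by (intro nn_integral_eq_integral) (auto simp: square_integrable_def)

lemma square_integrableI_nn_integral:
  assumes "f \<in> borel_measurable borel" "(\<integral>\<^sup>+ x. ennreal ((norm (f x))\<^sup>2) \<partial>lborel) < \<infinity>"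
  shows "square_integrable f"
  unfolding square_integrable_def
proof
  show "integrable lborel (\<lambda>x. (norm (f x))\<^sup>2)"
    using assms by (intro integrableI_nonneg) auto
qed (use assms in simp)

text \<open>The weights \<open>2\<^sup>k\<close> replace Minkowski's inequality in the usual proof.\<close>

lemma L2_AE_convergent:
  assumes f: "\<And>k. square_integrable (f k)"
    and small: "\<And>k. norm (abs_L2 (f (Suc k)) - abs_L2 (f k)) \<le> (1/2) ^ k"
  shows "AE x in lborel. convergent (\<lambda>k. f k x)"
proof -
  define h where "h k x = ennreal (2 ^ k * (norm (f (Suc k) x - f k x))\<^sup>2)" for k x
  have [measurable]: "f k \<in> borel_measurable borel" for k
    using f by (auto simp: square_integrable_def)
  \<comment> \<open>The squared norm decays like the fourth power series \<open>(1/4) ^ k\<close>,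
    so the weight \<open>2 ^ k\<close> leaves a convergent geometric series.\<close>
  have int: "(\<integral>\<^sup>+ x. h k x \<partial>lborel) \<le> ennreal ((1/2) ^ k)" for k
  proof -
    have sq: "square_integrable (\<lambda>x. f (Suc k) x - f k x)"
      by (intro square_integrable_diff f)
    have "(\<integral>\<^sup>+ x. h k x \<partial>lborel) = ennreal (2 ^ k) * (\<integral>\<^sup>+ x. ennreal ((norm (f (Suc k) x - f k x))\<^sup>2) \<partial>lborel)"
      unfolding h_def by (subst nn_integral_cmult[symmetric]) (simp_all add: ennreal_mult')
    also have "\<dots> = ennreal (2 ^ k * (norm (abs_L2 (f (Suc k)) - abs_L2 (f k)))\<^sup>2)"
      by (simp add: nn_integral_norm_L2[OF sq] abs_L2_ops f ennreal_mult')
    also have "\<dots> \<le> ennreal (2 ^ k * ((1/2) ^ k)\<^sup>2)"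
      by (intro ennreal_leI mult_left_mono power_mono small) auto
    also have "2 ^ k * ((1/2) ^ k)\<^sup>2 = (1/2 :: real) ^ k"
      by (simp add: power2_eq_square power_mult_distrib[symmetric] flip: mult.assoc)
    finally show ?thesis .
  qed
  have "(\<integral>\<^sup>+ x. (\<Sum>k. h k x) \<partial>lborel) = (\<Sum>k. \<integral>\<^sup>+ x. h k x \<partial>lborel)"
    by (intro nn_integral_suminf) (simp add: h_def)
  also have "\<dots> \<le> (\<Sum>k. ennreal ((1/2) ^ k))"
    by (intro suminf_le int summableI)
  also have "\<dots> = ennreal (\<Sum>k. (1/2) ^ k)"
    by (intro suminf_ennreal2) (auto intro: summable_geometric)
  also have "\<dots> < \<infinity>"
    by simp
  finally have "(\<integral>\<^sup>+ x. (\<Sum>k. h k x) \<partial>lborel) \<noteq> \<infinity>"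
    by simp
  then have "AE x in lborel. (\<Sum>k. h k x) \<noteq> \<infinity>"
    by (intro nn_integral_noteq_infinite) (simp_all add: h_def)
  then show ?thesis
  proof eventually_elim
    fix x assume fin: "(\<Sum>k. h k x) \<noteq> \<infinity>"
    then have "summable (\<lambda>k. 2 ^ k * (norm (f (Suc k) x - f k x))\<^sup>2)"
      unfolding h_def by (intro summable_suminf_not_top) auto
    \<comment> \<open>Bounded weighted terms give increments of size at most
      \<open>sqrt B * (1 / sqrt 2) ^ k\<close>, which are summable.\<close>
    then have "bounded (range (\<lambda>k. 2 ^ k * (norm (f (Suc k) x - f k x))\<^sup>2))"
      using summable_LIMSEQ_zero convergent_imp_bounded convergentI by blast
    then obtain B where B: "\<And>k. 2 ^ k * (norm (f (Suc k) x - f k x))\<^sup>2 \<le> B"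
      by (force simp: bounded_iff)
    have le: "norm (f (Suc k) x - f k x) \<le> sqrt B * (1 / sqrt 2) ^ k" for k
    proof -
      have "(norm (f (Suc k) x - f k x))\<^sup>2 \<le> B / 2 ^ k"
        using B[of k] by (simp add: field_simps)
      then have "norm (f (Suc k) x - f k x) \<le> sqrt (B / 2 ^ k)"
        by (rule real_le_rsqrt)
      then show ?thesis
        by (simp add: real_sqrt_divide real_sqrt_power power_one_over)
    qed
    have "1 / sqrt 2 < (1 :: real)"
      by simp
    then have "summable (\<lambda>k. sqrt B * (1 / sqrt 2) ^ k)"
      by (intro summable_mult summable_geometric) simp
    then have "summable (\<lambda>k. f (Suc k) x - f k x)"
      by (rule summable_comparison_test'[of _ 0]) (rule le)
    then show "convergent (\<lambda>k. f k x)"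
      by (simp add: summable_iff_convergent sum_lessThan_telescope[of "\<lambda>k. f k x"] convergent_diff_const_right_iff)
  qed
qed

instance L2 :: complete_space
proof
  fix X :: "nat \<Rightarrow> L2" assume X: "Cauchy X"
  have "\<exists>N. \<forall>m\<ge>N. \<forall>n\<ge>N. dist (X m) (X n) < (1/2) ^ k" for k
    using metric_CauchyD[OF X, of "(1/2) ^ k"] by simp
  then obtain N where N: "\<And>k m n. m \<ge> N k \<Longrightarrow> n \<ge> N k \<Longrightarrow> dist (X m) (X n) < (1/2) ^ k"
    by metis
  \<comment> \<open>The summand \<open>k\<close> makes the index strictly increasing, and the sum
    dominates every threshold up to \<open>k\<close>.\<close>
  define r where "r k = k + (\<Sum>j\<le>k. N j)" for k
  have "strict_mono r"
    by (rule strict_mono_Suc_iff[THEN iffD2]) (simp add: r_def)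
  have rN: "r j \<ge> N k" if "j \<ge> k" for j k
  proof -
    have "N k \<le> (\<Sum>i\<le>j. N i)"
      using that by (intro member_le_sum) auto
    then show ?thesis by (simp add: r_def)
  qed
  have close: "norm (X (r i) - X (r j)) \<le> (1/2) ^ k" if "i \<ge> k" "j \<ge> k" for i j k
    using N[OF rN[OF that(1)] rN[OF that(2)]] by (simp add: dist_norm)
  have "\<exists>g. square_integrable g \<and> X (r k) = abs_L2 g" for k
    by (rule L2_cases[of "X (r k)"]) blast
  then obtain f where f: "\<And>k. square_integrable (f k)" "\<And>k. X (r k) = abs_L2 (f k)"
    by metis
  have [measurable]: "f k \<in> borel_measurable borel" for k
    using f by (auto simp: square_integrable_def)
  define g where "g x = lim (\<lambda>k. f k x)" for x
  have [measurable]: "g \<in> borel_measurable borel"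
    unfolding g_def by (rule borel_measurable_lim_metric) measurable
  have "AE x in lborel. convergent (\<lambda>k. f k x)"
    using close[of _ "Suc _" _] by (intro L2_AE_convergent f) (simp add: f(2)[symmetric])
  then have lim: "AE x in lborel. (\<lambda>k. f k x) \<longlonglongrightarrow> g x"
    by eventually_elim (simp add: g_def convergent_LIMSEQ_iff)
  \<comment> \<open>One application of Fatou's lemma serves twice: it shows that the limit is square
    integrable and that the subsequence converges to it in norm.\<close>
  have fatou: "(\<integral>\<^sup>+ x. ennreal ((norm (g x - f k x))\<^sup>2) \<partial>lborel) \<le> ennreal (((1/2) ^ k)\<^sup>2)" for k
  proof -
    have "(\<integral>\<^sup>+ x. ennreal ((norm (g x - f k x))\<^sup>2) \<partial>lborel)
        = (\<integral>\<^sup>+ x. liminf (\<lambda>j. ennreal ((norm (f j x - f k x))\<^sup>2)) \<partial>lborel)"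
      using lim
    proof (intro nn_integral_cong_AE, eventually_elim)
      fix x assume "(\<lambda>k. f k x) \<longlonglongrightarrow> g x"
      then have "(\<lambda>j. ennreal ((norm (f j x - f k x))\<^sup>2)) \<longlonglongrightarrow> ennreal ((norm (g x - f k x))\<^sup>2)"
        by (intro tendsto_ennrealI tendsto_intros)
      then show "ennreal ((norm (g x - f k x))\<^sup>2) = liminf (\<lambda>j. ennreal ((norm (f j x - f k x))\<^sup>2))"
        by (rule lim_imp_Liminf[OF sequentially_bot, symmetric])
    qed
    also have "\<dots> \<le> liminf (\<lambda>j. \<integral>\<^sup>+ x. ennreal ((norm (f j x - f k x))\<^sup>2) \<partial>lborel)"
      by (rule nn_integral_liminf) measurable
    also have "\<dots> \<le> liminf (\<lambda>j :: nat. ennreal (((1/2) ^ k)\<^sup>2))"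
    proof (rule Liminf_mono, rule eventually_sequentiallyI)
      fix j assume "k \<le> j"
      then have "norm (abs_L2 (\<lambda>x. f j x - f k x)) \<le> (1/2) ^ k"
        using close[of k j k] by (simp add: f abs_L2_ops)
      then show "(\<integral>\<^sup>+ x. ennreal ((norm (f j x - f k x))\<^sup>2) \<partial>lborel) \<le> ennreal (((1/2) ^ k)\<^sup>2)"
        by (subst nn_integral_norm_L2) (auto intro!: square_integrable_diff f ennreal_leI power_mono)
    qed
    also have "\<dots> = ennreal (((1/2) ^ k)\<^sup>2)"
      by (rule Liminf_const) simp
    finally show ?thesis .
  qed
  have gf: "square_integrable (\<lambda>x. g x - f k x)" for k
    by (rule square_integrableI_nn_integral) (use fatou[of k] in \<open>auto intro: le_less_trans\<close>)
  have g: "square_integrable g"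
    using square_integrable_add[OF gf[of 0] f(1)[of 0]] by simp
  have le: "norm (X (r k) - abs_L2 g) \<le> (1/2) ^ k" for k
  proof -
    have "ennreal ((norm (abs_L2 (\<lambda>x. g x - f k x)))\<^sup>2) \<le> ennreal (((1/2) ^ k)\<^sup>2)"
      using fatou[of k] by (simp only: nn_integral_norm_L2[OF gf])
    then have "(norm (abs_L2 g - abs_L2 (f k)))\<^sup>2 \<le> ((1/2) ^ k)\<^sup>2"
      by (subst (asm) ennreal_le_iff) (simp_all add: abs_L2_ops f g)
    then have "norm (abs_L2 g - abs_L2 (f k)) \<le> (1/2) ^ k"
      by (rule power2_le_imp_le) simp
    then show ?thesis
      by (simp add: f(2) norm_minus_commute)
  qed
  have "(\<lambda>k. (1/2 :: real) ^ k) \<longlonglongrightarrow> 0"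
    by (rule LIMSEQ_power_zero) simp
  then have "(\<lambda>k. X (r k) - abs_L2 g) \<longlonglongrightarrow> 0"
    by (rule Lim_null_comparison[OF always_eventually[OF allI[OF le]]])
  then have "(X \<circ> r) \<longlonglongrightarrow> abs_L2 g"
    by (simp add: LIM_zero_iff o_def)
  then have "X \<longlonglongrightarrow> abs_L2 g"
    by (rule Cauchy_converges_subseq[OF X \<open>strict_mono r\<close>])
  then show "convergent X"
    by (rule convergentI)
qed

instance L2 :: chilbert_space ..

section \<open>Integrals on the real line\<close>

text \<open>The positive and negative parts of \<open>f\<close> are densities of finite measures
  that agree on all half-lines; half-lines determine the measures, and these determine their
  densities almost everywhere.\<close>

lemma AE_eq_0_if_tail_integrals_real:
  fixes f :: "real \<Rightarrow> real"
  assumes f: "integrable lborel f" and tail: "\<And>a. (\<integral>x. indicator {a<..} x * f x \<partial>lborel) = 0"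
  shows "AE x in lborel. f x = 0"
proof -
  have [measurable]: "f \<in> borel_measurable borel"
    using f by auto
  define p n where "p x = max 0 (f x)" and "n x = max 0 (- f x)" for x
  have int: "integrable lborel p" "integrable lborel n"
    unfolding p_def n_def using f by (intro integrable_max; simp)+
  have [measurable]: "p \<in> borel_measurable borel" "n \<in> borel_measurable borel"
    using int by auto
  have ind: "integrable lborel (\<lambda>x. indicator {a<..} x * g x)" if "integrable lborel g" for g :: "real \<Rightarrow> real" and a
    using integrable_mult_indicator[OF _ that, of "{a<..}"] by simp
  have em: "emeasure (density lborel (\<lambda>x. ennreal (g x))) {a<..} = ennreal (\<integral>x. indicator {a<..} x * g x \<partial>lborel)"
    if "integrable lborel g" "\<And>x. g x \<ge> 0" for g :: "real \<Rightarrow> real" and a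
  proof -
    have [measurable]: "g \<in> borel_measurable borel" using that by auto
    have "emeasure (density lborel (\<lambda>x. ennreal (g x))) {a<..} = (\<integral>\<^sup>+ x. ennreal (indicator {a<..} x * g x) \<partial>lborel)"
      by (auto simp: emeasure_density intro!: nn_integral_cong split: split_indicator)
    also have "\<dots> = ennreal (\<integral>x. indicator {a<..} x * g x \<partial>lborel)"
      using that by (intro nn_integral_eq_integral ind) auto
    finally show ?thesis .
  qed
  have eq: "(\<integral>x. indicator {a<..} x * p x \<partial>lborel) = (\<integral>x. indicator {a<..} x * n x \<partial>lborel)" for a
  proof -
    have "(\<integral>x. indicator {a<..} x * p x \<partial>lborel) - (\<integral>x. indicator {a<..} x * n x \<partial>lborel)
        = (\<integral>x. indicator {a<..} x * p x - indicator {a<..} x * n x \<partial>lborel)"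
      by (intro Bochner_Integration.integral_diff[symmetric] ind int)
    also have "\<dots> = (\<integral>x. indicator {a<..} x * f x \<partial>lborel)"
      by (intro Bochner_Integration.integral_cong) (auto simp: p_def n_def split: split_indicator)
    finally show ?thesis by (simp add: tail)
  qed
  have "density lborel (\<lambda>x. ennreal (p x)) = density lborel (\<lambda>x. ennreal (n x))"
  proof (rule measure_eqI_lessThan)
    show "emeasure (density lborel (\<lambda>x. ennreal (p x))) {x<..} < \<infinity>" for x
      using em[OF int(1)] by (simp add: p_def)
    show "emeasure (density lborel (\<lambda>x. ennreal (p x))) {x<..} = emeasure (density lborel (\<lambda>x. ennreal (n x))) {x<..}" for x
      using em[OF int(1)] em[OF int(2)] eq by (simp add: p_def n_def)
  qed simp_all
  then have "AE x in lborel. ennreal (p x) = ennreal (n x)"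
    by (intro sigma_finite_measure.density_unique[OF sigma_finite_lborel]) auto
  then show ?thesis
    by eventually_elim (auto simp: p_def n_def max_def split: if_splits)
qed

section \<open>Injectivity of the Laplace transform\<close>

lemma AE_eq_0_if_tail_integrals:
  fixes f :: "real \<Rightarrow> complex"
  assumes f: "integrable lborel f" and tail: "\<And>a. (\<integral>x. indicator {a<..} x *\<^sub>R f x \<partial>lborel) = 0"
  shows "AE x in lborel. f x = 0"
proof -
  have ind: "integrable lborel (\<lambda>x. indicator {a<..} x *\<^sub>R f x)" for a
    by (rule integrable_mult_indicator[OF _ f]) simp
  have "AE x in lborel. Re (f x) = 0"
  proof (rule AE_eq_0_if_tail_integrals_real)
    show "(\<integral>x. indicator {a<..} x * Re (f x) \<partial>lborel) = 0" for a
      using integral_Re[OF ind[of a]] tail[of a] by simp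
  qed (use f in auto)
  moreover have "AE x in lborel. Im (f x) = 0"
  proof (rule AE_eq_0_if_tail_integrals_real)
    show "(\<integral>x. indicator {a<..} x * Im (f x) \<partial>lborel) = 0" for a
      using integral_Im[OF ind[of a]] tail[of a] by simp
  qed (use f in auto)
  ultimately show ?thesis
    by eventually_elim (simp add: complex_eq_iff)
qed

text \<open>The polynomials \<open>(1 - t\<^sup>n)\<^sup>N\<close> with \<open>N = \<lceil>\<theta>\<^sup>n\<rceil>\<close> converge on \<open>[0, 1]\<close> to the indicator function of
  \<open>[0, 1/\<theta>)\<close>, boundedly and away from \<open>1/\<theta>\<close>.\<close>

lemma step_polynomials_tendsto:
  fixes t \<theta> :: real
  assumes t: "0 < t" "t < 1" and \<theta>: "\<theta> > 1" and ne: "t * \<theta> \<noteq> 1"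
  shows "(\<lambda>n. (1 - t ^ n) ^ nat \<lceil>\<theta> ^ n\<rceil>) \<longlonglongrightarrow> (if t * \<theta> < 1 then 1 else 0)"
proof -
  define N where "N n = nat \<lceil>\<theta> ^ n\<rceil>" for n
  have "\<theta> ^ n > 0" for n using \<theta> by simp
  then have N: "\<theta> ^ n \<le> real (N n)" "real (N n) \<le> \<theta> ^ n + 1" for n
    using le_of_int_ceiling[of "\<theta> ^ n"] of_int_ceiling_le_add_one[of "\<theta> ^ n"]
    by (simp_all add: N_def zero_le_ceiling order.strict_implies_order less_imp_le le_less_trans[OF _ \<open>\<theta> ^ n > 0\<close>, of "-1"])
  have tn: "0 < t ^ n" "t ^ n \<le> 1" for n
    using t by (auto intro: power_le_one)
  show ?thesis
  proof (cases "t * \<theta> < 1")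
    case True
    have "(\<lambda>n. 1 - ((t * \<theta>) ^ n + t ^ n)) \<longlonglongrightarrow> 1 - (0 + 0)"
      using t \<theta> True by (intro tendsto_intros LIMSEQ_power_zero) auto
    then have lim: "(\<lambda>n. 1 - ((t * \<theta>) ^ n + t ^ n)) \<longlonglongrightarrow> 1" by simp
    have "(\<lambda>n. (1 - t ^ n) ^ N n) \<longlonglongrightarrow> 1"
    proof (rule tendsto_sandwich[OF _ _ lim tendsto_const])
      show "\<forall>\<^sub>F n in sequentially. 1 - ((t * \<theta>) ^ n + t ^ n) \<le> (1 - t ^ n) ^ N n"
      proof (intro always_eventually allI)
        fix n
        \<comment> \<open>Bernoulli's inequality bounds the loss by \<open>N n * t ^ n\<close>;
          rounding \<open>\<theta> ^ n\<close> up costs at most one further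
          \<open>t ^ n\<close>.\<close>
        have "real (N n) * t ^ n \<le> (\<theta> ^ n + 1) * t ^ n"
          using N(2)[of n] tn(1)[of n] by (intro mult_right_mono) auto
        then have "1 - ((t * \<theta>) ^ n + t ^ n) \<le> 1 + real (N n) * (- (t ^ n))"
          by (simp add: algebra_simps power_mult_distrib)
        also have "\<dots> \<le> (1 + - (t ^ n)) ^ N n"
          using tn(2)[of n] by (intro Bernoulli_inequality) simp
        finally show "1 - ((t * \<theta>) ^ n + t ^ n) \<le> (1 - t ^ n) ^ N n" by simp
      qed
      show "\<forall>\<^sub>F n in sequentially. (1 - t ^ n) ^ N n \<le> 1"
        using tn by (intro always_eventually allI power_le_one) (auto simp: less_imp_le)
    qed
    with True show ?thesis by (simp add: N_def)
  next
    case False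
    then have gt: "t * \<theta> > 1" using ne by simp
    have lim: "(\<lambda>n. (1 / (t * \<theta>)) ^ n) \<longlonglongrightarrow> 0"
      using gt by (intro LIMSEQ_power_zero) simp
    have "(\<lambda>n. (1 - t ^ n) ^ N n) \<longlonglongrightarrow> 0"
    proof (rule tendsto_sandwich[OF _ _ tendsto_const lim])
      show "\<forall>\<^sub>F n in sequentially. 0 \<le> (1 - t ^ n) ^ N n"
        using tn by (intro always_eventually allI zero_le_power) auto
      show "\<forall>\<^sub>F n in sequentially. (1 - t ^ n) ^ N n \<le> (1 / (t * \<theta>)) ^ n"
      proof (intro always_eventually allI)
        fix n
        have pos: "(t * \<theta>) ^ n > 0" using gt by simp
        have "(1 - t ^ n) ^ N n \<le> exp (- (t ^ n)) ^ N n"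
          using tn(2)[of n] exp_ge_add_one_self[of "- (t ^ n)"] by (intro power_mono) auto
        also have "\<dots> = exp (- (real (N n) * t ^ n))"
          by (simp add: exp_of_nat_mult[symmetric])
        also have "\<dots> \<le> exp (- ((t * \<theta>) ^ n))"
          using N(1)[of n] tn(1)[of n] by (simp add: power_mult_distrib mult.commute)
        also have "\<dots> = inverse (exp ((t * \<theta>) ^ n))"
          by (rule exp_minus)
        also have "\<dots> \<le> inverse ((t * \<theta>) ^ n)"
        proof (rule le_imp_inverse_le[OF _ pos])
          show "(t * \<theta>) ^ n \<le> exp ((t * \<theta>) ^ n)"
            using exp_ge_add_one_self[of "(t * \<theta>) ^ n"] by linarith
        qed
        also have "\<dots> = (1 / (t * \<theta>)) ^ n"
          by (simp add: power_one_over inverse_eq_divide)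
        finally show "(1 - t ^ n) ^ N n \<le> (1 / (t * \<theta>)) ^ n" .
      qed
    qed
    with False show ?thesis by (simp add: N_def)
  qed
qed

text \<open>With t = exp (\<sigma> x), which is in (0, 1) on the support of \<open>m\<close>, the
  hypothesis says that all moments vanish, hence all integrals against polynomials in t. Dominated
  convergence along the step polynomials carries this to an indicator function.\<close>

lemma laplace_transform_step:
  fixes m :: "real \<Rightarrow> complex" and \<sigma> \<theta> :: real
  assumes m: "integrable lborel m" and supp: "\<And>x. \<sigma> * x \<ge> 0 \<Longrightarrow> m x = 0" and \<sigma>: "\<sigma> = 1 \<or> \<sigma> = -1"
    and zero: "\<And>j::nat. (\<integral>x. m x * of_real (exp (\<sigma> * x) ^ j) \<partial>lborel) = 0" and \<theta>: "\<theta> > 1"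
  shows "(\<integral>x. indicator {x. exp (\<sigma> * x) * \<theta> < 1} x *\<^sub>R m x \<partial>lborel) = 0"
proof -
  have [measurable]: "m \<in> borel_measurable borel"
    using m by auto
  have exp_le: "0 < exp (\<sigma> * x)" "exp (\<sigma> * x) < 1" if "m x \<noteq> 0" for x
  proof -
    have "\<sigma> * x < 0"
      using supp[of x] that by (meson not_le)
    then show "0 < exp (\<sigma> * x)" "exp (\<sigma> * x) < 1" by simp_all
  qed
  have int: "integrable lborel (\<lambda>x. m x * of_real (exp (\<sigma> * x) ^ j))" for j
  proof (rule Bochner_Integration.integrable_bound[OF m])
    show "AE x in lborel. norm (m x * of_real (exp (\<sigma> * x) ^ j)) \<le> norm (m x)"
    proof (intro AE_I2)
      fix x show "norm (m x * of_real (exp (\<sigma> * x) ^ j)) \<le> norm (m x)"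
        using exp_le[of x] by (cases "m x = 0") (auto simp: norm_mult norm_power intro!: mult_left_le power_le_one)
    qed
  qed simp
  have poly0: "(\<integral>x. m x * of_real (poly p (exp (\<sigma> * x))) \<partial>lborel) = 0" for p :: "real poly"
  proof -
    have "(\<integral>x. m x * of_real (poly p (exp (\<sigma> * x))) \<partial>lborel)
        = (\<integral>x. (\<Sum>i\<le>degree p. of_real (coeff p i) * (m x * of_real (exp (\<sigma> * x) ^ i))) \<partial>lborel)"
      by (intro Bochner_Integration.integral_cong) (simp_all add: poly_altdef sum_distrib_left mult_ac)
    also have "\<dots> = (\<Sum>i\<le>degree p. of_real (coeff p i) * (\<integral>x. m x * of_real (exp (\<sigma> * x) ^ i) \<partial>lborel))"
      by (subst Bochner_Integration.integral_sum) (auto intro!: integrable_mult_right int[unfolded of_real_power] sum.cong integral_mult_right_zero)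
    finally show ?thesis
      unfolding zero by simp
  qed
  define q where "q n = (1 - monom 1 n :: real poly) ^ nat \<lceil>\<theta> ^ n\<rceil>" for n
  have q: "poly (q n) t = (1 - t ^ n) ^ nat \<lceil>\<theta> ^ n\<rceil>" for n t
    by (simp add: q_def poly_power poly_monom)
  have [measurable]: "(\<lambda>x. poly (q n) (exp (\<sigma> * x))) \<in> borel_measurable borel" for n
    unfolding q by measurable
  have "(\<lambda>n. \<integral>x. m x * of_real (poly (q n) (exp (\<sigma> * x))) \<partial>lborel)
      \<longlonglongrightarrow> (\<integral>x. indicator {x. exp (\<sigma> * x) * \<theta> < 1} x *\<^sub>R m x \<partial>lborel)"
  proof (rule integral_dominated_convergence[where w = "\<lambda>x. norm (m x)"])
    show "integrable lborel (\<lambda>x. norm (m x))"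
      using m by simp
    \<comment> \<open>The only point with \<open>exp (\<sigma> * x) * \<theta> = 1\<close>, the jump
      of the step; as \<sigma> is 1 or -1, it is its own inverse.\<close>
    have "AE x in lborel. x \<noteq> - \<sigma> * ln \<theta>"
      by (rule AE_lborel_singleton)
    then show "AE x in lborel. (\<lambda>n. m x * of_real (poly (q n) (exp (\<sigma> * x))))
        \<longlonglongrightarrow> indicator {x. exp (\<sigma> * x) * \<theta> < 1} x *\<^sub>R m x"
    proof eventually_elim
      fix x assume x: "x \<noteq> - \<sigma> * ln \<theta>"
      show "(\<lambda>n. m x * of_real (poly (q n) (exp (\<sigma> * x)))) \<longlonglongrightarrow> indicator {x. exp (\<sigma> * x) * \<theta> < 1} x *\<^sub>R m x"
      proof (cases "m x = 0")
        case False
        have "exp (\<sigma> * x) * \<theta> \<noteq> 1"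
        proof
          assume "exp (\<sigma> * x) * \<theta> = 1"
          then have "ln (exp (\<sigma> * x) * \<theta>) = 0" by simp
          then have "\<sigma> * x = - ln \<theta>"
            using \<theta> by (simp add: ln_mult)
          then have "x = - \<sigma> * ln \<theta>"
            using \<sigma> by auto
          with x show False ..
        qed
        then have "(\<lambda>n. poly (q n) (exp (\<sigma> * x))) \<longlonglongrightarrow> (if exp (\<sigma> * x) * \<theta> < 1 then 1 else 0)"
          unfolding q using step_polynomials_tendsto exp_le[OF False] \<theta> by blast
        then have "(\<lambda>n. m x * of_real (poly (q n) (exp (\<sigma> * x))))
            \<longlonglongrightarrow> m x * of_real (if exp (\<sigma> * x) * \<theta> < 1 then 1 else 0)"
          by (intro tendsto_mult tendsto_const tendsto_of_real)
        then show ?thesis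
          by (cases "exp (\<sigma> * x) * \<theta> < 1") simp_all
      qed simp
    qed
    show "AE x in lborel. norm (m x * of_real (poly (q n) (exp (\<sigma> * x)))) \<le> norm (m x)" for n
    proof (intro AE_I2)
      fix x show "norm (m x * of_real (poly (q n) (exp (\<sigma> * x)))) \<le> norm (m x)"
      proof (cases "m x = 0")
        case False
        have "0 \<le> 1 - exp (\<sigma> * x) ^ n" "1 - exp (\<sigma> * x) ^ n \<le> 1"
          using exp_le[OF False] by (simp_all add: power_le_one)
        then have "0 \<le> poly (q n) (exp (\<sigma> * x))" "poly (q n) (exp (\<sigma> * x)) \<le> 1"
          unfolding q by (auto intro: power_le_one)
        then show ?thesis
          by (simp add: norm_mult mult_left_le)
      qed simp
    qed
  qed measurable
  then show ?thesis
    by (simp add: poly0 LIMSEQ_const_iff)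
qed

text \<open>Suitable \<theta> turn the step result into integrals over half-lines inside the
  support, and the moment of order 0 is the total integral; together they settle every half-line
  \<open>{a<..}\<close>.\<close>

lemma laplace_transform_unique:
  fixes m :: "real \<Rightarrow> complex" and \<sigma> :: real
  assumes m: "integrable lborel m" and supp: "\<And>x. \<sigma> * x \<ge> 0 \<Longrightarrow> m x = 0" and \<sigma>: "\<sigma> = 1 \<or> \<sigma> = -1"
    and zero: "\<And>j::nat. (\<integral>x. m x * of_real (exp (\<sigma> * x) ^ j) \<partial>lborel) = 0"
  shows "AE x in lborel. m x = 0"
proof (rule AE_eq_0_if_tail_integrals[OF m])
  note step = laplace_transform_step[OF m supp \<sigma> zero]
  have [measurable]: "m \<in> borel_measurable borel"
    using m by auto
  have total: "(\<integral>x. m x \<partial>lborel) = 0"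
    using zero[of 0] by simp
  fix a :: real
  show "(\<integral>x. indicator {a<..} x *\<^sub>R m x \<partial>lborel) = 0"
    using \<sigma>
  proof
    assume \<sigma>: "\<sigma> = 1"
    show ?thesis
    proof (cases "a < 0")
      case True
      have set: "{x. exp (\<sigma> * x) * exp (- a) < 1} = {..<a}"
        by (auto simp: \<sigma> exp_add[symmetric])
      have *: "(\<integral>x. indicator {..<a} x *\<^sub>R m x \<partial>lborel) = 0"
        using step[of "exp (- a)"] True unfolding set by simp
      have "(\<integral>x. indicator {a<..} x *\<^sub>R m x \<partial>lborel) = (\<integral>x. m x - indicator {..<a} x *\<^sub>R m x \<partial>lborel)"
      proof (rule integral_cong_AE)
        have "AE x in lborel. x \<noteq> a"
          by (rule AE_lborel_singleton)
        then show "AE x in lborel. indicator {a<..} x *\<^sub>R m x = m x - indicator {..<a} x *\<^sub>R m x"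
          by eventually_elim (auto split: split_indicator)
      qed measurable
      also have "\<dots> = 0"
        using integrable_mult_indicator[OF _ m, of "{..<a}"] by (simp add: m total *)
      finally show ?thesis .
    next
      case False
      then have "(\<lambda>x. indicator {a<..} x *\<^sub>R m x) = (\<lambda>_. 0)"
        using supp by (auto simp: \<sigma> fun_eq_iff split: split_indicator)
      then show ?thesis by (simp only: Bochner_Integration.integral_zero)
    qed
  next
    assume \<sigma>: "\<sigma> = -1"
    show ?thesis
    proof (cases "a > 0")
      case True
      have set: "{x. exp (\<sigma> * x) * exp a < 1} = {a<..}"
        by (auto simp: \<sigma> exp_add[symmetric])
      show ?thesis
        using step[of "exp a"] True unfolding set by simp
    next
      case False
      then have "indicator {a<..} x *\<^sub>R m x = m x" for x
        using supp[of x] by (auto simp: \<sigma> split: split_indicator)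
      then show ?thesis by (simp add: total)
    qed
  qed
qed

section \<open>Exponentials on half-lines\<close>

lemma integrable_exp_abs:
  assumes "\<delta> > 0"
  shows "integrable lborel (\<lambda>x. exp (- \<delta> * \<bar>x\<bar>) :: real)"
proof -
  have "(\<lambda>x. exp (- \<delta> * x)) absolutely_integrable_on {0..}"
    using integrable_on_exp_minus_to_infinity[OF assms, of 0]
    by (intro nonnegative_absolutely_integrable_1) auto
  then have "integrable lebesgue (\<lambda>x. indicator {0..} x *\<^sub>R exp (- \<delta> * x))"
    by (simp add: set_integrable_def)
  then have int: "integrable lborel (\<lambda>x. indicator {0..} x *\<^sub>R exp (- \<delta> * x))"
    by (subst (asm) integrable_completion) auto
  then have int': "integrable lborel (\<lambda>x. indicator {0..} (- x) *\<^sub>R exp (- \<delta> * (- x)))"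
    using lborel_integrable_real_affine_iff[of "-1" "\<lambda>x. indicator {0..} x *\<^sub>R exp (- \<delta> * x)" 0] by simp
  show ?thesis
    by (rule Bochner_Integration.integrable_bound[OF Bochner_Integration.integrable_add[OF int int']])
      (auto simp: abs_if split: split_indicator)
qed

lemma integral_Iio_FTC:
  fixes F f :: "real \<Rightarrow> complex"
  assumes F: "\<And>x. (F has_vector_derivative f x) (at x)" and f: "\<And>x. isCont f x"
    and int: "integrable lborel (\<lambda>x. indicator {..<t} x *\<^sub>R f x)" and lim: "(F \<longlongrightarrow> 0) at_bot"
  shows "(\<integral>x. indicator {..<t} x *\<^sub>R f x \<partial>lborel) = F t"
proof -
  have "isCont F t"
    using F has_vector_derivative_continuous by blast
  then have left: "(F \<longlongrightarrow> F t) (at_left t)"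
    by (simp add: continuous_within filterlim_at_split)
  have set: "einterval (-\<infinity>) (ereal t) = {..<t}"
    by (auto simp: einterval_def)
  have "(LBINT x=-\<infinity>..ereal t. f x) = F t - 0"
    using int lim left
    by (intro interval_integral_FTC_integrable) (auto simp: ereal_tendsto_simps set set_integrable_def intro: F f)
  then show ?thesis
    by (simp add: interval_lebesgue_integral_def set set_lebesgue_integral_def)
qed

lemma integral_Ioi_FTC:
  fixes F f :: "real \<Rightarrow> complex"
  assumes F: "\<And>x. (F has_vector_derivative f x) (at x)" and f: "\<And>x. isCont f x"
    and int: "integrable lborel (\<lambda>x. indicator {t<..} x *\<^sub>R f x)" and lim: "(F \<longlongrightarrow> 0) at_top"
  shows "(\<integral>x. indicator {t<..} x *\<^sub>R f x \<partial>lborel) = - F t"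
proof -
  have "isCont F t"
    using F has_vector_derivative_continuous by blast
  then have right: "(F \<longlongrightarrow> F t) (at_right t)"
    by (simp add: continuous_within filterlim_at_split)
  have set: "einterval (ereal t) \<infinity> = {t<..}"
    by (auto simp: einterval_def)
  have "(LBINT x=ereal t..\<infinity>. f x) = 0 - F t"
    using int lim right
    by (intro interval_integral_FTC_integrable) (auto simp: ereal_tendsto_simps set set_integrable_def intro: F f)
  then show ?thesis
    by (simp add: interval_lebesgue_integral_def set set_lebesgue_integral_def)
qed

text \<open>The solution of \<i> u' = \<mu> u on the half-line where it decays. Its jump at 0 is
  invisible to functions that vanish there.\<close>

definition half_exp :: "complex \<Rightarrow> real \<Rightarrow> complex"
  where "half_exp \<mu> x = (if Im \<mu> * x < 0 then exp (- \<i> * \<mu> * of_real x) else 0)"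

lemma half_exp_measurable [measurable]: "half_exp \<mu> \<in> borel_measurable borel"
  unfolding half_exp_def by measurable

lemma norm_half_exp_le: "cmod (half_exp \<mu> x) \<le> exp (- \<bar>Im \<mu>\<bar> * \<bar>x\<bar>)"
  by (auto simp: half_exp_def mult_less_0_iff abs_if)

text \<open>The product is again of the same kind, with imaginary part Im \<mu> + Im \<nu>, so a
  single integral computes all inner products of the family.\<close>

lemma half_exp_mult:
  assumes "Im \<mu> * Im \<nu> > 0"
  shows "half_exp \<mu> x * cnj (half_exp \<nu> x) = half_exp (\<mu> - cnj \<nu>) x"
proof -
  have "Im \<mu> * x < 0 \<longleftrightarrow> Im \<nu> * x < 0" "Im \<mu> * x < 0 \<longleftrightarrow> (Im \<mu> + Im \<nu>) * x < 0"
    using assms by (auto simp: zero_less_mult_iff mult_less_0_iff)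
  then show ?thesis
    by (simp add: half_exp_def exp_cnj exp_add[symmetric] algebra_simps)
qed

lemma half_exp_mult_opposite: "Im \<mu> * Im \<nu> \<le> 0 \<Longrightarrow> half_exp \<mu> x * cnj (half_exp \<nu> x) = 0"
  by (auto simp: half_exp_def zero_less_mult_iff mult_less_0_iff mult_le_0_iff)

lemma integrable_half_exp: "Im \<mu> \<noteq> 0 \<Longrightarrow> integrable lborel (half_exp \<mu>)"
  by (rule Bochner_Integration.integrable_bound[OF integrable_exp_abs[of "\<bar>Im \<mu>\<bar>"]])
    (use norm_half_exp_le in auto)

lemma exp_has_vector_derivative:
  assumes "\<mu> \<noteq> 0"
  shows "((\<lambda>x. (\<i> / \<mu>) * exp (- \<i> * \<mu> * of_real x)) has_vector_derivative exp (- \<i> * \<mu> * of_real x)) (at x)"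
proof -
  have "((\<lambda>z. (\<i> / \<mu>) * exp (- \<i> * \<mu> * z)) has_field_derivative exp (- \<i> * \<mu> * of_real x)) (at (of_real x))"
    by (rule derivative_eq_intros refl | use assms in simp)+
  then show ?thesis
    using has_vector_derivative_real_field by (simp add: o_def)
qed

lemma norm_exp_line: "norm (exp (- \<i> * \<mu> * of_real x)) = exp (Im \<mu> * x)"
  by simp

lemma tail_integral_half_exp:
  assumes "Im \<mu> \<noteq> 0"
  shows "Im \<mu> > 0 \<Longrightarrow> t \<le> 0 \<Longrightarrow>
      (\<integral>x. indicator {..<t} x *\<^sub>R half_exp \<mu> x \<partial>lborel) = (\<i> / \<mu>) * exp (- \<i> * \<mu> * of_real t)"
    and "Im \<mu> < 0 \<Longrightarrow> t \<ge> 0 \<Longrightarrow>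
      (\<integral>x. indicator {t<..} x *\<^sub>R half_exp \<mu> x \<partial>lborel) = - ((\<i> / \<mu>) * exp (- \<i> * \<mu> * of_real t))"
proof -
  have "\<mu> \<noteq> 0" using assms by auto
  have cont: "isCont (\<lambda>x. exp (- \<i> * \<mu> * of_real x)) x" for x :: real
    by (intro continuous_intros)
  have lim: "((\<lambda>x. (\<i> / \<mu>) * exp (- \<i> * \<mu> * of_real x)) \<longlongrightarrow> 0) F"
    if "((\<lambda>x. exp (Im \<mu> * x)) \<longlongrightarrow> 0) F" for F
  proof (rule tendsto_mult_right_zero, rule tendsto_norm_zero_cancel)
    show "((\<lambda>x. norm (exp (- \<i> * \<mu> * of_real x))) \<longlongrightarrow> 0) F"
      unfolding norm_exp_line by (rule that)
  qed
  show "(\<integral>x. indicator {..<t} x *\<^sub>R half_exp \<mu> x \<partial>lborel) = (\<i> / \<mu>) * exp (- \<i> * \<mu> * of_real t)"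
    if pos: "Im \<mu> > 0" "t \<le> 0"
  proof -
    have eq: "indicator {..<t} x *\<^sub>R half_exp \<mu> x = indicator {..<t} x *\<^sub>R exp (- \<i> * \<mu> * of_real x)" for x
      using pos by (auto simp: half_exp_def mult_less_0_iff split: split_indicator)
    have "integrable lborel (\<lambda>x. indicator {..<t} x *\<^sub>R half_exp \<mu> x)"
      by (intro integrable_mult_indicator integrable_half_exp assms) simp
    moreover have "((\<lambda>x. exp (Im \<mu> * x)) \<longlongrightarrow> 0) at_bot"
      by (rule filterlim_compose[OF exp_at_bot])
        (intro filterlim_tendsto_pos_mult_at_bot[OF tendsto_const] pos(1) filterlim_ident)
    ultimately show ?thesis
      unfolding eq
      by (intro integral_Iio_FTC[where F = "\<lambda>x. (\<i> / \<mu>) * exp (- \<i> * \<mu> * of_real x)"]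
          exp_has_vector_derivative[OF \<open>\<mu> \<noteq> 0\<close>] cont lim)
  qed
  show "(\<integral>x. indicator {t<..} x *\<^sub>R half_exp \<mu> x \<partial>lborel) = - ((\<i> / \<mu>) * exp (- \<i> * \<mu> * of_real t))"
    if neg: "Im \<mu> < 0" "t \<ge> 0"
  proof -
    have eq: "indicator {t<..} x *\<^sub>R half_exp \<mu> x = indicator {t<..} x *\<^sub>R exp (- \<i> * \<mu> * of_real x)" for x
      using neg by (auto simp: half_exp_def mult_less_0_iff split: split_indicator)
    have "integrable lborel (\<lambda>x. indicator {t<..} x *\<^sub>R half_exp \<mu> x)"
      by (intro integrable_mult_indicator integrable_half_exp assms) simp
    moreover have "((\<lambda>x. exp (Im \<mu> * x)) \<longlongrightarrow> 0) at_top"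
      by (rule filterlim_compose[OF exp_at_bot])
        (intro filterlim_tendsto_neg_mult_at_bot[OF tendsto_const] neg(1) filterlim_ident)
    ultimately show ?thesis
      unfolding eq
      by (intro integral_Ioi_FTC[where F = "\<lambda>x. (\<i> / \<mu>) * exp (- \<i> * \<mu> * of_real x)"]
          exp_has_vector_derivative[OF \<open>\<mu> \<noteq> 0\<close>] cont lim)
  qed
qed

lemma integral_half_exp:
  assumes "Im \<mu> \<noteq> 0"
  shows "(\<integral>x. half_exp \<mu> x \<partial>lborel) = of_real (sgn (Im \<mu>)) * (\<i> / \<mu>)"
proof (cases "Im \<mu> > 0")
  case True
  then have "half_exp \<mu> x = indicator {..<0} x *\<^sub>R half_exp \<mu> x" for x
    by (auto simp: half_exp_def mult_less_0_iff split: split_indicator)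
  then have "(\<integral>x. half_exp \<mu> x \<partial>lborel) = (\<integral>x. indicator {..<0} x *\<^sub>R half_exp \<mu> x \<partial>lborel)"
    by (intro Bochner_Integration.integral_cong) auto
  then show ?thesis
    using tail_integral_half_exp(1)[OF assms True, of 0] True by simp
next
  case False
  then have "half_exp \<mu> x = indicator {0<..} x *\<^sub>R half_exp \<mu> x" for x
    by (auto simp: half_exp_def mult_less_0_iff split: split_indicator)
  then have "(\<integral>x. half_exp \<mu> x \<partial>lborel) = (\<integral>x. indicator {0<..} x *\<^sub>R half_exp \<mu> x \<partial>lborel)"
    by (intro Bochner_Integration.integral_cong) auto
  then show ?thesis
    using tail_integral_half_exp(2)[OF assms, of 0] False assms by simp
qed

section \<open>Scalar square-integrable functions and their primitives\<close>

definition square_integrable1 :: "(real \<Rightarrow> complex) \<Rightarrow> bool"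
  where "square_integrable1 v \<longleftrightarrow> v \<in> borel_measurable borel \<and> integrable lborel (\<lambda>x. (cmod (v x))\<^sup>2)"

lemma integrable_exp_times_L2:
  assumes "square_integrable1 v" "\<delta> > 0"
  shows "integrable lborel (\<lambda>x. exp (- \<delta> * \<bar>x\<bar>) * cmod (v x))"
proof (rule Bochner_Integration.integrable_bound)
  have [measurable]: "v \<in> borel_measurable borel"
    using assms by (simp add: square_integrable1_def)
  show "integrable lborel (\<lambda>x. exp (- (2 * \<delta>) * \<bar>x\<bar>) + (cmod (v x))\<^sup>2)"
    using assms integrable_exp_abs[of "2 * \<delta>"] by (simp add: square_integrable1_def)
  show "(\<lambda>x. exp (- \<delta> * \<bar>x\<bar>) * cmod (v x)) \<in> borel_measurable lborel"
    by measurable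
  have "exp (- \<delta> * \<bar>x\<bar>) * cmod (v x) \<le> exp (- (2 * \<delta>) * \<bar>x\<bar>) + (cmod (v x))\<^sup>2" for x
  proof -
    have "exp (- (2 * \<delta>) * \<bar>x\<bar>) = (exp (- \<delta> * \<bar>x\<bar>))\<^sup>2"
      by (simp add: power2_eq_square exp_add[symmetric])
    moreover have "0 \<le> exp (- \<delta> * \<bar>x\<bar>) * cmod (v x)"
      by simp
    ultimately show ?thesis
      using sum_squares_bound[of "exp (- \<delta> * \<bar>x\<bar>)" "cmod (v x)"] by linarith
  qed
  then show "AE x in lborel. norm (exp (- \<delta> * \<bar>x\<bar>) * cmod (v x)) \<le> norm (exp (- (2 * \<delta>) * \<bar>x\<bar>) + (cmod (v x))\<^sup>2)"
    by (intro AE_I2) (simp add: abs_mult)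
qed

lemma integrable_half_exp_times:
  assumes "square_integrable1 v" "Im \<mu> \<noteq> 0"
  shows "integrable lborel (\<lambda>x. half_exp \<mu> x * v x)"
proof (rule Bochner_Integration.integrable_bound[OF integrable_exp_times_L2[OF assms(1), of "\<bar>Im \<mu>\<bar>"]])
  have [measurable]: "v \<in> borel_measurable borel"
    using assms by (simp add: square_integrable1_def)
  show "(\<lambda>x. half_exp \<mu> x * v x) \<in> borel_measurable lborel"
    by measurable
  show "AE x in lborel. norm (half_exp \<mu> x * v x) \<le> norm (exp (- \<bar>Im \<mu>\<bar> * \<bar>x\<bar>) * cmod (v x))"
    using norm_half_exp_le by (intro AE_I2) (simp add: norm_mult mult_right_mono)
qed (use assms in simp)

text \<open>\<open>primitive v x\<close> is the integral of \<open>v\<close> from \<open>0\<close> to \<open>x\<close>, written with a signed kernel on the whole line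
  so that Fubini's theorem applies directly.\<close>

definition signed_kernel :: "real \<Rightarrow> real \<Rightarrow> complex"
  where "signed_kernel x t = (if 0 \<le> t \<and> t < x then 1 else if x < t \<and> t < 0 then -1 else 0)"

definition primitive :: "(real \<Rightarrow> complex) \<Rightarrow> real \<Rightarrow> complex"
  where "primitive v x = (\<integral>t. signed_kernel x t * v t \<partial>lborel)"

lemma signed_kernel_measurable [measurable]:
  "(\<lambda>p. signed_kernel (fst p) (snd p)) \<in> borel_measurable (borel \<Otimes>\<^sub>M borel)"
  unfolding signed_kernel_def by measurable

lemma signed_kernel_measurable' [measurable]:
  "(\<lambda>t. signed_kernel x t) \<in> borel_measurable borel" "(\<lambda>x. signed_kernel x t) \<in> borel_measurable borel"
  unfolding signed_kernel_def by measurable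

text \<open>The kernel is supported where t is no farther from 0 than x, so any growth in x may be
  exchanged for decay in t.\<close>

lemma norm_signed_kernel_le: "cmod (signed_kernel x t) \<le> exp (\<delta> * (\<bar>x\<bar> - \<bar>t\<bar>))" if "\<delta> > 0"
  using that by (auto simp: signed_kernel_def)

lemma Fubini_primitive:
  assumes [measurable]: "\<psi> \<in> borel_measurable borel" and \<psi>: "\<And>x. cmod (\<psi> x) \<le> B * exp (- \<delta> * \<bar>x\<bar>)" and "\<delta> > 0"
    and v: "square_integrable1 v"
  shows "integrable lborel (\<lambda>x. \<psi> x * primitive v x)"
    and "(\<integral>x. \<psi> x * primitive v x \<partial>lborel) = (\<integral>t. v t * (\<integral>x. \<psi> x * signed_kernel x t \<partial>lborel) \<partial>lborel)"
proof -
  \<comment> \<open>Half of the decay of \<open>\<psi>\<close> is spent through the kernel bound on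
    decay in \<open>t\<close>; the other half keeps integrability in \<open>x\<close>.\<close>
  define \<epsilon> where "\<epsilon> = \<delta> / 2"
  have \<epsilon>: "\<epsilon> > 0" "\<delta> = 2 * \<epsilon>" using \<open>\<delta> > 0\<close> by (simp_all add: \<epsilon>_def)
  have [measurable]: "v \<in> borel_measurable borel"
    using v by (simp add: square_integrable1_def)
  have "B \<ge> 0"
    using order_trans[OF norm_ge_zero \<psi>[of 0]] by simp
  have bound: "norm (\<psi> x * signed_kernel x t) \<le> (B * exp (- \<epsilon> * \<bar>t\<bar>)) * exp (- \<epsilon> * \<bar>x\<bar>)" for x t
  proof -
    have "norm (\<psi> x * signed_kernel x t) \<le> (B * exp (- \<delta> * \<bar>x\<bar>)) * exp (\<epsilon> * (\<bar>x\<bar> - \<bar>t\<bar>))"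
      unfolding norm_mult by (intro mult_mono \<psi> norm_signed_kernel_le \<epsilon>) (use \<open>B \<ge> 0\<close> in auto)
    also have "\<dots> = (B * exp (- \<epsilon> * \<bar>t\<bar>)) * exp (- \<epsilon> * \<bar>x\<bar>)"
      by (simp add: mult.assoc exp_add[symmetric] \<epsilon>(2) algebra_simps)
    finally show ?thesis .
  qed
  have int_x: "integrable lborel (\<lambda>x. \<psi> x * signed_kernel x t)" for t
    by (rule Bochner_Integration.integrable_bound[OF integrable_mult_right[OF integrable_exp_abs[OF \<epsilon>(1)], of "B * exp (- \<epsilon> * \<bar>t\<bar>)"]])
      (measurable, intro AE_I2 order_trans[OF bound], simp)
  define f where "f p = v (fst p) * (\<psi> (snd p) * signed_kernel (snd p) (fst p))" for p
  have [measurable]: "(\<lambda>p. signed_kernel (snd p) (fst p)) \<in> borel_measurable (borel \<Otimes>\<^sub>M borel)"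
    unfolding signed_kernel_def by measurable
  have f_meas: "f \<in> borel_measurable (lborel \<Otimes>\<^sub>M lborel)"
    unfolding f_def by measurable
  define I where "I = (\<integral>x. exp (- \<epsilon> * \<bar>x\<bar>) \<partial>lborel)"
  have int_f: "integrable (lborel \<Otimes>\<^sub>M lborel) f"
  proof (rule lborel_pair.Fubini_integrable[OF f_meas])
    show "AE t in lborel. integrable lborel (\<lambda>x. f (t, x))"
      unfolding f_def by (intro AE_I2) (simp add: integrable_mult_right int_x)
    show "integrable lborel (\<lambda>t. \<integral>x. norm (f (t, x)) \<partial>lborel)"
    proof (rule Bochner_Integration.integrable_bound)
      show "integrable lborel (\<lambda>t. (B * I) * (exp (- \<epsilon> * \<bar>t\<bar>) * cmod (v t)))"
        by (intro integrable_mult_right integrable_exp_times_L2 v \<epsilon>)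
      show "(\<lambda>t. \<integral>x. norm (f (t, x)) \<partial>lborel) \<in> borel_measurable lborel"
        using f_meas by measurable
      show "AE t in lborel. norm (\<integral>x. norm (f (t, x)) \<partial>lborel) \<le> norm ((B * I) * (exp (- \<epsilon> * \<bar>t\<bar>) * cmod (v t)))"
      proof (intro AE_I2)
        fix t
        have "(\<integral>x. norm (f (t, x)) \<partial>lborel) \<le> (\<integral>x. (cmod (v t) * (B * exp (- \<epsilon> * \<bar>t\<bar>))) * exp (- \<epsilon> * \<bar>x\<bar>) \<partial>lborel)"
        proof (rule integral_mono)
          show "integrable lborel (\<lambda>x. norm (f (t, x)))"
            unfolding f_def by (intro integrable_norm) (simp add: integrable_mult_right int_x)
          show "integrable lborel (\<lambda>x. (cmod (v t) * (B * exp (- \<epsilon> * \<bar>t\<bar>))) * exp (- \<epsilon> * \<bar>x\<bar>))"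
            by (intro integrable_mult_right integrable_exp_abs \<epsilon>)
          show "norm (f (t, x)) \<le> (cmod (v t) * (B * exp (- \<epsilon> * \<bar>t\<bar>))) * exp (- \<epsilon> * \<bar>x\<bar>)" for x
            using mult_left_mono[OF bound[of x t] norm_ge_zero[of "v t"]]
            by (simp add: f_def norm_mult mult.assoc)
        qed
        also have "\<dots> = (B * I) * (exp (- \<epsilon> * \<bar>t\<bar>) * cmod (v t))"
          by (simp add: I_def)
        finally show "norm (\<integral>x. norm (f (t, x)) \<partial>lborel) \<le> norm ((B * I) * (exp (- \<epsilon> * \<bar>t\<bar>) * cmod (v t)))"
          by simp
      qed
    qed
  qed
  then have int_f': "integrable (lborel \<Otimes>\<^sub>M lborel) (\<lambda>(t, x). f (t, x))" by simp
  have inner: "(\<integral>t. f (t, x) \<partial>lborel) = \<psi> x * primitive v x" for x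
  proof -
    have "(\<integral>t. f (t, x) \<partial>lborel) = (\<integral>t. \<psi> x * (signed_kernel x t * v t) \<partial>lborel)"
      by (simp add: f_def mult_ac)
    then show ?thesis
      by (simp add: primitive_def)
  qed
  show "integrable lborel (\<lambda>x. \<psi> x * primitive v x)"
    using lborel_pair.integrable_snd[OF int_f'] by (simp only: inner)
  show "(\<integral>x. \<psi> x * primitive v x \<partial>lborel) = (\<integral>t. v t * (\<integral>x. \<psi> x * signed_kernel x t \<partial>lborel) \<partial>lborel)"
    using lborel_pair.Fubini_integral[OF int_f'] by (simp only: inner) (simp add: f_def)
qed

text \<open>Integration by parts at the level of kernels: the kernel restricts the exponential to
  the tail beyond \<open>t\<close>, whose integral is again an exponential. At t = 0
  \<open>half_exp\<close> is 0 while the tail integral need not be, so this point is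
  excluded.\<close>

lemma half_exp_signed_kernel:
  assumes "Im \<mu> \<noteq> 0" "t \<noteq> 0"
  shows "(\<integral>x. half_exp \<mu> x * signed_kernel x t \<partial>lborel) = - (\<i> / \<mu>) * half_exp \<mu> t"
proof (cases "t > 0")
  case True
  then have "half_exp \<mu> x * signed_kernel x t = indicator {t<..} x *\<^sub>R half_exp \<mu> x" for x
    by (auto simp: signed_kernel_def split: split_indicator)
  then have eq: "(\<integral>x. half_exp \<mu> x * signed_kernel x t \<partial>lborel) = (\<integral>x. indicator {t<..} x *\<^sub>R half_exp \<mu> x \<partial>lborel)"
    by (intro Bochner_Integration.integral_cong) auto
  show ?thesis
  proof (cases "Im \<mu> > 0")
    case False
    then show ?thesis
      unfolding eq using tail_integral_half_exp(2)[OF assms(1), of t] True assms(1)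
      by (simp add: half_exp_def mult_less_0_iff)
  next
    case pos: True
    then have "(\<lambda>x. indicator {t<..} x *\<^sub>R half_exp \<mu> x) = (\<lambda>_. 0)"
      using True by (auto simp: half_exp_def mult_less_0_iff fun_eq_iff split: split_indicator)
    moreover have "half_exp \<mu> t = 0"
      using pos True by (simp add: half_exp_def mult_less_0_iff)
    ultimately show ?thesis
      unfolding eq by (simp only: Bochner_Integration.integral_zero mult_zero_right)
  qed
next
  case False
  then have t: "t < 0" using assms(2) by simp
  then have "half_exp \<mu> x * signed_kernel x t = - (indicator {..<t} x *\<^sub>R half_exp \<mu> x)" for x
    by (auto simp: signed_kernel_def split: split_indicator)
  then have eq: "(\<integral>x. half_exp \<mu> x * signed_kernel x t \<partial>lborel) = - (\<integral>x. indicator {..<t} x *\<^sub>R half_exp \<mu> x \<partial>lborel)"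
    unfolding integral_minus[symmetric] by (intro Bochner_Integration.integral_cong) auto
  show ?thesis
  proof (cases "Im \<mu> > 0")
    case True
    then show ?thesis
      unfolding eq using tail_integral_half_exp(1)[OF assms(1), of t] t
      by (simp add: half_exp_def mult_less_0_iff)
  next
    case neg: False
    then have "(\<lambda>x. indicator {..<t} x *\<^sub>R half_exp \<mu> x) = (\<lambda>_. 0)"
      using t assms(1) by (auto simp: half_exp_def mult_less_0_iff fun_eq_iff split: split_indicator)
    moreover have "half_exp \<mu> t = 0"
      using neg t assms(1) by (simp add: half_exp_def mult_less_0_iff)
    ultimately show ?thesis
      unfolding eq by (simp only: Bochner_Integration.integral_zero mult_zero_right minus_zero)
  qed
qed

lemma half_exp_primitive:
  assumes v: "square_integrable1 v" and "Im \<mu> \<noteq> 0"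
  shows "integrable lborel (\<lambda>x. half_exp \<mu> x * primitive v x)"
    and "(\<integral>x. half_exp \<mu> x * primitive v x \<partial>lborel) = - (\<i> / \<mu>) * (\<integral>x. half_exp \<mu> x * v x \<partial>lborel)"
proof -
  have bound: "cmod (half_exp \<mu> x) \<le> 1 * exp (- \<bar>Im \<mu>\<bar> * \<bar>x\<bar>)" for x
    using norm_half_exp_le by simp
  have "\<bar>Im \<mu>\<bar> > 0" using assms(2) by simp
  note F = Fubini_primitive[OF half_exp_measurable bound this v]
  show "integrable lborel (\<lambda>x. half_exp \<mu> x * primitive v x)"
    by (rule F(1))
  have [measurable]: "v \<in> borel_measurable borel"
    using v by (simp add: square_integrable1_def)
  have "(\<integral>t. v t * (\<integral>x. half_exp \<mu> x * signed_kernel x t \<partial>lborel) \<partial>lborel)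
      = (\<integral>t. - (\<i> / \<mu>) * (half_exp \<mu> t * v t) \<partial>lborel)"
  proof (rule integral_cong_AE)
    have "AE t in lborel. t \<noteq> (0::real)"
      by (rule AE_lborel_singleton)
    then show "AE t in lborel. v t * (\<integral>x. half_exp \<mu> x * signed_kernel x t \<partial>lborel) = - (\<i> / \<mu>) * (half_exp \<mu> t * v t)"
      by eventually_elim (simp add: half_exp_signed_kernel[OF assms(2)])
    have [measurable]: "(\<lambda>p. signed_kernel (snd p) (fst p)) \<in> borel_measurable (borel \<Otimes>\<^sub>M borel)"
      unfolding signed_kernel_def by measurable
    show "(\<lambda>t. v t * (\<integral>x. half_exp \<mu> x * signed_kernel x t \<partial>lborel)) \<in> borel_measurable lborel"
      by measurable
    show "(\<lambda>t. - (\<i> / \<mu>) * (half_exp \<mu> t * v t)) \<in> borel_measurable lborel"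
      by measurable
  qed
  then show "(\<integral>x. half_exp \<mu> x * primitive v x \<partial>lborel) = - (\<i> / \<mu>) * (\<integral>x. half_exp \<mu> x * v x \<partial>lborel)"
    unfolding F(2) by (simp only: integral_mult_right_zero)
qed

text \<open>The parameters (1 + j) \<i> and - (1 + j) \<i> on the imaginary axis suffice: their
  exponentials are the first one times powers of exp x or exp (- x), so the vanishing integrals are
  the moments on the left or right half-line.\<close>

lemma half_exp_orthogonal_imp_0:
  assumes g: "g \<in> borel_measurable borel" and int: "\<And>\<mu>. Im \<mu> \<noteq> 0 \<Longrightarrow> integrable lborel (\<lambda>x. half_exp \<mu> x * g x)"
    and zero: "\<And>\<mu>. Im \<mu> \<noteq> 0 \<Longrightarrow> (\<integral>x. half_exp \<mu> x * g x \<partial>lborel) = 0"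
  shows "AE x in lborel. g x = 0"
proof -
  have *: "AE x in lborel. half_exp (of_real \<sigma> * \<i>) x * g x = 0" if \<sigma>: "\<sigma> = 1 \<or> \<sigma> = -1" for \<sigma> :: real
  proof (rule laplace_transform_unique[OF _ _ \<sigma>])
    show "integrable lborel (\<lambda>x. half_exp (of_real \<sigma> * \<i>) x * g x)"
      using \<sigma> by (intro int) auto
    show "half_exp (of_real \<sigma> * \<i>) x * g x = 0" if "0 \<le> \<sigma> * x" for x
      using that by (simp add: half_exp_def)
    fix j :: nat
    have eq: "half_exp (of_real \<sigma> * \<i>) x * g x * of_real (exp (\<sigma> * x) ^ j) = half_exp (of_real (\<sigma> * (1 + real j)) * \<i>) x * g x" for x
    proof -
      have "\<sigma> * (1 + real j) * x < 0 \<longleftrightarrow> \<sigma> * x < 0"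
        using \<sigma> by (auto simp: mult_less_0_iff zero_less_mult_iff)
      then show ?thesis
        by (simp add: half_exp_def exp_of_real[symmetric] exp_of_nat_mult[symmetric] exp_add[symmetric] algebra_simps)
    qed
    have ne: "Im (of_real (\<sigma> * (1 + real j)) * \<i>) \<noteq> 0"
      using \<sigma> by auto
    show "(\<integral>x. half_exp (of_real \<sigma> * \<i>) x * g x * of_real (exp (\<sigma> * x) ^ j) \<partial>lborel) = 0"
      using zero[OF ne] by (simp only: eq)
  qed
  have "AE x in lborel. half_exp \<i> x * g x = 0" "AE x in lborel. half_exp (- \<i>) x * g x = 0"
      "AE x in lborel. x \<noteq> (0::real)"
    using *[of 1] *[of "-1"] AE_lborel_singleton[of 0] by simp_all
  then show ?thesis
    by eventually_elim (auto simp: half_exp_def split: if_splits)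
qed

text \<open>By \<open>half_exp_primitive\<close> the primitive of \<i> z satisfies the equations on
  the left, and integrals against \<open>half_exp\<close> determine a function. The boundary value 0
  is built in because the primitive starts at 0.\<close>

lemma half_exp_primitive_iff:
  assumes y: "square_integrable1 y" and z: "square_integrable1 z"
  shows "(\<forall>\<mu>. Im \<mu> \<noteq> 0 \<longrightarrow> \<mu> * (\<integral>x. half_exp \<mu> x * y x \<partial>lborel) = (\<integral>x. half_exp \<mu> x * z x \<partial>lborel))
    \<longleftrightarrow> (AE x in lborel. y x = primitive (\<lambda>t. \<i> * z t) x)"
proof -
  let ?W = "primitive (\<lambda>t. \<i> * z t)"
  have [measurable]: "y \<in> borel_measurable borel" "z \<in> borel_measurable borel"
    using y z by (simp_all add: square_integrable1_def)
  have iz: "square_integrable1 (\<lambda>t. \<i> * z t)"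
    using z by (simp add: square_integrable1_def norm_mult)
  have [measurable]: "?W \<in> borel_measurable borel"
    unfolding primitive_def[abs_def] by measurable
  have W: "\<mu> * (\<integral>x. half_exp \<mu> x * ?W x \<partial>lborel) = (\<integral>x. half_exp \<mu> x * z x \<partial>lborel)" if "Im \<mu> \<noteq> 0" for \<mu>
  proof -
    have "\<mu> \<noteq> 0" using that by auto
    moreover have "(\<integral>x. half_exp \<mu> x * (\<i> * z x) \<partial>lborel) = \<i> * (\<integral>x. half_exp \<mu> x * z x \<partial>lborel)"
      by (simp add: mult.left_commute[of _ \<i>])
    ultimately show ?thesis
      by (simp add: half_exp_primitive(2)[OF iz that])
  qed
  show ?thesis
  proof
    assume eq: "\<forall>\<mu>. Im \<mu> \<noteq> 0 \<longrightarrow> \<mu> * (\<integral>x. half_exp \<mu> x * y x \<partial>lborel) = (\<integral>x. half_exp \<mu> x * z x \<partial>lborel)"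
    have "AE x in lborel. y x - ?W x = 0"
    proof (rule half_exp_orthogonal_imp_0)
      fix \<mu> :: complex assume Im: "Im \<mu> \<noteq> 0"
      then have "\<mu> \<noteq> 0" by auto
      note int = integrable_half_exp_times[OF y Im] half_exp_primitive(1)[OF iz Im]
      show "integrable lborel (\<lambda>x. half_exp \<mu> x * (y x - ?W x))"
        using int by (simp add: right_diff_distrib)
      have "\<mu> * (\<integral>x. half_exp \<mu> x * y x \<partial>lborel) = \<mu> * (\<integral>x. half_exp \<mu> x * ?W x \<partial>lborel)"
        using eq W Im by simp
      with \<open>\<mu> \<noteq> 0\<close> int show "(\<integral>x. half_exp \<mu> x * (y x - ?W x) \<partial>lborel) = 0"
        by (simp add: right_diff_distrib)
    qed measurable
    then show "AE x in lborel. y x = ?W x"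
      by eventually_elim simp
  next
    assume ae: "AE x in lborel. y x = ?W x"
    show "\<forall>\<mu>. Im \<mu> \<noteq> 0 \<longrightarrow> \<mu> * (\<integral>x. half_exp \<mu> x * y x \<partial>lborel) = (\<integral>x. half_exp \<mu> x * z x \<partial>lborel)"
    proof (intro allI impI)
      fix \<mu> :: complex assume Im: "Im \<mu> \<noteq> 0"
      have "(\<integral>x. half_exp \<mu> x * y x \<partial>lborel) = (\<integral>x. half_exp \<mu> x * ?W x \<partial>lborel)"
        using ae by (intro integral_cong_AE) (auto elim!: eventually_mono)
      then show "\<mu> * (\<integral>x. half_exp \<mu> x * y x \<partial>lborel) = (\<integral>x. half_exp \<mu> x * z x \<partial>lborel)"
        using W[OF Im] by simp
    qed
  qed
qed

lemma primitive_0 [simp]: "primitive v 0 = 0"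
proof -
  have "(\<lambda>t. signed_kernel 0 t * v t) = (\<lambda>_. 0)"
    by (auto simp: signed_kernel_def fun_eq_iff)
  then show ?thesis
    unfolding primitive_def by (simp only: Bochner_Integration.integral_zero)
qed

lemma continuous_primitive:
  assumes v: "square_integrable1 v"
  shows "isCont (primitive v) a"
  unfolding continuous_at_sequentially
proof (intro allI impI)
  fix X :: "nat \<Rightarrow> real" assume X: "X \<longlonglongrightarrow> a"
  have [measurable]: "v \<in> borel_measurable borel"
    using v by (simp add: square_integrable1_def)
  obtain B where B: "\<And>n. \<bar>X n\<bar> \<le> B"
    using convergent_imp_Bseq[OF convergentI[OF X]] by (auto simp: Bseq_def)
  have "(\<lambda>n. \<integral>t. signed_kernel (X n) t * v t \<partial>lborel) \<longlonglongrightarrow> (\<integral>t. signed_kernel a t * v t \<partial>lborel)"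
  proof (rule integral_dominated_convergence[where w = "\<lambda>t. exp B * (exp (- 1 * \<bar>t\<bar>) * cmod (v t))"])
    show "integrable lborel (\<lambda>t. exp B * (exp (- 1 * \<bar>t\<bar>) * cmod (v t)))"
      by (intro integrable_mult_right integrable_exp_times_L2 v) simp
    have "AE t in lborel. t \<noteq> a"
      by (rule AE_lborel_singleton)
    then show "AE t in lborel. (\<lambda>n. signed_kernel (X n) t * v t) \<longlonglongrightarrow> signed_kernel a t * v t"
    proof eventually_elim
      fix t assume "t \<noteq> a"
      have "\<forall>\<^sub>F n in sequentially. signed_kernel (X n) t = signed_kernel a t"
      proof (cases "t < a")
        case True
        from order_tendstoD(1)[OF X True] show ?thesis
          by eventually_elim (use True in \<open>simp add: signed_kernel_def\<close>)
      next
        case False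
        then have "a < t" using \<open>t \<noteq> a\<close> by simp
        from order_tendstoD(2)[OF X this] show ?thesis
          by eventually_elim (use \<open>a < t\<close> in \<open>simp add: signed_kernel_def\<close>)
      qed
      then have "(\<lambda>n. signed_kernel (X n) t) \<longlonglongrightarrow> signed_kernel a t"
        by (rule tendsto_eventually)
      then show "(\<lambda>n. signed_kernel (X n) t * v t) \<longlonglongrightarrow> signed_kernel a t * v t"
        by (intro tendsto_intros)
    qed
    show "AE t in lborel. norm (signed_kernel (X n) t * v t) \<le> exp B * (exp (- 1 * \<bar>t\<bar>) * cmod (v t))" for n
    proof (intro AE_I2)
      fix t
      have "cmod (signed_kernel (X n) t) \<le> exp (1 * (\<bar>X n\<bar> - \<bar>t\<bar>))"
        by (rule norm_signed_kernel_le) simp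
      also have "\<dots> \<le> exp (B - \<bar>t\<bar>)"
        using B[of n] by simp
      also have "\<dots> = exp B * exp (- 1 * \<bar>t\<bar>)"
        by (simp add: exp_add[symmetric])
      finally have "cmod (signed_kernel (X n) t) * cmod (v t) \<le> exp B * exp (- 1 * \<bar>t\<bar>) * cmod (v t)"
        by (rule mult_right_mono) simp
      then show "norm (signed_kernel (X n) t * v t) \<le> exp B * (exp (- 1 * \<bar>t\<bar>) * cmod (v t))"
        by (simp add: norm_mult mult.assoc)
    qed
  qed measurable
  then show "(primitive v \<circ> X) \<longlonglongrightarrow> primitive v a"
    by (simp add: primitive_def o_def)
qed

subsection \<open>Bump functions\<close>

text \<open>The parameters \<open>p\<close> and \<open>k\<close> close the family under
  differentiation: a derivative changes the polynomial and raises the power in the denominator, and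
  the exponential beats every such power at the end points.\<close>

definition bump :: "real \<Rightarrow> real \<Rightarrow> real poly \<Rightarrow> nat \<Rightarrow> real \<Rightarrow> real"
  where "bump a b p k x =
    (if a < x \<and> x < b then poly p x / ((x - a) * (b - x)) ^ k * exp (- 1 / ((x - a) * (b - x))) else 0)"

lemma has_real_derivative_0_if_quadratic:
  fixes g :: "real \<Rightarrow> real"
  assumes "g x = 0" "\<And>y. \<bar>g y\<bar> \<le> B * (y - x)\<^sup>2"
  shows "(g has_real_derivative 0) (at x)"
  unfolding has_field_derivative_iff
proof (rule Lim_null_comparison)
  show "\<forall>\<^sub>F y in at x. norm ((g y - g x) / (y - x)) \<le> B * \<bar>y - x\<bar>"
    unfolding eventually_at_filter
  proof (intro always_eventually allI impI)
    fix y assume "y \<noteq> x"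
    then show "norm ((g y - g x) / (y - x)) \<le> B * \<bar>y - x\<bar>"
      using assms(2)[of y] by (simp add: assms(1) field_simps power2_eq_square abs_mult_self_eq)
  qed
  have "((\<lambda>y. B * \<bar>y - x\<bar>) \<longlongrightarrow> B * \<bar>x - x\<bar>) (at x)"
    by (intro tendsto_intros)
  then show "((\<lambda>y. B * \<bar>y - x\<bar>) \<longlongrightarrow> 0) (at x)" by simp
qed

lemma power_div_fact_le_exp: "0 \<le> (x::real) \<Longrightarrow> x ^ n / fact n \<le> exp x"
proof -
  assume x: "0 \<le> x"
  have "(\<Sum>i\<in>{n}. x ^ i /\<^sub>R fact i) \<le> (\<Sum>i. x ^ i /\<^sub>R fact i)"
    using x by (intro sum_le_suminf summable_exp_generic) auto
  then show ?thesis
    by (simp add: exp_def field_simps)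
qed

lemma bump_quadratic_bound:
  assumes "a < b"
  obtains B where "\<And>y. \<bar>bump a b p k y\<bar> \<le> B * (y - a)\<^sup>2" "\<And>y. \<bar>bump a b p k y\<bar> \<le> B * (y - b)\<^sup>2"
proof -
  have "compact (poly p ` {a..b})"
    by (intro compact_continuous_image continuous_intros) auto
  then obtain M where "M > 0" "\<forall>z\<in>poly p ` {a..b}. norm z \<le> M"
    using compact_imp_bounded bounded_pos by metis
  then have M: "M > 0" "\<And>y. a \<le> y \<Longrightarrow> y \<le> b \<Longrightarrow> \<bar>poly p y\<bar> \<le> M"
    by auto
  have q_bound: "\<bar>bump a b p k y\<bar> \<le> M * (fact (k + 2) * ((y - a) * (b - y))\<^sup>2)" if y: "a < y" "y < b" for y
  proof -
    define q where "q = (y - a) * (b - y)"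
    have q: "q > 0" using y by (simp add: q_def)
    have *: "exp (- 1 / q) \<le> fact n * q ^ n" for n
    proof -
      have "(1 / q) ^ n / fact n \<le> exp (1 / q)"
        using q by (intro power_div_fact_le_exp) simp
      then have "inverse (exp (1 / q)) \<le> inverse ((1 / q) ^ n / fact n)"
        using q by (intro le_imp_inverse_le) auto
      then show ?thesis
        by (simp add: exp_minus power_one_over mult.commute)
    qed
    \<comment> \<open>Of the \<open>k + 2\<close> powers, \<open>k\<close> cancel the pole of the
      bump and two remain for the quadratic bound.\<close>
    have "exp (- 1 / q) \<le> fact (k + 2) * q ^ (k + 2)"
      by (rule *)
    then have "exp (- 1 / q) / q ^ k \<le> fact (k + 2) * q ^ (k + 2) / q ^ k"
      using q by (intro divide_right_mono) auto
    also have "\<dots> = fact (k + 2) * q\<^sup>2"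
      using q by (simp add: power_add power2_eq_square)
    finally have le: "exp (- 1 / q) / q ^ k \<le> fact (k + 2) * q\<^sup>2" .
    have "\<bar>bump a b p k y\<bar> = \<bar>poly p y\<bar> * (exp (- 1 / q) / q ^ k)"
      using y q by (simp add: bump_def q_def[symmetric] abs_mult)
    also have "\<dots> \<le> M * (fact (k + 2) * q\<^sup>2)"
      using M(2)[of y] y q le by (intro mult_mono) (auto simp: M(1) less_imp_le)
    finally show ?thesis unfolding q_def .
  qed
  define B where "B = M * (fact (k + 2) * (b - a)\<^sup>2)"
  have "B \<ge> 0" using M(1) by (simp add: B_def)
  show ?thesis
  proof (rule that[of B])
    fix y
    show "\<bar>bump a b p k y\<bar> \<le> B * (y - a)\<^sup>2"
    proof (cases "a < y \<and> y < b")
      case True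
      then have "((y - a) * (b - y))\<^sup>2 \<le> (b - a)\<^sup>2 * (y - a)\<^sup>2"
        unfolding power_mult_distrib mult.commute[of "(b - a)\<^sup>2"]
        by (intro mult_left_mono power_mono) auto
      then have "M * (fact (k + 2) * ((y - a) * (b - y))\<^sup>2) \<le> M * (fact (k + 2) * ((b - a)\<^sup>2 * (y - a)\<^sup>2))"
        using M(1) by (intro mult_left_mono) auto
      then show ?thesis
        using q_bound[of y] True by (simp add: B_def mult.assoc)
    qed (use \<open>B \<ge> 0\<close> in \<open>auto simp: bump_def\<close>)
    show "\<bar>bump a b p k y\<bar> \<le> B * (y - b)\<^sup>2"
    proof (cases "a < y \<and> y < b")
      case True
      then have "((y - a) * (b - y))\<^sup>2 \<le> (b - a)\<^sup>2 * (b - y)\<^sup>2"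
        unfolding power_mult_distrib
        by (intro mult_right_mono power_mono) auto
      then have "M * (fact (k + 2) * ((y - a) * (b - y))\<^sup>2) \<le> M * (fact (k + 2) * ((b - a)\<^sup>2 * (b - y)\<^sup>2))"
        using M(1) by (intro mult_left_mono) auto
      then show ?thesis
        using q_bound[of y] True by (simp add: B_def mult.assoc power2_commute[of y])
    qed (use \<open>B \<ge> 0\<close> in \<open>auto simp: bump_def\<close>)
  qed
qed

text \<open>The product rule as a polynomial identity modulo \<open>Q * i = 1\<close>, for exponent
  0 and for a successor exponent. Here \<open>i\<close> stands for the reciprocal of the quadratic
  polynomial, \<open>j\<close> for its power and \<open>e\<close> for the exponential.\<close>

lemma bump_derivative_identity:
  fixes P P' Q Q' i j n e :: real
  assumes "Q * i = 1"
  shows "P' * e + e * (i * Q' * i) * P = (P' * (Q * Q) + P * Q') * (i * i) * e"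
    and "(P' * (i * j) - (1 + n) * (i * Q' * i * j) * P) * e + e * (i * Q' * i) * (P * (i * j))
      = (P' * (Q * Q) - (1 + n) * P * Q' * Q + P * Q') * (i * (i * (i * j))) * e"
  using assms by algebra+

lemma bump_has_derivative:
  assumes "a < b"
  shows "\<exists>p' k'. \<forall>x. (bump a b p k has_real_derivative bump a b p' k' x) (at x)"
proof -
  define q where "q = [:- a, 1:] * [:b, - 1:]"
  \<comment> \<open>The numerator of the derivative over the common denominator
    \<open>q ^ (k + 2)\<close>.\<close>
  define p' where "p' = pderiv p * q\<^sup>2 - of_nat k * p * pderiv q * q + p * pderiv q"
  have q: "(x - a) * (b - x) = poly q x" for x
    by (simp add: q_def algebra_simps)
  have "(bump a b p k has_real_derivative bump a b p' (k + 2) x) (at x)" for x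
  proof -
    consider "a < x" "x < b" | "x < a \<or> b < x" | "x = a \<or> x = b"
      using assms by linarith
    then show ?thesis
    proof cases
      case 1
      then have q0: "poly q x \<noteq> 0"
        unfolding q[symmetric] by simp
      let ?i = "\<lambda>x. inverse (poly q x)"
      have di: "(?i has_real_derivative - (?i x * poly (pderiv q) x * ?i x)) (at x)"
        using DERIV_inverse'[OF poly_DERIV q0] by simp
      have "((\<lambda>x. poly p x * ?i x ^ k * exp (- ?i x)) has_real_derivative
          (poly (pderiv p) x * ?i x ^ k + of_nat k * (- (?i x * poly (pderiv q) x * ?i x) * ?i x ^ (k - Suc 0)) * poly p x) * exp (- ?i x)
          + exp (- ?i x) * (- (- (?i x * poly (pderiv q) x * ?i x))) * (poly p x * ?i x ^ k)) (at x)"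
        by (intro DERIV_mult DERIV_power di poly_DERIV DERIV_fun_exp DERIV_minus)
      also have "(poly (pderiv p) x * ?i x ^ k + of_nat k * (- (?i x * poly (pderiv q) x * ?i x) * ?i x ^ (k - Suc 0)) * poly p x) * exp (- ?i x)
          + exp (- ?i x) * (- (- (?i x * poly (pderiv q) x * ?i x))) * (poly p x * ?i x ^ k)
          = poly p' x * ?i x ^ (k + 2) * exp (- ?i x)"
      proof -
        have qi: "poly q x * ?i x = 1" using q0 by simp
        show ?thesis
        proof (cases k)
          case 0
          show ?thesis
            unfolding p'_def 0 using qi bump_derivative_identity(1)[of "poly q x" "?i x"]
            by (simp add: power2_eq_square)
        next
          case (Suc m)
          show ?thesis
            unfolding p'_def Suc using bump_derivative_identity(2)[OF qi, where j = "?i x ^ m"]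
            by (simp add: power2_eq_square)
        qed
      qed
      finally have "((\<lambda>x. poly p x * ?i x ^ k * exp (- ?i x)) has_real_derivative bump a b p' (k + 2) x) (at x)"
        using 1 by (simp add: bump_def q divide_inverse power_inverse)
      then show ?thesis
        by (rule has_field_derivative_transform_within_open[of _ _ _ "{a<..<b}"])
          (use 1 in \<open>auto simp: bump_def q divide_inverse power_inverse\<close>)
    next
      case 2
      then have "bump a b p' (k + 2) x = 0"
        by (auto simp: bump_def)
      then have "((\<lambda>_. 0) has_real_derivative bump a b p' (k + 2) x) (at x)"
        by (simp only: DERIV_const)
      then show ?thesis
        by (rule has_field_derivative_transform_within_open[of _ _ _ "{..<a} \<union> {b<..}"]) (use 2 in \<open>auto simp: bump_def\<close>)
    next
      case 3
      obtain B where B: "\<And>y. \<bar>bump a b p k y\<bar> \<le> B * (y - a)\<^sup>2" "\<And>y. \<bar>bump a b p k y\<bar> \<le> B * (y - b)\<^sup>2"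
        by (rule bump_quadratic_bound[OF assms]) blast
      have "(bump a b p k has_real_derivative 0) (at x)"
        using 3
      proof
        assume "x = a"
        then show ?thesis
          using B(1) by (intro has_real_derivative_0_if_quadratic[of _ _ B]) (simp_all add: bump_def[of a b p k a])
      next
        assume "x = b"
        then show ?thesis
          using B(2) by (intro has_real_derivative_0_if_quadratic[of _ _ B]) (simp_all add: bump_def[of a b p k b])
      qed
      moreover have "bump a b p' (k + 2) x = 0"
        using 3 by (auto simp: bump_def)
      ultimately show ?thesis by simp
    qed
  qed
  then show ?thesis by blast
qed

section \<open>Smooth steps and the lemma of du Bois-Reymond\<close>

definition smooth :: "(real \<Rightarrow> real) \<Rightarrow> bool"
  where "smooth f \<longleftrightarrow> (\<forall>n x. (deriv ^^ n) f field_differentiable at x)"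

lemma smooth_bump:
  assumes "a < b"
  shows "smooth (bump a b p k)"
proof -
  have "\<exists>p' k'. (deriv ^^ n) (bump a b p k) = bump a b p' k'" for n
  proof (induction n)
    case 0
    show ?case by auto
  next
    case (Suc n)
    then obtain p' k' where *: "(deriv ^^ n) (bump a b p k) = bump a b p' k'" by blast
    obtain p'' k'' where "\<And>x. (bump a b p' k' has_real_derivative bump a b p'' k'' x) (at x)"
      using bump_has_derivative[OF assms] by blast
    then have "deriv (bump a b p' k') = bump a b p'' k''"
      by (intro ext DERIV_imp_deriv)
    then show ?case by (auto simp: *)
  qed
  then show ?thesis
    unfolding smooth_def field_differentiable_def using bump_has_derivative[OF assms] by metis
qed

lemma smooth_linear_combination:
  assumes f: "smooth f" and g: "smooth g"
  shows "smooth (\<lambda>x. c * f x + d * g x)"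
proof -
  have eq: "(deriv ^^ n) (\<lambda>x. c * f x + d * g x) = (\<lambda>x. c * (deriv ^^ n) f x + d * (deriv ^^ n) g x)" for n
  proof (induction n)
    case (Suc n)
    have "deriv (\<lambda>x. c * (deriv ^^ n) f x + d * (deriv ^^ n) g x) x = c * deriv ((deriv ^^ n) f) x + d * deriv ((deriv ^^ n) g) x" for x
    proof (rule DERIV_imp_deriv)
      have "DERIV ((deriv ^^ n) f) x :> deriv ((deriv ^^ n) f) x" "DERIV ((deriv ^^ n) g) x :> deriv ((deriv ^^ n) g) x"
        using f g unfolding smooth_def by (blast intro: field_differentiable_derivI)+
      then show "DERIV (\<lambda>x. c * (deriv ^^ n) f x + d * (deriv ^^ n) g x) x :> c * deriv ((deriv ^^ n) f) x + d * deriv ((deriv ^^ n) g) x"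
        by (auto intro!: derivative_eq_intros)
    qed
    then show ?case
      by (simp add: Suc)
  qed simp
  show ?thesis
    unfolding smooth_def eq using f g
    by (intro allI field_differentiable_add field_differentiable_mult field_differentiable_const) (auto simp: smooth_def)
qed

lemma smooth_antiderivative:
  assumes f: "smooth f" and F: "\<And>x. (F has_real_derivative f x) (at x)"
  shows "smooth F" "deriv F = f"
proof -
  show F': "deriv F = f"
    using F by (intro ext DERIV_imp_deriv)
  show "smooth F"
    unfolding smooth_def
  proof (intro allI)
    fix n x
    show "(deriv ^^ n) F field_differentiable at x"
    proof (cases n)
      case 0
      then show ?thesis
        using F by (auto simp: field_differentiable_def)
    next
      case (Suc m)
      then have "(deriv ^^ n) F = (deriv ^^ m) f"
        by (simp add: funpow_Suc_right F' del: funpow.simps)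
      then show ?thesis
        using f by (simp add: smooth_def)
    qed
  qed
qed

lemma smooth_continuous: "smooth f \<Longrightarrow> isCont f x"
  unfolding smooth_def by (metis field_differentiable_imp_continuous_at funpow_0)

lemma smooth_step_exists:
  fixes a \<epsilon> :: real
  assumes "\<epsilon> > 0"
  obtains \<rho> P where "smooth \<rho>" "smooth P" "\<And>x. \<rho> x \<ge> 0" "\<And>x. x \<notin> {a<..<a + \<epsilon>} \<Longrightarrow> \<rho> x = 0"
    "\<And>x. (P has_real_derivative \<rho> x) (at x)" "\<And>x. x \<le> a \<Longrightarrow> P x = 0" "\<And>x. x \<ge> a + \<epsilon> \<Longrightarrow> P x = 1"
    "integrable lborel \<rho>" "(\<integral>x. \<rho> x \<partial>lborel) = 1"
proof -
  define r where "r = bump a (a + \<epsilon>) 1 0"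
  have sr: "smooth r"
    unfolding r_def using assms by (intro smooth_bump) simp
  have r0: "r x \<ge> 0" "x \<notin> {a<..<a + \<epsilon>} \<Longrightarrow> r x = 0" "x \<in> {a<..<a + \<epsilon>} \<Longrightarrow> r x > 0" for x
    by (auto simp: r_def bump_def)
  have cont: "continuous_on S r" for S
    using smooth_continuous[OF sr] by (intro continuous_at_imp_continuous_on) auto
  have int: "r integrable_on {u..v}" for u v
    by (intro integrable_continuous_interval cont)
  define I where "I = integral {a..a + \<epsilon>} r"
  have "I \<noteq> 0"
  proof
    assume "I = 0"
    then have "(r has_integral 0) (cbox a (a + \<epsilon>))"
      using integrable_integral[OF int, of a "a + \<epsilon>"] by (simp add: I_def)
    then have "r (a + \<epsilon> / 2) = 0"
      using assms r0 cont by (intro has_integral_0_cbox_imp_0[of a "a + \<epsilon>" r]) auto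
    with r0(3)[of "a + \<epsilon> / 2"] assms show False by auto
  qed
  \<comment> \<open>Starting at \<open>a - 1\<close>, where \<open>r\<close> already vanishes, puts
    \<open>a\<close> into the interior of the interval, so the derivative there is
    two-sided.\<close>
  define Q where "Q x = integral {a - 1..x} r" for x
  have Q0: "Q x = 0" if "x \<le> a" for x
    unfolding Q_def using that
    by (intro Henstock_Kurzweil_Integration.integral_unique has_integral_is_0 r0(2)) auto
  have QI: "Q x = I" if "x \<ge> a + \<epsilon>" for x
  proof -
    have "Q x = integral {a - 1..a} r + integral {a..x} r"
      unfolding Q_def using that assms by (intro Henstock_Kurzweil_Integration.integral_combine[symmetric] int) auto
    also have "integral {a..x} r = I + integral {a + \<epsilon>..x} r"
      unfolding I_def using that assms by (intro Henstock_Kurzweil_Integration.integral_combine[symmetric] int) auto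
    also have "integral {a + \<epsilon>..x} r = 0"
      by (intro Henstock_Kurzweil_Integration.integral_unique has_integral_is_0 r0(2)) auto
    also have "integral {a - 1..a} r = 0"
      by (intro Henstock_Kurzweil_Integration.integral_unique has_integral_is_0 r0(2)) auto
    finally show ?thesis by simp
  qed
  have dQ: "(Q has_real_derivative r x) (at x)" for x
  proof (cases "x < a")
    case True
    have "((\<lambda>_. 0) has_real_derivative r x) (at x)"
      using r0(2)[of x] True by simp
    then show ?thesis
      by (rule has_field_derivative_transform_within_open[of _ _ _ "{..<a}"]) (use True Q0 in auto)
  next
    case False
    have "(Q has_real_derivative r x) (at x within {a - 1..x + 1})"
      unfolding Q_def using False by (intro integral_has_real_derivative cont) auto
    moreover have "at x within {a - 1..x + 1} = at x"
      using False by (intro at_within_Icc_at) auto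
    ultimately show ?thesis by simp
  qed
  define \<rho> P where "\<rho> x = inverse I * r x" and "P x = inverse I * Q x" for x
  have "I > 0"
  proof -
    have "I \<ge> 0"
      unfolding I_def by (intro Henstock_Kurzweil_Integration.integral_nonneg int r0)
    with \<open>I \<noteq> 0\<close> show ?thesis by simp
  qed
  have s\<rho>: "smooth \<rho>"
    using smooth_linear_combination[OF sr sr, of "inverse I" 0] by (simp add: \<rho>_def[abs_def])
  have dP: "(P has_real_derivative \<rho> x) (at x)" for x
    unfolding P_def[abs_def] \<rho>_def using dQ by (rule DERIV_cmult)
  have set: "set_integrable lborel {a..a + \<epsilon>} r"
    by (rule borel_integrable_atLeastAtMost') (rule cont)
  have ind: "indicator {a..a + \<epsilon>} x *\<^sub>R r x = r x" for x
    using r0(2)[of x] by (auto split: split_indicator)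
  have "integrable lborel r"
    using set by (simp only: set_integrable_def ind)
  moreover have "(\<integral>x. r x \<partial>lborel) = I"
    using set_borel_integral_eq_integral(2)[OF set] unfolding set_lebesgue_integral_def ind I_def .
  ultimately have "integrable lborel \<rho>" "(\<integral>x. \<rho> x \<partial>lborel) = 1"
    using \<open>I > 0\<close> by (simp_all add: \<rho>_def[abs_def])
  then show ?thesis
    using \<open>I > 0\<close> r0 Q0 QI
    by (intro that[of \<rho> P] s\<rho> smooth_antiderivative(1)[OF s\<rho> dP] dP) (auto simp: \<rho>_def P_def)
qed

text \<open>\<open>\<rho>\<close> is a normalised bump just to the right of \<open>c\<close>, so its
  integral against \<open>h\<close> averages values near \<open>h c\<close>. The antiderivative
  \<open>P\<close> is the material from which a test function with this derivative is made.\<close>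

lemma smooth_step_approximates:
  fixes h :: "real \<Rightarrow> complex"
  assumes h: "\<And>x. isCont h x" and "\<delta> > 0"
  obtains \<rho> P R where "smooth P" "\<And>x. (P has_real_derivative \<rho> x) (at x)"
    "\<And>x. x \<le> c \<Longrightarrow> P x = 0" "\<And>x. x \<ge> R \<Longrightarrow> P x = 1" "integrable lborel (\<lambda>x. of_real (\<rho> x) * h x)"
    "cmod ((\<integral>x. of_real (\<rho> x) * h x \<partial>lborel) - h c) \<le> \<delta>"
proof -
  have [measurable]: "h \<in> borel_measurable borel"
    using h by (intro borel_measurable_continuous_onI continuous_at_imp_continuous_on) auto
  have near: "\<exists>\<epsilon>>0. \<forall>x. \<bar>x - c\<bar> \<le> \<epsilon> \<longrightarrow> cmod (h x - h c) \<le> \<delta>"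
  proof -
    obtain e where "e > 0" "\<And>x. dist x c < e \<Longrightarrow> dist (h x) (h c) < \<delta>"
      using h[of c] \<open>\<delta> > 0\<close> unfolding continuous_at_eps_delta by metis
    then show ?thesis
      by (intro exI[of _ "e / 2"]) (force simp: dist_norm intro: less_imp_le)
  qed
  obtain \<epsilon> where \<epsilon>: "\<epsilon> > 0" "\<And>x. \<bar>x - c\<bar> \<le> \<epsilon> \<Longrightarrow> cmod (h x - h c) \<le> \<delta>"
    using near by blast
  obtain \<rho> P where \<rho>: "smooth \<rho>" "smooth P" "\<And>x. \<rho> x \<ge> 0" "\<And>x. x \<notin> {c<..<c + \<epsilon>} \<Longrightarrow> \<rho> x = 0"
      "\<And>x. (P has_real_derivative \<rho> x) (at x)" "\<And>x. x \<le> c \<Longrightarrow> P x = 0" "\<And>x. x \<ge> c + \<epsilon> \<Longrightarrow> P x = 1"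
      "integrable lborel \<rho>" "(\<integral>x. \<rho> x \<partial>lborel) = 1"
    by (rule smooth_step_exists[OF \<epsilon>(1)]) blast
  have [measurable]: "\<rho> \<in> borel_measurable borel"
    using \<rho>(8) by auto
  have le: "cmod (of_real (\<rho> x) * (h x - h c)) \<le> \<rho> x * \<delta>" for x
  proof (cases "x \<in> {c<..<c + \<epsilon>}")
    case True
    then have "cmod (h x - h c) \<le> \<delta>" by (intro \<epsilon>) auto
    then show ?thesis
      using \<rho>(3)[of x] by (simp add: norm_mult mult_left_mono)
  qed (simp add: \<rho>(4))
  have i1: "integrable lborel (\<lambda>x. of_real (\<rho> x) * (h x - h c))"
  proof (rule Bochner_Integration.integrable_bound)
    show "integrable lborel (\<lambda>x. \<rho> x * \<delta>)"
      using \<rho>(8) by simp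
    show "AE x in lborel. norm (of_real (\<rho> x) * (h x - h c)) \<le> norm (\<rho> x * \<delta>)"
      using le by (intro AE_I2) (auto intro: order_trans abs_ge_self)
  qed measurable
  have i2: "integrable lborel (\<lambda>x. of_real (\<rho> x) * h c)"
    using \<rho>(8) by (intro integrable_mult_left) (simp add: integrable_of_real)
  have i: "integrable lborel (\<lambda>x. of_real (\<rho> x) * h x)"
    using Bochner_Integration.integrable_add[OF i1 i2] by (simp add: algebra_simps)
  have "(\<integral>x. of_real (\<rho> x) * h c \<partial>lborel) = h c"
    using \<rho>(9) by (simp add: integral_complex_of_real)
  then have "(\<integral>x. of_real (\<rho> x) * h x \<partial>lborel) - h c = (\<integral>x. of_real (\<rho> x) * (h x - h c) \<partial>lborel)"
    using Bochner_Integration.integral_diff[OF i i2] by (simp add: right_diff_distrib)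
  also have "cmod \<dots> \<le> (\<integral>x. \<rho> x * \<delta> \<partial>lborel)"
    using \<rho>(8) le by (intro Bochner_Integration.integral_norm_bound_integral i1) auto
  also have "\<dots> = \<delta>"
    by (simp add: \<rho>(9))
  finally show ?thesis
    using that[OF \<rho>(2,5,6,7) i] by blast
qed

text \<open>The difference of a smooth step at \<open>a\<close> and one at \<open>b\<close> has
  compact support, since the constants cancel on the right. Its derivative compares the average of
  \<open>h\<close> near \<open>a\<close> with that near \<open>b\<close>.\<close>

lemma du_Bois_Reymond:
  fixes h :: "real \<Rightarrow> complex"
  assumes h: "\<And>x. isCont h x" and zero: "\<And>\<phi>. test_function \<phi> \<Longrightarrow> (\<integral>x. of_real (deriv \<phi> x) * h x \<partial>lborel) = 0"
  shows "h a = h b"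
proof -
  have "cmod (h a - h b) \<le> 2 * \<delta>" if "\<delta> > 0" for \<delta>
  proof -
    obtain \<rho>1 P1 R1 where 1: "smooth P1" "\<And>x. (P1 has_real_derivative \<rho>1 x) (at x)"
        "\<And>x. x \<le> a \<Longrightarrow> P1 x = 0" "\<And>x. x \<ge> R1 \<Longrightarrow> P1 x = 1" "integrable lborel (\<lambda>x. of_real (\<rho>1 x) * h x)"
        "cmod ((\<integral>x. of_real (\<rho>1 x) * h x \<partial>lborel) - h a) \<le> \<delta>"
      by (rule smooth_step_approximates[OF h \<open>\<delta> > 0\<close>, of a]) blast
    obtain \<rho>2 P2 R2 where 2: "smooth P2" "\<And>x. (P2 has_real_derivative \<rho>2 x) (at x)"
        "\<And>x. x \<le> b \<Longrightarrow> P2 x = 0" "\<And>x. x \<ge> R2 \<Longrightarrow> P2 x = 1" "integrable lborel (\<lambda>x. of_real (\<rho>2 x) * h x)"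
        "cmod ((\<integral>x. of_real (\<rho>2 x) * h x \<partial>lborel) - h b) \<le> \<delta>"
      by (rule smooth_step_approximates[OF h \<open>\<delta> > 0\<close>, of b]) blast
    define \<phi> where "\<phi> x = 1 * P1 x + (-1) * P2 x" for x
    have d\<phi>: "deriv \<phi> x = \<rho>1 x - \<rho>2 x" for x
      unfolding \<phi>_def[abs_def] by (rule DERIV_imp_deriv) (auto intro!: derivative_eq_intros 1(2) 2(2))
    have "{x. \<phi> x \<noteq> 0} \<subseteq> {min a b..max R1 R2}"
    proof (rule subsetI, rule ccontr)
      fix x assume "x \<in> {x. \<phi> x \<noteq> 0}" "x \<notin> {min a b..max R1 R2}"
      then have "\<phi> x \<noteq> 0" "x \<le> a \<and> x \<le> b \<or> R1 \<le> x \<and> R2 \<le> x"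
        by auto
      then show False
        using 1(3,4)[of x] 2(3,4)[of x] by (auto simp: \<phi>_def)
    qed
    then have "bounded {x. \<phi> x \<noteq> 0}"
      by (rule bounded_subset[rotated]) simp
    then have "compact (closure {x. \<phi> x \<noteq> 0})"
      by (simp add: compact_closure)
    moreover have "smooth \<phi>"
      unfolding \<phi>_def[abs_def] by (rule smooth_linear_combination[OF 1(1) 2(1)])
    ultimately have "test_function \<phi>"
      by (simp add: test_function_def smooth_def)
    from zero[OF this] have "(\<integral>x. of_real (\<rho>1 x) * h x - of_real (\<rho>2 x) * h x \<partial>lborel) = 0"
      by (simp add: d\<phi> left_diff_distrib)
    then have "(\<integral>x. of_real (\<rho>1 x) * h x \<partial>lborel) = (\<integral>x. of_real (\<rho>2 x) * h x \<partial>lborel)"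
      by (simp add: Bochner_Integration.integral_diff[OF 1(5) 2(5)])
    then have "h a - h b = ((\<integral>x. of_real (\<rho>2 x) * h x \<partial>lborel) - h b) - ((\<integral>x. of_real (\<rho>1 x) * h x \<partial>lborel) - h a)"
      by simp
    then show ?thesis
      using 1(6) 2(6) norm_triangle_ineq4[of "(\<integral>x. of_real (\<rho>2 x) * h x \<partial>lborel) - h b" "(\<integral>x. of_real (\<rho>1 x) * h x \<partial>lborel) - h a"]
      by simp
  qed
  note le = this
  have "cmod (h a - h b) \<le> 0"
  proof (rule field_le_epsilon)
    fix e :: real assume "e > 0"
    then show "cmod (h a - h b) \<le> 0 + e"
      using le[of "e / 2"] by simp
  qed
  then show ?thesis by simp
qed

subsection \<open>The model operator\<close>

text \<open>Compact support is recast as exponential decay, the shape in which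
  \<open>Fubini_primitive\<close> and \<open>integral_scaleR_component\<close> take their
  hypothesis.\<close>

lemma test_functionD:
  assumes "test_function \<phi>"
  shows "(\<phi> has_real_derivative deriv \<phi> x) (at x)" "isCont (deriv \<phi>) x"
    and "\<exists>B. \<forall>x. \<bar>\<phi> x\<bar> \<le> B * exp (- 1 * \<bar>x\<bar>)" "\<exists>B. \<forall>x. \<bar>deriv \<phi> x\<bar> \<le> B * exp (- 1 * \<bar>x\<bar>)"
    and "(\<phi> \<longlongrightarrow> 0) at_bot" "(\<phi> \<longlongrightarrow> 0) at_top"
proof -
  have diff: "(deriv ^^ n) \<phi> field_differentiable at x" for n x
    using assms by (simp add: test_function_def)
  show d: "(\<phi> has_real_derivative deriv \<phi> x) (at x)" for x
    using diff[of 0 x] by (simp add: field_differentiable_derivI)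
  have c1: "isCont (deriv \<phi>) x" for x
    using diff[of 1 x] by (simp add: field_differentiable_imp_continuous_at)
  then show "isCont (deriv \<phi>) x" .
  have "bounded {x. \<phi> x \<noteq> 0}"
    using assms by (simp add: test_function_def compact_closure)
  then obtain L where L: "\<And>x. \<phi> x \<noteq> 0 \<Longrightarrow> \<bar>x\<bar> \<le> L"
    by (auto simp: bounded_iff)
  have z: "\<phi> x = 0" if "\<bar>x\<bar> > L" for x
    using L that by fastforce
  have dz: "deriv \<phi> x = 0" if "\<bar>x\<bar> > L" for x
  proof (rule DERIV_imp_deriv)
    have "((\<lambda>_. 0) has_real_derivative 0) (at x)" by simp
    then show "(\<phi> has_real_derivative 0) (at x)"
    proof (rule has_field_derivative_transform_within_open[of _ _ _ "{y. \<bar>y\<bar> > L}"])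
      show "open {y. \<bar>y\<bar> > L}"
        by (intro open_Collect_less continuous_intros)
    qed (use that z in auto)
  qed
  have bound: "\<exists>B. \<forall>x. \<bar>f x\<bar> \<le> B * exp (- 1 * \<bar>x\<bar>)" if f: "\<And>x. isCont f x" "\<And>x. \<bar>x\<bar> > L \<Longrightarrow> f x = 0" for f :: "real \<Rightarrow> real"
  proof -
    have "compact (f ` {- L..L})"
      using f(1) by (intro compact_continuous_image continuous_at_imp_continuous_on) auto
    then obtain M where "M > 0" "\<forall>z\<in>f ` {- L..L}. norm z \<le> M"
      using compact_imp_bounded bounded_pos by metis
    then have M: "M > 0" "\<And>x. x \<in> {- L..L} \<Longrightarrow> \<bar>f x\<bar> \<le> M"
      by auto
    have "\<bar>f x\<bar> \<le> (M * exp L) * exp (- 1 * \<bar>x\<bar>)" for x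
    proof (cases "\<bar>x\<bar> > L")
      case False
      then have "x \<in> {- L..L}" by auto
      then have "\<bar>f x\<bar> \<le> M * 1"
        using M(2) by simp
      also have "\<dots> \<le> M * exp (L - \<bar>x\<bar>)"
        using False M(1) by (intro mult_left_mono) auto
      also have "\<dots> = (M * exp L) * exp (- 1 * \<bar>x\<bar>)"
        by (simp add: mult.assoc exp_add[symmetric])
      finally show ?thesis .
    qed (use f(2) M(1) in auto)
    then show ?thesis by blast
  qed
  show "\<exists>B. \<forall>x. \<bar>\<phi> x\<bar> \<le> B * exp (- 1 * \<bar>x\<bar>)"
    using d z by (intro bound DERIV_isCont) auto
  show "\<exists>B. \<forall>x. \<bar>deriv \<phi> x\<bar> \<le> B * exp (- 1 * \<bar>x\<bar>)"
    using c1 dz by (intro bound) auto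
  have "\<forall>\<^sub>F x in at_bot. \<phi> x = 0"
    using eventually_le_at_bot[of "- L - 1"] by eventually_elim (rule z, linarith)
  then show "(\<phi> \<longlongrightarrow> 0) at_bot"
    by (rule tendsto_eventually)
  have "\<forall>\<^sub>F x in at_top. \<phi> x = 0"
    using eventually_gt_at_top[of L] by eventually_elim (rule z, linarith)
  then show "(\<phi> \<longlongrightarrow> 0) at_top"
    by (rule tendsto_eventually)
qed

lemma test_function_signed_kernel:
  assumes \<phi>: "test_function \<phi>"
  shows "(\<integral>x. of_real (deriv \<phi> x) * signed_kernel x t \<partial>lborel) = - of_real (\<phi> t)"
proof -
  let ?f = "\<lambda>x. of_real (deriv \<phi> x) :: complex" and ?F = "\<lambda>x. of_real (\<phi> x) :: complex"
  note D = test_functionD[OF \<phi>]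
  note [measurable] = test_function_measurable[OF \<phi>]
  obtain B where B: "\<And>x. \<bar>deriv \<phi> x\<bar> \<le> B * exp (- 1 * \<bar>x\<bar>)"
    using D(4) by blast
  have "integrable lborel ?f"
  proof (rule Bochner_Integration.integrable_bound)
    show "integrable lborel (\<lambda>x. B * exp (- 1 * \<bar>x\<bar>))"
      by (intro integrable_mult_right integrable_exp_abs) simp
    show "AE x in lborel. norm (?f x) \<le> norm (B * exp (- 1 * \<bar>x\<bar>))"
      using B by (intro AE_I2) (auto intro: order_trans abs_ge_self)
  qed measurable
  then have int: "integrable lborel (\<lambda>x. indicator A x *\<^sub>R ?f x)" if "A \<in> sets borel" for A
    using that by (intro integrable_mult_indicator) auto
  have dF: "(?F has_vector_derivative ?f x) (at x)" for x
    using D(1)[of x] unfolding has_real_derivative_iff_has_vector_derivative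
    by (rule bounded_linear.has_vector_derivative[OF bounded_linear_of_real])
  have cf: "isCont ?f x" for x
    using D(2)[of x] by (intro continuous_of_real)
  have lim: "(?F \<longlongrightarrow> 0) at_bot" "(?F \<longlongrightarrow> 0) at_top"
    using tendsto_of_real[OF D(5)] tendsto_of_real[OF D(6)] by auto
  show ?thesis
  proof (cases "0 \<le> t")
    case True
    then have "?f x * signed_kernel x t = indicator {t<..} x *\<^sub>R ?f x" for x
      by (auto simp: signed_kernel_def split: split_indicator)
    then have "(\<integral>x. ?f x * signed_kernel x t \<partial>lborel) = (\<integral>x. indicator {t<..} x *\<^sub>R ?f x \<partial>lborel)"
      by (intro Bochner_Integration.integral_cong) auto
    then show ?thesis
      using integral_Ioi_FTC[OF dF cf int lim(2), of t] by simp
  next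
    case False
    then have "?f x * signed_kernel x t = - (indicator {..<t} x *\<^sub>R ?f x)" for x
      by (auto simp: signed_kernel_def split: split_indicator)
    then have "(\<integral>x. ?f x * signed_kernel x t \<partial>lborel) = - (\<integral>x. indicator {..<t} x *\<^sub>R ?f x \<partial>lborel)"
      unfolding integral_minus[symmetric] by (intro Bochner_Integration.integral_cong) auto
    then show ?thesis
      using integral_Iio_FTC[OF dF cf int lim(1), of t] by simp
  qed
qed

lemma integral_test_function_primitive:
  assumes \<phi>: "test_function \<phi>" and v: "square_integrable1 v"
  shows "integrable lborel (\<lambda>x. of_real (deriv \<phi> x) * primitive v x)"
    and "(\<integral>x. of_real (deriv \<phi> x) * primitive v x \<partial>lborel) = - (\<integral>x. of_real (\<phi> x) * v x \<partial>lborel)"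
proof -
  note [measurable] = test_function_measurable[OF \<phi>]
  obtain B where B: "\<And>x. \<bar>deriv \<phi> x\<bar> \<le> B * exp (- 1 * \<bar>x\<bar>)"
    using test_functionD(4)[OF \<phi>] by blast
  have meas: "(\<lambda>x. of_real (deriv \<phi> x) :: complex) \<in> borel_measurable borel"
    by measurable
  have bound: "cmod (of_real (deriv \<phi> x)) \<le> B * exp (- 1 * \<bar>x\<bar>)" for x
    using B by simp
  note F = Fubini_primitive[OF meas bound zero_less_one v]
  show "integrable lborel (\<lambda>x. of_real (deriv \<phi> x) * primitive v x)"
    by (rule F(1))
  show "(\<integral>x. of_real (deriv \<phi> x) * primitive v x \<partial>lborel) = - (\<integral>x. of_real (\<phi> x) * v x \<partial>lborel)"
    unfolding F(2) test_function_signed_kernel[OF \<phi>] by (simp add: mult.commute)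
qed

lemma square_integrable_component:
  assumes "square_integrable f"
  shows "square_integrable1 (\<lambda>x. f x $ k)"
  unfolding square_integrable1_def
proof
  have [measurable]: "f \<in> borel_measurable borel"
    using assms by (simp add: square_integrable_def)
  show "(\<lambda>x. f x $ k) \<in> borel_measurable borel"
    by measurable
  show "integrable lborel (\<lambda>x. (cmod (f x $ k))\<^sup>2)"
  proof (rule Bochner_Integration.integrable_bound)
    show "integrable lborel (\<lambda>x. (norm (f x))\<^sup>2)"
      using assms by (simp add: square_integrable_def)
    show "AE x in lborel. norm ((cmod (f x $ k))\<^sup>2) \<le> norm ((norm (f x))\<^sup>2)"
      by (intro AE_I2) (simp add: Finite_Cartesian_Product.norm_nth_le power_mono)
  qed measurable
qed

lemma integral_scaleR_component:
  assumes f: "square_integrable f" and [measurable]: "\<psi> \<in> borel_measurable borel"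
    and B: "\<And>x. \<bar>\<psi> x\<bar> \<le> B * exp (- 1 * \<bar>x\<bar>)"
  shows "(\<integral>x. \<psi> x *\<^sub>R f x \<partial>lborel) $ k = (\<integral>x. of_real (\<psi> x) * f x $ k \<partial>lborel)"
    and "integrable lborel (\<lambda>x. of_real (\<psi> x) * f x $ k)"
proof -
  have [measurable]: "f \<in> borel_measurable borel"
    using f by (simp add: square_integrable_def)
  have "B \<ge> 0"
    using order_trans[OF abs_ge_zero B[of 0]] by simp
  have comp: "integrable lborel (\<lambda>x. of_real (\<psi> x) * f x $ k)" for k
  proof (rule Bochner_Integration.integrable_bound)
    show "integrable lborel (\<lambda>x. B * (exp (- 1 * \<bar>x\<bar>) * cmod (f x $ k)))"
      by (intro integrable_mult_right integrable_exp_times_L2 square_integrable_component f) simp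
    show "AE x in lborel. norm (of_real (\<psi> x) * f x $ k) \<le> norm (B * (exp (- 1 * \<bar>x\<bar>) * cmod (f x $ k)))"
    proof (intro AE_I2)
      fix x
      show "norm (of_real (\<psi> x) * f x $ k) \<le> norm (B * (exp (- 1 * \<bar>x\<bar>) * cmod (f x $ k)))"
        using mult_right_mono[OF B[of x] norm_ge_zero[of "f x $ k"]] \<open>B \<ge> 0\<close>
        by (simp add: norm_mult abs_mult mult.assoc)
    qed
  qed measurable
  then show "integrable lborel (\<lambda>x. of_real (\<psi> x) * f x $ k)" .
  have nth: "(\<psi> x *\<^sub>R f x) $ k = of_real (\<psi> x) * f x $ k" for x k
    by (subst vector_scaleR_component) (rule scaleR_conv_of_real)
  have int: "integrable lborel (\<lambda>x. \<psi> x *\<^sub>R f x)"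
  proof (rule Bochner_Integration.integrable_bound)
    show "integrable lborel (\<lambda>x. \<Sum>k\<in>UNIV. norm (of_real (\<psi> x) * f x $ k))"
      by (intro Bochner_Integration.integrable_sum integrable_norm comp)
    show "AE x in lborel. norm (\<psi> x *\<^sub>R f x) \<le> norm (\<Sum>k\<in>UNIV. norm (of_real (\<psi> x) * f x $ k))"
    proof (intro AE_I2)
      fix x
      have "norm (\<psi> x *\<^sub>R f x) \<le> (\<Sum>k\<in>UNIV. norm ((\<psi> x *\<^sub>R f x) $ k))"
        unfolding norm_vec_def by (rule L2_set_le_sum) simp
      then show "norm (\<psi> x *\<^sub>R f x) \<le> norm (\<Sum>k\<in>UNIV. norm (of_real (\<psi> x) * f x $ k))"
        unfolding nth by (rule order_trans) simp
    qed
  qed measurable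
  show "(\<integral>x. \<psi> x *\<^sub>R f x \<partial>lborel) $ k = (\<integral>x. of_real (\<psi> x) * f x $ k \<partial>lborel)"
    using integral_bounded_linear[OF bounded_linear_vec_nth int, of k] by (simp only: nth)
qed

text \<open>Fubini's theorem shows that a primitive has the expected weak derivative. Conversely, du
  Bois-Reymond makes the continuous representative differ from the primitive by a constant, and the
  value at 0 fixes that constant.\<close>

lemma weak_derivative_iff_primitive:
  assumes u: "square_integrable u" and v: "square_integrable v"
  shows "(\<forall>\<phi>. test_function \<phi> \<longrightarrow> (\<integral>x. deriv \<phi> x *\<^sub>R u x \<partial>lborel) = - (\<integral>x. \<phi> x *\<^sub>R v x \<partial>lborel)) \<and>
      (\<exists>f. continuous_on UNIV f \<and> (AE x in lborel. f x = u x) \<and> f 0 = 0)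
    \<longleftrightarrow> (\<forall>k. AE x in lborel. u x $ k = primitive (\<lambda>t. v t $ k) x)"
proof -
  have [measurable]: "u \<in> borel_measurable borel"
    using u by (simp add: square_integrable_def)
  note vk = square_integrable_component[OF v]
  define w where "w x = (\<chi> k. primitive (\<lambda>t. v t $ k) x)" for x
  have contw: "isCont (primitive (\<lambda>t. v t $ k)) x" for k x
    by (rule continuous_primitive[OF vk])
  have [measurable]: "primitive (\<lambda>t. v t $ k) \<in> borel_measurable borel" for k
    using contw by (intro borel_measurable_continuous_onI continuous_at_imp_continuous_on) auto
  have comp: "((\<integral>x. deriv \<phi> x *\<^sub>R u x \<partial>lborel) = - (\<integral>x. \<phi> x *\<^sub>R v x \<partial>lborel)) \<longleftrightarrow>
      (\<forall>k. (\<integral>x. of_real (deriv \<phi> x) * u x $ k \<partial>lborel) = (\<integral>x. of_real (deriv \<phi> x) * primitive (\<lambda>t. v t $ k) x \<partial>lborel))"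
    if \<phi>: "test_function \<phi>" for \<phi>
  proof -
    obtain B B' where B: "\<And>x. \<bar>\<phi> x\<bar> \<le> B * exp (- 1 * \<bar>x\<bar>)" "\<And>x. \<bar>deriv \<phi> x\<bar> \<le> B' * exp (- 1 * \<bar>x\<bar>)"
      using test_functionD(3,4)[OF \<phi>] by blast
    show ?thesis
      unfolding vec_eq_iff integral_test_function_primitive(2)[OF \<phi> vk]
      by (simp add: integral_scaleR_component(1)[OF u test_function_measurable(2)[OF \<phi>] B(2)]
          integral_scaleR_component(1)[OF v test_function_measurable(1)[OF \<phi>] B(1)])
  qed
  show ?thesis
  proof
    assume ae: "\<forall>k. AE x in lborel. u x $ k = primitive (\<lambda>t. v t $ k) x"
    show "(\<forall>\<phi>. test_function \<phi> \<longrightarrow> (\<integral>x. deriv \<phi> x *\<^sub>R u x \<partial>lborel) = - (\<integral>x. \<phi> x *\<^sub>R v x \<partial>lborel)) \<and>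
      (\<exists>f. continuous_on UNIV f \<and> (AE x in lborel. f x = u x) \<and> f 0 = 0)"
    proof (intro conjI allI impI)
      fix \<phi> assume \<phi>: "test_function \<phi>"
      note [measurable] = test_function_measurable[OF \<phi>]
      show "(\<integral>x. deriv \<phi> x *\<^sub>R u x \<partial>lborel) = - (\<integral>x. \<phi> x *\<^sub>R v x \<partial>lborel)"
        unfolding comp[OF \<phi>]
      proof
        fix k
        show "(\<integral>x. of_real (deriv \<phi> x) * u x $ k \<partial>lborel) = (\<integral>x. of_real (deriv \<phi> x) * primitive (\<lambda>t. v t $ k) x \<partial>lborel)"
          using ae by (intro integral_cong_AE) (auto elim!: eventually_mono dest!: spec[of _ k])
      qed
    next
      have "AE x in lborel. \<forall>k\<in>UNIV. u x $ k = primitive (\<lambda>t. v t $ k) x"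
        using ae by (intro AE_finite_allI) auto
      then have "AE x in lborel. w x = u x"
        by eventually_elim (simp add: w_def vec_eq_iff)
      moreover have "continuous_on UNIV w"
        unfolding w_def[abs_def] using contw
        by (intro continuous_on_vec_lambda continuous_at_imp_continuous_on) auto
      moreover have "w 0 = 0"
        by (simp add: w_def vec_eq_iff)
      ultimately show "\<exists>f. continuous_on UNIV f \<and> (AE x in lborel. f x = u x) \<and> f 0 = 0"
        by blast
    qed
  next
    assume *: "(\<forall>\<phi>. test_function \<phi> \<longrightarrow> (\<integral>x. deriv \<phi> x *\<^sub>R u x \<partial>lborel) = - (\<integral>x. \<phi> x *\<^sub>R v x \<partial>lborel)) \<and>
      (\<exists>f. continuous_on UNIV f \<and> (AE x in lborel. f x = u x) \<and> f 0 = 0)"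
    then obtain f where f: "continuous_on UNIV f" "AE x in lborel. f x = u x" "f 0 = 0" by blast
    have contf: "isCont (\<lambda>x. f x $ k) x" for k x
      using f(1) by (intro continuous_intros) (simp add: continuous_on_eq_continuous_at)
    have [measurable]: "(\<lambda>x. f x $ k) \<in> borel_measurable borel" for k
      using contf by (intro borel_measurable_continuous_onI continuous_at_imp_continuous_on) auto
    show "\<forall>k. AE x in lborel. u x $ k = primitive (\<lambda>t. v t $ k) x"
    proof
      fix k
      let ?h = "\<lambda>x. f x $ k - primitive (\<lambda>t. v t $ k) x"
      have "?h x = ?h 0" for x
      proof (rule du_Bois_Reymond)
        show "isCont ?h x" for x
          by (intro continuous_intros contf contw)
        fix \<phi> assume \<phi>: "test_function \<phi>"
        note [measurable] = test_function_measurable[OF \<phi>]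
        obtain B' where B: "\<And>x. \<bar>deriv \<phi> x\<bar> \<le> B' * exp (- 1 * \<bar>x\<bar>)"
          using test_functionD(4)[OF \<phi>] by blast
        have "(\<integral>x. of_real (deriv \<phi> x) * ?h x \<partial>lborel)
            = (\<integral>x. of_real (deriv \<phi> x) * u x $ k - of_real (deriv \<phi> x) * primitive (\<lambda>t. v t $ k) x \<partial>lborel)"
          using f(2) by (intro integral_cong_AE) (auto elim!: eventually_mono simp: right_diff_distrib)
        also have "\<dots> = (\<integral>x. of_real (deriv \<phi> x) * u x $ k \<partial>lborel) - (\<integral>x. of_real (deriv \<phi> x) * primitive (\<lambda>t. v t $ k) x \<partial>lborel)"
          by (intro Bochner_Integration.integral_diff integral_test_function_primitive(1)[OF \<phi> vk]
              integral_scaleR_component(2)[OF u test_function_measurable(2)[OF \<phi>] B])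
        also have "\<dots> = 0"
          using * comp[OF \<phi>] \<phi> by simp
        finally show "(\<integral>x. of_real (deriv \<phi> x) * ?h x \<partial>lborel) = 0" .
      qed
      then have eq: "f x $ k = primitive (\<lambda>t. v t $ k) x" for x
        using f(3) by simp
      from f(2) show "AE x in lborel. u x $ k = primitive (\<lambda>t. v t $ k) x"
        by eventually_elim (simp flip: eq)
    qed
  qed
qed

lemma model_operator_iff:
  assumes y: "square_integrable y" and z: "square_integrable z"
  shows "(abs_L2 y, abs_L2 z) \<in> model_operator \<longleftrightarrow>
    (\<forall>k. AE x in lborel. y x $ k = primitive (\<lambda>t. - \<i> * z t $ k) x)"
proof -
  define v where "v x = (- \<i>) *\<^sub>C z x" for x
  have v: "square_integrable v"
    unfolding v_def using z by (rule square_integrable_scaleC)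
  have vz: "abs_L2 v = (- \<i>) *\<^sub>C abs_L2 z"
    unfolding v_def[abs_def] abs_L2_ops(3)[OF z z] ..
  have "abs_L2 z = \<i> *\<^sub>C w \<longleftrightarrow> w = abs_L2 v" for w
    unfolding vz by (auto simp: scaleC_scaleC scaleC_one)
  then have "(abs_L2 y, abs_L2 z) \<in> model_operator \<longleftrightarrow>
      has_weak_derivative (abs_L2 y) (abs_L2 v) \<and> vanishes_at (abs_L2 y) 0"
    by (auto simp: model_operator_def sobolev_W21_def)
  also have "\<dots> \<longleftrightarrow> (\<forall>k. AE x in lborel. y x $ k = primitive (\<lambda>t. v t $ k) x)"
    unfolding weak_derivative_iff_primitive[OF y v, symmetric]
    using y v by (simp add: has_weak_derivative.abs_eq vanishes_at.abs_eq L2_rel_refl_iff)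
  also have "(\<lambda>k t. v t $ k) = (\<lambda>k t. - \<i> * z t $ k)"
    by (simp add: v_def scaleC_vec_def scaleC_complex_def)
  then have "(\<forall>k. AE x in lborel. y x $ k = primitive (\<lambda>t. v t $ k) x) \<longleftrightarrow>
      (\<forall>k. AE x in lborel. y x $ k = primitive (\<lambda>t. - \<i> * z t $ k) x)"
    by (simp add: fun_eq_iff)
  finally show ?thesis .
qed

section \<open>The canonical family of the model operator\<close>

lemma cnj_primitive: "cnj (primitive v x) = primitive (\<lambda>t. cnj (v t)) x"
proof -
  have eq: "cnj (signed_kernel x t * v t) = signed_kernel x t * cnj (v t)" for t
    by (simp add: signed_kernel_def)
  show ?thesis
    unfolding primitive_def eq[symmetric]
    by (rule integral_bounded_linear'[OF bounded_linear_cnj bounded_linear_cnj, symmetric]) simp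
qed

lemma square_integrable1_cnj:
  assumes "square_integrable1 v"
  shows "square_integrable1 (\<lambda>x. cnj (v x))"
proof -
  have [measurable]: "v \<in> borel_measurable borel"
    using assms by (simp add: square_integrable1_def)
  have "(\<lambda>x. cnj (v x)) \<in> borel_measurable borel"
    by measurable
  then show ?thesis
    using assms by (simp add: square_integrable1_def)
qed

text \<open>The factor \<open>sqrt 2\<close> is a normalisation: \<open>half_exp \<i>\<close> has
  squared norm 1/2, whereas \<open>defect_kernel \<i> \<i>\<close> is 1.\<close>

definition model_family :: "complex \<Rightarrow> complex ^ 2 \<Rightarrow> real \<Rightarrow> complex ^ 2"
  where "model_family \<mu> c x = (of_real (sqrt 2) * half_exp \<mu> x) *\<^sub>C c"

lemma square_integrable_model_family:
  assumes "Im \<mu> \<noteq> 0"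
  shows "square_integrable (model_family \<mu> c)"
  unfolding square_integrable_def
proof
  have "continuous_on UNIV (\<lambda>z. z *\<^sub>C c)"
    unfolding scaleC_vec_def scaleC_complex_def by (intro continuous_intros)
  then have [measurable]: "(\<lambda>z. z *\<^sub>C c) \<in> borel_measurable borel"
    by (rule borel_measurable_continuous_onI)
  show meas: "model_family \<mu> c \<in> borel_measurable lborel"
    unfolding model_family_def[abs_def] by measurable
  show "integrable lborel (\<lambda>x. (norm (model_family \<mu> c x))\<^sup>2)"
  proof (rule Bochner_Integration.integrable_bound)
    show "integrable lborel (\<lambda>x. (2 * (norm c)\<^sup>2) * exp (- (2 * \<bar>Im \<mu>\<bar>) * \<bar>x\<bar>))"
      using assms by (intro integrable_mult_right integrable_exp_abs) simp
    show "AE x in lborel. norm ((norm (model_family \<mu> c x))\<^sup>2) \<le> norm ((2 * (norm c)\<^sup>2) * exp (- (2 * \<bar>Im \<mu>\<bar>) * \<bar>x\<bar>))"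
    proof (intro AE_I2)
      fix x
      have "(cmod (half_exp \<mu> x))\<^sup>2 \<le> (exp (- \<bar>Im \<mu>\<bar> * \<bar>x\<bar>))\<^sup>2"
        by (intro power_mono norm_half_exp_le) simp
      also have "\<dots> = exp (- (2 * \<bar>Im \<mu>\<bar>) * \<bar>x\<bar>)"
        by (simp add: power2_eq_square exp_add[symmetric])
      finally have "(2 * (norm c)\<^sup>2) * (cmod (half_exp \<mu> x))\<^sup>2 \<le> (2 * (norm c)\<^sup>2) * exp (- (2 * \<bar>Im \<mu>\<bar>) * \<bar>x\<bar>)"
        by (intro mult_left_mono) auto
      then show "norm ((norm (model_family \<mu> c x))\<^sup>2) \<le> norm ((2 * (norm c)\<^sup>2) * exp (- (2 * \<bar>Im \<mu>\<bar>) * \<bar>x\<bar>))"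
        by (simp add: model_family_def norm_mult power_mult_distrib mult_ac)
    qed
  qed (use meas in measurable)
qed

lemma cinner_model_family:
  assumes g: "square_integrable g" and "Im \<mu> \<noteq> 0"
  shows "cinner (abs_L2 (model_family \<mu> c)) (abs_L2 g) =
    of_real (sqrt 2) * (\<Sum>k\<in>UNIV. c $ k * (\<integral>x. half_exp \<mu> x * cnj (g x $ k) \<partial>lborel))"
proof -
  have int: "integrable lborel (\<lambda>x. half_exp \<mu> x * cnj (g x $ k))" for k
    by (intro integrable_half_exp_times square_integrable1_cnj square_integrable_component g assms(2))
  have "cinner (model_family \<mu> c x) (g x) = (\<Sum>k\<in>UNIV. (of_real (sqrt 2) * c $ k) * (half_exp \<mu> x * cnj (g x $ k)))" for x
    by (simp add: model_family_def cinner_vec_def scaleC_vec_def scaleC_complex_def cinner_complex_def mult_ac)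
  then have "cinner (abs_L2 (model_family \<mu> c)) (abs_L2 g)
      = (\<integral>x. (\<Sum>k\<in>UNIV. (of_real (sqrt 2) * c $ k) * (half_exp \<mu> x * cnj (g x $ k))) \<partial>lborel)"
    by (simp add: abs_L2_ops(4)[OF square_integrable_model_family[OF assms(2)] g])
  also have "\<dots> = (\<Sum>k\<in>UNIV. (of_real (sqrt 2) * c $ k) * (\<integral>x. half_exp \<mu> x * cnj (g x $ k) \<partial>lborel))"
    by (subst Bochner_Integration.integral_sum) (auto intro!: integrable_mult_right int)
  finally show ?thesis
    by (simp add: sum_distrib_left mult.assoc)
qed

lemma sum_components_eq_iff:
  fixes a b :: "2 \<Rightarrow> complex"
  shows "(\<forall>c :: complex ^ 2. (\<Sum>k\<in>UNIV. c $ k * a k) = (\<Sum>k\<in>UNIV. c $ k * b k)) \<longleftrightarrow> (\<forall>k. a k = b k)"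
proof
  assume *: "\<forall>c :: complex ^ 2. (\<Sum>k\<in>UNIV. c $ k * a k) = (\<Sum>k\<in>UNIV. c $ k * b k)"
  show "\<forall>k. a k = b k"
    using *[rule_format, of "axis 1 1"] *[rule_format, of "axis 2 1"]
    by (simp add: sum_2 forall_2 axis_def)
qed simp

lemma canonical_family_model:
  "canonical_family (\<lambda>\<mu> c. abs_L2 (model_family \<mu> c)) model_operator"
  unfolding canonical_family_def
proof (intro conjI allI impI)
  fix \<mu> \<nu> :: complex and c d :: "complex ^ 2" assume Im: "Im \<mu> \<noteq> 0" "Im \<nu> \<noteq> 0"
  have "cinner (model_family \<mu> c x) (model_family \<nu> d x) = 2 * cinner c d * (half_exp \<mu> x * cnj (half_exp \<nu> x))" for x
  proof -
    have "complex_of_real (sqrt 2) * of_real (sqrt 2) = 2"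
      by (simp flip: of_real_mult)
    then show ?thesis
      unfolding model_family_def cinner_simps by (simp add: mult_ac)
  qed
  then have eq: "cinner (abs_L2 (model_family \<mu> c)) (abs_L2 (model_family \<nu> d))
      = 2 * cinner c d * (\<integral>x. half_exp \<mu> x * cnj (half_exp \<nu> x) \<partial>lborel)"
    by (simp add: abs_L2_ops(4) square_integrable_model_family Im)
  show "cinner (abs_L2 (model_family \<mu> c)) (abs_L2 (model_family \<nu> d)) = defect_kernel \<mu> \<nu> * cinner c d"
  proof (cases "Im \<mu> * Im \<nu> > 0")
    case True
    have "Im (\<mu> - cnj \<nu>) \<noteq> 0" "sgn (Im (\<mu> - cnj \<nu>)) = sgn (Im \<mu>)"
      using True by (auto simp: zero_less_mult_iff sgn_if)
    then show ?thesis
      unfolding eq half_exp_mult[OF True] by (simp add: integral_half_exp defect_kernel_def True)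
  next
    case False
    then show ?thesis
      unfolding eq by (simp add: half_exp_mult_opposite defect_kernel_def)
  qed
next
  \<comment> \<open>This serves both remaining clauses: for general \<open>z\<close> it decides
    membership in the operator, and for z = 0 it is totality. The conjugates come from the second
    argument of \<open>cinner\<close>.\<close>
  have comp: "(\<forall>\<mu> c. Im \<mu> \<noteq> 0 \<longrightarrow> \<mu> * cinner (abs_L2 (model_family \<mu> c)) (abs_L2 y) = cinner (abs_L2 (model_family \<mu> c)) (abs_L2 z))
      \<longleftrightarrow> (\<forall>k. AE x in lborel. cnj (y x $ k) = primitive (\<lambda>t. \<i> * cnj (z t $ k)) x)"
    if y: "square_integrable y" and z: "square_integrable z" for y z
  proof -
    have "(\<forall>c. \<mu> * cinner (abs_L2 (model_family \<mu> c)) (abs_L2 y) = cinner (abs_L2 (model_family \<mu> c)) (abs_L2 z)) \<longleftrightarrow>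
        (\<forall>k. \<mu> * (\<integral>x. half_exp \<mu> x * cnj (y x $ k) \<partial>lborel) = (\<integral>x. half_exp \<mu> x * cnj (z x $ k) \<partial>lborel))"
      if "Im \<mu> \<noteq> 0" for \<mu>
    proof -
      have "\<mu> * cinner (abs_L2 (model_family \<mu> c)) (abs_L2 y) = cinner (abs_L2 (model_family \<mu> c)) (abs_L2 z) \<longleftrightarrow>
          (\<Sum>k\<in>UNIV. c $ k * (\<mu> * (\<integral>x. half_exp \<mu> x * cnj (y x $ k) \<partial>lborel)))
          = (\<Sum>k\<in>UNIV. c $ k * (\<integral>x. half_exp \<mu> x * cnj (z x $ k) \<partial>lborel))" for c
        unfolding cinner_model_family[OF y that] cinner_model_family[OF z that]
        by (simp add: sum_distrib_left[symmetric] mult.left_commute[of _ \<mu>])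
      then show ?thesis
        by (simp only: sum_components_eq_iff)
    qed
    note pointwise = this
    have "(\<forall>\<mu> c. Im \<mu> \<noteq> 0 \<longrightarrow> \<mu> * cinner (abs_L2 (model_family \<mu> c)) (abs_L2 y) = cinner (abs_L2 (model_family \<mu> c)) (abs_L2 z))
      \<longleftrightarrow> (\<forall>k. \<forall>\<mu>. Im \<mu> \<noteq> 0 \<longrightarrow> \<mu> * (\<integral>x. half_exp \<mu> x * cnj (y x $ k) \<partial>lborel) = (\<integral>x. half_exp \<mu> x * cnj (z x $ k) \<partial>lborel))"
    proof -
      have "(\<forall>\<mu> c. Im \<mu> \<noteq> 0 \<longrightarrow> P \<mu> c) \<longleftrightarrow> (\<forall>k \<mu>. Im \<mu> \<noteq> 0 \<longrightarrow> Q \<mu> k)"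
        if "\<And>\<mu>. Im \<mu> \<noteq> 0 \<Longrightarrow> (\<forall>c. P \<mu> c) \<longleftrightarrow> (\<forall>k. Q \<mu> k)" for P :: "complex \<Rightarrow> complex ^ 2 \<Rightarrow> bool" and Q :: "complex \<Rightarrow> 2 \<Rightarrow> bool"
        using that by blast
      from this[OF pointwise] show ?thesis .
    qed
    also have "\<dots> \<longleftrightarrow> (\<forall>k. AE x in lborel. cnj (y x $ k) = primitive (\<lambda>t. \<i> * cnj (z t $ k)) x)"
      by (intro all_cong1 half_exp_primitive_iff square_integrable1_cnj square_integrable_component y z)
    finally show ?thesis .
  qed
  {
    fix u :: L2
    assume u: "\<forall>\<mu> c. Im \<mu> \<noteq> 0 \<longrightarrow> cinner u (abs_L2 (model_family \<mu> c)) = 0"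
    obtain g where g: "square_integrable g" "u = abs_L2 g"
      by (rule L2_cases)
    have zero: "abs_L2 (\<lambda>_. 0) = 0"
      by (simp add: zero_L2.abs_eq)
    have "\<forall>\<mu> c. Im \<mu> \<noteq> 0 \<longrightarrow> \<mu> * cinner (abs_L2 (model_family \<mu> c)) (abs_L2 g) = cinner (abs_L2 (model_family \<mu> c)) (abs_L2 (\<lambda>_. 0))"
      unfolding zero using u cinner_eq_0_commute unfolding g(2) by fastforce
    then have "\<forall>k. AE x in lborel. cnj (g x $ k) = primitive (\<lambda>t. \<i> * cnj ((0 :: complex ^ 2) $ k)) x"
      unfolding comp[OF g(1) square_integrable_0] .
    then have "\<forall>k. AE x in lborel. g x $ k = 0"
      by (simp add: primitive_def)
    then have "AE x in lborel. \<forall>k\<in>UNIV. g x $ k = 0"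
      by (intro AE_finite_allI) auto
    then have "AE x in lborel. g x = 0"
      by eventually_elim (simp add: vec_eq_iff)
    then show "u = 0"
      unfolding g(2) zero[symmetric] by (subst abs_L2_eq_iff) (auto simp: g(1) square_integrable_0)
  }
  {
    have "q \<in> model_operator \<longleftrightarrow> (\<forall>\<mu> c. Im \<mu> \<noteq> 0 \<longrightarrow> bform (ev \<mu> (abs_L2 (model_family \<mu> c))) q = 0)" for q
    proof -
      obtain y where y: "square_integrable y" "fst q = abs_L2 y"
        by (rule L2_cases)
      obtain z where z: "square_integrable z" "snd q = abs_L2 z"
        by (rule L2_cases)
      have q: "q = (abs_L2 y, abs_L2 z)"
        using y z by (simp add: prod_eq_iff)
      have "(\<forall>\<mu> c. Im \<mu> \<noteq> 0 \<longrightarrow> bform (ev \<mu> (abs_L2 (model_family \<mu> c))) q = 0) \<longleftrightarrow>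
          (\<forall>k. AE x in lborel. cnj (y x $ k) = primitive (\<lambda>t. \<i> * cnj (z t $ k)) x)"
        unfolding comp[OF y(1) z(1), symmetric] by (simp add: q bform_def cinner_scaleC_left)
      also have "\<dots> \<longleftrightarrow> (\<forall>k. AE x in lborel. y x $ k = primitive (\<lambda>t. - \<i> * z t $ k) x)"
      proof -
        have "cnj (primitive (\<lambda>t. - \<i> * z t $ k) x) = primitive (\<lambda>t. \<i> * cnj (z t $ k)) x" for k x
          by (simp add: cnj_primitive)
        then have "cnj (y x $ k) = primitive (\<lambda>t. \<i> * cnj (z t $ k)) x \<longleftrightarrow> y x $ k = primitive (\<lambda>t. - \<i> * z t $ k) x" for k x
          by (metis complex_cnj_cancel_iff)
        then show ?thesis by simp
      qed
      also have "\<dots> \<longleftrightarrow> q \<in> model_operator"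
        unfolding q model_operator_iff[OF y(1) z(1)] ..
      finally show ?thesis by simp
    qed
    then show "model_operator = adj {ev \<mu> (abs_L2 (model_family \<mu> c)) | \<mu> c. Im \<mu> \<noteq> 0}"
      unfolding set_eq_iff mem_adj_iff by blast
  }
qed

theorem corollary3p5:
  fixes J R :: "'a::chilbert_space \<Rightarrow> 'a" and S :: "'a operator" and \<alpha> :: "real ^ 3"
  assumes "nontrivial_fundamental_symmetry J" and "nontrivial_fundamental_symmetry R"
    and "\<And>x. J (R x) = - R (J x)"
    and "linear_operator S" and "closed S" and "densely_defined S" and "symmetric_operator S"
    and "S \<circ>\<^sub>o graph_of J = graph_of J \<circ>\<^sub>o S" and "S \<circ>\<^sub>o graph_of R = graph_of R \<circ>\<^sub>o S"
    and "simple_operator S"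
    and "deficiency_indices S = (2, 2)"
    and "\<alpha> \<in> sphere 0 1"
  shows
    "((\<Union>\<beta>\<in>{\<beta> \<in> sphere 0 1. \<alpha> \<bullet> \<beta> = 0}.
          Xi_pair S (clifford_sym J R \<alpha>) (clifford_sym J R \<beta>))
        \<subset> Xi_ext S (clifford_sym J R \<alpha>)
      \<longleftrightarrow>
      (\<exists>\<Gamma>0 \<Gamma>1 :: 'a \<Rightarrow> complex ^ 2. boundary_triplet S \<Gamma>0 \<Gamma>1 \<and> weyl_constant S \<Gamma>0 \<Gamma>1)) \<and>
    ((\<exists>\<Gamma>0 \<Gamma>1 :: 'a \<Rightarrow> complex ^ 2. boundary_triplet S \<Gamma>0 \<Gamma>1 \<and> weyl_constant S \<Gamma>0 \<Gamma>1)
      \<longleftrightarrow>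
      unitarily_equivalent S model_operator) \<and>
    (\<forall>\<Gamma>0 \<Gamma>1 :: 'a \<Rightarrow> 'h::chilbert_space. boundary_triplet S \<Gamma>0 \<Gamma>1 \<longrightarrow>
      (weyl_constant S \<Gamma>0 \<Gamma>1 \<longleftrightarrow> unitarily_equivalent S model_operator))"
proof -
  have dim: "cdim (defect S \<i>) = 2" "cdim (defect S (- \<i>)) = 2"
    using assms(11) by (simp_all add: deficiency_indices_def defect_def)
  interpret clifford_operator S J R
    using assms dim by unfold_locales (auto simp: nontrivial_fundamental_symmetry_def)
  have i: "(\<Union>\<beta>\<in>{\<beta> \<in> sphere 0 1. \<alpha> \<bullet> \<beta> = 0}. Xi_pair S (clifford_sym J R \<alpha>) (clifford_sym J R \<beta>))
      \<subset> Xi_ext S (clifford_sym J R \<alpha>) \<longleftrightarrow> constant_defect"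
    using assms(12) by (intro strict_inclusion_iff_constant_defect) simp
  \<comment> \<open>By \<open>weyl_constant_iff\<close> constancy does not depend on the triplet, so
    the existential statement only adds that a triplet with boundary space
    \<open>complex ^ 2\<close> exists.\<close>
  have ii: "(\<exists>\<Gamma>0 \<Gamma>1 :: 'a \<Rightarrow> complex ^ 2. boundary_triplet S \<Gamma>0 \<Gamma>1 \<and> weyl_constant S \<Gamma>0 \<Gamma>1) \<longleftrightarrow> constant_defect"
    using boundary_triplet_exists[OF dim] weyl_constant_iff by blast
  have iii: "unitarily_equivalent S model_operator \<longleftrightarrow> constant_defect"
    by (rule unitarily_equivalent_iff_constant_defect[OF assms(10) dim canonical_family_model])
  show ?thesis
    unfolding i ii iii using weyl_constant_iff by blast
qed

end
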